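(* Let $\mathcal{Q}$ be a Dynkin quiver. The category $\bmod\,\mathcal{H}_{\mathcal{Q}}^{\rm op}$ has global dimension at most two.
   Context: Let $k$ be a field, $\mathcal{Q}$ a Dynkin quiver (an orientation of a simply laced Dynkin diagram), $k\mathcal{Q}$ its path algebra, $\bmod\,k\mathcal{Q}$ the category of finite dimensional left $k\mathcal{Q}$-modules, identified with finite dimensional representations of $\mathcal{Q}$, and ${\rm proj}\,k\mathcal{Q}$ the full subcategory of projectives. ${\rm Hom}^{\rm mono}({\rm proj}\,k\mathcal{Q})$ is the category whose objects are injective maps $\iota:P\to Q$ between objects of ${\rm proj}\,k\mathcal{Q}$, with morphisms from $\iota:P\to Q$ to $\iota':P'\to Q'$ the pairs $(\varphi:P\to P',\psi:Q\to Q')$ with $\psi\iota=\iota'\varphi$. $\mathcal{H}_{\mathcal{Q}}$ is the full subcategory of objects without (nonzero) direct summands of the form $0\to P$. $\bmod\,\mathcal{H}_{\mathcal{Q}}^{\rm op}$ is the category of $k$-linear additive contravariant functors from $\mathcal{H}_{\mathcal{Q}}$ to finite dimensional $k$-vector spaces. *)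

theory Defs
  imports
    "Graph_Theory.Digraph"
    "Jordan_Normal_Form.Matrix"
    "HOL-Library.FuncSet"
    "HOL-Library.Extended_Nat"
begin

section \<open>Linear categories\<close>

text \<open>\<open>Comp C g f\<close> is the composite "\<open>g\<close> after \<open>f\<close>".\<close>

record ('k, 'o, 'm) linear_category =
  Ob :: "'o set"
  Hom :: "'o \<Rightarrow> 'o \<Rightarrow> 'm set"
  Comp :: "'m \<Rightarrow> 'm \<Rightarrow> 'm"
  Ident :: "'o \<Rightarrow> 'm"
  Zero :: "'o \<Rightarrow> 'o \<Rightarrow> 'm"
  Add :: "'m \<Rightarrow> 'm \<Rightarrow> 'm"
  Smult :: "'k \<Rightarrow> 'm \<Rightarrow> 'm"

definition full_subcategory ::
  "('k, 'o, 'm) linear_category \<Rightarrow> ('o \<Rightarrow> bool) \<Rightarrow> ('k, 'o, 'm) linear_category" where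
  "full_subcategory C S = C\<lparr>Ob := {X \<in> Ob C. S X}\<rparr>"

definition zero_object :: "('k, 'o, 'm) linear_category \<Rightarrow> 'o \<Rightarrow> bool" where
  "zero_object C X \<longleftrightarrow> X \<in> Ob C \<and> Ident C X = Zero C X X"

definition direct_summand :: "('k, 'o, 'm) linear_category \<Rightarrow> 'o \<Rightarrow> 'o \<Rightarrow> bool" where
  "direct_summand C Y X \<longleftrightarrow>
     Y \<in> Ob C \<and> X \<in> Ob C \<and>
     (\<exists>Z \<in> Ob C. \<exists>i \<in> Hom C Y X. \<exists>p \<in> Hom C X Y. \<exists>j \<in> Hom C Z X. \<exists>q \<in> Hom C X Z.
        Comp C p i = Ident C Y \<and> Comp C q j = Ident C Z \<and>
        Comp C q i = Zero C Y Z \<and> Comp C p j = Zero C Z Y \<and>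
        Add C (Comp C i p) (Comp C j q) = Ident C X)"

definition epimorphism :: "('k, 'o, 'm) linear_category \<Rightarrow> 'o \<Rightarrow> 'o \<Rightarrow> 'm \<Rightarrow> bool" where
  "epimorphism C X Y e \<longleftrightarrow>
     e \<in> Hom C X Y \<and>
     (\<forall>T \<in> Ob C. \<forall>u \<in> Hom C Y T. \<forall>v \<in> Hom C Y T. Comp C u e = Comp C v e \<longrightarrow> u = v)"

definition projective_object :: "('k, 'o, 'm) linear_category \<Rightarrow> 'o \<Rightarrow> bool" where
  "projective_object C P \<longleftrightarrow>
     P \<in> Ob C \<and>
     (\<forall>X \<in> Ob C. \<forall>Y \<in> Ob C. \<forall>e f. epimorphism C X Y e \<longrightarrow> f \<in> Hom C P Y \<longrightarrow>
        (\<exists>g \<in> Hom C P X. Comp C e g = f))"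

definition kernel_of ::
  "('k, 'o, 'm) linear_category \<Rightarrow> 'o \<Rightarrow> 'o \<Rightarrow> 'm \<Rightarrow> 'o \<Rightarrow> 'm \<Rightarrow> bool" where
  "kernel_of C X Y g K \<kappa> \<longleftrightarrow>
     K \<in> Ob C \<and> \<kappa> \<in> Hom C K X \<and> Comp C g \<kappa> = Zero C K Y \<and>
     (\<forall>T \<in> Ob C. \<forall>t \<in> Hom C T X. Comp C g t = Zero C T Y \<longrightarrow>
        (\<exists>!u. u \<in> Hom C T K \<and> Comp C \<kappa> u = t))"

text \<open>
  Exactness of \<open>X \<rightarrow> Y \<rightarrow> Z\<close> at \<open>Y\<close> in an abelian category: \<open>f\<close> factors as an
  epimorphism onto the kernel of \<open>g\<close>.
\<close>

definition exact_at ::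
  "('k, 'o, 'm) linear_category \<Rightarrow> 'o \<Rightarrow> 'm \<Rightarrow> 'o \<Rightarrow> 'm \<Rightarrow> 'o \<Rightarrow> bool" where
  "exact_at C X f Y g Z \<longleftrightarrow>
     f \<in> Hom C X Y \<and> g \<in> Hom C Y Z \<and>
     (\<exists>K \<kappa> e. kernel_of C Y Z g K \<kappa> \<and> epimorphism C X K e \<and> f = Comp C \<kappa> e)"

text \<open>The resolution is \<open>\<dots> \<rightarrow> P 2 \<rightarrow> P 1 \<rightarrow> P 0 \<rightarrow> M \<rightarrow> 0\<close> with differentials
  \<open>d i : P (i + 1) \<rightarrow> P i\<close> and augmentation \<open>\<epsilon> : P 0 \<rightarrow> M\<close>.\<close>

definition projective_resolution ::
  "('k, 'o, 'm) linear_category \<Rightarrow> 'o \<Rightarrow> (nat \<Rightarrow> 'o) \<Rightarrow> (nat \<Rightarrow> 'm) \<Rightarrow> 'm \<Rightarrow> bool" where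
  "projective_resolution C M P d \<epsilon> \<longleftrightarrow>
     (\<forall>i. projective_object C (P i)) \<and>
     epimorphism C (P 0) M \<epsilon> \<and>
     exact_at C (P 1) (d 0) (P 0) \<epsilon> M \<and>
     (\<forall>i. exact_at C (P (i + 2)) (d (i + 1)) (P (i + 1)) (d i) (P i))"

text \<open>The infimum of the empty set is \<open>\<infinity>\<close>, as it should be for objects without a
  finite projective resolution.\<close>

definition projective_dimension :: "('k, 'o, 'm) linear_category \<Rightarrow> 'o \<Rightarrow> enat" where
  "projective_dimension C M =
     Inf {enat n | n. \<exists>P d \<epsilon>. projective_resolution C M P d \<epsilon> \<and>
                               (\<forall>i > n. zero_object C (P i))}"

definition global_dimension :: "('k, 'o, 'm) linear_category \<Rightarrow> enat" where
  "global_dimension C = (SUP M \<in> Ob C. projective_dimension C M)"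


section \<open>Contravariant linear functors to finite dimensional vector spaces\<close>

text \<open>
  Finite dimensional vector spaces are taken in coordinates: \<open>n :: nat\<close> stands for \<open>k\<^sup>n\<close>
  and the linear maps \<open>k\<^sup>n \<rightarrow> k\<^sup>m\<close> are the \<open>m \<times> n\<close> matrices, so that composition is the
  matrix product.  The value of a functor outside the objects and morphisms of \<open>C\<close> is
  irrelevant; natural transformations are extensional, so that equality in the Hom sets
  is equality on all objects of \<open>C\<close>.
\<close>

record ('k, 'o, 'm) matrix_functor =
  fobj :: "'o \<Rightarrow> nat"
  fmap :: "'o \<Rightarrow> 'o \<Rightarrow> 'm \<Rightarrow> 'k mat"

definition contravariant_linear_functor ::
  "('k :: field, 'o, 'm) linear_category \<Rightarrow> ('k, 'o, 'm) matrix_functor \<Rightarrow> bool" where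
  "contravariant_linear_functor C F \<longleftrightarrow>
     (\<forall>X \<in> Ob C. \<forall>Y \<in> Ob C. \<forall>f \<in> Hom C X Y.
        fmap F X Y f \<in> carrier_mat (fobj F X) (fobj F Y)) \<and>
     (\<forall>X \<in> Ob C. fmap F X X (Ident C X) = 1\<^sub>m (fobj F X)) \<and>
     (\<forall>X \<in> Ob C. \<forall>Y \<in> Ob C. \<forall>Z \<in> Ob C. \<forall>f \<in> Hom C X Y. \<forall>g \<in> Hom C Y Z.
        fmap F X Z (Comp C g f) = fmap F X Y f * fmap F Y Z g) \<and>
     (\<forall>X \<in> Ob C. \<forall>Y \<in> Ob C. \<forall>f \<in> Hom C X Y. \<forall>g \<in> Hom C X Y.
        fmap F X Y (Add C f g) = fmap F X Y f + fmap F X Y g) \<and>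
     (\<forall>X \<in> Ob C. \<forall>Y \<in> Ob C. \<forall>f \<in> Hom C X Y. \<forall>c.
        fmap F X Y (Smult C c f) = c \<cdot>\<^sub>m fmap F X Y f)"

definition natural_transformations ::
  "('k :: field, 'o, 'm) linear_category \<Rightarrow> ('k, 'o, 'm) matrix_functor \<Rightarrow>
   ('k, 'o, 'm) matrix_functor \<Rightarrow> ('o \<Rightarrow> 'k mat) set" where
  "natural_transformations C F G =
     {\<eta> \<in> (\<Pi>\<^sub>E X \<in> Ob C. carrier_mat (fobj G X) (fobj F X)).
        \<forall>X \<in> Ob C. \<forall>Y \<in> Ob C. \<forall>f \<in> Hom C X Y.
          \<eta> X * fmap F X Y f = fmap G X Y f * \<eta> Y}"

definition mod_op ::
  "('k :: field, 'o, 'm) linear_category \<Rightarrow>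
   ('k, ('k, 'o, 'm) matrix_functor, 'o \<Rightarrow> 'k mat) linear_category" where
  "mod_op C =
     \<lparr>Ob = {F. contravariant_linear_functor C F},
      Hom = natural_transformations C,
      Comp = (\<lambda>\<eta> \<theta>. \<lambda>X \<in> Ob C. \<eta> X * \<theta> X),
      Ident = (\<lambda>F. \<lambda>X \<in> Ob C. 1\<^sub>m (fobj F X)),
      Zero = (\<lambda>F G. \<lambda>X \<in> Ob C. 0\<^sub>m (fobj G X) (fobj F X)),
      Add = (\<lambda>\<eta> \<theta>. \<lambda>X \<in> Ob C. \<eta> X + \<theta> X),
      Smult = (\<lambda>c \<eta>. \<lambda>X \<in> Ob C. c \<cdot>\<^sub>m \<eta> X)\<rparr>"


section \<open>Dynkin quivers\<close>

text \<open>
  The simply laced Dynkin diagrams as graphs on the vertex set \<open>{..<n}\<close>, given by their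
  edge sets.  In types D and E a chain on the first \<open>n - 1\<close> vertices has one further
  vertex attached.
\<close>

definition chain_edges :: "nat \<Rightarrow> nat set set" where
  "chain_edges n = {{i, i + 1} | i. i + 1 < n}"

inductive dynkin_diagram :: "nat \<Rightarrow> nat set set \<Rightarrow> bool" where
  type_A: "n \<ge> 1 \<Longrightarrow> dynkin_diagram n (chain_edges n)"
| type_D: "n \<ge> 4 \<Longrightarrow> dynkin_diagram n (insert {n - 3, n - 1} (chain_edges (n - 1)))"
| type_E: "n \<in> {6, 7, 8} \<Longrightarrow> dynkin_diagram n (insert {2, n - 1} (chain_edges (n - 1)))"

definition dynkin_quiver :: "('v, 'e) pre_digraph \<Rightarrow> bool" where
  "dynkin_quiver Q \<longleftrightarrow>
     wf_digraph Q \<and>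
     (\<exists>n E \<phi>. dynkin_diagram n E \<and>
        bij_betw \<phi> (verts Q) {..<n} \<and>
        bij_betw (\<lambda>a. {\<phi> (tail Q a), \<phi> (head Q a)}) (arcs Q) E)"


section \<open>Representations of a quiver\<close>

record ('k, 'v, 'e) representation =
  rdim :: "'v \<Rightarrow> nat"
  rmap :: "'e \<Rightarrow> 'k mat"

definition rep_homs ::
  "('v, 'e) pre_digraph \<Rightarrow> ('k :: field, 'v, 'e) representation \<Rightarrow>
   ('k, 'v, 'e) representation \<Rightarrow> ('v \<Rightarrow> 'k mat) set" where
  "rep_homs Q M N =
     {f \<in> (\<Pi>\<^sub>E v \<in> verts Q. carrier_mat (rdim N v) (rdim M v)).
        \<forall>a \<in> arcs Q. f (head Q a) * rmap M a = rmap N a * f (tail Q a)}"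

definition rep_comp ::
  "('v, 'e) pre_digraph \<Rightarrow> ('v \<Rightarrow> 'k :: field mat) \<Rightarrow> ('v \<Rightarrow> 'k mat) \<Rightarrow> 'v \<Rightarrow> 'k mat" where
  "rep_comp Q g f = (\<lambda>v \<in> verts Q. g v * f v)"

definition rep_category ::
  "('v, 'e) pre_digraph \<Rightarrow>
   ('k :: field, ('k, 'v, 'e) representation, 'v \<Rightarrow> 'k mat) linear_category" where
  "rep_category Q =
     \<lparr>Ob = {M. \<forall>a \<in> arcs Q. rmap M a \<in> carrier_mat (rdim M (head Q a)) (rdim M (tail Q a))},
      Hom = rep_homs Q,
      Comp = rep_comp Q,
      Ident = (\<lambda>M. \<lambda>v \<in> verts Q. 1\<^sub>m (rdim M v)),
      Zero = (\<lambda>M N. \<lambda>v \<in> verts Q. 0\<^sub>m (rdim N v) (rdim M v)),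
      Add = (\<lambda>f g. \<lambda>v \<in> verts Q. f v + g v),
      Smult = (\<lambda>c f. \<lambda>v \<in> verts Q. c \<cdot>\<^sub>m f v)\<rparr>"

definition injective_rep_hom ::
  "('v, 'e) pre_digraph \<Rightarrow> ('k :: field, 'v, 'e) representation \<Rightarrow> ('v \<Rightarrow> 'k mat) \<Rightarrow> bool" where
  "injective_rep_hom Q M f \<longleftrightarrow>
     (\<forall>v \<in> verts Q. inj_on (\<lambda>x. f v *\<^sub>v x) (carrier_vec (rdim M v)))"


section \<open>The monomorphism category and its subcategory without summands \<open>0 \<rightarrow> P\<close>\<close>

record ('k, 'v, 'e) rep_arrow =
  asrc :: "('k, 'v, 'e) representation"
  atgt :: "('k, 'v, 'e) representation"
  amap :: "'v \<Rightarrow> 'k mat"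

definition mono_proj_category ::
  "('v, 'e) pre_digraph \<Rightarrow>
   ('k :: field, ('k, 'v, 'e) rep_arrow, ('v \<Rightarrow> 'k mat) \<times> ('v \<Rightarrow> 'k mat)) linear_category" where
  "mono_proj_category Q =
     (let R = rep_category Q in
      \<lparr>Ob = {A. projective_object R (asrc A) \<and> projective_object R (atgt A) \<and>
                amap A \<in> Hom R (asrc A) (atgt A) \<and> injective_rep_hom Q (asrc A) (amap A)},
       Hom = (\<lambda>A B. {(\<phi>, \<psi>). \<phi> \<in> Hom R (asrc A) (asrc B) \<and> \<psi> \<in> Hom R (atgt A) (atgt B) \<and>
                             Comp R \<psi> (amap A) = Comp R (amap B) \<phi>}),
       Comp = (\<lambda>g f. (Comp R (fst g) (fst f), Comp R (snd g) (snd f))),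
       Ident = (\<lambda>A. (Ident R (asrc A), Ident R (atgt A))),
       Zero = (\<lambda>A B. (Zero R (asrc A) (asrc B), Zero R (atgt A) (atgt B))),
       Add = (\<lambda>f g. (Add R (fst f) (fst g), Add R (snd f) (snd g))),
       Smult = (\<lambda>c f. (Smult R c (fst f), Smult R c (snd f)))\<rparr>)"

definition H_category ::
  "('v, 'e) pre_digraph \<Rightarrow>
   ('k :: field, ('k, 'v, 'e) rep_arrow, ('v \<Rightarrow> 'k mat) \<times> ('v \<Rightarrow> 'k mat)) linear_category" where
  "H_category Q =
     full_subcategory (mono_proj_category Q)
       (\<lambda>A. \<forall>B. direct_summand (mono_proj_category Q) B A \<longrightarrow>
                zero_object (rep_category Q) (asrc B) \<longrightarrow>
                zero_object (mono_proj_category Q) B)"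

end

theory Submission
  imports
    Defs
    "Jordan_Normal_Form.Gauss_Jordan_Elimination"
    "Jordan_Normal_Form.Determinant"
begin

text \<open>
  Let \<open>C\<close> be a linear category with finite dimensional Hom spaces, kernels
  and biproducts, all of whose identities are sums of maps through a fixed finite set of objects.
  A functor \<open>F\<close> with finite dimensional values is then generated by finitely many elements, and
  biproducts combine them into one element of some \<open>F X\<close>, that is, into an epimorphism
  \<open>Hom(-,X) \<rightarrow> F\<close>.  Its kernel is covered by some \<open>Hom(-,Y)\<close> in the same way.  By the Yoneda lemma
  the map \<open>Hom(-,Y) \<rightarrow> Hom(-,X)\<close> is composition with some \<open>u : Y \<rightarrow> X\<close>, and if \<open>Z\<close> is a kernel of
  \<open>u\<close>, then \<open>0 \<rightarrow> Hom(-,Z) \<rightarrow> Hom(-,Y) \<rightarrow> Hom(-,X) \<rightarrow> F \<rightarrow> 0\<close> is exact.  Representables are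
  projective, so the projective dimension of \<open>F\<close> is at most two (\<open>global_dimension_mod_op_le_2\<close>).
  It remains to see that \<open>\<H>\<close> is such a category.

  Subrepresentations of projectives are projective (\<open>subrep_projective\<close>), so
  the vertexwise kernel of a map between monomorphisms of projectives is again such a
  monomorphism (\<open>mono_kernel\<close>).  Heredity also shows that an object lies in \<open>\<H>\<close> iff it has no
  nonzero map to an object \<open>0 \<rightarrow> P\<close>: the image of such a map is projective and splits off
  (\<open>H_Ob_iff\<close>).  Hence every object is the sum of an object of \<open>\<H>\<close> and one of the form \<open>0 \<rightarrow> P\<close>,
  and maps from \<open>\<H>\<close> only see the former (\<open>H_part\<close>); the \<open>\<H>\<close>-part of a kernel is a kernel in \<open>\<H>\<close>.

  A monomorphism \<open>P \<rightarrow> Q\<close> of projectives is a projective resolution of its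
  cokernel.  If the identity of the cokernel is a sum of maps through representations in a finite set
  \<open>L\<close>, lifting these maps to resolutions gives an endomorphism of \<open>P \<rightarrow> Q\<close> that differs from the
  identity by a null-homotopic map, and such a map factors through the identity of \<open>Q\<close>
  (\<open>mono_generated\<close>).  So a finite generator of \<open>\<H>\<close> comes from a finite generator \<open>L\<close> of all
  representations, which exists for Dynkin quivers because they have finite representation type.

  The argument follows Bernstein, Gelfand and Ponomarev, but avoids
  indecomposables.  Reflecting at a sink splits off copies of the simple representation at the sink
  and transports the rest to the reflected quiver, where its dimension vector is changed by a simple
  reflection.  After a sequence of reflections, every representation is, up to a map through
  finitely many representations, one whose successively reflected dimension vectors stay
  nonnegative (\<open>reflections_generate\<close>).  Reflecting at all vertices in turn acts as a Coxeter
  transformation \<open>c\<close>.  The Tits form is positive definite, so \<open>c\<close> has finite order and no nonzero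
  fixed vector.  The sum of the orbit of a surviving dimension vector is fixed by \<open>c\<close>, hence zero, and
  nothing survives (\<open>finite_type\<close>).  Definiteness for the Dynkin diagrams is shown by completing
  squares along the tree (\<open>tree_form_ge\<close>).

  Vertexwise linear algebra is done with matrices that carry no format, and a contravariant functor is
  treated as a representation of the possibly infinite quiver whose vertices are the objects and whose
  arrows are the morphisms, so that kernels, images and epimorphisms of representations and of
  functors are handled together.
\<close>

section \<open>Finitary matrices\<close>

text \<open>Matrices with infinitely many rows and columns, of which finitely many entries are nonzero.  They
  form a ring without unit, so identities between products need no side conditions on formats; the
  format of a matrix is the separate predicate \<open>fcar\<close>.\<close>

typedef (overloaded) 'k fmat = "{A :: nat \<Rightarrow> nat \<Rightarrow> 'k :: zero. \<exists>n. \<forall>i j. n \<le> i \<or> n \<le> j \<longrightarrow> A i j = 0}"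
  morphisms ent Abs_fmat
  by (rule exI[of _ "\<lambda>_ _. 0"]) auto

setup_lifting type_definition_fmat

lemma fmat_eqI: "(\<And>i j. ent A i j = ent B i j) \<Longrightarrow> A = B"
  by transfer blast

lemma ent_bound: "\<exists>n. \<forall>i j. n \<le> i \<or> n \<le> j \<longrightarrow> ent A i j = 0"
  by transfer

instantiation fmat :: (field) ring
begin

lift_definition zero_fmat :: "'a fmat" is "\<lambda>_ _. 0" by simp

lift_definition plus_fmat :: "'a fmat \<Rightarrow> 'a fmat \<Rightarrow> 'a fmat" is "\<lambda>A B i j. A i j + B i j"
proof -
  fix A B :: "nat \<Rightarrow> nat \<Rightarrow> 'a"
  assume "\<exists>n. \<forall>i j. n \<le> i \<or> n \<le> j \<longrightarrow> A i j = 0" "\<exists>n. \<forall>i j. n \<le> i \<or> n \<le> j \<longrightarrow> B i j = 0"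
  then obtain n m where "\<forall>i j. n \<le> i \<or> n \<le> j \<longrightarrow> A i j = 0" "\<forall>i j. m \<le> i \<or> m \<le> j \<longrightarrow> B i j = 0"
    by blast
  then show "\<exists>n. \<forall>i j. n \<le> i \<or> n \<le> j \<longrightarrow> A i j + B i j = 0"
    by (intro exI[of _ "max n m"]) auto
qed

lift_definition uminus_fmat :: "'a fmat \<Rightarrow> 'a fmat" is "\<lambda>A i j. - A i j"
  by simp

definition minus_fmat :: "'a fmat \<Rightarrow> 'a fmat \<Rightarrow> 'a fmat" where
  "minus_fmat A B = A + - B"

lift_definition times_fmat :: "'a fmat \<Rightarrow> 'a fmat \<Rightarrow> 'a fmat" is
  "\<lambda>A B i j. \<Sum>k | A i k \<noteq> 0. A i k * B k j"
proof -
  fix A B :: "nat \<Rightarrow> nat \<Rightarrow> 'a"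
  assume "\<exists>n. \<forall>i j. n \<le> i \<or> n \<le> j \<longrightarrow> A i j = 0" "\<exists>n. \<forall>i j. n \<le> i \<or> n \<le> j \<longrightarrow> B i j = 0"
  then obtain n m where n: "\<forall>i j. n \<le> i \<or> n \<le> j \<longrightarrow> A i j = 0"
    and m: "\<forall>i j. m \<le> i \<or> m \<le> j \<longrightarrow> B i j = 0"
    by blast
  show "\<exists>n. \<forall>i j. n \<le> i \<or> n \<le> j \<longrightarrow> (\<Sum>k | A i k \<noteq> 0. A i k * B k j) = 0"
    using n m by (intro exI[of _ "max n m"]) (auto intro!: sum.neutral)
qed

lemma ent_times_bound:
  assumes "\<And>k. N \<le> k \<Longrightarrow> ent A i k = 0"
  shows "ent (A * B) i j = (\<Sum>k<N. ent A i k * ent B k j)"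
proof -
  have "ent (A * B) i j = (\<Sum>k | ent A i k \<noteq> 0. ent A i k * ent B k j)"
    by transfer simp
  also have "\<dots> = (\<Sum>k<N. ent A i k * ent B k j)"
    using assms by (intro sum.mono_neutral_left) (auto simp: not_le[symmetric])
  finally show ?thesis .
qed

lemma ent_add [simp]: "ent (A + B) i j = ent A i j + ent B i j"
  by transfer simp

lemma ent_zero [simp]: "ent 0 i j = 0"
  by transfer simp

lemma ent_uminus [simp]: "ent (- A) i j = - ent A i j"
  by transfer simp

lemma ent_minus [simp]: "ent (A - B) i j = ent A i j - ent B i j"
  by (simp add: minus_fmat_def)

instance
proof
  fix A B C :: "'a fmat"
  show "A * B * C = A * (B * C)"
  proof (rule fmat_eqI)
    fix i j
    obtain n m where n: "\<And>i k. n \<le> k \<Longrightarrow> ent A i k = 0" and m: "\<And>i k. m \<le> k \<Longrightarrow> ent B i k = 0"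
      using ent_bound[of A] ent_bound[of B] by blast
    have AB: "m \<le> k \<Longrightarrow> ent (A * B) i k = 0" for i k
      by (subst ent_times_bound[OF n]) (auto simp: m)
    have "ent (A * B * C) i j = (\<Sum>l<m. (\<Sum>k<n. ent A i k * ent B k l) * ent C l j)"
      by (subst ent_times_bound[OF AB]) (auto simp: ent_times_bound[OF n])
    also have "\<dots> = (\<Sum>k<n. ent A i k * (\<Sum>l<m. ent B k l * ent C l j))"
      by (simp add: sum_distrib_left sum_distrib_right mult.assoc sum.swap[of _ "{..<m}"])
    also have "\<dots> = ent (A * (B * C)) i j"
      by (subst ent_times_bound[OF n]) (auto simp: ent_times_bound[OF m])
    finally show "ent (A * B * C) i j = ent (A * (B * C)) i j" .
  qed
  show "(A + B) * C = A * C + B * C"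
  proof (rule fmat_eqI)
    fix i j
    obtain n m where n: "\<And>i k. n \<le> k \<Longrightarrow> ent A i k = 0" and m: "\<And>i k. m \<le> k \<Longrightarrow> ent B i k = 0"
      using ent_bound[of A] ent_bound[of B] by blast
    show "ent ((A + B) * C) i j = ent (A * C + B * C) i j"
      by (simp add: ent_times_bound[of "max n m"] n m sum.distrib[symmetric] distrib_right)
  qed
  show "A * (B + C) = A * B + A * C"
  proof (rule fmat_eqI)
    fix i j
    obtain n where n: "\<And>i k. n \<le> k \<Longrightarrow> ent A i k = 0"
      using ent_bound[of A] by blast
    show "ent (A * (B + C)) i j = ent (A * B + A * C) i j"
      by (simp add: ent_times_bound[of n] n sum.distrib[symmetric] distrib_left)
  qed
qed (auto intro!: fmat_eqI simp: minus_fmat_def add.assoc add.commute)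

end

lift_definition fscale :: "'k :: field \<Rightarrow> 'k fmat \<Rightarrow> 'k fmat" is "\<lambda>c A i j. c * A i j"
  by (metis mult_zero_right)

lemma ent_fscale [simp]: "ent (fscale c A) i j = c * ent A i j"
  by transfer simp

lemma fscale_mult: "fscale c A * B = fscale c (A * B)" "A * fscale c B = fscale c (A * B)"
proof -
  obtain n where n: "\<And>i k. n \<le> k \<Longrightarrow> ent A i k = 0"
    using ent_bound[of A] by blast
  show "fscale c A * B = fscale c (A * B)" "A * fscale c B = fscale c (A * B)"
    by (rule fmat_eqI, simp add: ent_times_bound[of n] n sum_distrib_left ac_simps)+
qed

lemma fscale_props:
  "fscale c (A + B) = fscale c A + fscale c B" "fscale c 0 = 0"
  "fscale (c + d) A = fscale c A + fscale d A" "fscale (c * d) A = fscale c (fscale d A)"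
  "fscale 1 A = A" "fscale 0 A = 0"
  by (auto intro!: fmat_eqI simp: algebra_simps)

definition fcar :: "nat \<Rightarrow> nat \<Rightarrow> 'k :: field fmat set" where
  "fcar m n = {A. \<forall>i j. m \<le> i \<or> n \<le> j \<longrightarrow> ent A i j = 0}"

lift_definition fone :: "nat \<Rightarrow> 'k :: field fmat" is "\<lambda>n i j. if i = j \<and> i < n then 1 else 0"
proof -
  fix n :: nat
  show "\<exists>m. \<forall>i j. m \<le> i \<or> m \<le> j \<longrightarrow> (if i = j \<and> i < n then 1 else 0 :: 'k) = 0"
    by (intro exI[of _ n]) auto
qed

lemma ent_fone: "ent (fone n) i j = (if i = j \<and> i < n then 1 else 0)"
  by transfer simp

lemma fone_fcar [simp, intro]: "fone n \<in> fcar n n"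
  by (auto simp: fcar_def ent_fone)

lemma fcar_times: "A \<in> fcar m n \<Longrightarrow> B \<in> fcar p q \<Longrightarrow> A * B \<in> fcar m q"
  unfolding fcar_def using ent_times_bound[of n A]
  by auto

lemma fcar_zero [simp, intro]: "0 \<in> fcar m n"
  by (auto simp: fcar_def)

lemma fcar_add [intro]: "A \<in> fcar m n \<Longrightarrow> B \<in> fcar m n \<Longrightarrow> A + B \<in> fcar m n"
  by (auto simp: fcar_def)

lemma fcar_diff [intro]: "A \<in> fcar m n \<Longrightarrow> B \<in> fcar m n \<Longrightarrow> A - B \<in> fcar m n"
  by (auto simp: fcar_def)

lemma fcar_fscale [intro]: "A \<in> fcar m n \<Longrightarrow> fscale c A \<in> fcar m n"
  by (auto simp: fcar_def)

lemma fcar_sum [intro]: "(\<And>a. a \<in> S \<Longrightarrow> f a \<in> fcar m n) \<Longrightarrow> sum f S \<in> fcar m n"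
  by (induction S rule: infinite_finite_induct) auto

lemma fone_left [simp]: "A \<in> fcar m n \<Longrightarrow> fone m * A = A"
proof (rule fmat_eqI)
  fix i j assume A: "A \<in> fcar m n"
  have "ent (fone m * A) i j = (\<Sum>k<m. ent (fone m) i k * ent A k j)"
    by (rule ent_times_bound) (simp add: ent_fone)
  also have "\<dots> = (\<Sum>k<m. if k = i then ent A i j else 0)"
    by (intro sum.cong) (auto simp: ent_fone)
  also have "\<dots> = ent A i j"
    using A by (auto simp: fcar_def)
  finally show "ent (fone m * A) i j = ent A i j" .
qed

lemma fone_right [simp]: "A \<in> fcar m n \<Longrightarrow> A * fone n = A"
proof (rule fmat_eqI)
  fix i j assume A: "A \<in> fcar m n"
  have "ent (A * fone n) i j = (\<Sum>k<n. ent A i k * ent (fone n) k j)"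
    using A by (intro ent_times_bound) (simp add: fcar_def)
  also have "\<dots> = (\<Sum>k<n. if k = j then ent A i j else 0)"
    by (intro sum.cong) (auto simp: ent_fone)
  also have "\<dots> = ent A i j"
    using A by (auto simp: fcar_def)
  finally show "ent (A * fone n) i j = ent A i j" .
qed

lemma fone_idem [simp]: "fone n * fone n = fone n"
  by (rule fone_left) (rule fone_fcar)

lemma fone_0 [simp]: "fone 0 = 0"
  by (rule fmat_eqI) (simp add: ent_fone)

lemma fcar_0 [simp]: "A \<in> fcar 0 n \<longleftrightarrow> A = 0" "A \<in> fcar m 0 \<longleftrightarrow> A = 0"
  by (auto simp: fcar_def intro!: fmat_eqI)

lemma fone_eq_0_iff [simp]: "fone n = 0 \<longleftrightarrow> n = 0"
proof
  assume "fone n = (0 :: 'a fmat)"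
  then have "ent (fone n :: 'a fmat) 0 0 = 0" by simp
  then show "n = 0" by (simp add: ent_fone split: if_splits)
qed simp

subsection \<open>Comparison with matrices of fixed format\<close>

definition of_mat :: "'k :: field mat \<Rightarrow> 'k fmat" where
  "of_mat A = Abs_fmat (\<lambda>i j. if i < dim_row A \<and> j < dim_col A then A $$ (i, j) else 0)"

lemma ent_of_mat: "ent (of_mat A) i j = (if i < dim_row A \<and> j < dim_col A then A $$ (i, j) else 0)"
proof -
  have "\<exists>n. \<forall>i j. n \<le> i \<or> n \<le> j \<longrightarrow> (if i < dim_row A \<and> j < dim_col A then A $$ (i, j) else 0) = 0"
    by (intro exI[of _ "max (dim_row A) (dim_col A)"]) auto
  then show ?thesis by (simp add: of_mat_def Abs_fmat_inverse)
qed

definition to_mat :: "nat \<Rightarrow> nat \<Rightarrow> 'k :: field fmat \<Rightarrow> 'k mat" where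
  "to_mat m n A = mat m n (\<lambda>(i, j). ent A i j)"

lemma to_mat_dims [simp]: "dim_row (to_mat m n A) = m" "dim_col (to_mat m n A) = n"
  "to_mat m n A \<in> carrier_mat m n"
  by (auto simp: to_mat_def)

lemma of_mat_fcar_dims: "of_mat A \<in> fcar (dim_row A) (dim_col A)"
  by (auto simp: fcar_def ent_of_mat)

lemma of_mat_fcar [intro]: "A \<in> carrier_mat m n \<Longrightarrow> of_mat A \<in> fcar m n"
  using of_mat_fcar_dims[of A] by auto

lemma of_mat_to_mat [simp]: "A \<in> fcar m n \<Longrightarrow> of_mat (to_mat m n A) = A"
  by (rule fmat_eqI) (auto simp: ent_of_mat to_mat_def fcar_def)

lemma to_mat_of_mat [simp]: "A \<in> carrier_mat m n \<Longrightarrow> to_mat m n (of_mat A) = A"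
  by (rule eq_matI) (auto simp: ent_of_mat to_mat_def)

lemma of_mat_inj: "A \<in> carrier_mat m n \<Longrightarrow> B \<in> carrier_mat m n \<Longrightarrow> of_mat A = of_mat B \<longleftrightarrow> A = B"
  by (metis to_mat_of_mat)

lemma of_mat_mult: "dim_col A = dim_row B \<Longrightarrow> of_mat (A * B) = of_mat A * of_mat B"
proof (rule fmat_eqI)
  fix i j assume d: "dim_col A = dim_row B"
  have "ent (of_mat A * of_mat B) i j = (\<Sum>k<dim_col A. ent (of_mat A) i k * ent (of_mat B) k j)"
    by (rule ent_times_bound) (simp add: ent_of_mat)
  then show "ent (of_mat (A * B)) i j = ent (of_mat A * of_mat B) i j"
    using d by (auto simp: ent_of_mat scalar_prod_def atLeast0LessThan)
qed

lemma of_mat_add: "dim_row A = dim_row B \<Longrightarrow> dim_col A = dim_col B \<Longrightarrow> of_mat (A + B) = of_mat A + of_mat B"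
  by (rule fmat_eqI) (auto simp: ent_of_mat)

lemma of_mat_smult: "of_mat (c \<cdot>\<^sub>m A) = fscale c (of_mat A)"
  by (rule fmat_eqI) (auto simp: ent_of_mat)

lemma of_mat_one [simp]: "of_mat (1\<^sub>m n) = fone n"
  by (rule fmat_eqI) (auto simp: ent_of_mat ent_fone)

lemma of_mat_zero [simp]: "of_mat (0\<^sub>m m n) = 0"
  by (rule fmat_eqI) (auto simp: ent_of_mat)

subsection \<open>Linear algebra\<close>

text \<open>The only place where Gaussian elimination is used: a row echelon form gives a factorization through
  \<open>k\<^sup>r\<close> into a split mono and a split epi.  Everything else about kernels, cokernels and one-sided
  inverses follows from it formally.\<close>

lemma rank_factorization:
  assumes A: "A \<in> fcar m n"
  obtains r E E' D D' where "E \<in> fcar m r" "E' \<in> fcar r m" "D \<in> fcar r n" "D' \<in> fcar n r"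
    "A = E * D" "E' * E = fone r" "D * D' = fone r"
proof -
  let ?A = "to_mat m n A"
  define C where "C = gauss_jordan_single ?A"
  note g = gauss_jordan_single[OF to_mat_dims(3)[of m n A] C_def[symmetric]]
  obtain P R where PR: "C = P * ?A" "P \<in> carrier_mat m m" "R \<in> carrier_mat m m"
    "P * R = 1\<^sub>m m" "R * P = 1\<^sub>m m"
    using g(4) by blast
  have C: "C \<in> carrier_mat m n" by (rule g(2))
  then have dC: "dim_row C = m" "dim_col C = n" by auto
  from g(3) dC obtain f where "pivot_fun C f n"
    unfolding row_echelon_form_def by auto
  note f = pivot_funD[OF dC(1) this]
  define r where "r = (LEAST i. i \<ge> m \<or> f i = n)"
  have r: "r \<ge> m \<or> f r = n" unfolding r_def by (rule LeastI[of _ m]) simp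
  have rm: "r \<le> m" unfolding r_def by (rule Least_le) simp
  have piv: "f i < n \<and> i < m" if "i < r" for i
    using not_less_Least[OF that[unfolded r_def]] f(1)[of i] by (auto simp: le_less)
  have nonpiv: "f i = n" if "r \<le> i" "i < m" for i
    using that
  proof (induction i rule: dec_induct)
    case base then show ?case using r by auto
  next
    case (step i) then show ?case using f(1)[of "Suc i"] f(3)[of i] by auto
  qed
  define J where "J = mat m r (\<lambda>(i, j). if i = j then 1 else 0 :: 'a)"
  define J' where "J' = mat r m (\<lambda>(i, j). if i = j then 1 else 0 :: 'a)"
  define S where "S = mat n r (\<lambda>(j, i). if j = f i then 1 else 0 :: 'a)"
  have carr: "J \<in> carrier_mat m r" "J' \<in> carrier_mat r m" "S \<in> carrier_mat n r"
    by (auto simp: J_def J'_def S_def)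
  have JJ: "J' * J = 1\<^sub>m r"
    using rm by (intro eq_matI) (auto simp: J_def J'_def scalar_prod_def if_distrib[of "\<lambda>x. x * _"] cong: if_cong)
  have J'C: "(J' * C) $$ (i, j) = C $$ (i, j)" if "i < r" "j < n" for i j
    using that rm dC piv by (auto simp: J'_def scalar_prod_def if_distrib[of "\<lambda>x. x * _"] cong: if_cong)
  have J'Cc: "J' * C \<in> carrier_mat r n" using carr C by auto
  have "(J * (J' * C)) $$ (i, j) = C $$ (i, j)" if "i < m" "j < n" for i j
  proof -
    have "(J * (J' * C)) $$ (i, j) = (\<Sum>k<r. J $$ (i, k) * (J' * C) $$ (k, j))"
      using that J'Cc carr by (auto simp: scalar_prod_def atLeast0LessThan intro!: sum.cong)
    also have "\<dots> = (\<Sum>k<r. if k = i then C $$ (i, j) else 0)"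
      using that piv by (intro sum.cong) (auto simp: J'C J_def)
    also have "\<dots> = C $$ (i, j)"
      using that nonpiv[of i] f(2)[of i j] by auto
    finally show ?thesis .
  qed
  then have JJC: "J * (J' * C) = C"
    using carr C by (intro eq_matI) auto
  have DS: "(J' * C) * S = 1\<^sub>m r"
  proof (rule eq_matI)
    fix i l assume il: "i < dim_row (1\<^sub>m r :: 'a mat)" "l < dim_col (1\<^sub>m r :: 'a mat)"
    then have "((J' * C) * S) $$ (i, l) = (\<Sum>j<n. (J' * C) $$ (i, j) * S $$ (j, l))"
      using J'Cc carr by (auto simp: scalar_prod_def atLeast0LessThan simp del: index_mult_mat intro!: sum.cong)
        (auto simp: scalar_prod_def atLeast0LessThan)
    also have "\<dots> = (\<Sum>j<n. if j = f l then C $$ (i, f l) else 0)"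
      using il by (intro sum.cong) (auto simp: J'C S_def simp del: index_mult_mat)
    also have "\<dots> = C $$ (i, f l)"
      using il piv[of l] by auto
    also have "\<dots> = 1\<^sub>m r $$ (i, l)"
      using il piv[of l] piv[of i] f(4)[of l] f(5)[of l i] by auto
    finally show "((J' * C) * S) $$ (i, l) = 1\<^sub>m r $$ (i, l)" .
  qed (use carr C in simp_all)
  have RC: "R * C = ?A" unfolding PR(1)
    using assoc_mult_mat[OF PR(3) PR(2) to_mat_dims(3)] PR(5) by simp
  let ?o = of_mat
  have c: "dim_row J = m" "dim_col J = r" "dim_row J' = r" "dim_col J' = m" "dim_row S = n" "dim_col S = r"
    "dim_row P = m" "dim_col P = m" "dim_row R = m" "dim_col R = m"
    using carr PR by auto
  have jj: "?o J' * ?o J = fone r" using arg_cong[OF JJ, of ?o] by (simp add: of_mat_mult c)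
  have jjc: "?o J * (?o J' * ?o C) = ?o C" using arg_cong[OF JJC, of ?o] by (simp add: of_mat_mult c dC)
  have ds: "?o J' * ?o C * ?o S = fone r" using arg_cong[OF DS, of ?o] by (simp add: of_mat_mult c dC)
  have rc: "?o R * ?o C = A" using arg_cong[OF RC, of ?o] A by (simp add: of_mat_mult c dC)
  have pr: "?o P * ?o R = fone m" using arg_cong[OF PR(4), of ?o] by (simp add: of_mat_mult c)
  have "A = ?o R * ?o J * (?o J' * ?o C)" using rc jjc by (simp add: mult.assoc)
  moreover have "?o J' * ?o P * (?o R * ?o J) = ?o J' * (?o P * ?o R) * ?o J" by (simp add: mult.assoc)
  then have "?o J' * ?o P * (?o R * ?o J) = fone r" using of_mat_fcar[OF carr(2)] by (simp add: pr jj)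
  moreover have "?o R * ?o J \<in> fcar m r" "?o J' * ?o P \<in> fcar r m" "?o J' * ?o C \<in> fcar r n" "?o S \<in> fcar n r"
    by (rule fcar_times of_mat_fcar carr PR C)+
  ultimately show ?thesis using ds that by metis
qed

text \<open>If \<open>m < n\<close>, both matrices can be read as square ones with zero columns or rows, and for square
  matrices a one-sided inverse is two-sided.\<close>

lemma left_inverse_dim_le:
  assumes A: "A \<in> fcar n m" and B: "B \<in> fcar m n" and AB: "A * B = fone n"
  shows "n \<le> m" "n = m \<Longrightarrow> B * A = fone m"
proof -
  have sq: "Y * X = fone p" if "X \<in> fcar p p" "Y \<in> fcar p p" "X * Y = fone p" for X Y :: "'a fmat" and p
  proof -
    have "of_mat (to_mat p p X * to_mat p p Y) = of_mat (1\<^sub>m p)"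
      using that by (simp add: of_mat_mult)
    then have "to_mat p p X * to_mat p p Y = 1\<^sub>m p"
      by (subst (asm) of_mat_inj[of _ p p]) auto
    then have "to_mat p p Y * to_mat p p X = 1\<^sub>m p"
      by (rule mat_mult_left_right_inverse[OF to_mat_dims(3) to_mat_dims(3)])
    then have "of_mat (to_mat p p Y * to_mat p p X) = fone p" by simp
    then show ?thesis using that by (simp add: of_mat_mult)
  qed
  show "n = m \<Longrightarrow> B * A = fone m" using sq[of A m B] assms by simp
  show "n \<le> m"
  proof (rule ccontr)
    assume "\<not> n \<le> m"
    then have m: "m < n" by simp
    then have "A \<in> fcar n n" "B \<in> fcar n n" using A B by (auto simp: fcar_def)
    from sq[OF this AB] have "ent (B * A) m m = ent (fone n :: 'a fmat) m m" by simp
    moreover have "B * A \<in> fcar m m" using B A by (rule fcar_times)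
    ultimately show False using m by (simp add: ent_fone fcar_def)
  qed
qed

lemma idempotent_splits:
  assumes e: "e \<in> fcar n n" and ee: "e * e = e"
  obtains s K L where "K \<in> fcar n s" "L \<in> fcar s n" "e = K * L" "L * K = fone s"
proof -
  obtain s K L' L K' where k: "K \<in> fcar n s" "L' \<in> fcar s n" "L \<in> fcar s n" "K' \<in> fcar n s"
    "e = K * L" "L' * K = fone s" "L * K' = fone s"
    by (rule rank_factorization[OF e])
  have "L' * (e * e) * K' = L' * e * K'" by (simp add: ee)
  moreover have "L' * (e * e) * K' = (L' * K) * (L * K) * (L * K')" by (simp only: k(5) mult.assoc)
  moreover have "L' * e * K' = (L' * K) * (L * K')" by (simp only: k(5) mult.assoc)
  moreover have "L * K \<in> fcar s s" by (rule fcar_times k)+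
  ultimately have "L * K = fone s" by (simp add: k)
  with k that show ?thesis by metis
qed

lemma kernel_matrix:
  assumes A: "A \<in> fcar m n"
  obtains r K K' where "K \<in> fcar n r" "K' \<in> fcar r n" "K' * K = fone r" "A * K = 0"
    "\<And>p X. X \<in> fcar n p \<Longrightarrow> A * X = 0 \<Longrightarrow> K * (K' * X) = X"
proof -
  obtain r E E' D D' where f: "E \<in> fcar m r" "E' \<in> fcar r m" "D \<in> fcar r n" "D' \<in> fcar n r"
    "A = E * D" "E' * E = fone r" "D * D' = fone r"
    by (rule rank_factorization[OF A])
  define e where "e = fone n - D' * D"
  have e: "e \<in> fcar n n" unfolding e_def by (rule fcar_diff fone_fcar fcar_times f)+
  have De: "D * e = 0"
    using f(3) by (simp add: e_def right_diff_distrib mult.assoc[symmetric] f(7))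
  have "e * e = fone n * e - D' * (D * e)" by (subst (1) e_def) (simp add: left_diff_distrib mult.assoc)
  then have ee: "e * e = e" using e by (simp add: De)
  obtain s K L where k: "K \<in> fcar n s" "L \<in> fcar s n" "e = K * L" "L * K = fone s"
    by (rule idempotent_splits[OF e ee])
  have "D * K = D * (K * (L * K))" unfolding k(4) fone_right[OF k(1)] ..
  also have "\<dots> = D * e * K" by (simp only: k(3) mult.assoc)
  finally have DK: "D * K = 0" by (simp add: De)
  have X: "K * (L * X) = X" if "X \<in> fcar n p" "A * X = 0" for X p
  proof -
    have "D * X \<in> fcar r p" using f(3) that(1) by (rule fcar_times)
    then have "D * X = E' * E * (D * X)" using f(6) by simp
    also have "\<dots> = E' * (A * X)" by (simp add: f(5) mult.assoc)
    finally have "D * X = 0" using that by simp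
    moreover have "e * X = fone n * X - D' * (D * X)" by (simp add: e_def left_diff_distrib mult.assoc)
    ultimately have "e * X = X" using that by simp
    moreover have "K * (L * X) = e * X" by (simp only: k(3) mult.assoc)
    ultimately show ?thesis by simp
  qed
  have "A * K = 0" using DK by (simp add: f(5) mult.assoc)
  then show ?thesis using that[OF k(1,2,4)] X by blast
qed

lemma cokernel_matrix:
  assumes A: "A \<in> fcar m n"
  obtains r C C' where "C \<in> fcar r m" "C' \<in> fcar m r" "C * C' = fone r" "C * A = 0"
    "\<And>p X. X \<in> fcar p m \<Longrightarrow> X * A = 0 \<Longrightarrow> X * C' * C = X"
proof -
  obtain r E E' D D' where f: "E \<in> fcar m r" "E' \<in> fcar r m" "D \<in> fcar r n" "D' \<in> fcar n r"
    "A = E * D" "E' * E = fone r" "D * D' = fone r"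
    by (rule rank_factorization[OF A])
  define e where "e = fone m - E * E'"
  have e: "e \<in> fcar m m" unfolding e_def by (rule fcar_diff fone_fcar fcar_times f)+
  have eE: "e * E = 0"
    using f(1) by (simp add: e_def left_diff_distrib mult.assoc f(6))
  have "e * e = e * fone m - e * E * E'" by (subst (2) e_def) (simp add: right_diff_distrib mult.assoc)
  then have ee: "e * e = e" using e by (simp add: eE)
  obtain s C' C where k: "C' \<in> fcar m s" "C \<in> fcar s m" "e = C' * C" "C * C' = fone s"
    by (rule idempotent_splits[OF e ee])
  have "C * E = (C * C') * C * E" unfolding k(4) fone_left[OF k(2)] ..
  also have "\<dots> = C * (e * E)" by (simp only: k(3) mult.assoc)
  finally have CE: "C * E = 0" by (simp add: eE)
  have X: "X * C' * C = X" if "X \<in> fcar p m" "X * A = 0" for X p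
  proof -
    have "X * E \<in> fcar p r" using that(1) f(1) by (rule fcar_times)
    then have "X * E = X * E * (D * D')" using f(7) by simp
    also have "\<dots> = (X * A) * D'" by (simp add: f(5) mult.assoc)
    finally have "X * E = 0" using that by simp
    moreover have "X * e = X * fone m - (X * E) * E'" by (simp add: e_def right_diff_distrib mult.assoc)
    ultimately have "X * e = X" using that by simp
    moreover have "X * C' * C = X * e" by (simp only: k(3) mult.assoc)
    ultimately show ?thesis by simp
  qed
  have "C * A = 0" using CE by (simp add: f(5) mult.assoc[symmetric])
  then show ?thesis using that[OF k(2,1,4)] X by blast
qed

lemma left_inverse_exists:
  assumes A: "A \<in> fcar m n" and inj: "\<And>X. X \<in> fcar n n \<Longrightarrow> A * X = 0 \<Longrightarrow> X = 0"
  obtains L where "L \<in> fcar n m" "L * A = fone n"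
proof -
  obtain r E E' D D' where f: "E \<in> fcar m r" "E' \<in> fcar r m" "D \<in> fcar r n" "D' \<in> fcar n r"
    "A = E * D" "E' * E = fone r" "D * D' = fone r"
    by (rule rank_factorization[OF A])
  have c: "D' * D \<in> fcar n n" by (rule fcar_times f)+
  have "D * (D' * D) = D" using f by (simp add: mult.assoc[symmetric])
  then have "A * (fone n - D' * D) = 0"
    using f by (simp add: right_diff_distrib mult.assoc)
  moreover have "fone n - D' * D \<in> fcar n n" using c by auto
  ultimately have "fone n - D' * D = 0" by (rule inj[rotated])
  moreover have "D' * E' * A = D' * (E' * E) * D" by (simp only: f(5) mult.assoc)
  ultimately have "D' * E' * A = fone n" using f by simp
  moreover have "D' * E' \<in> fcar n m" by (rule fcar_times f)+
  ultimately show ?thesis using that by blast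
qed

lemma right_inverse_exists:
  assumes A: "A \<in> fcar m n" and epi: "\<And>X. X \<in> fcar m m \<Longrightarrow> X * A = 0 \<Longrightarrow> X = 0"
  obtains R where "R \<in> fcar n m" "A * R = fone m"
proof -
  obtain r E E' D D' where f: "E \<in> fcar m r" "E' \<in> fcar r m" "D \<in> fcar r n" "D' \<in> fcar n r"
    "A = E * D" "E' * E = fone r" "D * D' = fone r"
    by (rule rank_factorization[OF A])
  have c: "E * E' \<in> fcar m m" by (rule fcar_times f)+
  have "E * E' * E = E" using f by (simp add: mult.assoc)
  then have "(fone m - E * E') * A = 0"
    using f by (simp add: left_diff_distrib mult.assoc[symmetric])
  moreover have "fone m - E * E' \<in> fcar m m" using c by auto
  ultimately have "fone m - E * E' = 0" by (rule epi[rotated])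
  moreover have "A * (D' * E') = E * (D * D') * E'" by (simp only: f(5) mult.assoc)
  ultimately have "A * (D' * E') = fone m" using f by simp
  moreover have "D' * E' \<in> fcar n m" by (rule fcar_times f)+
  ultimately show ?thesis using that by blast
qed

lemma left_inverse_of_inj_on:
  assumes A: "A \<in> carrier_mat m n" and inj: "inj_on (\<lambda>x. A *\<^sub>v x) (carrier_vec n)"
  obtains L where "L \<in> fcar n m" "L * of_mat A = fone n"
proof (rule left_inverse_exists[OF of_mat_fcar[OF A]])
  fix X assume X: "X \<in> fcar n n" "of_mat A * X = 0"
  let ?X = "to_mat n n X"
  have "of_mat (A * ?X) = of_mat (0\<^sub>m m n)" using A X by (simp add: of_mat_mult)
  then have AX: "A * ?X = 0\<^sub>m m n" using A by (subst (asm) of_mat_inj[of _ m n]) auto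
  have "col ?X j = 0\<^sub>v n" if "j < n" for j
  proof -
    have "A *\<^sub>v col ?X j = col (A * ?X) j" using that A by (intro col_mult2[symmetric]) auto
    also have "\<dots> = A *\<^sub>v 0\<^sub>v n" using that A by (auto simp: AX)
    finally show ?thesis using inj by (auto dest!: inj_onD simp: carrier_vecI)
  qed
  then have "?X = 0\<^sub>m n n" by (intro eq_matI) (auto simp: vec_eq_iff)
  then have "of_mat ?X = 0" by simp
  then show "X = 0" using X by simp
qed

lemma inj_on_of_left_inverse:
  assumes A: "A \<in> carrier_mat m n" and L: "L \<in> fcar n m" "L * of_mat A = fone n"
  shows "inj_on (\<lambda>x. A *\<^sub>v x) (carrier_vec n)"
proof -
  let ?L = "to_mat n m L"
  have "of_mat (?L * A) = of_mat (1\<^sub>m n)" using A L by (simp add: of_mat_mult)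
  then have "?L * A = 1\<^sub>m n" using A by (subst (asm) of_mat_inj[of _ n n]) auto
  then have "?L *\<^sub>v (A *\<^sub>v x) = x" if "x \<in> carrier_vec n" for x
    using that A by (subst assoc_mult_mat_vec[symmetric, of _ n m _ n]) auto
  then show ?thesis by (metis inj_onI)
qed

subsection \<open>Direct sums\<close>

lift_definition shift_in :: "nat \<Rightarrow> nat \<Rightarrow> 'k :: field fmat" is "\<lambda>m n i j. if i = m + j \<and> j < n then 1 else 0"
proof -
  fix m n :: nat
  show "\<exists>l. \<forall>i j. l \<le> i \<or> l \<le> j \<longrightarrow> (if i = m + j \<and> j < n then 1 else 0 :: 'k) = 0"
    by (intro exI[of _ "m + n"]) auto
qed

lift_definition shift_out :: "nat \<Rightarrow> nat \<Rightarrow> 'k :: field fmat" is "\<lambda>m n i j. if j = m + i \<and> i < n then 1 else 0"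
proof -
  fix m n :: nat
  show "\<exists>l. \<forall>i j. l \<le> i \<or> l \<le> j \<longrightarrow> (if j = m + i \<and> i < n then 1 else 0 :: 'k) = 0"
    by (intro exI[of _ "m + n"]) auto
qed

lemma ent_shift:
  "ent (shift_in m n) i j = (if i = m + j \<and> j < n then 1 else 0)"
  "ent (shift_out m n) i j = (if j = m + i \<and> i < n then 1 else 0)"
  by (transfer, simp)+

lemma shift_fcar:
  "shift_in m n \<in> fcar (m + n) n" "shift_out m n \<in> fcar n (m + n)"
  "fone m \<in> fcar (m + n) m" "fone m \<in> fcar m (m + n)"
  by (auto simp: fcar_def ent_shift ent_fone)

lemma shift_mult:
  "shift_out m n * shift_in m n = (fone n :: 'a :: field fmat)" "shift_out m n * fone m = (0 :: 'a fmat)"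
  "fone m * shift_in m n = (0 :: 'a fmat)" "fone m + shift_in m n * shift_out m n = (fone (m + n) :: 'a fmat)"
proof -
  have o: "ent (shift_out m n * B) i j = (if i < n then ent B (m + i) j else 0)" for B :: "'a fmat" and i j
  proof -
    have "ent (shift_out m n * B) i j = (\<Sum>k<m+n. ent (shift_out m n) i k * ent B k j)"
      by (rule ent_times_bound) (auto simp: ent_shift)
    also have "\<dots> = (\<Sum>k<m+n. if k = m + i then (if i < n then ent B (m + i) j else 0) else 0)"
      by (rule sum.cong) (auto simp: ent_shift)
    finally show ?thesis by auto
  qed
  have i: "ent (shift_in m n * B) i j = (if m \<le> i \<and> i < m + n then ent B (i - m) j else 0)" for B :: "'a fmat" and i j
  proof -
    have "ent (shift_in m n * B) i j = (\<Sum>k<n. ent (shift_in m n) i k * ent B k j)"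
      by (rule ent_times_bound) (auto simp: ent_shift)
    also have "\<dots> = (\<Sum>k<n. if k = i - m then (if m \<le> i \<and> i < m + n then ent B (i - m) j else 0) else 0)"
      by (rule sum.cong) (auto simp: ent_shift)
    finally show ?thesis by auto
  qed
  have f: "ent (fone m * B) i j = (if i < m then ent B i j else 0)" for B :: "'a fmat" and i j
  proof -
    have "ent (fone m * B) i j = (\<Sum>k<m. ent (fone m) i k * ent B k j)"
      by (rule ent_times_bound) (auto simp: ent_fone)
    also have "\<dots> = (\<Sum>k<m. if k = i then (if i < m then ent B i j else 0) else 0)"
      by (rule sum.cong) (auto simp: ent_fone)
    finally show ?thesis by auto
  qed
  show "shift_out m n * shift_in m n = (fone n :: 'a fmat)" "shift_out m n * fone m = (0 :: 'a fmat)"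
    "fone m * shift_in m n = (0 :: 'a fmat)" "fone m + shift_in m n * shift_out m n = (fone (m + n) :: 'a fmat)"
    by (auto intro!: fmat_eqI simp: o i f ent_shift ent_fone)
qed

lemma finite_direct_sum:
  fixes d :: "'a \<Rightarrow> nat"
  assumes "finite S"
  obtains \<iota> \<pi> :: "'a \<Rightarrow> 'k :: field fmat" where
    "\<And>a. a \<in> S \<Longrightarrow> \<iota> a \<in> fcar (sum d S) (d a)" "\<And>a. a \<in> S \<Longrightarrow> \<pi> a \<in> fcar (d a) (sum d S)"
    "\<And>a b. a \<in> S \<Longrightarrow> b \<in> S \<Longrightarrow> \<pi> a * \<iota> b = (if a = b then fone (d a) else 0)"
    "(\<Sum>a\<in>S. \<iota> a * \<pi> a) = fone (sum d S)"
proof -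
  have "\<exists>\<iota> \<pi> :: 'a \<Rightarrow> 'k fmat. (\<forall>a \<in> S. \<iota> a \<in> fcar (sum d S) (d a) \<and> \<pi> a \<in> fcar (d a) (sum d S)) \<and>
    (\<forall>a \<in> S. \<forall>b \<in> S. \<pi> a * \<iota> b = (if a = b then fone (d a) else 0)) \<and>
    (\<Sum>a\<in>S. \<iota> a * \<pi> a) = fone (sum d S)"
    using assms
  proof (induction S)
    case empty then show ?case by simp
  next
    case (insert x S)
    then obtain \<iota> \<pi> :: "'a \<Rightarrow> 'k fmat" where
      J: "\<forall>a \<in> S. \<iota> a \<in> fcar (sum d S) (d a) \<and> \<pi> a \<in> fcar (d a) (sum d S)"
        "\<forall>a \<in> S. \<forall>b \<in> S. \<pi> a * \<iota> b = (if a = b then fone (d a) else 0)"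
        and I4: "(\<Sum>a\<in>S. \<iota> a * \<pi> a) = fone (sum d S)"
      by auto
    have I: "\<And>a. a \<in> S \<Longrightarrow> \<iota> a \<in> fcar (sum d S) (d a)" "\<And>a. a \<in> S \<Longrightarrow> \<pi> a \<in> fcar (d a) (sum d S)"
      "\<And>a b. a \<in> S \<Longrightarrow> b \<in> S \<Longrightarrow> \<pi> a * \<iota> b = (if a = b then fone (d a) else 0)"
      using J by simp_all
    let ?m = "d x" and ?n = "sum d S"
    define \<iota>' where "\<iota>' a = (if a = x then fone ?m else shift_in ?m ?n * \<iota> a)" for a
    define \<pi>' where "\<pi>' a = (if a = x then fone ?m else \<pi> a * shift_out ?m ?n)" for a
    have s: "sum d (insert x S) = ?m + ?n" using insert by simp
    have 1: "\<iota>' a \<in> fcar (?m + ?n) (d a) \<and> \<pi>' a \<in> fcar (d a) (?m + ?n)" if "a \<in> insert x S" for a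
      using that I shift_fcar[of ?m ?n] by (auto simp: \<iota>'_def \<pi>'_def intro: fcar_times)
    have 2: "\<pi>' a * \<iota>' b = (if a = b then fone (d a) else 0)" if "a \<in> insert x S" "b \<in> insert x S" for a b
    proof -
      have "\<pi> a * shift_out ?m ?n * (shift_in ?m ?n * \<iota> b) = \<pi> a * (shift_out ?m ?n * shift_in ?m ?n) * \<iota> b"
        by (simp only: mult.assoc)
      moreover have "\<pi> a * shift_out ?m ?n * fone ?m = \<pi> a * (shift_out ?m ?n * fone ?m)" by (simp only: mult.assoc)
      moreover have "fone ?m * (shift_in ?m ?n * \<iota> b) = (fone ?m * shift_in ?m ?n) * \<iota> b" by (simp only: mult.assoc)
      ultimately show ?thesis
        using that by (auto simp: \<iota>'_def \<pi>'_def shift_mult I(3) fone_right[OF I(2)])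
    qed
    have "(\<Sum>a\<in>S. \<iota>' a * \<pi>' a) = (\<Sum>a\<in>S. shift_in ?m ?n * (\<iota> a * \<pi> a) * shift_out ?m ?n)"
      using insert by (intro sum.cong) (auto simp: \<iota>'_def \<pi>'_def mult.assoc)
    also have "\<dots> = shift_in ?m ?n * fone ?n * shift_out ?m ?n"
      by (simp add: I4[symmetric] sum_distrib_left sum_distrib_right)
    also have "\<dots> = shift_in ?m ?n * shift_out ?m ?n" by (simp only: fone_right[OF shift_fcar(1)])
    finally have 3: "(\<Sum>a\<in>insert x S. \<iota>' a * \<pi>' a) = fone (?m + ?n)"
      using insert by (simp add: \<iota>'_def \<pi>'_def shift_mult)
    show ?case unfolding s using 1 2 3 by (intro exI[of _ \<iota>'] exI[of _ \<pi>']) simp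
  qed
  then obtain \<iota> \<pi> :: "'a \<Rightarrow> 'k fmat" where "(\<forall>a \<in> S. \<iota> a \<in> fcar (sum d S) (d a) \<and> \<pi> a \<in> fcar (d a) (sum d S))"
    "(\<forall>a \<in> S. \<forall>b \<in> S. \<pi> a * \<iota> b = (if a = b then fone (d a) else 0))" "(\<Sum>a\<in>S. \<iota> a * \<pi> a) = fone (sum d S)"
    by auto
  then show ?thesis by (intro that[of \<iota> \<pi>]) auto
qed

text \<open>The two inclusions together are an isomorphism from the standard sum of the two spaces, and
  isomorphic coordinate spaces have the same dimension.\<close>

lemma split_exact_dim:
  assumes K: "K \<in> fcar d n" "K' \<in> fcar n d" and E: "E \<in> fcar d m" "E' \<in> fcar m d"
    and KK: "K' * K = fone n" and EE: "E' * E = fone m" and one: "K * K' + E * E' = fone d"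
  shows "n + m = d"
proof -
  have "K' * (K * K' + E * E') = K'" using K by (simp add: one)
  then have "K' * E * E' = 0" using K by (simp add: distrib_left mult.assoc[symmetric] KK)
  moreover have "K' * E \<in> fcar n m" by (rule fcar_times K E)+
  then have "K' * E * (E' * E) = K' * E" by (simp add: EE)
  then have "K' * E * E' * E = K' * E" by (simp only: mult.assoc)
  ultimately have KE: "K' * E = 0" by simp
  have "(K * K' + E * E') * K = K" using K by (simp add: one)
  then have "E * (E' * K) = 0" using K by (simp add: distrib_right mult.assoc KK)
  moreover have "E' * K \<in> fcar m n" by (rule fcar_times K E)+
  then have "(E' * E) * (E' * K) = E' * K" by (simp add: EE)
  then have "E' * (E * (E' * K)) = E' * K" by (simp only: mult.assoc)
  ultimately have EK: "E' * K = 0" by simp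
  let ?i = "shift_in n m :: 'a fmat" and ?o = "shift_out n m :: 'a fmat"
  define U where "U = fone n * K' + ?i * E'"
  define W where "W = K * fone n + E * ?o"
  note sh = shift_fcar[of n m]
  have U: "U \<in> fcar (n + m) d" unfolding U_def by (rule fcar_add fcar_times sh K E)+
  have W: "W \<in> fcar d (n + m)" unfolding W_def by (rule fcar_add fcar_times sh K E)+
  have Un: "fone n * U = K'"
    using K by (simp add: U_def distrib_left mult.assoc[symmetric] shift_mult)
  have oU: "?o * U = E'"
    using E by (simp add: U_def distrib_left mult.assoc[symmetric] shift_mult)
  have WU: "W * U = fone d"
    using one by (simp add: W_def distrib_right mult.assoc Un oU)
  have KW: "K' * W = fone n" and EW: "E' * W = ?o"
    by (simp_all add: W_def distrib_left mult.assoc[symmetric] KK EE KE EK fone_left[OF sh(2)])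
  have "U * W = fone n * (K' * W) + ?i * (E' * W)"
    by (simp only: U_def distrib_right mult.assoc)
  also have "\<dots> = fone (n + m)" by (simp add: KW EW shift_mult)
  finally have UW: "U * W = fone (n + m)" .
  show ?thesis
    using left_inverse_dim_le(1)[OF U W UW] left_inverse_dim_le(1)[OF W U WU] by simp
qed

section \<open>Linear categories\<close>

text \<open>The record carries only data.  The Hom sets are groups, composition is bilinear, and scalars act by
  endomorphisms of the Hom functors.\<close>

locale lincat =
  fixes C :: "('k :: field, 'o, 'm) linear_category"
  assumes comp_in: "\<lbrakk>X \<in> Ob C; Y \<in> Ob C; Z \<in> Ob C; f \<in> Hom C X Y; g \<in> Hom C Y Z\<rbrakk> \<Longrightarrow> Comp C g f \<in> Hom C X Z"
    and ident_in: "X \<in> Ob C \<Longrightarrow> Ident C X \<in> Hom C X X"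
    and zero_in: "\<lbrakk>X \<in> Ob C; Y \<in> Ob C\<rbrakk> \<Longrightarrow> Zero C X Y \<in> Hom C X Y"
    and add_in: "\<lbrakk>X \<in> Ob C; Y \<in> Ob C; f \<in> Hom C X Y; g \<in> Hom C X Y\<rbrakk> \<Longrightarrow> Add C f g \<in> Hom C X Y"
    and smult_in: "\<lbrakk>X \<in> Ob C; Y \<in> Ob C; f \<in> Hom C X Y\<rbrakk> \<Longrightarrow> Smult C c f \<in> Hom C X Y"
    and comp_assoc: "\<lbrakk>X \<in> Ob C; Y \<in> Ob C; Z \<in> Ob C; W \<in> Ob C; f \<in> Hom C X Y; g \<in> Hom C Y Z; h \<in> Hom C Z W\<rbrakk> \<Longrightarrow>
          Comp C (Comp C h g) f = Comp C h (Comp C g f)"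
    and ident_left: "\<lbrakk>X \<in> Ob C; Y \<in> Ob C; f \<in> Hom C X Y\<rbrakk> \<Longrightarrow> Comp C (Ident C Y) f = f"
    and ident_right: "\<lbrakk>X \<in> Ob C; Y \<in> Ob C; f \<in> Hom C X Y\<rbrakk> \<Longrightarrow> Comp C f (Ident C X) = f"
    and add_assoc: "\<lbrakk>X \<in> Ob C; Y \<in> Ob C; f \<in> Hom C X Y; g \<in> Hom C X Y; h \<in> Hom C X Y\<rbrakk> \<Longrightarrow>
          Add C (Add C f g) h = Add C f (Add C g h)"
    and add_commute: "\<lbrakk>X \<in> Ob C; Y \<in> Ob C; f \<in> Hom C X Y; g \<in> Hom C X Y\<rbrakk> \<Longrightarrow> Add C f g = Add C g f"
    and add_zero: "\<lbrakk>X \<in> Ob C; Y \<in> Ob C; f \<in> Hom C X Y\<rbrakk> \<Longrightarrow> Add C f (Zero C X Y) = f"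
    and add_neg: "\<lbrakk>X \<in> Ob C; Y \<in> Ob C; f \<in> Hom C X Y\<rbrakk> \<Longrightarrow> Add C f (Smult C (- 1) f) = Zero C X Y"
    and comp_add_right: "\<lbrakk>X \<in> Ob C; Y \<in> Ob C; Z \<in> Ob C; f \<in> Hom C X Y; g \<in> Hom C X Y; h \<in> Hom C Y Z\<rbrakk> \<Longrightarrow>
          Comp C h (Add C f g) = Add C (Comp C h f) (Comp C h g)"
    and comp_add_left: "\<lbrakk>X \<in> Ob C; Y \<in> Ob C; Z \<in> Ob C; f \<in> Hom C X Y; g \<in> Hom C Y Z; h \<in> Hom C Y Z\<rbrakk> \<Longrightarrow>
          Comp C (Add C g h) f = Add C (Comp C g f) (Comp C h f)"
    and smult_left: "\<lbrakk>X \<in> Ob C; Y \<in> Ob C; Z \<in> Ob C; f \<in> Hom C X Y; g \<in> Hom C Y Z\<rbrakk> \<Longrightarrow>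
          Comp C (Smult C c g) f = Smult C c (Comp C g f)"
    and smult_right: "\<lbrakk>X \<in> Ob C; Y \<in> Ob C; Z \<in> Ob C; f \<in> Hom C X Y; g \<in> Hom C Y Z\<rbrakk> \<Longrightarrow>
          Comp C g (Smult C c f) = Smult C c (Comp C g f)"
    and smult_add: "\<lbrakk>X \<in> Ob C; Y \<in> Ob C; f \<in> Hom C X Y; g \<in> Hom C X Y\<rbrakk> \<Longrightarrow>
          Smult C c (Add C f g) = Add C (Smult C c f) (Smult C c g)"
    and smult_zero: "\<lbrakk>X \<in> Ob C; Y \<in> Ob C\<rbrakk> \<Longrightarrow> Smult C c (Zero C X Y) = Zero C X Y"
    and comp_zero_left: "\<lbrakk>X \<in> Ob C; Y \<in> Ob C; Z \<in> Ob C; f \<in> Hom C X Y\<rbrakk> \<Longrightarrow> Comp C (Zero C Y Z) f = Zero C X Z"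
    and comp_zero_right: "\<lbrakk>X \<in> Ob C; Y \<in> Ob C; Z \<in> Ob C; f \<in> Hom C Y Z\<rbrakk> \<Longrightarrow> Comp C f (Zero C X Y) = Zero C X Z"

lemma full_subcategory_simps [simp]:
  "Ob (full_subcategory C S) = {X \<in> Ob C. S X}" "Hom (full_subcategory C S) = Hom C"
  "Comp (full_subcategory C S) = Comp C" "Ident (full_subcategory C S) = Ident C"
  "Zero (full_subcategory C S) = Zero C" "Add (full_subcategory C S) = Add C"
  "Smult (full_subcategory C S) = Smult C"
  by (simp_all add: full_subcategory_def)

lemma (in lincat) lincat_full_subcategory: "lincat (full_subcategory C S)"
  apply unfold_locales
  apply (simp_all only: full_subcategory_simps mem_Collect_eq)
  subgoal by (elim conjE) (rule comp_in)
  subgoal by (elim conjE) (rule ident_in)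
  subgoal by (elim conjE) (rule zero_in)
  subgoal by (elim conjE) (rule add_in)
  subgoal by (elim conjE) (rule smult_in)
  subgoal by (elim conjE) (rule comp_assoc)
  subgoal by (elim conjE) (rule ident_left)
  subgoal by (elim conjE) (rule ident_right)
  subgoal by (elim conjE) (rule add_assoc)
  subgoal by (elim conjE) (rule add_commute)
  subgoal by (elim conjE) (rule add_zero)
  subgoal by (elim conjE) (rule add_neg)
  subgoal by (elim conjE) (rule comp_add_right)
  subgoal by (elim conjE) (rule comp_add_left)
  subgoal by (elim conjE) (rule smult_left)
  subgoal by (elim conjE) (rule smult_right)
  subgoal by (elim conjE) (rule smult_add)
  subgoal by (elim conjE) (rule smult_zero)
  subgoal by (elim conjE) (rule comp_zero_left)
  subgoal by (elim conjE) (rule comp_zero_right)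
  done

text \<open>When the objects of \<open>L\<close> have direct sums, \<open>through C L X X (Ident C X)\<close> says that \<open>X\<close> is a
  direct summand of a finite direct sum of objects of \<open>L\<close>.  The formulation by sums of maps avoids
  choosing such sums and decompositions.\<close>

inductive through :: "('k, 'o, 'm) linear_category \<Rightarrow> 'o set \<Rightarrow> 'o \<Rightarrow> 'o \<Rightarrow> 'm \<Rightarrow> bool"
  for C L X Y where
  through_zero: "through C L X Y (Zero C X Y)"
| through_step: "through C L X Y f \<Longrightarrow> G \<in> L \<Longrightarrow> b \<in> Hom C X G \<Longrightarrow> a \<in> Hom C G Y \<Longrightarrow>
     through C L X Y (Add C (Comp C a b) f)"

lemma through_mono: "through C L X Y f \<Longrightarrow> L \<subseteq> L' \<Longrightarrow> through C L' X Y f"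
  by (induction rule: through.induct) (auto intro: through.intros)

context lincat
begin

lemma add_left_zero: "\<lbrakk>X \<in> Ob C; Y \<in> Ob C; f \<in> Hom C X Y\<rbrakk> \<Longrightarrow> Add C (Zero C X Y) f = f"
  using add_zero add_commute zero_in by metis

lemma through_in:
  assumes "through C L X Y f" "X \<in> Ob C" "Y \<in> Ob C" "L \<subseteq> Ob C"
  shows "f \<in> Hom C X Y"
  using assms by (induction rule: through.induct) (auto intro!: zero_in add_in intro: comp_in)

lemma through_add:
  assumes "through C L X Y f" "through C L X Y g" "X \<in> Ob C" "Y \<in> Ob C" "L \<subseteq> Ob C"
  shows "through C L X Y (Add C f g)"
  using assms
proof (induction rule: through.induct)
  case through_zero
  then show ?case using add_left_zero[of X Y g] through_in[of L X Y g] by simp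
next
  case (through_step f G b a)
  have "Comp C a b \<in> Hom C X Y" using through_step comp_in[of X G Y] by blast
  moreover have "f \<in> Hom C X Y" "g \<in> Hom C X Y" using through_in through_step by blast+
  ultimately have "Add C (Add C (Comp C a b) f) g = Add C (Comp C a b) (Add C f g)"
    using through_step add_assoc by blast
  then show ?case using through_step through.through_step by metis
qed

lemma through_comp_left:
  assumes "through C L X Y f" "g \<in> Hom C Y Z" "X \<in> Ob C" "Y \<in> Ob C" "Z \<in> Ob C" "L \<subseteq> Ob C"
  shows "through C L X Z (Comp C g f)"
  using assms
proof (induction rule: through.induct)
  case through_zero
  then show ?case using comp_zero_right[of X Y Z g] through.through_zero[of C L X Z] by simp
next
  case (through_step f G b a)
  then have G: "G \<in> Ob C" by blast
  have f: "f \<in> Hom C X Y" using through_in through_step by blast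
  have ab: "Comp C a b \<in> Hom C X Y" using through_step G comp_in[of X G Y] by blast
  have ga: "Comp C g a \<in> Hom C G Z" using through_step G comp_in[of G Y Z] by blast
  have "Comp C g (Add C (Comp C a b) f) = Add C (Comp C (Comp C g a) b) (Comp C g f)"
    using through_step.prems through_step.hyps G f ab comp_add_right[of X Y Z "Comp C a b" f g] comp_assoc[of X G Y Z b a g]
    by simp
  then show ?case using through.through_step[OF through_step.IH[OF through_step.prems] through_step.hyps(2,3) ga] by simp
qed

lemma through_comp_right:
  assumes "through C L Y Z f" "g \<in> Hom C X Y" "X \<in> Ob C" "Y \<in> Ob C" "Z \<in> Ob C" "L \<subseteq> Ob C"
  shows "through C L X Z (Comp C f g)"
  using assms
proof (induction rule: through.induct)
  case through_zero
  then show ?case using comp_zero_left[of X Y Z g] through.through_zero[of C L X Z] by simp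
next
  case (through_step f G b a)
  then have G: "G \<in> Ob C" by blast
  have f: "f \<in> Hom C Y Z" using through_in through_step by blast
  have ab: "Comp C a b \<in> Hom C Y Z" using through_step G comp_in[of Y G Z] by blast
  have bg: "Comp C b g \<in> Hom C X G" using through_step G comp_in[of X Y G] by blast
  have "Comp C (Add C (Comp C a b) f) g = Add C (Comp C a (Comp C b g)) (Comp C f g)"
    using through_step.prems through_step.hyps G f ab comp_add_left[of X Y Z g "Comp C a b" f] comp_assoc[of X Y G Z g b a]
    by simp
  then show ?case using through.through_step[OF through_step.IH[OF through_step.prems] through_step.hyps(2) bg through_step.hyps(4)] by simp
qed

text \<open>A kernel of the retraction is a complement: the idempotent \<open>1 - i p\<close> factors through it.\<close>

lemma summand_of_retract:
  assumes X: "X \<in> Ob C" and Y: "Y \<in> Ob C" and i: "i \<in> Hom C Y X" and p: "p \<in> Hom C X Y"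
    and pi: "Comp C p i = Ident C Y" and K: "kernel_of C X Y p K \<kappa>"
  shows "direct_summand C Y X"
proof -
  from K have K': "K \<in> Ob C" "\<kappa> \<in> Hom C K X" "Comp C p \<kappa> = Zero C K Y"
    and U: "\<And>T t. \<lbrakk>T \<in> Ob C; t \<in> Hom C T X; Comp C p t = Zero C T Y\<rbrakk> \<Longrightarrow> \<exists>!u. u \<in> Hom C T K \<and> Comp C \<kappa> u = t"
    unfolding kernel_of_def by blast+
  let ?ip = "Comp C i p"
  let ?e = "Add C (Ident C X) (Smult C (- 1) ?ip)"
  have ip: "?ip \<in> Hom C X X" using comp_in[OF X Y X p i] .
  have e: "?e \<in> Hom C X X" using ip X by (intro add_in ident_in smult_in)
  have pip: "Comp C p ?ip = p" using comp_assoc[OF X Y X Y p i p] pi ident_left[OF X Y p] by simp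
  have "Comp C p ?e = Add C p (Smult C (- 1) p)"
    using comp_add_right[OF X X Y ident_in[OF X] smult_in[OF X X ip] p] ident_right[OF X Y p]
      smult_right[OF X X Y ip p] pip by simp
  then have "Comp C p ?e = Zero C X Y" using add_neg[OF X Y p] by simp
  then obtain q where q: "q \<in> Hom C X K" "Comp C \<kappa> q = ?e"
    using U[OF X e] by blast
  have kq: "Add C ?ip (Comp C \<kappa> q) = Ident C X"
  proof -
    have "Add C ?ip ?e = Add C ?ip (Add C (Smult C (- 1) ?ip) (Ident C X))"
      using add_commute[OF X X ident_in[OF X] smult_in[OF X X ip]] by simp
    also have "\<dots> = Add C (Add C ?ip (Smult C (- 1) ?ip)) (Ident C X)"
      using add_assoc[OF X X ip smult_in[OF X X ip] ident_in[OF X]] by simp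
    also have "\<dots> = Ident C X"
      using add_neg[OF X X ip] add_left_zero[OF X X ident_in[OF X]] by simp
    finally show ?thesis using q by simp
  qed
  have uniq: "a = b" if "a \<in> Hom C T K" "b \<in> Hom C T K" "T \<in> Ob C" "Comp C \<kappa> a = Comp C \<kappa> b" for a b T
  proof -
    have 1: "Comp C \<kappa> a \<in> Hom C T X" using comp_in[OF that(3) K'(1) X that(1) K'(2)] .
    have "Comp C p (Comp C \<kappa> a) = Zero C T Y"
      using comp_assoc[OF that(3) K'(1) X Y that(1) K'(2) p] K'(3) comp_zero_left[OF that(3) K'(1) Y that(1)] by simp
    from U[OF that(3) 1 this] that show ?thesis by metis
  qed
  have qk: "Comp C q \<kappa> = Ident C K"
  proof (rule uniq[OF comp_in[OF K'(1) X K'(1) K'(2) q(1)] ident_in[OF K'(1)] K'(1)])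
    have "Comp C \<kappa> (Comp C q \<kappa>) = Comp C ?e \<kappa>"
      using comp_assoc[OF K'(1) X K'(1) X K'(2) q(1) K'(2)] q by simp
    also have "\<dots> = Add C \<kappa> (Smult C (- 1) (Comp C ?ip \<kappa>))"
      using comp_add_left[OF K'(1) X X K'(2) ident_in[OF X] smult_in[OF X X ip]]
        ident_left[OF K'(1) X K'(2)] smult_left[OF K'(1) X X K'(2) ip] by simp
    also have "Comp C ?ip \<kappa> = Zero C K X"
      using comp_assoc[OF K'(1) X Y X K'(2) p i] K'(3) comp_zero_right[OF K'(1) Y X i] by simp
    finally show "Comp C \<kappa> (Comp C q \<kappa>) = Comp C \<kappa> (Ident C K)"
      using smult_zero[OF K'(1) X] add_zero[OF K'(1) X K'(2)] ident_right[OF K'(1) X K'(2)] by simp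
  qed
  have qi: "Comp C q i = Zero C Y K"
  proof (rule uniq[OF comp_in[OF Y X K'(1) i q(1)] zero_in[OF Y K'(1)] Y])
    have ipi: "Comp C ?ip i = i" using comp_assoc[OF Y X Y X i p i] pi ident_right[OF Y X i] by simp
    have "Comp C \<kappa> (Comp C q i) = Comp C ?e i"
      using comp_assoc[OF Y X K'(1) X i q(1) K'(2)] q by simp
    also have "\<dots> = Add C i (Smult C (- 1) i)"
      using comp_add_left[OF Y X X i ident_in[OF X] smult_in[OF X X ip]]
        ident_left[OF Y X i] smult_left[OF Y X X i ip] ipi by simp
    finally show "Comp C \<kappa> (Comp C q i) = Comp C \<kappa> (Zero C Y K)"
      using add_neg[OF Y X i] comp_zero_right[OF Y K'(1) X K'(2)] by simp
  qed
  show ?thesis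
    unfolding direct_summand_def using X Y K' i p q pi qk qi kq by blast
qed

end

section \<open>Representations of an arbitrary quiver\<close>

lemma rep_category_simps [simp]:
  "Ob (rep_category Q) = {M. \<forall>a \<in> arcs Q. rmap M a \<in> carrier_mat (rdim M (head Q a)) (rdim M (tail Q a))}"
  "Hom (rep_category Q) = rep_homs Q" "Comp (rep_category Q) = rep_comp Q"
  "Ident (rep_category Q) = (\<lambda>M. \<lambda>v \<in> verts Q. 1\<^sub>m (rdim M v))"
  "Zero (rep_category Q) = (\<lambda>M N. \<lambda>v \<in> verts Q. 0\<^sub>m (rdim N v) (rdim M v))"
  "Add (rep_category Q) = (\<lambda>f g. \<lambda>v \<in> verts Q. f v + g v)"
  "Smult (rep_category Q) = (\<lambda>c f. \<lambda>v \<in> verts Q. c \<cdot>\<^sub>m f v)"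
  by (simp_all add: rep_category_def)

abbreviation Rep where "Rep \<equiv> rep_category"

text \<open>Representations and homomorphisms are built from matrices without format, which are cut down to
  the format that the dimensions prescribe.\<close>

definition mk_rep :: "('v, 'e) pre_digraph \<Rightarrow> ('v \<Rightarrow> nat) \<Rightarrow> ('e \<Rightarrow> 'k :: field fmat) \<Rightarrow> ('k, 'v, 'e) representation" where
  "mk_rep Q d m = \<lparr>rdim = d, rmap = (\<lambda>a. to_mat (d (head Q a)) (d (tail Q a)) (m a))\<rparr>"

definition mk_hom :: "('v, 'e) pre_digraph \<Rightarrow> ('k :: field, 'v, 'e) representation \<Rightarrow>
   ('k, 'v, 'e) representation \<Rightarrow> ('v \<Rightarrow> 'k fmat) \<Rightarrow> 'v \<Rightarrow> 'k mat" where
  "mk_hom Q M N g = (\<lambda>v \<in> verts Q. to_mat (rdim N v) (rdim M v) (g v))"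

lemma mk_rep_rdim [simp]: "rdim (mk_rep Q d m) = d"
  by (simp add: mk_rep_def)

lemma mk_rep_Ob [simp]: "mk_rep Q d m \<in> Ob (Rep Q)"
  by (simp add: mk_rep_def)

lemma mk_rep_rmap: "m a \<in> fcar (d (head Q a)) (d (tail Q a)) \<Longrightarrow> of_mat (rmap (mk_rep Q d m) a) = m a"
  by (simp add: mk_rep_def)

lemma rep_map_fcar:
  "M \<in> Ob (Rep Q) \<Longrightarrow> a \<in> arcs Q \<Longrightarrow> of_mat (rmap M a) \<in> fcar (rdim M (head Q a)) (rdim M (tail Q a))"
  by (auto intro: of_mat_fcar)

lemma rep_hom_carrier: "f \<in> rep_homs Q M N \<Longrightarrow> v \<in> verts Q \<Longrightarrow> f v \<in> carrier_mat (rdim N v) (rdim M v)"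
  by (auto simp: rep_homs_def)

lemma rep_hom_fcar: "f \<in> rep_homs Q M N \<Longrightarrow> v \<in> verts Q \<Longrightarrow> of_mat (f v) \<in> fcar (rdim N v) (rdim M v)"
  by (rule of_mat_fcar) (rule rep_hom_carrier)

lemma rep_hom_dims: "f \<in> rep_homs Q M N \<Longrightarrow> v \<in> verts Q \<Longrightarrow> dim_row (f v) = rdim N v"
  "f \<in> rep_homs Q M N \<Longrightarrow> v \<in> verts Q \<Longrightarrow> dim_col (f v) = rdim M v"
  using rep_hom_carrier[of f Q M N v] by auto

lemma rep_hom_eqI:
  assumes "f \<in> rep_homs Q M N" "g \<in> rep_homs Q M N" "\<And>v. v \<in> verts Q \<Longrightarrow> of_mat (f v) = of_mat (g v)"
  shows "f = g"
proof
  fix v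
  show "f v = g v"
  proof (cases "v \<in> verts Q")
    case True
    then show ?thesis using assms of_mat_inj[OF rep_hom_carrier[OF assms(1)] rep_hom_carrier[OF assms(2)]] by blast
  next
    case False
    then show ?thesis using assms(1,2) by (auto simp: rep_homs_def PiE_def extensional_def)
  qed
qed

lemma rep_comp_dims:
  assumes "g \<in> rep_homs Q N L" "f \<in> rep_homs Q M N" "v \<in> verts Q"
  shows "of_mat (rep_comp Q g f v) = of_mat (g v) * of_mat (f v)"
  using assms by (simp add: rep_comp_def of_mat_mult rep_hom_dims)

lemma rep_add_at:
  assumes "f \<in> rep_homs Q M N" "g \<in> rep_homs Q M N" "v \<in> verts Q"
  shows "of_mat (Add (Rep Q) f g v) = of_mat (f v) + of_mat (g v)"
  using assms by (simp add: of_mat_add rep_hom_dims[OF assms(1)] rep_hom_dims[OF assms(2)])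

lemma rep_ident_at [simp]: "v \<in> verts Q \<Longrightarrow> of_mat (Ident (Rep Q) M v) = fone (rdim M v)"
  by simp

lemma rep_zero_at [simp]: "v \<in> verts Q \<Longrightarrow> of_mat (Zero (Rep Q) M N v) = 0"
  by simp

context
  fixes Q :: "('v, 'e) pre_digraph"
  assumes wf: "wf_digraph Q"
begin

lemma arc_ends: "a \<in> arcs Q \<Longrightarrow> head Q a \<in> verts Q" "a \<in> arcs Q \<Longrightarrow> tail Q a \<in> verts Q"
  using wf by (auto simp: wf_digraph_def)

lemma rep_hom_natural:
  assumes "M \<in> Ob (Rep Q)" "N \<in> Ob (Rep Q)" "f \<in> rep_homs Q M N" "a \<in> arcs Q"
  shows "of_mat (f (head Q a)) * of_mat (rmap M a) = of_mat (rmap N a) * of_mat (f (tail Q a))"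
proof -
  have "f (head Q a) * rmap M a = rmap N a * f (tail Q a)" using assms by (auto simp: rep_homs_def)
  moreover have "dim_col (f (head Q a)) = dim_row (rmap M a)" "dim_col (rmap N a) = dim_row (f (tail Q a))"
    using assms arc_ends[OF assms(4)] by (auto simp: rep_hom_dims)
  ultimately show ?thesis by (metis of_mat_mult)
qed

lemma rep_homI:
  assumes M: "M \<in> Ob (Rep Q)" and N: "N \<in> Ob (Rep Q)"
    and f: "f \<in> extensional (verts Q)" "\<And>v. v \<in> verts Q \<Longrightarrow> f v \<in> carrier_mat (rdim N v) (rdim M v)"
    and nat: "\<And>a. a \<in> arcs Q \<Longrightarrow> of_mat (f (head Q a)) * of_mat (rmap M a) = of_mat (rmap N a) * of_mat (f (tail Q a))"
  shows "f \<in> rep_homs Q M N"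
proof -
  have "f (head Q a) * rmap M a = rmap N a * f (tail Q a)" if a: "a \<in> arcs Q" for a
  proof -
    note c = f(2)[OF arc_ends(1)[OF a]] f(2)[OF arc_ends(2)[OF a]]
    have m: "rmap M a \<in> carrier_mat (rdim M (head Q a)) (rdim M (tail Q a))"
      "rmap N a \<in> carrier_mat (rdim N (head Q a)) (rdim N (tail Q a))"
      using M N a by auto
    have "of_mat (f (head Q a) * rmap M a) = of_mat (rmap N a * f (tail Q a))"
      using nat[OF a] c m by (auto simp: of_mat_mult)
    then show ?thesis
      using c m by (subst (asm) of_mat_inj[of _ "rdim N (head Q a)" "rdim M (tail Q a)"]) auto
  qed
  then show ?thesis using f by (auto simp: rep_homs_def PiE_def)
qed

lemma mk_hom:
  assumes M: "M \<in> Ob (Rep Q)" and N: "N \<in> Ob (Rep Q)"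
    and g: "\<And>v. v \<in> verts Q \<Longrightarrow> g v \<in> fcar (rdim N v) (rdim M v)"
    and nat: "\<And>a. a \<in> arcs Q \<Longrightarrow> g (head Q a) * of_mat (rmap M a) = of_mat (rmap N a) * g (tail Q a)"
  shows "mk_hom Q M N g \<in> rep_homs Q M N" "v \<in> verts Q \<Longrightarrow> of_mat (mk_hom Q M N g v) = g v"
proof -
  show 1: "of_mat (mk_hom Q M N g v) = g v" if "v \<in> verts Q" for v
    using that g by (simp add: mk_hom_def)
  show "mk_hom Q M N g \<in> rep_homs Q M N"
    by (rule rep_homI[OF M N]) (auto simp: mk_hom_def[symmetric] 1 nat arc_ends, simp_all add: mk_hom_def)
qed

lemma rep_comp_in:
  assumes "M \<in> Ob (Rep Q)" "N \<in> Ob (Rep Q)" "L \<in> Ob (Rep Q)"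
    "f \<in> rep_homs Q M N" "g \<in> rep_homs Q N L"
  shows "rep_comp Q g f \<in> rep_homs Q M L"
proof (rule rep_homI[OF assms(1,3)])
  show "rep_comp Q g f \<in> extensional (verts Q)" by (simp add: rep_comp_def)
  show "rep_comp Q g f v \<in> carrier_mat (rdim L v) (rdim M v)" if "v \<in> verts Q" for v
    using that rep_hom_carrier[OF assms(4) that] rep_hom_carrier[OF assms(5) that] by (simp add: rep_comp_def)
  fix a assume a: "a \<in> arcs Q"
  note n1 = rep_hom_natural[OF assms(1,2,4) a] and n2 = rep_hom_natural[OF assms(2,3,5) a]
  have "of_mat (g (head Q a)) * of_mat (f (head Q a)) * of_mat (rmap M a)
      = of_mat (g (head Q a)) * of_mat (rmap N a) * of_mat (f (tail Q a))"
    by (simp only: mult.assoc n1)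
  then show "of_mat (rep_comp Q g f (head Q a)) * of_mat (rmap M a) = of_mat (rmap L a) * of_mat (rep_comp Q g f (tail Q a))"
    by (simp only: rep_comp_dims[OF assms(5,4)] arc_ends[OF a] n2 mult.assoc)
qed

lemma rep_ident_in: "M \<in> Ob (Rep Q) \<Longrightarrow> (\<lambda>v \<in> verts Q. 1\<^sub>m (rdim M v)) \<in> rep_homs Q M M"
  by (rule rep_homI) (auto simp: arc_ends fone_left[OF rep_map_fcar] fone_right[OF rep_map_fcar])

lemma rep_zero_in: "M \<in> Ob (Rep Q) \<Longrightarrow> N \<in> Ob (Rep Q) \<Longrightarrow>
    (\<lambda>v \<in> verts Q. 0\<^sub>m (rdim N v) (rdim M v)) \<in> rep_homs Q M N"
  by (rule rep_homI) (auto simp: arc_ends)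

lemma rep_add_in:
  assumes "M \<in> Ob (Rep Q)" "N \<in> Ob (Rep Q)" "f \<in> rep_homs Q M N" "g \<in> rep_homs Q M N"
  shows "(\<lambda>v \<in> verts Q. f v + g v) \<in> rep_homs Q M N"
  using rep_hom_natural[OF assms(1,2,3)] rep_hom_natural[OF assms(1,2,4)] rep_hom_carrier[OF assms(3)] rep_hom_carrier[OF assms(4)]
  by (intro rep_homI[OF assms(1,2)])
    (auto simp: arc_ends of_mat_add rep_hom_dims[OF assms(3)] rep_hom_dims[OF assms(4)] distrib_left distrib_right)

lemma rep_smult_in:
  assumes "M \<in> Ob (Rep Q)" "N \<in> Ob (Rep Q)" "f \<in> rep_homs Q M N"
  shows "(\<lambda>v \<in> verts Q. c \<cdot>\<^sub>m f v) \<in> rep_homs Q M N"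
  using rep_hom_natural[OF assms(1,2,3)] rep_hom_carrier[OF assms(3)]
  by (intro rep_homI[OF assms(1,2)]) (auto simp: arc_ends of_mat_smult fscale_mult)

lemma rep_Ident_in: "M \<in> Ob (Rep Q) \<Longrightarrow> Ident (Rep Q) M \<in> rep_homs Q M M"
  using rep_ident_in by simp

lemma rep_Zero_in: "M \<in> Ob (Rep Q) \<Longrightarrow> N \<in> Ob (Rep Q) \<Longrightarrow> Zero (Rep Q) M N \<in> rep_homs Q M N"
  using rep_zero_in by simp

lemma rep_Add_in: "M \<in> Ob (Rep Q) \<Longrightarrow> N \<in> Ob (Rep Q) \<Longrightarrow> f \<in> rep_homs Q M N \<Longrightarrow>
    g \<in> rep_homs Q M N \<Longrightarrow> Add (Rep Q) f g \<in> rep_homs Q M N"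
  using rep_add_in by simp

lemmas rep_in = rep_comp_in rep_ident_in rep_zero_in rep_add_in rep_smult_in

lemma lincat_rep_category: "lincat (Rep Q)"
proof
  let ?C = "Rep Q"
  fix W X Y Z :: "('k :: field, 'v, 'e) representation" and f g h :: "'v \<Rightarrow> 'k mat" and c :: 'k
  note simps = rep_category_simps(2-7)
  note e1 = rep_hom_fcar fone_left[OF rep_hom_fcar] fone_right[OF rep_hom_fcar]
  { assume O: "X \<in> Ob ?C" "Y \<in> Ob ?C" "f \<in> Hom ?C X Y"
    note O' = O[unfolded simps]
    show "Smult ?C c f \<in> Hom ?C X Y" unfolding simps by (rule rep_smult_in O')+
    show "Comp ?C (Ident ?C Y) f = f" unfolding simps
      by (rule rep_hom_eqI[of _ Q X Y]) (rule rep_in O' | simp add: rep_comp_dims[OF rep_ident_in O'(3)] O' del: rep_category_simps | simp add: fone_left[OF rep_hom_fcar[OF O'(3)]])+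
    show "Comp ?C f (Ident ?C X) = f" unfolding simps
      by (rule rep_hom_eqI[of _ Q X Y]) (rule rep_in O' | simp add: rep_comp_dims[OF O'(3) rep_ident_in] O' del: rep_category_simps | simp add: fone_right[OF rep_hom_fcar[OF O'(3)]])+
    show "Add ?C f (Zero ?C X Y) = f" unfolding simps
      by (rule rep_hom_eqI[of _ Q X Y]) (rule rep_in O' | simp add: of_mat_add rep_hom_dims[OF O'(3)])+
    show "Add ?C f (Smult ?C (- 1) f) = Zero ?C X Y" unfolding simps
      by (rule rep_hom_eqI[of _ Q X Y]) (rule rep_in O' | simp add: of_mat_add of_mat_smult rep_hom_dims[OF O'(3)] | (rule fmat_eqI, simp))+
  }
  { assume O: "X \<in> Ob ?C" "Y \<in> Ob ?C" "f \<in> Hom ?C X Y" "g \<in> Hom ?C X Y"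
    note O' = O[unfolded simps]
    show "Add ?C f g \<in> Hom ?C X Y" unfolding simps by (rule rep_in O')+
    show "Add ?C f g = Add ?C g f" unfolding simps
      by (rule rep_hom_eqI[of _ Q X Y]) (rule rep_in O' | simp add: of_mat_add rep_hom_dims[OF O'(3)] rep_hom_dims[OF O'(4)] add.commute)+
    show "Smult ?C c (Add ?C f g) = Add ?C (Smult ?C c f) (Smult ?C c g)" unfolding simps
      by (rule rep_hom_eqI[of _ Q X Y]) (rule rep_in O' | simp add: of_mat_add of_mat_smult fscale_props rep_hom_dims[OF O'(3)] rep_hom_dims[OF O'(4)])+
  }
  { assume O: "X \<in> Ob ?C" "Y \<in> Ob ?C" "f \<in> Hom ?C X Y" "g \<in> Hom ?C X Y" "h \<in> Hom ?C X Y"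
    note O' = O[unfolded simps]
    show "Add ?C (Add ?C f g) h = Add ?C f (Add ?C g h)" unfolding simps
      by (rule rep_hom_eqI[of _ Q X Y]) (rule rep_in O' | simp add: of_mat_add rep_hom_dims[OF O'(3)] rep_hom_dims[OF O'(4)] rep_hom_dims[OF O'(5)] add.assoc)+
  }
  { assume O: "X \<in> Ob ?C" "Y \<in> Ob ?C"
    note O' = O[unfolded simps]
    show "Zero ?C X Y \<in> Hom ?C X Y" unfolding simps by (rule rep_in O')+
    show "Smult ?C c (Zero ?C X Y) = Zero ?C X Y" unfolding simps
      by (rule rep_hom_eqI[of _ Q X Y]) (rule rep_in O' | simp add: of_mat_smult fscale_props)+
  }
  { assume O: "X \<in> Ob ?C" "Y \<in> Ob ?C" "Z \<in> Ob ?C" "f \<in> Hom ?C X Y" "g \<in> Hom ?C Y Z"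
    note O' = O[unfolded simps]
    show "Comp ?C g f \<in> Hom ?C X Z" unfolding simps by (rule rep_comp_in[of X Y Z] O')+
    show "Comp ?C (Smult ?C c g) f = Smult ?C c (Comp ?C g f)" unfolding simps
      by (rule rep_hom_eqI[of _ Q X Z]) (rule rep_comp_in[of X Y Z] rep_smult_in O' | simp add: rep_comp_def of_mat_mult of_mat_smult fscale_mult rep_hom_dims[OF O'(4)] rep_hom_dims[OF O'(5)])+
    show "Comp ?C g (Smult ?C c f) = Smult ?C c (Comp ?C g f)" unfolding simps
      by (rule rep_hom_eqI[of _ Q X Z]) (rule rep_comp_in[of X Y Z] rep_smult_in O' | simp add: rep_comp_def of_mat_mult of_mat_smult fscale_mult rep_hom_dims[OF O'(4)] rep_hom_dims[OF O'(5)])+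
  }
  { assume O: "X \<in> Ob ?C" "Y \<in> Ob ?C" "Z \<in> Ob ?C" "f \<in> Hom ?C X Y" "g \<in> Hom ?C X Y" "h \<in> Hom ?C Y Z"
    note O' = O[unfolded simps]
    show "Comp ?C h (Add ?C f g) = Add ?C (Comp ?C h f) (Comp ?C h g)" unfolding simps
      by (rule rep_hom_eqI[of _ Q X Z]) (rule rep_comp_in[of X Y Z] rep_add_in O' | simp add: rep_comp_def of_mat_mult of_mat_add distrib_left rep_hom_dims[OF O'(4)] rep_hom_dims[OF O'(5)] rep_hom_dims[OF O'(6)])+
  }
  { assume O: "X \<in> Ob ?C" "Y \<in> Ob ?C" "Z \<in> Ob ?C" "f \<in> Hom ?C X Y" "g \<in> Hom ?C Y Z" "h \<in> Hom ?C Y Z"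
    note O' = O[unfolded simps]
    show "Comp ?C (Add ?C g h) f = Add ?C (Comp ?C g f) (Comp ?C h f)" unfolding simps
      by (rule rep_hom_eqI[of _ Q X Z]) (rule rep_comp_in[of X Y Z] rep_add_in O' | simp add: rep_comp_def of_mat_mult of_mat_add distrib_right rep_hom_dims[OF O'(4)] rep_hom_dims[OF O'(5)] rep_hom_dims[OF O'(6)])+
  }
  { assume O: "X \<in> Ob ?C" "Y \<in> Ob ?C" "Z \<in> Ob ?C" "W \<in> Ob ?C" "f \<in> Hom ?C X Y" "g \<in> Hom ?C Y Z" "h \<in> Hom ?C Z W"
    note O' = O[unfolded simps]
    show "Comp ?C (Comp ?C h g) f = Comp ?C h (Comp ?C g f)" unfolding simps
      by (rule rep_hom_eqI[of _ Q X W]) (rule rep_comp_in[of X Y W] rep_comp_in[of X Z W] rep_comp_in[of X Y Z] rep_comp_in[of Y Z W] O' | simp add: rep_comp_def of_mat_mult mult.assoc rep_hom_dims[OF O'(5)] rep_hom_dims[OF O'(6)] rep_hom_dims[OF O'(7)])+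
  }
  { assume O: "X \<in> Ob ?C" "Y \<in> Ob ?C" "Z \<in> Ob ?C" "f \<in> Hom ?C X Y"
    note O' = O[unfolded simps]
    show "Comp ?C (Zero ?C Y Z) f = Zero ?C X Z" unfolding simps
      by (rule rep_hom_eqI[of _ Q X Z]) (rule rep_comp_in[of X Y Z] rep_zero_in O' | simp add: rep_comp_def of_mat_mult rep_hom_dims[OF O'(4)])+
  }
  { assume O: "X \<in> Ob ?C" "Y \<in> Ob ?C" "Z \<in> Ob ?C" "f \<in> Hom ?C Y Z"
    note O' = O[unfolded simps]
    show "Comp ?C f (Zero ?C X Y) = Zero ?C X Z" unfolding simps
      by (rule rep_hom_eqI[of _ Q X Z]) (rule rep_comp_in[of X Y Z] rep_zero_in O' | simp add: rep_comp_def of_mat_mult rep_hom_dims[OF O'(4)])+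
  }
  { assume O: "X \<in> Ob ?C"
    show "Ident ?C X \<in> Hom ?C X X" unfolding simps by (rule rep_in O)+
  }
qed

end

section \<open>Kernels, cokernels and images of representations\<close>

text \<open>Over a field, injective matrices are those with a left inverse.  The explicit inverses are what the
  constructions below compute with.\<close>

definition pointwise_injective where
  "pointwise_injective Q M N f \<longleftrightarrow>
     (\<forall>v \<in> verts Q. \<exists>L \<in> fcar (rdim M v) (rdim N v). L * of_mat (f v) = fone (rdim M v))"

definition pointwise_surjective where
  "pointwise_surjective Q M N f \<longleftrightarrow>
     (\<forall>v \<in> verts Q. \<exists>R \<in> fcar (rdim M v) (rdim N v). of_mat (f v) * R = fone (rdim N v))"

definition pointwise_exact where
  "pointwise_exact Q K \<kappa> M f \<longleftrightarrow>
     (\<forall>v \<in> verts Q. of_mat (f v) * of_mat (\<kappa> v) = 0 \<and>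
        (\<forall>p. \<forall>X \<in> fcar (rdim M v) p. of_mat (f v) * X = 0 \<longrightarrow> (\<exists>Y \<in> fcar (rdim K v) p. X = of_mat (\<kappa> v) * Y)))"

lemma left_cancel: "L * A = fone n \<Longrightarrow> X \<in> fcar n p \<Longrightarrow> Y \<in> fcar n p \<Longrightarrow> A * X = A * Y \<Longrightarrow> X = Y"
  by (metis fone_left mult.assoc)

lemma right_cancel: "A * R = fone n \<Longrightarrow> X \<in> fcar p n \<Longrightarrow> Y \<in> fcar p n \<Longrightarrow> X * A = Y * A \<Longrightarrow> X = Y"
  by (metis fone_right mult.assoc)

lemma injective_rep_hom_iff:
  assumes "f \<in> rep_homs Q M N"
  shows "injective_rep_hom Q M f \<longleftrightarrow> pointwise_injective Q M N f"
proof -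
  have "inj_on (\<lambda>x. f v *\<^sub>v x) (carrier_vec (rdim M v)) \<longleftrightarrow>
      (\<exists>L \<in> fcar (rdim M v) (rdim N v). L * of_mat (f v) = fone (rdim M v))" if "v \<in> verts Q" for v
    using left_inverse_of_inj_on[OF rep_hom_carrier[OF assms that]] inj_on_of_left_inverse[OF rep_hom_carrier[OF assms that]]
    by metis
  then show ?thesis by (simp add: injective_rep_hom_def pointwise_injective_def)
qed

definition pointwise_coexact where
  "pointwise_coexact Q f N K k \<longleftrightarrow>
     (\<forall>v \<in> verts Q. of_mat (k v) * of_mat (f v) = 0 \<and>
        (\<forall>p. \<forall>X \<in> fcar p (rdim N v). X * of_mat (f v) = 0 \<longrightarrow> (\<exists>Y \<in> fcar p (rdim K v). X = Y * of_mat (k v))))"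

context
  fixes Q :: "('v, 'e) pre_digraph"
  assumes wf: "wf_digraph Q"
begin

lemma pointwise_injective_cancel:
  assumes O: "T \<in> Ob (Rep Q)" "K \<in> Ob (Rep Q)" "M \<in> Ob (Rep Q)"
    and k: "k \<in> rep_homs Q K M" and inj: "pointwise_injective Q K M k"
    and uv: "u \<in> rep_homs Q T K" "v \<in> rep_homs Q T K" and eq: "rep_comp Q k u = rep_comp Q k v"
  shows "u = v"
proof (rule rep_hom_eqI[OF uv])
  fix x assume x: "x \<in> verts Q"
  obtain L where "L * of_mat (k x) = fone (rdim K x)" using inj x by (auto simp: pointwise_injective_def)
  moreover have "of_mat (k x) * of_mat (u x) = of_mat (k x) * of_mat (v x)"
    using arg_cong[OF eq, of "\<lambda>f. of_mat (f x)"] by (simp add: rep_comp_dims[OF k uv(1) x] rep_comp_dims[OF k uv(2) x])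
  ultimately show "of_mat (u x) = of_mat (v x)"
    using left_cancel rep_hom_fcar[OF uv(1) x] rep_hom_fcar[OF uv(2) x] by blast
qed

lemma pointwise_surjective_cancel:
  assumes e: "e \<in> rep_homs Q M N" and epi: "pointwise_surjective Q M N e"
    and uv: "u \<in> rep_homs Q N T" "v \<in> rep_homs Q N T" and eq: "rep_comp Q u e = rep_comp Q v e"
  shows "u = v"
proof (rule rep_hom_eqI[OF uv])
  fix x assume x: "x \<in> verts Q"
  obtain R where "of_mat (e x) * R = fone (rdim N x)" using epi x by (auto simp: pointwise_surjective_def)
  moreover have "of_mat (u x) * of_mat (e x) = of_mat (v x) * of_mat (e x)"
    using arg_cong[OF eq, of "\<lambda>f. of_mat (f x)"] by (simp add: rep_comp_dims[OF uv(1) e x] rep_comp_dims[OF uv(2) e x])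
  ultimately show "of_mat (u x) = of_mat (v x)"
    using right_cancel rep_hom_fcar[OF uv(1) x] rep_hom_fcar[OF uv(2) x] by blast
qed

lemma lift_through_injective:
  assumes O: "T \<in> Ob (Rep Q)" "K \<in> Ob (Rep Q)" "M \<in> Ob (Rep Q)"
    and k: "k \<in> rep_homs Q K M" and inj: "pointwise_injective Q K M k" and t: "t \<in> rep_homs Q T M"
    and fac: "\<And>v. v \<in> verts Q \<Longrightarrow> \<exists>Y \<in> fcar (rdim K v) (rdim T v). of_mat (t v) = of_mat (k v) * Y"
  obtains u where "u \<in> rep_homs Q T K" "rep_comp Q k u = t"
proof -
  obtain Y where Y: "\<And>v. v \<in> verts Q \<Longrightarrow> Y v \<in> fcar (rdim K v) (rdim T v)"
    "\<And>v. v \<in> verts Q \<Longrightarrow> of_mat (k v) * Y v = of_mat (t v)"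
    using fac by metis
  have nat: "Y (head Q a) * of_mat (rmap T a) = of_mat (rmap K a) * Y (tail Q a)" if a: "a \<in> arcs Q" for a
  proof -
    note h = arc_ends(1)[OF wf a] and tl = arc_ends(2)[OF wf a]
    obtain L where L: "L * of_mat (k (head Q a)) = fone (rdim K (head Q a))"
      using inj h by (auto simp: pointwise_injective_def)
    have "of_mat (k (head Q a)) * (Y (head Q a) * of_mat (rmap T a)) = of_mat (t (head Q a)) * of_mat (rmap T a)"
      by (simp only: Y(2)[OF h, symmetric] mult.assoc)
    also have "\<dots> = of_mat (rmap M a) * (of_mat (k (tail Q a)) * Y (tail Q a))"
      by (simp only: rep_hom_natural[OF wf O(1,3) t a] Y(2)[OF tl])
    also have "\<dots> = of_mat (rmap M a) * of_mat (k (tail Q a)) * Y (tail Q a)"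
      by (simp only: mult.assoc)
    also have "\<dots> = of_mat (k (head Q a)) * (of_mat (rmap K a) * Y (tail Q a))"
      by (simp only: rep_hom_natural[OF wf O(2,3) k a, symmetric] mult.assoc)
    finally show ?thesis
      by (rule left_cancel[OF L, rotated 2]) (rule fcar_times Y h tl rep_map_fcar O a)+
  qed
  note m = mk_hom[OF wf O(1,2) Y(1) nat]
  have "rep_comp Q k (mk_hom Q T K Y) = t"
    by (rule rep_hom_eqI[OF rep_comp_in[OF wf O(1,2,3) m(1) k] t]) (simp_all add: rep_comp_dims[OF k m(1)] m(2) Y(2))
  then show ?thesis using that m(1) by blast
qed

text \<open>The structure maps of the subrepresentation are \<open>\<rho> M \<kappa>\<close>; invariance makes \<open>\<kappa>\<close> a homomorphism.\<close>

lemma subrepresentation: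
  assumes M: "M \<in> Ob (Rep Q)"
    and \<kappa>: "\<And>v. v \<in> verts Q \<Longrightarrow> \<kappa> v \<in> fcar (rdim M v) (d v)"
    and \<rho>: "\<And>v. v \<in> verts Q \<Longrightarrow> \<rho> v \<in> fcar (d v) (rdim M v)" "\<And>v. v \<in> verts Q \<Longrightarrow> \<rho> v * \<kappa> v = fone (d v)"
    and inv: "\<And>a. a \<in> arcs Q \<Longrightarrow> \<exists>Y. of_mat (rmap M a) * \<kappa> (tail Q a) = \<kappa> (head Q a) * Y"
  obtains K k where "K \<in> Ob (Rep Q)" "k \<in> rep_homs Q K M" "rdim K = d"
    "\<And>v. v \<in> verts Q \<Longrightarrow> of_mat (k v) = \<kappa> v" "pointwise_injective Q K M k"
proof -
  define K where "K = mk_rep Q d (\<lambda>a. \<rho> (head Q a) * of_mat (rmap M a) * \<kappa> (tail Q a))"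
  have K: "K \<in> Ob (Rep Q)" unfolding K_def by (rule mk_rep_Ob)
  have d: "rdim K = d" by (simp add: K_def)
  have m: "of_mat (rmap K a) = \<rho> (head Q a) * of_mat (rmap M a) * \<kappa> (tail Q a)" if "a \<in> arcs Q" for a
    unfolding K_def by (rule mk_rep_rmap) (rule fcar_times \<rho> \<kappa> arc_ends[OF wf] rep_map_fcar M that)+
  have nat: "\<kappa> (head Q a) * of_mat (rmap K a) = of_mat (rmap M a) * \<kappa> (tail Q a)" if a: "a \<in> arcs Q" for a
  proof -
    obtain Y where Y: "of_mat (rmap M a) * \<kappa> (tail Q a) = \<kappa> (head Q a) * Y" using inv a by blast
    note h = arc_ends(1)[OF wf a]
    have "\<kappa> (head Q a) * of_mat (rmap K a) = \<kappa> (head Q a) * (\<rho> (head Q a) * (of_mat (rmap M a) * \<kappa> (tail Q a)))"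
      by (simp only: m[OF a] mult.assoc)
    also have "\<dots> = \<kappa> (head Q a) * (\<rho> (head Q a) * \<kappa> (head Q a)) * Y" by (simp only: Y mult.assoc)
    also have "\<dots> = \<kappa> (head Q a) * Y" by (simp only: \<rho>(2)[OF h] fone_right[OF \<kappa>[OF h]])
    finally show ?thesis by (simp only: Y)
  qed
  note k = mk_hom[OF wf K M, unfolded d, OF \<kappa> nat]
  show ?thesis
  proof (rule that[OF K k(1) d])
    show "pointwise_injective Q K M (mk_hom Q K M \<kappa>)"
      using \<rho> by (auto simp: pointwise_injective_def k(2) d)
  qed (auto simp: k(2))
qed

lemma quotient_representation:
  assumes M: "M \<in> Ob (Rep Q)"
    and \<pi>: "\<And>v. v \<in> verts Q \<Longrightarrow> \<pi> v \<in> fcar (d v) (rdim M v)"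
    and \<sigma>: "\<And>v. v \<in> verts Q \<Longrightarrow> \<sigma> v \<in> fcar (rdim M v) (d v)" "\<And>v. v \<in> verts Q \<Longrightarrow> \<pi> v * \<sigma> v = fone (d v)"
    and inv: "\<And>a. a \<in> arcs Q \<Longrightarrow> \<exists>Y. \<pi> (head Q a) * of_mat (rmap M a) = Y * \<pi> (tail Q a)"
  obtains K k where "K \<in> Ob (Rep Q)" "k \<in> rep_homs Q M K" "rdim K = d"
    "\<And>v. v \<in> verts Q \<Longrightarrow> of_mat (k v) = \<pi> v" "pointwise_surjective Q M K k"
proof -
  define K where "K = mk_rep Q d (\<lambda>a. \<pi> (head Q a) * of_mat (rmap M a) * \<sigma> (tail Q a))"
  have K: "K \<in> Ob (Rep Q)" unfolding K_def by (rule mk_rep_Ob)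
  have d: "rdim K = d" by (simp add: K_def)
  have m: "of_mat (rmap K a) = \<pi> (head Q a) * of_mat (rmap M a) * \<sigma> (tail Q a)" if "a \<in> arcs Q" for a
    unfolding K_def by (rule mk_rep_rmap) (rule fcar_times \<sigma> \<pi> arc_ends[OF wf] rep_map_fcar M that)+
  have nat: "\<pi> (head Q a) * of_mat (rmap M a) = of_mat (rmap K a) * \<pi> (tail Q a)" if a: "a \<in> arcs Q" for a
  proof -
    obtain Y where Y: "\<pi> (head Q a) * of_mat (rmap M a) = Y * \<pi> (tail Q a)" using inv a by blast
    note h = arc_ends(2)[OF wf a]
    have "of_mat (rmap K a) * \<pi> (tail Q a) = (\<pi> (head Q a) * of_mat (rmap M a)) * \<sigma> (tail Q a) * \<pi> (tail Q a)"
      by (simp only: m[OF a] mult.assoc)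
    also have "\<dots> = Y * (\<pi> (tail Q a) * \<sigma> (tail Q a) * \<pi> (tail Q a))" by (simp only: Y mult.assoc)
    also have "\<dots> = Y * \<pi> (tail Q a)" by (simp only: \<sigma>(2)[OF h] fone_left[OF \<pi>[OF h]])
    finally show ?thesis by (simp only: Y)
  qed
  note k = mk_hom[OF wf M K, unfolded d, OF \<pi> nat]
  show ?thesis
  proof (rule that[OF K k(1) d])
    show "pointwise_surjective Q M K (mk_hom Q M K \<pi>)"
      using \<sigma> by (auto simp: pointwise_surjective_def k(2) d)
  qed (auto simp: k(2))
qed

lemma kernel_rep:
  assumes M: "M \<in> Ob (Rep Q)" and N: "N \<in> Ob (Rep Q)" and f: "f \<in> rep_homs Q M N"
  obtains K k where "K \<in> Ob (Rep Q)" "k \<in> rep_homs Q K M" "pointwise_injective Q K M k"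
    "pointwise_exact Q K k M f"
proof -
  define P where "P v r K K' \<longleftrightarrow> K \<in> fcar (rdim M v) r \<and> K' \<in> fcar r (rdim M v) \<and> K' * K = fone r \<and>
      of_mat (f v) * K = 0 \<and> (\<forall>p. \<forall>X \<in> fcar (rdim M v) p. of_mat (f v) * X = 0 \<longrightarrow> K * (K' * X) = X)" for v r K K'
  have "\<exists>r K K'. P v r K K'" if "v \<in> verts Q" for v
    unfolding P_def by (rule kernel_matrix[OF rep_hom_fcar[OF f that]]) blast
  then obtain d \<kappa> \<rho> where "\<And>v. v \<in> verts Q \<Longrightarrow> P v (d v) (\<kappa> v) (\<rho> v)"
    by metis
  then have
    k: "\<And>v. v \<in> verts Q \<Longrightarrow> \<kappa> v \<in> fcar (rdim M v) (d v)" "\<And>v. v \<in> verts Q \<Longrightarrow> \<rho> v \<in> fcar (d v) (rdim M v)"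
      "\<And>v. v \<in> verts Q \<Longrightarrow> \<rho> v * \<kappa> v = fone (d v)" "\<And>v. v \<in> verts Q \<Longrightarrow> of_mat (f v) * \<kappa> v = 0"
      "\<And>v p X. v \<in> verts Q \<Longrightarrow> X \<in> fcar (rdim M v) p \<Longrightarrow> of_mat (f v) * X = 0 \<Longrightarrow> \<kappa> v * (\<rho> v * X) = X"
    by (simp_all add: P_def)
  have inv: "\<exists>Y. of_mat (rmap M a) * \<kappa> (tail Q a) = \<kappa> (head Q a) * Y" if a: "a \<in> arcs Q" for a
  proof -
    note h = arc_ends(1)[OF wf a] and tl = arc_ends(2)[OF wf a]
    have "of_mat (f (head Q a)) * (of_mat (rmap M a) * \<kappa> (tail Q a)) = of_mat (rmap N a) * (of_mat (f (tail Q a)) * \<kappa> (tail Q a))"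
      by (simp only: mult.assoc[symmetric] rep_hom_natural[OF wf M N f a])
    then have "of_mat (f (head Q a)) * (of_mat (rmap M a) * \<kappa> (tail Q a)) = 0" by (simp add: k(4)[OF tl])
    from k(5)[OF h fcar_times[OF rep_map_fcar[OF M a] k(1)[OF tl]] this] show ?thesis by metis
  qed
  obtain K h where K: "K \<in> Ob (Rep Q)" "h \<in> rep_homs Q K M" "rdim K = d"
    "\<And>v. v \<in> verts Q \<Longrightarrow> of_mat (h v) = \<kappa> v" "pointwise_injective Q K M h"
    by (rule subrepresentation[OF M k(1-3) inv]) auto
  have "pointwise_exact Q K h M f"
    unfolding pointwise_exact_def
  proof (intro ballI conjI allI impI)
    fix v p X assume v: "v \<in> verts Q"
    show "of_mat (f v) * of_mat (h v) = 0" using k(4)[OF v] K(4)[OF v] by simp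
    assume X: "X \<in> fcar (rdim M v) p" "of_mat (f v) * X = 0"
    then have "X = of_mat (h v) * (\<rho> v * X)" using k(5)[OF v] K(4)[OF v] by simp
    moreover have "\<rho> v * X \<in> fcar (rdim K v) p" unfolding K(3) by (rule fcar_times k(2) X v)+
    ultimately show "\<exists>Y \<in> fcar (rdim K v) p. X = of_mat (h v) * Y" by blast
  qed
  then show ?thesis using that K by blast
qed

lemma kernel_of_pointwise:
  assumes O: "K \<in> Ob (Rep Q)" "M \<in> Ob (Rep Q)" "N \<in> Ob (Rep Q)"
    and k: "k \<in> rep_homs Q K M" and f: "f \<in> rep_homs Q M N"
    and inj: "pointwise_injective Q K M k" and ex: "pointwise_exact Q K k M f"
  shows "kernel_of (Rep Q) M N f K k"
  unfolding kernel_of_def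
proof (intro conjI ballI impI)
  show "K \<in> Ob (Rep Q)" by fact
  show "k \<in> Hom (Rep Q) K M" using k by simp
  show "Comp (Rep Q) f k = Zero (Rep Q) K N"
    unfolding rep_category_simps(3,5)
    by (rule rep_hom_eqI[OF rep_comp_in[OF wf O k f] rep_zero_in[OF wf O(1,3)]])
      (use ex in \<open>simp add: rep_comp_dims[OF f k] pointwise_exact_def\<close>)
  fix T t assume T: "T \<in> Ob (Rep Q)" and t: "t \<in> Hom (Rep Q) T M"
    and z: "Comp (Rep Q) f t = Zero (Rep Q) T N"
  from t have t': "t \<in> rep_homs Q T M" by simp
  have "\<exists>Y \<in> fcar (rdim K v) (rdim T v). of_mat (t v) = of_mat (k v) * Y" if v: "v \<in> verts Q" for v
  proof -
    have "of_mat (f v) * of_mat (t v) = 0"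
      using arg_cong[OF z, of "\<lambda>g. of_mat (g v)"] v by (simp add: rep_comp_dims[OF f t' v])
    then show ?thesis using ex v rep_hom_fcar[OF t' v] by (auto simp: pointwise_exact_def)
  qed
  then obtain u where "u \<in> rep_homs Q T K" "rep_comp Q k u = t"
    by (rule lift_through_injective[OF T O(1,2) k inj t']) auto
  then show "\<exists>!u. u \<in> Hom (Rep Q) T K \<and> Comp (Rep Q) k u = t"
    using pointwise_injective_cancel[OF T O(1,2) k inj] by (auto simp del: rep_category_simps(1))
qed

lemma cokernel_rep:
  assumes M: "M \<in> Ob (Rep Q)" and N: "N \<in> Ob (Rep Q)" and f: "f \<in> rep_homs Q M N"
  obtains K k where "K \<in> Ob (Rep Q)" "k \<in> rep_homs Q N K" "pointwise_surjective Q N K k"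
    "pointwise_coexact Q f N K k"
proof -
  define P where "P v r K K' \<longleftrightarrow> K \<in> fcar r (rdim N v) \<and> K' \<in> fcar (rdim N v) r \<and> K * K' = fone r \<and>
      K * of_mat (f v) = 0 \<and> (\<forall>p. \<forall>X \<in> fcar p (rdim N v). X * of_mat (f v) = 0 \<longrightarrow> X * K' * K = X)" for v r K K'
  have "\<exists>r K K'. P v r K K'" if "v \<in> verts Q" for v
    unfolding P_def by (rule cokernel_matrix[OF rep_hom_fcar[OF f that]]) blast
  then obtain d \<pi> \<sigma> where "\<And>v. v \<in> verts Q \<Longrightarrow> P v (d v) (\<pi> v) (\<sigma> v)"
    by metis
  then have
    k: "\<And>v. v \<in> verts Q \<Longrightarrow> \<pi> v \<in> fcar (d v) (rdim N v)" "\<And>v. v \<in> verts Q \<Longrightarrow> \<sigma> v \<in> fcar (rdim N v) (d v)"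
      "\<And>v. v \<in> verts Q \<Longrightarrow> \<pi> v * \<sigma> v = fone (d v)" "\<And>v. v \<in> verts Q \<Longrightarrow> \<pi> v * of_mat (f v) = 0"
      "\<And>v p X. v \<in> verts Q \<Longrightarrow> X \<in> fcar p (rdim N v) \<Longrightarrow> X * of_mat (f v) = 0 \<Longrightarrow> X * \<sigma> v * \<pi> v = X"
    by (simp_all add: P_def)
  have inv: "\<exists>Y. \<pi> (head Q a) * of_mat (rmap N a) = Y * \<pi> (tail Q a)" if a: "a \<in> arcs Q" for a
  proof -
    note h = arc_ends(1)[OF wf a] and tl = arc_ends(2)[OF wf a]
    have "\<pi> (head Q a) * of_mat (rmap N a) * of_mat (f (tail Q a)) = (\<pi> (head Q a) * of_mat (f (head Q a))) * of_mat (rmap M a)"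
      by (simp only: mult.assoc rep_hom_natural[OF wf M N f a])
    then have "\<pi> (head Q a) * of_mat (rmap N a) * of_mat (f (tail Q a)) = 0" by (simp add: k(4)[OF h])
    from k(5)[OF tl fcar_times[OF k(1)[OF h] rep_map_fcar[OF N a]] this] show ?thesis by metis
  qed
  obtain K h where K: "K \<in> Ob (Rep Q)" "h \<in> rep_homs Q N K" "rdim K = d"
    "\<And>v. v \<in> verts Q \<Longrightarrow> of_mat (h v) = \<pi> v" "pointwise_surjective Q N K h"
    by (rule quotient_representation[OF N k(1-3) inv]) auto
  have "\<exists>Y \<in> fcar p (rdim K v). X = Y * of_mat (h v)" if "v \<in> verts Q" "X \<in> fcar p (rdim N v)" "X * of_mat (f v) = 0" for v p X
    using k(5)[OF that] fcar_times[OF that(2) k(2)[OF that(1)]] K(3) K(4)[OF that(1)] by metis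
  then have "pointwise_coexact Q f N K h"
    unfolding pointwise_coexact_def using K(4) k(4) by simp
  then show ?thesis by (rule that[OF K(1,2,5)])
qed

text \<open>A mono is a kernel of its cokernel.\<close>

lemma pointwise_exact_cokernel:
  assumes f: "f \<in> rep_homs Q M N" and inj: "pointwise_injective Q M N f"
    and c: "pointwise_coexact Q f N K k"
  shows "pointwise_exact Q M f N k"
  unfolding pointwise_exact_def
proof (intro ballI conjI allI impI)
  fix v p X assume v: "v \<in> verts Q"
  show "of_mat (k v) * of_mat (f v) = 0" using c v by (simp add: pointwise_coexact_def)
  assume X: "X \<in> fcar (rdim N v) p" "of_mat (k v) * X = 0"
  obtain L where L: "L \<in> fcar (rdim M v) (rdim N v)" "L * of_mat (f v) = fone (rdim M v)"
    using inj v by (auto simp: pointwise_injective_def)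
  let ?e = "fone (rdim N v) - of_mat (f v) * L"
  have "?e \<in> fcar (rdim N v) (rdim N v)" by (rule fcar_diff fone_fcar fcar_times L rep_hom_fcar[OF f v])+
  moreover have "?e * of_mat (f v) = 0"
    by (simp only: left_diff_distrib mult.assoc L(2) fone_left[OF rep_hom_fcar[OF f v]] fone_right[OF rep_hom_fcar[OF f v]]) simp
  ultimately obtain Y where "?e = Y * of_mat (k v)" using c v unfolding pointwise_coexact_def by blast
  then have "?e * X = Y * (of_mat (k v) * X)" by (simp only: mult.assoc)
  then have "?e * X = 0" using X(2) by simp
  then have "X = of_mat (f v) * (L * X)"
    by (simp add: left_diff_distrib mult.assoc fone_left[OF X(1)])
  moreover have "L * X \<in> fcar (rdim M v) p" by (rule fcar_times L X)+
  ultimately show "\<exists>Y \<in> fcar (rdim M v) p. X = of_mat (f v) * Y" by blast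
qed

text \<open>The projection to the cokernel and the zero map agree after an epimorphism, so its cokernel vanishes.\<close>

lemma epimorphism_rep_iff:
  assumes M: "M \<in> Ob (Rep Q)" and N: "N \<in> Ob (Rep Q)"
  shows "epimorphism (Rep Q) M N e \<longleftrightarrow> e \<in> rep_homs Q M N \<and> pointwise_surjective Q M N e"
proof
  assume "e \<in> rep_homs Q M N \<and> pointwise_surjective Q M N e"
  then show "epimorphism (Rep Q) M N e"
    using pointwise_surjective_cancel[of e M N] by (auto simp: epimorphism_def)
next
  assume epi: "epimorphism (Rep Q) M N e"
  then have e: "e \<in> rep_homs Q M N" by (simp add: epimorphism_def)
  obtain K k where K: "K \<in> Ob (Rep Q)" "k \<in> rep_homs Q N K"
    and "pointwise_surjective Q N K k" and "pointwise_coexact Q e N K k"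
    by (rule cokernel_rep[OF M N e])
  then have K34: "\<And>v. v \<in> verts Q \<Longrightarrow> of_mat (k v) * of_mat (e v) = 0"
    "\<And>v p X. v \<in> verts Q \<Longrightarrow> X \<in> fcar p (rdim N v) \<Longrightarrow> X * of_mat (e v) = 0 \<Longrightarrow>
       \<exists>Y \<in> fcar p (rdim K v). X = Y * of_mat (k v)"
    by (auto simp: pointwise_coexact_def)
  let ?z = "Zero (Rep Q) N K"
  have z: "?z \<in> rep_homs Q N K" using rep_zero_in[OF wf N K(1)] by simp
  have "rep_comp Q k e = rep_comp Q ?z e"
    by (rule rep_hom_eqI[OF rep_comp_in[OF wf M N K(1) e K(2)] rep_comp_in[OF wf M N K(1) e z]])
      (simp add: rep_comp_dims[OF K(2) e] rep_comp_dims[OF z e, simplified] K34(1))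
  then have kz: "k = ?z" using epi K(1,2) z by (auto simp: epimorphism_def simp del: rep_category_simps(1,5))
  have "\<exists>R \<in> fcar (rdim M v) (rdim N v). of_mat (e v) * R = fone (rdim N v)" if v: "v \<in> verts Q" for v
  proof (rule right_inverse_exists[OF rep_hom_fcar[OF e v]])
    fix X assume "X \<in> fcar (rdim N v) (rdim N v)" "X * of_mat (e v) = 0"
    from K34(2)[OF v this] show "X = 0" using v by (auto simp: kz)
  qed blast
  then show "e \<in> rep_homs Q M N \<and> pointwise_surjective Q M N e" using e by (simp add: pointwise_surjective_def)
qed

lemma image_factorization:
  assumes M: "M \<in> Ob (Rep Q)" and N: "N \<in> Ob (Rep Q)" and f: "f \<in> rep_homs Q M N"
  obtains I e m where "I \<in> Ob (Rep Q)" "e \<in> rep_homs Q M I" "m \<in> rep_homs Q I N"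
    "pointwise_surjective Q M I e" "pointwise_injective Q I N m" "f = rep_comp Q m e"
proof -
  define P where "P v r E E' D D' \<longleftrightarrow> E \<in> fcar (rdim N v) r \<and> E' \<in> fcar r (rdim N v) \<and> D \<in> fcar r (rdim M v) \<and>
      D' \<in> fcar (rdim M v) r \<and> of_mat (f v) = E * D \<and> E' * E = fone r \<and> D * D' = fone r" for v r E E' D D'
  have "\<exists>r E E' D D'. P v r E E' D D'" if "v \<in> verts Q" for v
    unfolding P_def by (rule rank_factorization[OF rep_hom_fcar[OF f that]]) blast
  then obtain d E E' D D' where "\<And>v. v \<in> verts Q \<Longrightarrow> P v (d v) (E v) (E' v) (D v) (D' v)"
    by metis
  then have
    k: "\<And>v. v \<in> verts Q \<Longrightarrow> E v \<in> fcar (rdim N v) (d v)" "\<And>v. v \<in> verts Q \<Longrightarrow> E' v \<in> fcar (d v) (rdim N v)"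
      "\<And>v. v \<in> verts Q \<Longrightarrow> E' v * E v = fone (d v)"
      "\<And>v. v \<in> verts Q \<Longrightarrow> D v \<in> fcar (d v) (rdim M v)" "\<And>v. v \<in> verts Q \<Longrightarrow> D' v \<in> fcar (rdim M v) (d v)"
      "\<And>v. v \<in> verts Q \<Longrightarrow> of_mat (f v) = E v * D v" "\<And>v. v \<in> verts Q \<Longrightarrow> D v * D' v = fone (d v)"
    by (simp_all add: P_def)
  have inv: "\<exists>Y. of_mat (rmap N a) * E (tail Q a) = E (head Q a) * Y" if a: "a \<in> arcs Q" for a
  proof -
    note h = arc_ends(1)[OF wf a] and tl = arc_ends(2)[OF wf a]
    have "of_mat (rmap N a) * E (tail Q a) = of_mat (rmap N a) * (E (tail Q a) * (D (tail Q a) * D' (tail Q a)))"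
      by (simp only: k(7)[OF tl] fone_right[OF k(1)[OF tl]])
    also have "\<dots> = of_mat (rmap N a) * of_mat (f (tail Q a)) * D' (tail Q a)" by (simp only: k(6)[OF tl] mult.assoc)
    also have "\<dots> = E (head Q a) * (D (head Q a) * of_mat (rmap M a) * D' (tail Q a))"
      by (simp only: rep_hom_natural[OF wf M N f a, symmetric] k(6)[OF h] mult.assoc)
    finally show ?thesis by blast
  qed
  obtain I m where I: "I \<in> Ob (Rep Q)" "m \<in> rep_homs Q I N" "rdim I = d"
    "\<And>v. v \<in> verts Q \<Longrightarrow> of_mat (m v) = E v" "pointwise_injective Q I N m"
    by (rule subrepresentation[OF N k(1-3) inv]) auto
  have "\<exists>Y \<in> fcar (rdim I v) (rdim M v). of_mat (f v) = of_mat (m v) * Y" if "v \<in> verts Q" for v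
    using k(4,6)[OF that] I(3) I(4)[OF that] by auto
  then obtain e where e: "e \<in> rep_homs Q M I" "rep_comp Q m e = f"
    by (rule lift_through_injective[OF M I(1) N I(2,5) f]) auto
  have "of_mat (e v) * D' v = fone (rdim I v)" if v: "v \<in> verts Q" for v
  proof -
    have "E v * of_mat (e v) = of_mat (f v)"
      using e(2) I(4)[OF v] rep_comp_dims[OF I(2) e(1) v] by simp
    then have "E v * of_mat (e v) = E v * D v" using k(6)[OF v] by simp
    then have "of_mat (e v) = D v"
      using left_cancel[OF k(3)[OF v]] rep_hom_fcar[OF e(1) v] k(4)[OF v] unfolding I(3) by blast
    then show ?thesis using k(7)[OF v] I(3) by simp
  qed
  then have "pointwise_surjective Q M I e"
    unfolding pointwise_surjective_def using k(5) I(3) by metis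
  then show ?thesis using that I e by metis
qed

lemma zero_rep: "mk_rep Q (\<lambda>_. 0) (\<lambda>_. 0) \<in> Ob (Rep Q)" "zero_object (Rep Q) (mk_rep Q (\<lambda>_. 0) (\<lambda>_. 0))"
  by (simp_all add: zero_object_def mk_rep_def) (auto intro!: restrict_ext eq_matI)

lemma biproduct_rep:
  assumes M: "M \<in> Ob (Rep Q)" and N: "N \<in> Ob (Rep Q)"
  obtains S i j p q where "S \<in> Ob (Rep Q)" "i \<in> rep_homs Q M S" "j \<in> rep_homs Q N S"
    "p \<in> rep_homs Q S M" "q \<in> rep_homs Q S N" "rdim S = (\<lambda>v. rdim M v + rdim N v)"
    "\<And>v. v \<in> verts Q \<Longrightarrow> of_mat (p v) * of_mat (i v) = fone (rdim M v)"
    "\<And>v. v \<in> verts Q \<Longrightarrow> of_mat (q v) * of_mat (j v) = fone (rdim N v)"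
    "\<And>v. v \<in> verts Q \<Longrightarrow> of_mat (q v) * of_mat (i v) = 0"
    "\<And>v. v \<in> verts Q \<Longrightarrow> of_mat (p v) * of_mat (j v) = 0"
    "\<And>v. v \<in> verts Q \<Longrightarrow> of_mat (i v) * of_mat (p v) + of_mat (j v) * of_mat (q v) = fone (rdim S v)"
proof -
  define d where "d v = rdim M v + rdim N v" for v
  define s where "s a = fone (rdim M (head Q a)) * of_mat (rmap M a) * fone (rdim M (tail Q a)) +
     shift_in (rdim M (head Q a)) (rdim N (head Q a)) * of_mat (rmap N a) * shift_out (rdim M (tail Q a)) (rdim N (tail Q a))" for a
  define S where "S = mk_rep Q d s"
  have S: "S \<in> Ob (Rep Q)" unfolding S_def by (rule mk_rep_Ob)
  have rd: "rdim S v = rdim M v + rdim N v" for v by (simp add: S_def d_def)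
  have sm: "of_mat (rmap S a) = s a" if "a \<in> arcs Q" for a
    unfolding S_def by (rule mk_rep_rmap) (unfold d_def s_def, (rule fcar_add fcar_times shift_fcar rep_map_fcar[OF M that] rep_map_fcar[OF N that])+)
  have c1: "A * (B * X) = (A * B) * X" for A B X :: "'a fmat" by (simp only: mult.assoc)
  have x: "fone n * (shift_in n m * X) = 0" "shift_out n m * (fone n * X) = 0" "shift_out n m * (shift_in n m * X) = fone m * X"
    "fone n * (fone n * X) = fone n * X"
    for n m and X :: "'a fmat"
    by (simp_all only: c1 shift_mult fone_idem) simp_all
  have y: "shift_out (rdim M v) m * of_mat (rmap M a) = 0" if "a \<in> arcs Q" "v = head Q a" for v m a
    using c1[of "shift_out (rdim M v) m" "fone (rdim M v)" "of_mat (rmap M a)"] fone_left[OF rep_map_fcar[OF M that(1)]] that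
    by (simp add: shift_mult)
  have y': "of_mat (rmap M a) * shift_in (rdim M v) m = 0" if "a \<in> arcs Q" "v = tail Q a" for v m a
    using c1[of "of_mat (rmap M a)" "fone (rdim M v)" "shift_in (rdim M v) m"] fone_right[OF rep_map_fcar[OF M that(1)]] that
    by (simp add: shift_mult)
  have y'': "fone (rdim N v) * (of_mat (rmap N a) * X) = of_mat (rmap N a) * X" if "a \<in> arcs Q" "v = head Q a" for v X a
    using fone_left[OF rep_map_fcar[OF N that(1)]] that by (simp add: mult.assoc[symmetric])
  note mm = y y' y'' fone_left[OF rep_map_fcar[OF M]] fone_right[OF rep_map_fcar[OF M]] fone_left[OF rep_map_fcar[OF N]] fone_right[OF rep_map_fcar[OF N]]
  note so = fone_left[OF shift_fcar(2)] fone_right[OF shift_fcar(1)]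
  note i = mk_hom[OF wf M S, where g="\<lambda>v. fone (rdim M v)"]
  note j = mk_hom[OF wf N S, where g="\<lambda>v. shift_in (rdim M v) (rdim N v)"]
  note p = mk_hom[OF wf S M, where g="\<lambda>v. fone (rdim M v)"]
  note q = mk_hom[OF wf S N, where g="\<lambda>v. shift_out (rdim M v) (rdim N v)"]
  note e = sm s_def distrib_left distrib_right mult.assoc shift_mult mm x so shift_fcar rd fone_idem
  have i': "mk_hom Q M S (\<lambda>v. fone (rdim M v)) \<in> rep_homs Q M S"
    "v \<in> verts Q \<Longrightarrow> of_mat (mk_hom Q M S (\<lambda>v. fone (rdim M v)) v) = fone (rdim M v)" for v
    by (rule i; simp add: e)+
  have j': "mk_hom Q N S (\<lambda>v. shift_in (rdim M v) (rdim N v)) \<in> rep_homs Q N S"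
    "v \<in> verts Q \<Longrightarrow> of_mat (mk_hom Q N S (\<lambda>v. shift_in (rdim M v) (rdim N v)) v) = shift_in (rdim M v) (rdim N v)" for v
    by (rule j; simp add: e)+
  have p': "mk_hom Q S M (\<lambda>v. fone (rdim M v)) \<in> rep_homs Q S M"
    "v \<in> verts Q \<Longrightarrow> of_mat (mk_hom Q S M (\<lambda>v. fone (rdim M v)) v) = fone (rdim M v)" for v
    by (rule p; simp add: e)+
  have q': "mk_hom Q S N (\<lambda>v. shift_out (rdim M v) (rdim N v)) \<in> rep_homs Q S N"
    "v \<in> verts Q \<Longrightarrow> of_mat (mk_hom Q S N (\<lambda>v. shift_out (rdim M v) (rdim N v)) v) = shift_out (rdim M v) (rdim N v)" for v
    by (rule q; simp add: e)+
  show ?thesis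
    by (rule that[OF S i'(1) j'(1) p'(1) q'(1)]) (simp_all add: i' j' p' q' shift_mult rd fun_eq_iff)
qed

end

section \<open>Linear maps between coordinate spaces as matrices\<close>

definition linear_map :: "nat \<Rightarrow> nat \<Rightarrow> ('k :: field vec \<Rightarrow> 'k vec) \<Rightarrow> bool" where
  "linear_map m n L \<longleftrightarrow> (\<forall>v \<in> carrier_vec n. L v \<in> carrier_vec m) \<and>
     (\<forall>u \<in> carrier_vec n. \<forall>v \<in> carrier_vec n. L (u + v) = L u + L v) \<and>
     (\<forall>c. \<forall>v \<in> carrier_vec n. L (c \<cdot>\<^sub>v v) = c \<cdot>\<^sub>v L v)"

definition matrix_of :: "nat \<Rightarrow> nat \<Rightarrow> ('k :: field vec \<Rightarrow> 'k vec) \<Rightarrow> 'k mat" where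
  "matrix_of m n L = mat m n (\<lambda>(i, j). L (unit_vec n j) $ i)"

lemma matrix_of_carrier [simp]: "matrix_of m n L \<in> carrier_mat m n"
  by (simp add: matrix_of_def)

lemma coordinate_induct [consumes 1, case_names zero add]:
  fixes v :: "'k :: field vec"
  assumes v: "v \<in> carrier_vec n" and z: "P (0\<^sub>v n)"
    and s: "\<And>u c j. u \<in> carrier_vec n \<Longrightarrow> j < n \<Longrightarrow> P u \<Longrightarrow> P (u + c \<cdot>\<^sub>v unit_vec n j)"
  shows "P v"
proof -
  define t where "t k = vec n (\<lambda>i. if i < k then v $ i else 0)" for k
  have "P (t k)" if "k \<le> n" for k
    using that
  proof (induction k)
    case 0
    have "t 0 = 0\<^sub>v n" by (auto simp: t_def)
    then show ?case using z by simp
  next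
    case (Suc k)
    then have "t (Suc k) = t k + (v $ k) \<cdot>\<^sub>v unit_vec n k"
      by (intro eq_vecI) (auto simp: t_def less_Suc_eq)
    then show ?case using Suc s[of "t k" k "v $ k"] by (simp add: t_def)
  qed
  moreover have "t n = v" using v by (auto simp: t_def)
  ultimately show ?thesis by (metis order_refl)
qed

lemma smult_mat_vec: "A \<in> carrier_mat m n \<Longrightarrow> v \<in> carrier_vec n \<Longrightarrow> (c \<cdot>\<^sub>m A) *\<^sub>v v = c \<cdot>\<^sub>v (A *\<^sub>v (v :: 'k :: field vec))"
  by (intro eq_vecI) (auto simp: scalar_prod_def sum_distrib_left mult.assoc)

lemma mat_vec_unit: "A \<in> carrier_mat m n \<Longrightarrow> j < n \<Longrightarrow> A *\<^sub>v unit_vec n j = col (A :: 'k :: field mat) j"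
  by (intro eq_vecI) auto

lemma mat_vec_zero: "A \<in> carrier_mat m n \<Longrightarrow> A *\<^sub>v 0\<^sub>v n = 0\<^sub>v m" for A :: "'k :: field mat"
  by (intro eq_vecI) auto

lemma linear_map_zero: "linear_map m n L \<Longrightarrow> L (0\<^sub>v n) = 0\<^sub>v m"
proof -
  assume L: "linear_map m n L"
  then have L0: "L (0 \<cdot>\<^sub>v 0\<^sub>v n) = 0 \<cdot>\<^sub>v L (0\<^sub>v n)" "L (0\<^sub>v n) \<in> carrier_vec m"
    by (auto simp: linear_map_def)
  have "0 \<cdot>\<^sub>v 0\<^sub>v n = (0\<^sub>v n :: 'a vec)" by (intro eq_vecI) auto
  moreover have "0 \<cdot>\<^sub>v L (0\<^sub>v n) = 0\<^sub>v m" using L0(2) by (intro eq_vecI) auto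
  ultimately show ?thesis using L0(1) by simp
qed

lemma matrix_of_mult_vec:
  assumes L: "linear_map m n L" and v: "v \<in> carrier_vec n"
  shows "matrix_of m n L *\<^sub>v v = L v"
  using v
proof (induction v rule: coordinate_induct)
  case zero
  show ?case using linear_map_zero[OF L] mat_vec_zero[OF matrix_of_carrier] by metis
next
  case (add u c j)
  have e: "matrix_of m n L *\<^sub>v unit_vec n j = L (unit_vec n j)"
  proof -
    have "L (unit_vec n j) \<in> carrier_vec m" using L by (simp add: linear_map_def)
    then show ?thesis using add(2)
      by (subst mat_vec_unit[OF matrix_of_carrier]) (auto simp: matrix_of_def intro!: eq_vecI)
  qed
  have "matrix_of m n L *\<^sub>v (u + c \<cdot>\<^sub>v unit_vec n j) = matrix_of m n L *\<^sub>v u + c \<cdot>\<^sub>v (matrix_of m n L *\<^sub>v unit_vec n j)"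
    using add by (simp add: mult_add_distrib_mat_vec[OF matrix_of_carrier] mult_mat_vec[OF matrix_of_carrier])
  also have "\<dots> = L u + L (c \<cdot>\<^sub>v unit_vec n j)"
    using L add by (simp add: e linear_map_def)
  also have "\<dots> = L (u + c \<cdot>\<^sub>v unit_vec n j)"
    using L add by (simp add: linear_map_def)
  finally show ?case .
qed

lemma mat_eq_if_vec_eq:
  assumes A: "A \<in> carrier_mat m n" and B: "B \<in> carrier_mat m n"
    and eq: "\<And>v. v \<in> carrier_vec n \<Longrightarrow> A *\<^sub>v v = B *\<^sub>v (v :: 'k :: field vec)"
  shows "A = B"
proof (rule eq_matI)
  fix i j assume "i < dim_row B" "j < dim_col B"
  then show "A $$ (i, j) = B $$ (i, j)"
    using eq[of "unit_vec n j"] A B mat_vec_unit[OF A, of j] mat_vec_unit[OF B, of j]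
    by (auto dest!: arg_cong[of _ _ "\<lambda>v. v $ i"])
qed (use A B in auto)

lemma solve_columnwise:
  fixes X :: "'k :: field fmat"
  assumes K: "K \<in> carrier_mat n r" and X: "X \<in> fcar n p"
    and s: "\<And>j. j < p \<Longrightarrow> \<exists>y \<in> carrier_vec r. K *\<^sub>v y = col (to_mat n p X) j"
  obtains Y where "Y \<in> fcar r p" "X = of_mat K * Y"
proof -
  obtain y where y: "\<And>j. j < p \<Longrightarrow> y j \<in> carrier_vec r" "\<And>j. j < p \<Longrightarrow> K *\<^sub>v y j = col (to_mat n p X) j"
    using s by metis
  define Y where "Y = mat r p (\<lambda>(i, j). y j $ i)"
  have Y: "Y \<in> carrier_mat r p" by (simp add: Y_def)
  have c: "col (K * Y) j = col (to_mat n p X) j" if "j < p" for j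
  proof -
    have "col Y j = y j" using y(1)[OF that] that by (auto simp: Y_def)
    then show ?thesis using col_mult2[OF K Y that] y(2)[OF that] by simp
  qed
  have "K * Y = to_mat n p X"
  proof (rule eq_matI)
    fix i j assume ij: "i < dim_row (to_mat n p X)" "j < dim_col (to_mat n p X)"
    then show "(K * Y) $$ (i, j) = to_mat n p X $$ (i, j)"
      using arg_cong[OF c[of j], of "\<lambda>v. v $ i"] K Y by (simp del: col_mult2)
  qed (use K Y in auto)
  then have "of_mat (K * Y) = X" using X by simp
  then have "X = of_mat K * of_mat Y" using K Y by (simp add: of_mat_mult)
  then show ?thesis using that[of "of_mat Y"] Y by blast
qed

section \<open>Contravariant functors as representations\<close>

text \<open>Forgetting functoriality, a contravariant functor is a representation of the quiver of all
  morphisms; since functors are contravariant, the arrow of \<open>f : X \<rightarrow> Y\<close> goes from \<open>Y\<close> to \<open>X\<close>.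
  Natural transformations are exactly the homomorphisms of these representations, and functors are
  closed under subobjects and quotients.\<close>

definition mod_quiver :: "('k :: field, 'o, 'm) linear_category \<Rightarrow> ('o, 'o \<times> 'o \<times> 'm) pre_digraph" where
  "mod_quiver C = \<lparr>verts = Ob C, arcs = {(X, Y, f). X \<in> Ob C \<and> Y \<in> Ob C \<and> f \<in> Hom C X Y},
     tail = (\<lambda>(X, Y, f). Y), head = (\<lambda>(X, Y, f). X)\<rparr>"

definition rep_of :: "('k, 'o, 'm) matrix_functor \<Rightarrow> ('k, 'o, 'o \<times> 'o \<times> 'm) representation" where
  "rep_of F = \<lparr>rdim = fobj F, rmap = (\<lambda>(X, Y, f). fmap F X Y f)\<rparr>"

definition functor_of :: "('k, 'o, 'o \<times> 'o \<times> 'm) representation \<Rightarrow> ('k, 'o, 'm) matrix_functor" where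
  "functor_of M = \<lparr>fobj = rdim M, fmap = (\<lambda>X Y f. rmap M (X, Y, f))\<rparr>"

lemma rep_of_functor_of [simp]: "rep_of (functor_of M) = M"
  by (simp add: rep_of_def functor_of_def)

lemma rep_of_simps [simp]: "rdim (rep_of F) = fobj F" "rmap (rep_of F) (X, Y, f) = fmap F X Y f"
  by (simp_all add: rep_of_def)

lemma functor_of_simps [simp]: "fmap (functor_of M) X Y f = rmap M (X, Y, f)"
  by (simp_all add: functor_of_def)

lemma mod_quiver_simps [simp]: "verts (mod_quiver C) = Ob C"
  "(X, Y, f) \<in> arcs (mod_quiver C) \<longleftrightarrow> X \<in> Ob C \<and> Y \<in> Ob C \<and> f \<in> Hom C X Y"
  "tail (mod_quiver C) (X, Y, f) = Y" "head (mod_quiver C) (X, Y, f) = X"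
  by (simp_all add: mod_quiver_def)

lemma wf_mod_quiver: "wf_digraph (mod_quiver C)"
  by unfold_locales (auto simp: mod_quiver_def)

lemma mod_op_simps:
  "Ob (mod_op C) = {F. contravariant_linear_functor C F}"
  "Hom (mod_op C) F G = rep_homs (mod_quiver C) (rep_of F) (rep_of G)"
  "Comp (mod_op C) = rep_comp (mod_quiver C)"
  "Ident (mod_op C) F = (\<lambda>X \<in> Ob C. 1\<^sub>m (fobj F X))"
  "Zero (mod_op C) F G = (\<lambda>X \<in> Ob C. 0\<^sub>m (fobj G X) (fobj F X))"
  by (auto simp: mod_op_def natural_transformations_def rep_homs_def rep_comp_def fun_eq_iff mod_quiver_def)

lemma functor_Ob: "contravariant_linear_functor C F \<Longrightarrow> rep_of F \<in> Ob (rep_category (mod_quiver C))"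
  by (auto simp: contravariant_linear_functor_def mod_quiver_def)

definition fm :: "('k :: field, 'o, 'm) matrix_functor \<Rightarrow> 'o \<Rightarrow> 'o \<Rightarrow> 'm \<Rightarrow> 'k fmat" where
  "fm F X Y f = of_mat (fmap F X Y f)"

text \<open>The functor laws in terms of matrices without format, where they can be cancelled against split
  monos and epis.\<close>

lemma functor_iff:
  assumes "lincat C"
  shows "contravariant_linear_functor C F \<longleftrightarrow>
    (\<forall>X \<in> Ob C. \<forall>Y \<in> Ob C. \<forall>f \<in> Hom C X Y. fmap F X Y f \<in> carrier_mat (fobj F X) (fobj F Y)) \<and>
    (\<forall>X \<in> Ob C. fm F X X (Ident C X) = fone (fobj F X)) \<and>
    (\<forall>X \<in> Ob C. \<forall>Y \<in> Ob C. \<forall>Z \<in> Ob C. \<forall>f \<in> Hom C X Y. \<forall>g \<in> Hom C Y Z. fm F X Z (Comp C g f) = fm F X Y f * fm F Y Z g) \<and>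
    (\<forall>X \<in> Ob C. \<forall>Y \<in> Ob C. \<forall>f \<in> Hom C X Y. \<forall>g \<in> Hom C X Y. fm F X Y (Add C f g) = fm F X Y f + fm F X Y g) \<and>
    (\<forall>X \<in> Ob C. \<forall>Y \<in> Ob C. \<forall>f \<in> Hom C X Y. \<forall>c. fm F X Y (Smult C c f) = fscale c (fm F X Y f))"
    (is "_ \<longleftrightarrow> ?c \<and> ?r")
proof -
  interpret lincat C by fact
  show ?thesis
  proof (cases ?c)
    case c: True
    have m: "fmap F X Y f \<in> carrier_mat (fobj F X) (fobj F Y)" if "X \<in> Ob C" "Y \<in> Ob C" "f \<in> Hom C X Y" for X Y f
      using c that by blast
    have 1: "fmap F X X (Ident C X) = 1\<^sub>m (fobj F X) \<longleftrightarrow> fm F X X (Ident C X) = fone (fobj F X)" if "X \<in> Ob C" for X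
      using of_mat_inj[OF m[OF that that ident_in[OF that]] one_carrier_mat] by (simp add: fm_def)
    have 2: "fmap F X Z (Comp C g f) = fmap F X Y f * fmap F Y Z g \<longleftrightarrow> fm F X Z (Comp C g f) = fm F X Y f * fm F Y Z g"
      if "X \<in> Ob C" "Y \<in> Ob C" "Z \<in> Ob C" "f \<in> Hom C X Y" "g \<in> Hom C Y Z" for X Y Z f g
    proof -
      note a = m[OF that(1,2,4)] and b = m[OF that(2,3,5)] and d = m[OF that(1,3) comp_in[OF that]]
      show ?thesis using of_mat_inj[OF d mult_carrier_mat[OF a b]] a b by (simp add: fm_def of_mat_mult)
    qed
    have 3: "fmap F X Y (Add C f g) = fmap F X Y f + fmap F X Y g \<longleftrightarrow> fm F X Y (Add C f g) = fm F X Y f + fm F X Y g"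
      if "X \<in> Ob C" "Y \<in> Ob C" "f \<in> Hom C X Y" "g \<in> Hom C X Y" for X Y f g
    proof -
      note a = m[OF that(1,2,3)] and b = m[OF that(1,2,4)] and d = m[OF that(1,2) add_in[OF that]]
      show ?thesis using of_mat_inj[OF d add_carrier_mat[OF b, of "fmap F X Y f"]] a b by (simp add: fm_def of_mat_add)
    qed
    have 4: "fmap F X Y (Smult C c f) = c \<cdot>\<^sub>m fmap F X Y f \<longleftrightarrow> fm F X Y (Smult C c f) = fscale c (fm F X Y f)"
      if "X \<in> Ob C" "Y \<in> Ob C" "f \<in> Hom C X Y" for X Y f c
    proof -
      note a = m[OF that] and d = m[OF that(1,2) smult_in[OF that]]
      show ?thesis using of_mat_inj[OF d smult_carrier_mat[OF a]] by (simp add: fm_def of_mat_smult)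
    qed
    show ?thesis using c by (simp add: contravariant_linear_functor_def 1 2 3 4 cong: ball_cong)
  next
    case False
    then show ?thesis by (auto simp: contravariant_linear_functor_def)
  qed
qed

context lincat
begin

abbreviation "QC \<equiv> mod_quiver C"

lemma natural_fm:
  assumes "rep_of F \<in> Ob (Rep QC)" "rep_of G \<in> Ob (Rep QC)" "\<eta> \<in> rep_homs QC (rep_of F) (rep_of G)"
    and "X \<in> Ob C" "Y \<in> Ob C" "f \<in> Hom C X Y"
  shows "of_mat (\<eta> X) * fm F X Y f = fm G X Y f * of_mat (\<eta> Y)"
  using rep_hom_natural[OF wf_mod_quiver assms(1-3), of "(X, Y, f)"] assms by (simp add: fm_def)

lemma fm_fcar:
  assumes "rep_of F \<in> Ob (Rep QC)" "X \<in> Ob C" "Y \<in> Ob C" "f \<in> Hom C X Y"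
  shows "fm F X Y f \<in> fcar (fobj F X) (fobj F Y)"
  using rep_map_fcar[OF assms(1), of "(X, Y, f)"] assms by (simp add: fm_def)

lemma subfunctor:
  assumes F: "contravariant_linear_functor C F" and K: "rep_of K \<in> Ob (Rep QC)"
    and k: "k \<in> rep_homs QC (rep_of K) (rep_of F)" and inj: "pointwise_injective QC (rep_of K) (rep_of F) k"
  shows "contravariant_linear_functor C K"
proof -
  note nat = natural_fm[OF K functor_Ob[OF F] k]
  note car = fm_fcar[OF K]
  note FF = F[unfolded functor_iff[OF lincat_axioms]]
  have kc: "of_mat (k X) \<in> fcar (fobj F X) (fobj K X)" if "X \<in> Ob C" for X
    using rep_hom_fcar[OF k, of X] that by simp
  have cancel: "A = B" if "X \<in> Ob C" "A \<in> fcar (fobj K X) p" "B \<in> fcar (fobj K X) p" "of_mat (k X) * A = of_mat (k X) * B" for X A B p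
  proof -
    have "\<exists>L \<in> fcar (fobj K X) (fobj F X). L * of_mat (k X) = fone (fobj K X)"
      using inj that(1) by (simp add: pointwise_injective_def)
    then obtain L where "L * of_mat (k X) = fone (fobj K X)" by (elim bexE)
    then show ?thesis using left_cancel that(2-4) by blast
  qed
  show ?thesis
    unfolding functor_iff[OF lincat_axioms]
  proof (intro conjI ballI allI)
    fix X Y f assume h: "X \<in> Ob C" "Y \<in> Ob C" "f \<in> Hom C X Y"
    then have a: "(X, Y, f) \<in> arcs QC" by simp
    show "fmap K X Y f \<in> carrier_mat (fobj K X) (fobj K Y)" using K[unfolded rep_category_simps mem_Collect_eq, rule_format, OF a] by simp
    show "fm K X Y (Smult C c f) = fscale c (fm K X Y f)" for c
    proof (rule cancel[OF h(1)])
      show "fm K X Y (Smult C c f) \<in> fcar (fobj K X) (fobj K Y)" "fscale c (fm K X Y f) \<in> fcar (fobj K X) (fobj K Y)"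
        using car[OF h] car[OF h(1,2) smult_in[OF h]] by auto
      show "of_mat (k X) * fm K X Y (Smult C c f) = of_mat (k X) * fscale c (fm K X Y f)"
        using nat[OF h] nat[OF h(1,2) smult_in[OF h]] FF h by (simp add: fscale_mult)
    qed
    fix g assume g: "g \<in> Hom C X Y"
    show "fm K X Y (Add C f g) = fm K X Y f + fm K X Y g"
    proof (rule cancel[OF h(1)])
      show "fm K X Y (Add C f g) \<in> fcar (fobj K X) (fobj K Y)" "fm K X Y f + fm K X Y g \<in> fcar (fobj K X) (fobj K Y)"
        using car[OF h] car[OF h(1,2) g] car[OF h(1,2) add_in[OF h g]] by auto
      show "of_mat (k X) * fm K X Y (Add C f g) = of_mat (k X) * (fm K X Y f + fm K X Y g)"
        using nat[OF h] nat[OF h(1,2) g] nat[OF h(1,2) add_in[OF h g]] FF h g by (simp add: distrib_left distrib_right)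
    qed
  next
    fix X assume h: "X \<in> Ob C"
    show "fm K X X (Ident C X) = fone (fobj K X)"
    proof (rule cancel[OF h])
      show "fm K X X (Ident C X) \<in> fcar (fobj K X) (fobj K X)" using car[OF h h ident_in[OF h]] .
      show "of_mat (k X) * fm K X X (Ident C X) = of_mat (k X) * fone (fobj K X)"
        using nat[OF h h ident_in[OF h]] FF h by (simp add: fone_left[OF kc[OF h]] fone_right[OF kc[OF h]])
    qed simp
  next
    fix X Y Z f g assume h: "X \<in> Ob C" "Y \<in> Ob C" "Z \<in> Ob C" "f \<in> Hom C X Y" "g \<in> Hom C Y Z"
    show "fm K X Z (Comp C g f) = fm K X Y f * fm K Y Z g"
    proof (rule cancel[OF h(1)])
      show "fm K X Z (Comp C g f) \<in> fcar (fobj K X) (fobj K Z)" using car[OF h(1,3) comp_in[OF h]] .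
      show "fm K X Y f * fm K Y Z g \<in> fcar (fobj K X) (fobj K Z)" by (rule fcar_times car h)+
      have "of_mat (k X) * fm K X Z (Comp C g f) = fm F X Y f * (fm F Y Z g * of_mat (k Z))"
        using nat[OF h(1,3) comp_in[OF h]] FF h by (simp add: mult.assoc)
      also have "\<dots> = (fm F X Y f * of_mat (k Y)) * fm K Y Z g"
        by (simp only: nat[OF h(2,3,5), symmetric] mult.assoc)
      also have "\<dots> = of_mat (k X) * (fm K X Y f * fm K Y Z g)"
        by (simp only: nat[OF h(1,2,4), symmetric] mult.assoc)
      finally show "of_mat (k X) * fm K X Z (Comp C g f) = of_mat (k X) * (fm K X Y f * fm K Y Z g)" .
    qed
  qed
qed

lemma quotient_functor:
  assumes F: "contravariant_linear_functor C F" and K: "rep_of K \<in> Ob (Rep QC)"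
    and k: "k \<in> rep_homs QC (rep_of F) (rep_of K)" and epi: "pointwise_surjective QC (rep_of F) (rep_of K) k"
  shows "contravariant_linear_functor C K"
proof -
  note nat = natural_fm[OF functor_Ob[OF F] K k, symmetric]
  note car = fm_fcar[OF K]
  note FF = F[unfolded functor_iff[OF lincat_axioms]]
  have kc: "of_mat (k X) \<in> fcar (fobj K X) (fobj F X)" if "X \<in> Ob C" for X
    using rep_hom_fcar[OF k, of X] that by simp
  have cancel: "A = B" if "X \<in> Ob C" "A \<in> fcar p (fobj K X)" "B \<in> fcar p (fobj K X)" "A * of_mat (k X) = B * of_mat (k X)" for X A B p
  proof -
    have "\<exists>L \<in> fcar (fobj F X) (fobj K X). of_mat (k X) * L = fone (fobj K X)"
      using epi that(1) by (simp add: pointwise_surjective_def)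
    then obtain L where "of_mat (k X) * L = fone (fobj K X)" by (elim bexE)
    then show ?thesis using right_cancel that(2-4) by blast
  qed
  show ?thesis
    unfolding functor_iff[OF lincat_axioms]
  proof (intro conjI ballI allI)
    fix X Y f assume h: "X \<in> Ob C" "Y \<in> Ob C" "f \<in> Hom C X Y"
    then have a: "(X, Y, f) \<in> arcs QC" by simp
    show "fmap K X Y f \<in> carrier_mat (fobj K X) (fobj K Y)" using K[unfolded rep_category_simps mem_Collect_eq, rule_format, OF a] by simp
    show "fm K X Y (Smult C c f) = fscale c (fm K X Y f)" for c
    proof (rule cancel[OF h(2)])
      show "fm K X Y (Smult C c f) \<in> fcar (fobj K X) (fobj K Y)" "fscale c (fm K X Y f) \<in> fcar (fobj K X) (fobj K Y)"
        using car[OF h] car[OF h(1,2) smult_in[OF h]] by auto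
      show "fm K X Y (Smult C c f) * of_mat (k Y) = fscale c (fm K X Y f) * of_mat (k Y)"
        using nat[OF h] nat[OF h(1,2) smult_in[OF h]] FF h by (simp add: fscale_mult)
    qed
    fix g assume g: "g \<in> Hom C X Y"
    show "fm K X Y (Add C f g) = fm K X Y f + fm K X Y g"
    proof (rule cancel[OF h(2)])
      show "fm K X Y (Add C f g) \<in> fcar (fobj K X) (fobj K Y)" "fm K X Y f + fm K X Y g \<in> fcar (fobj K X) (fobj K Y)"
        using car[OF h] car[OF h(1,2) g] car[OF h(1,2) add_in[OF h g]] by auto
      show "fm K X Y (Add C f g) * of_mat (k Y) = (fm K X Y f + fm K X Y g) * of_mat (k Y)"
        using nat[OF h] nat[OF h(1,2) g] nat[OF h(1,2) add_in[OF h g]] FF h g by (simp add: distrib_left distrib_right)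
    qed
  next
    fix X assume h: "X \<in> Ob C"
    show "fm K X X (Ident C X) = fone (fobj K X)"
    proof (rule cancel[OF h])
      show "fm K X X (Ident C X) \<in> fcar (fobj K X) (fobj K X)" using car[OF h h ident_in[OF h]] .
      show "fm K X X (Ident C X) * of_mat (k X) = fone (fobj K X) * of_mat (k X)"
        using nat[OF h h ident_in[OF h]] FF h by (simp add: fone_left[OF kc[OF h]] fone_right[OF kc[OF h]])
    qed simp
  next
    fix X Y Z f g assume h: "X \<in> Ob C" "Y \<in> Ob C" "Z \<in> Ob C" "f \<in> Hom C X Y" "g \<in> Hom C Y Z"
    show "fm K X Z (Comp C g f) = fm K X Y f * fm K Y Z g"
    proof (rule cancel[OF h(3)])
      show "fm K X Z (Comp C g f) \<in> fcar (fobj K X) (fobj K Z)" using car[OF h(1,3) comp_in[OF h]] .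
      show "fm K X Y f * fm K Y Z g \<in> fcar (fobj K X) (fobj K Z)" by (rule fcar_times car h)+
      have "fm K X Z (Comp C g f) * of_mat (k Z) = (of_mat (k X) * fm F X Y f) * fm F Y Z g"
        using nat[OF h(1,3) comp_in[OF h]] FF h by (simp add: mult.assoc)
      also have "\<dots> = fm K X Y f * (of_mat (k Y) * fm F Y Z g)"
        by (simp only: nat[OF h(1,2,4), symmetric] mult.assoc)
      also have "\<dots> = fm K X Y f * fm K Y Z g * of_mat (k Z)"
        by (simp only: nat[OF h(2,3,5), symmetric] mult.assoc)
      finally show "fm K X Z (Comp C g f) * of_mat (k Z) = fm K X Y f * fm K Y Z g * of_mat (k Z)" .
    qed
  qed
qed

lemma epimorphism_mod_op_iff:
  assumes F: "contravariant_linear_functor C F" and G: "contravariant_linear_functor C G"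
  shows "epimorphism (mod_op C) F G e \<longleftrightarrow> e \<in> rep_homs QC (rep_of F) (rep_of G) \<and> pointwise_surjective QC (rep_of F) (rep_of G) e"
proof
  assume "e \<in> rep_homs QC (rep_of F) (rep_of G) \<and> pointwise_surjective QC (rep_of F) (rep_of G) e"
  then show "epimorphism (mod_op C) F G e"
    using pointwise_surjective_cancel[OF wf_mod_quiver, of e C "rep_of F" "rep_of G"] by (auto simp: epimorphism_def mod_op_simps)
next
  assume epi: "epimorphism (mod_op C) F G e"
  then have e: "e \<in> rep_homs QC (rep_of F) (rep_of G)" by (simp add: epimorphism_def mod_op_simps)
  have "epimorphism (Rep QC) (rep_of F) (rep_of G) e"
  proof -
    obtain K k where K: "K \<in> Ob (Rep QC)" "k \<in> rep_homs QC (rep_of G) K"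
      "pointwise_surjective QC (rep_of G) K k" "pointwise_coexact QC e (rep_of G) K k"
      by (rule cokernel_rep[OF wf_mod_quiver functor_Ob[OF F] functor_Ob[OF G] e])
    have KF: "contravariant_linear_functor C (functor_of K)"
      by (rule quotient_functor[OF G, of _ k]) (use K in auto)
    let ?z = "Zero (Rep QC) (rep_of G) K"
    have z: "?z \<in> rep_homs QC (rep_of G) K" using rep_zero_in[OF wf_mod_quiver functor_Ob[OF G] K(1)] by simp
    have "rep_comp QC k e = rep_comp QC ?z e"
      by (rule rep_hom_eqI[OF rep_comp_in[OF wf_mod_quiver functor_Ob[OF F] functor_Ob[OF G] K(1) e K(2)]
              rep_comp_in[OF wf_mod_quiver functor_Ob[OF F] functor_Ob[OF G] K(1) e z]])
        (use K(4) in \<open>simp add: rep_comp_dims[OF K(2) e] rep_comp_dims[OF z e, simplified] pointwise_coexact_def\<close>)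
    then have kz: "k = ?z"
      using epi K(2) z KF unfolding epimorphism_def mod_op_simps
      by (metis mem_Collect_eq rep_of_functor_of)
    have "pointwise_surjective QC (rep_of F) (rep_of G) e"
      unfolding pointwise_surjective_def
    proof
      fix v assume v: "v \<in> verts QC"
      show "\<exists>R \<in> fcar (rdim (rep_of F) v) (rdim (rep_of G) v). of_mat (e v) * R = fone (rdim (rep_of G) v)"
      proof (rule right_inverse_exists[OF rep_hom_fcar[OF e v]])
        fix X assume "X \<in> fcar (rdim (rep_of G) v) (rdim (rep_of G) v)" "X * of_mat (e v) = 0"
        then obtain Y where "X = Y * of_mat (k v)" using K(4) v unfolding pointwise_coexact_def by blast
        then show "X = 0" using v by (auto simp: kz)
      qed blast
    qed
    then show ?thesis using e epimorphism_rep_iff[OF wf_mod_quiver functor_Ob[OF F] functor_Ob[OF G]] by blast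
  qed
  then show "e \<in> rep_homs QC (rep_of F) (rep_of G) \<and> pointwise_surjective QC (rep_of F) (rep_of G) e"
    using epimorphism_rep_iff[OF wf_mod_quiver functor_Ob[OF F] functor_Ob[OF G]] by blast
qed

lemma kernel_of_mod_op:
  assumes O: "contravariant_linear_functor C K" "contravariant_linear_functor C M" "contravariant_linear_functor C N"
    and k: "k \<in> rep_homs QC (rep_of K) (rep_of M)" and f: "f \<in> rep_homs QC (rep_of M) (rep_of N)"
    and inj: "pointwise_injective QC (rep_of K) (rep_of M) k" and ex: "pointwise_exact QC (rep_of K) k (rep_of M) f"
  shows "kernel_of (mod_op C) M N f K k"
proof -
  have "kernel_of (Rep QC) (rep_of M) (rep_of N) f (rep_of K) k"
    by (rule kernel_of_pointwise[OF wf_mod_quiver functor_Ob[OF O(1)] functor_Ob[OF O(2)] functor_Ob[OF O(3)] k f inj ex])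
  note ker = this[unfolded kernel_of_def rep_category_simps(2-5)]
  note ker_univ = ker[THEN conjunct2, THEN conjunct2, THEN conjunct2, rule_format]
  show ?thesis
    unfolding kernel_of_def mod_op_simps
  proof (intro conjI ballI impI)
    show "rep_comp QC f k = (\<lambda>X\<in>Ob C. 0\<^sub>m (fobj N X) (fobj K X))" using ker by simp
    fix T t assume "T \<in> {F. contravariant_linear_functor C F}" "t \<in> rep_homs QC (rep_of T) (rep_of M)"
      "rep_comp QC f t = (\<lambda>X\<in>Ob C. 0\<^sub>m (fobj N X) (fobj T X))"
    then show "\<exists>!u. u \<in> rep_homs QC (rep_of T) (rep_of K) \<and> rep_comp QC k u = t"
      using ker_univ[of "rep_of T" t] functor_Ob[of C T] by simp
  qed (use O k in auto)
qed

end

section \<open>Representable functors\<close>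

text \<open>A choice of bases of all Hom spaces into \<open>X\<close>, needed because the values of the functors are
  coordinate spaces rather than abstract vector spaces.\<close>

definition coordinates where
  "coordinates C X n b \<longleftrightarrow> (\<forall>Y \<in> Ob C.
     bij_betw (b Y) (carrier_vec (n Y)) (Hom C Y X) \<and>
     (\<forall>u \<in> carrier_vec (n Y). \<forall>v \<in> carrier_vec (n Y). b Y (u + v) = Add C (b Y u) (b Y v)) \<and>
     (\<forall>c. \<forall>u \<in> carrier_vec (n Y). b Y (c \<cdot>\<^sub>v u) = Smult C c (b Y u)))"

definition coord where
  "coord n b Y f = inv_into (carrier_vec (n Y)) (b Y) f"

text \<open>The functor \<open>Hom(-, X)\<close> in the chosen coordinates.\<close>

definition representable where
  "representable C n b = \<lparr>fobj = n, fmap = (\<lambda>Y Z f. matrix_of (n Y) (n Z) (\<lambda>v. coord n b Y (Comp C (b Z v) f)))\<rparr>"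

context lincat
begin

lemma functor_car: "contravariant_linear_functor C F \<Longrightarrow> Y \<in> Ob C \<Longrightarrow> Z \<in> Ob C \<Longrightarrow> f \<in> Hom C Y Z \<Longrightarrow>
    fmap F Y Z f \<in> carrier_mat (fobj F Y) (fobj F Z)"
  by (auto simp: contravariant_linear_functor_def)

context
  fixes X :: 'o and n :: "'o \<Rightarrow> nat" and b :: "'o \<Rightarrow> 'k vec \<Rightarrow> 'm"
  assumes X: "X \<in> Ob C" and co: "coordinates C X n b"
begin

abbreviation "hX \<equiv> representable C n b"
abbreviation "c \<equiv> coord n b"

lemma b_in: "Y \<in> Ob C \<Longrightarrow> v \<in> carrier_vec (n Y) \<Longrightarrow> b Y v \<in> Hom C Y X"
  using co bij_betwE[of "b Y" "carrier_vec (n Y)" "Hom C Y X"] by (simp add: coordinates_def)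

lemma c_in: "Y \<in> Ob C \<Longrightarrow> f \<in> Hom C Y X \<Longrightarrow> c Y f \<in> carrier_vec (n Y)"
  using co unfolding coordinates_def coord_def bij_betw_def by (metis inv_into_into)

lemma b_c: "Y \<in> Ob C \<Longrightarrow> f \<in> Hom C Y X \<Longrightarrow> b Y (c Y f) = f"
  using co unfolding coordinates_def coord_def by (metis bij_betw_inv_into_right)

lemma c_b: "Y \<in> Ob C \<Longrightarrow> v \<in> carrier_vec (n Y) \<Longrightarrow> c Y (b Y v) = v"
  using co unfolding coordinates_def coord_def by (metis bij_betw_inv_into_left)

lemma c_add: "Y \<in> Ob C \<Longrightarrow> f \<in> Hom C Y X \<Longrightarrow> g \<in> Hom C Y X \<Longrightarrow> c Y (Add C f g) = c Y f + c Y g"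
proof -
  assume h: "Y \<in> Ob C" "f \<in> Hom C Y X" "g \<in> Hom C Y X"
  have "b Y (c Y f + c Y g) = Add C f g"
    using co h c_in[OF h(1,2)] c_in[OF h(1,3)] by (auto simp: coordinates_def b_c)
  then show ?thesis using c_b[OF h(1), of "c Y f + c Y g"] c_in[OF h(1,2)] c_in[OF h(1,3)] by simp
qed

lemma c_smult: "Y \<in> Ob C \<Longrightarrow> f \<in> Hom C Y X \<Longrightarrow> c Y (Smult C a f) = a \<cdot>\<^sub>v c Y f"
proof -
  assume h: "Y \<in> Ob C" "f \<in> Hom C Y X"
  have "b Y (a \<cdot>\<^sub>v c Y f) = Smult C a f"
    using co h c_in[OF h(1,2)] by (auto simp: coordinates_def b_c)
  then show ?thesis using c_b[OF h(1), of "a \<cdot>\<^sub>v c Y f"] c_in[OF h(1,2)] by simp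
qed

lemma b_add: "Y \<in> Ob C \<Longrightarrow> u \<in> carrier_vec (n Y) \<Longrightarrow> v \<in> carrier_vec (n Y) \<Longrightarrow> b Y (u + v) = Add C (b Y u) (b Y v)"
  using co by (auto simp: coordinates_def)

lemma b_smult: "Y \<in> Ob C \<Longrightarrow> u \<in> carrier_vec (n Y) \<Longrightarrow> b Y (a \<cdot>\<^sub>v u) = Smult C a (b Y u)"
  using co by (auto simp: coordinates_def)

lemma representable_linear:
  assumes "Y \<in> Ob C" "Z \<in> Ob C" "f \<in> Hom C Y Z"
  shows "linear_map (n Y) (n Z) (\<lambda>v. c Y (Comp C (b Z v) f))"
  unfolding linear_map_def
  using assms by (auto simp: c_in b_in comp_in[OF _ _ X] b_add b_smult comp_add_left[OF _ _ X] c_add smult_left[OF _ _ X] c_smult)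

lemma representable_simps: "fobj hX = n" "fmap hX Y Z f \<in> carrier_mat (n Y) (n Z)"
  by (simp_all add: representable_def)

lemma representable_apply:
  assumes "Y \<in> Ob C" "Z \<in> Ob C" "f \<in> Hom C Y Z" "g \<in> Hom C Z X"
  shows "fmap hX Y Z f *\<^sub>v c Z g = c Y (Comp C g f)"
  using matrix_of_mult_vec[OF representable_linear[OF assms(1-3)] c_in[OF assms(2,4)]] b_c[OF assms(2,4)]
  by (simp add: representable_def)

lemma vec_from_hom:
  assumes "Y \<in> Ob C" "v \<in> carrier_vec (n Y)"
  obtains g where "g \<in> Hom C Y X" "v = c Y g"
  using that[OF b_in[OF assms]] c_b[OF assms] by simp

lemma representable_functor: "contravariant_linear_functor C hX"
  unfolding contravariant_linear_functor_def
proof (intro conjI ballI allI)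
  note car = representable_simps
  fix Y assume Y: "Y \<in> Ob C"
  show "fmap hX Y Y (Ident C Y) = 1\<^sub>m (fobj hX Y)"
  proof (rule mat_eq_if_vec_eq[of _ "n Y" "n Y"])
    fix v :: "'k vec" assume "v \<in> carrier_vec (n Y)"
    then obtain g where g: "g \<in> Hom C Y X" "v = c Y g" using vec_from_hom[OF Y] by metis
    then show "fmap hX Y Y (Ident C Y) *\<^sub>v v = 1\<^sub>m (fobj hX Y) *\<^sub>v v"
      using representable_apply[OF Y Y ident_in[OF Y] g(1)] ident_right[OF Y X g(1)] c_in[OF Y g(1)]
      by (simp add: car)
  qed (simp_all add: car)
next
  note car = representable_simps
  fix Y Z f assume h: "Y \<in> Ob C" "Z \<in> Ob C" "f \<in> Hom C Y Z"
  show "fmap hX Y Z f \<in> carrier_mat (fobj hX Y) (fobj hX Z)" using car by simp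
  show "fmap hX Y Z (Smult C a f) = a \<cdot>\<^sub>m fmap hX Y Z f" for a
  proof (rule mat_eq_if_vec_eq[of _ "n Y" "n Z"])
    fix v :: "'k vec" assume v: "v \<in> carrier_vec (n Z)"
    then obtain g where g: "g \<in> Hom C Z X" "v = c Z g" using vec_from_hom[OF h(2)] by metis
    show "fmap hX Y Z (Smult C a f) *\<^sub>v v = (a \<cdot>\<^sub>m fmap hX Y Z f) *\<^sub>v v"
      using representable_apply[OF h(1,2) smult_in[OF h] g(1)] representable_apply[OF h g(1)] v
        smult_right[OF h(1,2) X h(3) g(1)] c_smult[OF h(1) comp_in[OF h(1,2) X h(3) g(1)]]
      by (simp add: g(2) smult_mat_vec[OF car(2)])
  qed (simp_all add: car)
  fix f' assume f': "f' \<in> Hom C Y Z"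
  show "fmap hX Y Z (Add C f f') = fmap hX Y Z f + fmap hX Y Z f'"
  proof (rule mat_eq_if_vec_eq[of _ "n Y" "n Z"])
    fix v :: "'k vec" assume v: "v \<in> carrier_vec (n Z)"
    then obtain g where g: "g \<in> Hom C Z X" "v = c Z g" using vec_from_hom[OF h(2)] by metis
    show "fmap hX Y Z (Add C f f') *\<^sub>v v = (fmap hX Y Z f + fmap hX Y Z f') *\<^sub>v v"
      using representable_apply[OF h(1,2) add_in[OF h f'] g(1)] representable_apply[OF h g(1)] v
        representable_apply[OF h(1,2) f' g(1)] comp_add_right[OF h(1,2) X h(3) f' g(1)]
        c_add[OF h(1) comp_in[OF h(1,2) X h(3) g(1)] comp_in[OF h(1,2) X f' g(1)]]
      by (simp add: g(2) add_mult_distrib_mat_vec[OF car(2) car(2)])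
  qed (simp_all add: car)
next
  note car = representable_simps
  fix Y Z W f f' assume h: "Y \<in> Ob C" "Z \<in> Ob C" "W \<in> Ob C" "f \<in> Hom C Y Z" "f' \<in> Hom C Z W"
  show "fmap hX Y W (Comp C f' f) = fmap hX Y Z f * fmap hX Z W f'"
  proof (rule mat_eq_if_vec_eq[of _ "n Y" "n W"])
    fix v :: "'k vec" assume v: "v \<in> carrier_vec (n W)"
    then obtain g where g: "g \<in> Hom C W X" "v = c W g" using vec_from_hom[OF h(3)] by metis
    show "fmap hX Y W (Comp C f' f) *\<^sub>v v = (fmap hX Y Z f * fmap hX Z W f') *\<^sub>v v"
      using representable_apply[OF h(1,3) comp_in[OF h] g(1)] representable_apply[OF h(2,3,5) g(1)] v
        representable_apply[OF h(1,2,4) comp_in[OF h(2,3) X h(5) g(1)]] comp_assoc[OF h(1-3) X h(4,5) g(1)]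
      by (simp add: g(2) assoc_mult_mat_vec[OF car(2) car(2)])
  qed (use car(2) in \<open>simp_all add: mult_carrier_mat[OF car(2) car(2)]\<close>)
qed

definition yoneda :: "('k, 'o, 'm) matrix_functor \<Rightarrow> 'k vec \<Rightarrow> 'o \<Rightarrow> 'k mat" where
  "yoneda F x = (\<lambda>Y \<in> Ob C. matrix_of (fobj F Y) (n Y) (\<lambda>v. fmap F Y X (b Y v) *\<^sub>v x))"

context
  fixes F :: "('k, 'o, 'm) matrix_functor" and x :: "'k vec"
  assumes F: "contravariant_linear_functor C F" and x: "x \<in> carrier_vec (fobj F X)"
begin

lemma yoneda_carrier: "Y \<in> Ob C \<Longrightarrow> yoneda F x Y \<in> carrier_mat (fobj F Y) (n Y)"
  by (simp add: yoneda_def)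

lemma yoneda_apply:
  assumes "Y \<in> Ob C" "g \<in> Hom C Y X"
  shows "yoneda F x Y *\<^sub>v c Y g = fmap F Y X g *\<^sub>v x"
proof -
  have "linear_map (fobj F Y) (n Y) (\<lambda>v. fmap F Y X (b Y v) *\<^sub>v x)"
    unfolding linear_map_def
  proof (intro conjI ballI allI)
    fix v :: "'k vec" assume v: "v \<in> carrier_vec (n Y)"
    note m = functor_car[OF F assms(1) X b_in[OF assms(1) v]]
    show "fmap F Y X (b Y v) *\<^sub>v x \<in> carrier_vec (fobj F Y)" using m x by simp
    show "fmap F Y X (b Y (a \<cdot>\<^sub>v v)) *\<^sub>v x = a \<cdot>\<^sub>v (fmap F Y X (b Y v) *\<^sub>v x)" for a
      using F b_in[OF assms(1) v] X assms(1) b_smult[OF assms(1) v] smult_mat_vec[OF m x]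
      by (simp add: contravariant_linear_functor_def)
    fix u :: "'k vec" assume u: "u \<in> carrier_vec (n Y)"
    note m' = functor_car[OF F assms(1) X b_in[OF assms(1) u]]
    show "fmap F Y X (b Y (u + v)) *\<^sub>v x = fmap F Y X (b Y u) *\<^sub>v x + fmap F Y X (b Y v) *\<^sub>v x"
      using F b_in[OF assms(1) v] b_in[OF assms(1) u] X assms(1) b_add[OF assms(1) u v] add_mult_distrib_mat_vec[OF m' m x]
      by (simp add: contravariant_linear_functor_def)
  qed
  from matrix_of_mult_vec[OF this c_in[OF assms]] show ?thesis
    using assms by (simp add: yoneda_def b_c)
qed

lemma yoneda_natural: "yoneda F x \<in> rep_homs QC (rep_of hX) (rep_of F)"
proof -
  have "yoneda F x Y * fmap hX Y Z f = fmap F Y Z f * yoneda F x Z"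
    if h: "Y \<in> Ob C" "Z \<in> Ob C" "f \<in> Hom C Y Z" for Y Z f
  proof (rule mat_eq_if_vec_eq[of _ "fobj F Y" "n Z"])
    note m1 = yoneda_carrier[OF h(1)] and m2 = yoneda_carrier[OF h(2)] and m3 = functor_car[OF F h]
    fix v :: "'k vec" assume v: "v \<in> carrier_vec (n Z)"
    then obtain g where g: "g \<in> Hom C Z X" "v = c Z g" using vec_from_hom[OF h(2)] by metis
    have gf: "Comp C g f \<in> Hom C Y X" using comp_in[OF h(1,2) X h(3) g(1)] .
    have e: "fmap F Y X (Comp C g f) = fmap F Y Z f * fmap F Z X g"
      using F h X g(1) unfolding contravariant_linear_functor_def by blast
    have "(yoneda F x Y * fmap hX Y Z f) *\<^sub>v v = yoneda F x Y *\<^sub>v c Y (Comp C g f)"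
      using assoc_mult_mat_vec[OF m1 representable_simps(2) v] representable_apply[OF h g(1)] by (simp add: g(2))
    also have "\<dots> = fmap F Y Z f *\<^sub>v (fmap F Z X g *\<^sub>v x)"
      using yoneda_apply[OF h(1) gf] assoc_mult_mat_vec[OF m3 functor_car[OF F h(2) X g(1)] x] by (simp add: e)
    also have "\<dots> = (fmap F Y Z f * yoneda F x Z) *\<^sub>v v"
      using assoc_mult_mat_vec[OF m3 m2 v] yoneda_apply[OF h(2) g(1)] by (simp add: g(2))
    finally show "(yoneda F x Y * fmap hX Y Z f) *\<^sub>v v = (fmap F Y Z f * yoneda F x Z) *\<^sub>v v" .
  qed (rule mult_carrier_mat[OF yoneda_carrier[OF h(1)] representable_simps(2)],
      rule mult_carrier_mat[OF functor_car[OF F h] yoneda_carrier[OF h(2)]])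
  then show ?thesis
    by (auto simp: rep_homs_def yoneda_carrier representable_simps(1) mod_quiver_def yoneda_def)
qed

lemma yoneda_ident: "yoneda F x X *\<^sub>v c X (Ident C X) = x"
  using yoneda_apply[OF X ident_in[OF X]] F X x by (simp add: contravariant_linear_functor_def)

end

lemma natural_vec:
  assumes F: "contravariant_linear_functor C F" and \<eta>: "\<eta> \<in> rep_homs QC (rep_of hX) (rep_of F)"
    and h: "Y \<in> Ob C" "g \<in> Hom C Y X"
  shows "\<eta> Y *\<^sub>v c Y g = fmap F Y X g *\<^sub>v (\<eta> X *\<^sub>v c X (Ident C X))"
proof -
  have cr: "\<eta> Z \<in> carrier_mat (fobj F Z) (n Z)" if "Z \<in> Ob C" for Z
    using rep_hom_carrier[OF \<eta>, of Z] that by (simp add: representable_simps)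
  have "(Y, X, g) \<in> arcs QC" using h X by simp
  then have nat: "\<eta> Y * fmap hX Y X g = fmap F Y X g * \<eta> X"
    using \<eta> unfolding rep_homs_def by fastforce
  note ci = c_in[OF X ident_in[OF X]]
  have "\<eta> Y *\<^sub>v c Y g = \<eta> Y *\<^sub>v (fmap hX Y X g *\<^sub>v c X (Ident C X))"
    using representable_apply[OF h(1) X h(2) ident_in[OF X]] ident_left[OF h(1) X h(2)] by simp
  also have "\<dots> = (\<eta> Y * fmap hX Y X g) *\<^sub>v c X (Ident C X)"
    using assoc_mult_mat_vec[OF cr[OF h(1)] representable_simps(2) ci] by simp
  also have "\<dots> = fmap F Y X g *\<^sub>v (\<eta> X *\<^sub>v c X (Ident C X))"
    using assoc_mult_mat_vec[OF functor_car[OF F h(1) X h(2)] cr[OF X] ci] by (simp add: nat)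
  finally show ?thesis .
qed

lemma natural_eqI:
  assumes F: "contravariant_linear_functor C F"
    and \<eta>: "\<eta> \<in> rep_homs QC (rep_of hX) (rep_of F)" and \<theta>: "\<theta> \<in> rep_homs QC (rep_of hX) (rep_of F)"
    and eq: "\<eta> X *\<^sub>v c X (Ident C X) = \<theta> X *\<^sub>v c X (Ident C X)"
  shows "\<eta> = \<theta>"
proof (rule rep_hom_eqI[OF \<eta> \<theta>])
  fix Y assume "Y \<in> verts QC"
  then have Y: "Y \<in> Ob C" by simp
  have "\<eta> Y = \<theta> Y"
  proof (rule mat_eq_if_vec_eq[of _ "fobj F Y" "n Y"])
    show "\<eta> Y \<in> carrier_mat (fobj F Y) (n Y)" "\<theta> Y \<in> carrier_mat (fobj F Y) (n Y)"
      using rep_hom_carrier[OF \<eta>, of Y] rep_hom_carrier[OF \<theta>, of Y] Y by (simp_all add: representable_simps)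
    fix v :: "'k vec" assume "v \<in> carrier_vec (n Y)"
    then obtain g where g: "g \<in> Hom C Y X" "v = c Y g" using vec_from_hom[OF Y] by metis
    then show "\<eta> Y *\<^sub>v v = \<theta> Y *\<^sub>v v"
      using natural_vec[OF F \<eta> Y g(1)] natural_vec[OF F \<theta> Y g(1)] eq by simp
  qed
  then show "of_mat (\<eta> Y) = of_mat (\<theta> Y)" by simp
qed

text \<open>By the Yoneda lemma, a lift of a map is given by a preimage of the corresponding element.\<close>

lemma representable_projective: "projective_object (mod_op C) hX"
  unfolding projective_object_def mod_op_simps
proof (intro conjI ballI allI impI)
  show "hX \<in> {F. contravariant_linear_functor C F}" using representable_functor by simp
  fix F G e f assume "F \<in> {F. contravariant_linear_functor C F}" "G \<in> {F. contravariant_linear_functor C F}"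
    and epi: "epimorphism (mod_op C) F G e" and f: "f \<in> rep_homs QC (rep_of hX) (rep_of G)"
  then have F: "contravariant_linear_functor C F" and G: "contravariant_linear_functor C G" by auto
  have e: "e \<in> rep_homs QC (rep_of F) (rep_of G)" and surj: "pointwise_surjective QC (rep_of F) (rep_of G) e"
    using epi epimorphism_mod_op_iff[OF F G] by auto
  have cr: "e Y \<in> carrier_mat (fobj G Y) (fobj F Y)" "f Y \<in> carrier_mat (fobj G Y) (n Y)" if "Y \<in> Ob C" for Y
    using rep_hom_carrier[OF e, of Y] rep_hom_carrier[OF f, of Y] that by (simp_all add: representable_simps)
  define y where "y = f X *\<^sub>v c X (Ident C X)"
  have y: "y \<in> carrier_vec (fobj G X)" using cr(2)[OF X] c_in[OF X ident_in[OF X]] by (simp add: y_def)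
  have "\<exists>R \<in> fcar (fobj F X) (fobj G X). of_mat (e X) * R = fone (fobj G X)"
    using surj X by (simp add: pointwise_surjective_def)
  then obtain R where R: "R \<in> fcar (fobj F X) (fobj G X)" "of_mat (e X) * R = fone (fobj G X)" by (elim bexE)
  let ?R = "to_mat (fobj F X) (fobj G X) R"
  have "of_mat (e X * ?R) = of_mat (1\<^sub>m (fobj G X))" using R cr(1)[OF X] by (simp add: of_mat_mult)
  then have eR: "e X * ?R = 1\<^sub>m (fobj G X)"
    using cr(1)[OF X] by (subst (asm) of_mat_inj[of _ "fobj G X" "fobj G X"]) auto
  define x where "x = ?R *\<^sub>v y"
  have x: "x \<in> carrier_vec (fobj F X)" using y by (simp add: x_def mult_mat_vec_carrier[OF to_mat_dims(3)])
  have ex: "e X *\<^sub>v x = y"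
    using assoc_mult_mat_vec[OF cr(1)[OF X] to_mat_dims(3) y, of R] y eR by (simp add: x_def)
  note yn = yoneda_natural[OF F x]
  have "rep_comp QC e (yoneda F x) = f"
  proof (rule natural_eqI[OF G _ f])
    show "rep_comp QC e (yoneda F x) \<in> rep_homs QC (rep_of hX) (rep_of G)"
      by (rule rep_comp_in[OF wf_mod_quiver functor_Ob[OF representable_functor] functor_Ob[OF F] functor_Ob[OF G] yn e])
    show "rep_comp QC e (yoneda F x) X *\<^sub>v c X (Ident C X) = f X *\<^sub>v c X (Ident C X)"
      using assoc_mult_mat_vec[OF cr(1)[OF X] yoneda_carrier[OF F x X] c_in[OF X ident_in[OF X]]] X
      by (simp add: rep_comp_def yoneda_ident[OF F x] ex y_def)
  qed
  then show "\<exists>g \<in> rep_homs QC (rep_of hX) (rep_of F). rep_comp QC e g = f" using yn by blast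
qed

lemma yoneda_surjective:
  assumes F: "contravariant_linear_functor C F" and x: "x \<in> carrier_vec (fobj F X)"
    and gen: "\<And>Y y. Y \<in> Ob C \<Longrightarrow> y \<in> carrier_vec (fobj F Y) \<Longrightarrow> \<exists>f \<in> Hom C Y X. fmap F Y X f *\<^sub>v x = y"
  shows "pointwise_surjective QC (rep_of hX) (rep_of F) (yoneda F x)"
  unfolding pointwise_surjective_def
proof
  fix Y assume "Y \<in> verts QC"
  then have Y: "Y \<in> Ob C" by simp
  obtain R where "R \<in> fcar (n Y) (fobj F Y)" "fone (fobj F Y) = of_mat (yoneda F x Y) * R"
  proof (rule solve_columnwise[OF yoneda_carrier[OF F x Y] fone_fcar])
    fix j assume j: "j < fobj F Y"
    obtain f where f: "f \<in> Hom C Y X" "fmap F Y X f *\<^sub>v x = col (to_mat (fobj F Y) (fobj F Y) (fone (fobj F Y))) j"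
      using gen[OF Y, of "col (to_mat (fobj F Y) (fobj F Y) (fone (fobj F Y))) j"] by (auto simp: carrier_vecI)
    then show "\<exists>y \<in> carrier_vec (n Y). yoneda F x Y *\<^sub>v y = col (to_mat (fobj F Y) (fobj F Y) (fone (fobj F Y))) j"
      using yoneda_apply[OF F x Y f(1)] c_in[OF Y f(1)] by metis
  qed
  then show "\<exists>R \<in> fcar (rdim (rep_of hX) Y) (rdim (rep_of F) Y). of_mat (yoneda F x Y) * R = fone (rdim (rep_of F) Y)"
    by (auto simp: representable_simps)
qed

end

section \<open>Global dimension two from kernels and finite generation\<close>

lemma functor_zero:
  assumes F: "contravariant_linear_functor C F" and h: "X \<in> Ob C" "Y \<in> Ob C"
  shows "fmap F X Y (Zero C X Y) = 0\<^sub>m (fobj F X) (fobj F Y)"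
proof -
  note z = zero_in[OF h]
  note m = functor_car[OF F h z]
  have "fmap F X Y (Zero C X Y) = fmap F X Y (Zero C X Y) + fmap F X Y (Zero C X Y)"
    using F h z add_zero[OF h z] unfolding contravariant_linear_functor_def by metis
  then have "of_mat (fmap F X Y (Zero C X Y)) = of_mat (fmap F X Y (Zero C X Y)) + of_mat (fmap F X Y (Zero C X Y))"
    by (metis of_mat_add)
  then have "of_mat (fmap F X Y (Zero C X Y)) = of_mat (0\<^sub>m (fobj F X) (fobj F Y))" by simp
  then show ?thesis using of_mat_inj[OF m zero_carrier_mat] by blast
qed

lemma functor_comp:
  assumes F: "contravariant_linear_functor C F" and h: "X \<in> Ob C" "Y \<in> Ob C" "Z \<in> Ob C" "f \<in> Hom C X Y" "g \<in> Hom C Y Z"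
    and y: "y \<in> carrier_vec (fobj F Z)"
  shows "fmap F X Z (Comp C g f) *\<^sub>v y = fmap F X Y f *\<^sub>v (fmap F Y Z g *\<^sub>v y)"
  using assoc_mult_mat_vec[OF functor_car[OF F h(1,2,4)] functor_car[OF F h(2,3,5)] y] F h
  by (simp add: contravariant_linear_functor_def)

end

definition has_biproducts where
  "has_biproducts C \<longleftrightarrow> (\<forall>X \<in> Ob C. \<forall>Y \<in> Ob C. \<exists>S \<in> Ob C. \<exists>i \<in> Hom C X S. \<exists>j \<in> Hom C Y S.
     \<exists>p \<in> Hom C S X. \<exists>q \<in> Hom C S Y. Comp C p i = Ident C X \<and> Comp C q j = Ident C Y \<and>
     Comp C q i = Zero C X Y \<and> Comp C p j = Zero C Y X)"

definition has_kernels where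
  "has_kernels C \<longleftrightarrow> (\<forall>X \<in> Ob C. \<forall>Y \<in> Ob C. \<forall>f \<in> Hom C X Y. \<exists>K \<kappa>. kernel_of C X Y f K \<kappa>)"

context lincat
begin

text \<open>Two elements \<open>x\<close> of \<open>F X\<close> and \<open>y\<close> of \<open>F Y\<close> are both images of the element of \<open>F (X \<oplus> Y)\<close> with these
  components.\<close>

lemma finite_family_cyclic:
  assumes F: "contravariant_linear_functor C F" and ne: "Ob C \<noteq> {}" and bi: "has_biproducts C"
    and E: "finite E" "\<And>G y. (G, y) \<in> E \<Longrightarrow> G \<in> Ob C \<and> y \<in> carrier_vec (fobj F G)"
  shows "\<exists>X \<in> Ob C. \<exists>x \<in> carrier_vec (fobj F X). \<forall>(G, y) \<in> E. \<exists>f \<in> Hom C G X. fmap F G X f *\<^sub>v x = y"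
  using E
proof (induction E)
  case empty
  obtain X where "X \<in> Ob C" using ne by blast
  then show ?case by (intro bexI[of _ X] bexI[of _ "0\<^sub>v (fobj F X)"]) auto
next
  case (insert e E)
  obtain G y where e: "e = (G, y)" by (cases e)
  have G: "G \<in> Ob C" and y: "y \<in> carrier_vec (fobj F G)" using insert.prems e by auto
  have "\<exists>X \<in> Ob C. \<exists>x \<in> carrier_vec (fobj F X). \<forall>(G, y) \<in> E. \<exists>f \<in> Hom C G X. fmap F G X f *\<^sub>v x = y"
    using insert.prems by (intro insert.IH) auto
  then obtain X x where X: "X \<in> Ob C" and x: "x \<in> carrier_vec (fobj F X)"
    and IH: "\<And>G y. (G, y) \<in> E \<Longrightarrow> \<exists>f \<in> Hom C G X. fmap F G X f *\<^sub>v x = y" by fast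
  obtain S i j p q where S: "S \<in> Ob C" and i: "i \<in> Hom C X S" and j: "j \<in> Hom C G S" and p: "p \<in> Hom C S X"
    and q: "q \<in> Hom C S G" and eq: "Comp C p i = Ident C X" "Comp C q j = Ident C G" "Comp C q i = Zero C X G"
      "Comp C p j = Zero C G X"
    using bi X G unfolding has_biproducts_def by metis
  define z where "z = fmap F S X p *\<^sub>v x + fmap F S G q *\<^sub>v y"
  note mp = functor_car[OF F S X p] and mq = functor_car[OF F S G q] and mi = functor_car[OF F X S i] and mj = functor_car[OF F G S j]
  have px: "fmap F S X p *\<^sub>v x \<in> carrier_vec (fobj F S)" and qy: "fmap F S G q *\<^sub>v y \<in> carrier_vec (fobj F S)"
    using mult_mat_vec_carrier[OF mp x] mult_mat_vec_carrier[OF mq y] .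
  then have z: "z \<in> carrier_vec (fobj F S)" by (simp add: z_def)
  have one: "fmap F Y Y (Ident C Y) *\<^sub>v v = v" if "Y \<in> Ob C" "v \<in> carrier_vec (fobj F Y)" for Y v
    using F that by (simp add: contravariant_linear_functor_def)
  have zv: "0\<^sub>m m n *\<^sub>v v = 0\<^sub>v m" if "v \<in> carrier_vec n" for m n and v :: "'k vec"
    using that by (intro eq_vecI) auto
  have iz: "fmap F X S i *\<^sub>v z = x"
    using functor_comp[OF F X S X i p x, symmetric] functor_comp[OF F X S G i q y, symmetric] x y
    by (simp add: z_def mult_add_distrib_mat_vec[OF mi px qy] eq one[OF X x] functor_zero[OF F X G] zv[OF y])
  have jz: "fmap F G S j *\<^sub>v z = y"
    using functor_comp[OF F G S X j p x, symmetric] functor_comp[OF F G S G j q y, symmetric] x y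
    by (simp add: z_def mult_add_distrib_mat_vec[OF mj px qy] eq one[OF G y] functor_zero[OF F G X] zv[OF x])
  have "\<exists>f \<in> Hom C G' S. fmap F G' S f *\<^sub>v z = y'" if m: "(G', y') \<in> insert e E" for G' y'
  proof (cases "(G', y') = e")
    case True
    then show ?thesis using jz j e by auto
  next
    case False
    then have "(G', y') \<in> E" using m by simp
    then obtain f where f: "f \<in> Hom C G' X" "fmap F G' X f *\<^sub>v x = y'" using IH by blast
    have G': "G' \<in> Ob C" using insert.prems(1)[OF m] by simp
    have "fmap F G' S (Comp C i f) *\<^sub>v z = y'"
      using functor_comp[OF F G' X S f(1) i z] iz f(2) by simp
    then show ?thesis using comp_in[OF G' X S f(1) i] by blast
  qed
  then show ?case using S z by blast
qed

text \<open>The elements obtained from \<open>x\<close> form a subfunctor.  It contains bases of the values at the finitely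
  many generators, hence, as identities are sums of maps through generators, everything.\<close>

lemma functor_cyclic:
  assumes F: "contravariant_linear_functor C F" and ne: "Ob C \<noteq> {}" and bi: "has_biproducts C"
    and L: "finite L" "L \<subseteq> Ob C" "\<And>X. X \<in> Ob C \<Longrightarrow> through C L X X (Ident C X)"
  obtains X x where "X \<in> Ob C" "x \<in> carrier_vec (fobj F X)"
    "\<forall>Y \<in> Ob C. \<forall>y \<in> carrier_vec (fobj F Y). \<exists>f \<in> Hom C Y X. fmap F Y X f *\<^sub>v x = y"
proof -
  define E :: "('o \<times> 'k vec) set" where "E = (\<Union>G \<in> L. (\<lambda>l. (G, unit_vec (fobj F G) l)) ` {..<fobj F G})"
  have "finite E" "\<And>G y. (G, y) \<in> E \<Longrightarrow> G \<in> Ob C \<and> y \<in> carrier_vec (fobj F G)"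
    using L by (auto simp: E_def)
  from finite_family_cyclic[OF F ne bi this] obtain X x where X: "X \<in> Ob C" and x: "x \<in> carrier_vec (fobj F X)"
    and gen: "\<And>G y. (G, y) \<in> E \<Longrightarrow> \<exists>f \<in> Hom C G X. fmap F G X f *\<^sub>v x = y" by fast
  define S where "S Y = {fmap F Y X f *\<^sub>v x | f. f \<in> Hom C Y X}" for Y
  have S_add: "u + v \<in> S Y" if Y: "Y \<in> Ob C" and uv: "u \<in> S Y" "v \<in> S Y" for Y u v
  proof -
    obtain f g where fg: "f \<in> Hom C Y X" "g \<in> Hom C Y X" "u = fmap F Y X f *\<^sub>v x" "v = fmap F Y X g *\<^sub>v x"
      using uv by (auto simp: S_def)
    have "u + v = fmap F Y X (Add C f g) *\<^sub>v x"
      using F fg Y X add_mult_distrib_mat_vec[OF functor_car[OF F Y X fg(1)] functor_car[OF F Y X fg(2)] x]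
      by (simp add: contravariant_linear_functor_def)
    then show ?thesis using add_in[OF Y X fg(1,2)] by (auto simp: S_def)
  qed
  have S_smult: "a \<cdot>\<^sub>v u \<in> S Y" if Y: "Y \<in> Ob C" and uv: "u \<in> S Y" for Y u a
  proof -
    obtain f where f: "f \<in> Hom C Y X" "u = fmap F Y X f *\<^sub>v x"
      using uv by (auto simp: S_def)
    have "a \<cdot>\<^sub>v u = fmap F Y X (Smult C a f) *\<^sub>v x"
      using F f Y X smult_mat_vec[OF functor_car[OF F Y X f(1)] x] by (simp add: contravariant_linear_functor_def)
    then show ?thesis using smult_in[OF Y X f(1)] by (auto simp: S_def)
  qed
  have S_zero: "0\<^sub>v (fobj F Y) \<in> S Y" if Y: "Y \<in> Ob C" for Y
  proof -
    have "0\<^sub>v (fobj F Y) = fmap F Y X (Zero C Y X) *\<^sub>v x"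
      using x by (simp add: functor_zero[OF F Y X]) (intro eq_vecI; auto)
    then show ?thesis using zero_in[OF Y X] by (auto simp: S_def)
  qed
  have S_pull: "fmap F Y Z h *\<^sub>v u \<in> S Y" if h: "Y \<in> Ob C" "Z \<in> Ob C" "h \<in> Hom C Y Z" and u: "u \<in> S Z" for Y Z h u
  proof -
    obtain f where f: "f \<in> Hom C Z X" "u = fmap F Z X f *\<^sub>v x" using u by (auto simp: S_def)
    then have "fmap F Y Z h *\<^sub>v u = fmap F Y X (Comp C f h) *\<^sub>v x" using functor_comp[OF F h(1,2) X h(3) f(1) x] by simp
    then show ?thesis using comp_in[OF h(1,2) X h(3) f(1)] by (auto simp: S_def)
  qed
  have S_gen: "y \<in> S G" if G: "G \<in> L" and y: "y \<in> carrier_vec (fobj F G)" for G y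
    using y
  proof (induction y rule: coordinate_induct)
    case zero
    show ?case using S_zero G L by blast
  next
    case (add u a j)
    have "(G, unit_vec (fobj F G) j) \<in> E" using G add by (auto simp: E_def)
    from gen[OF this] obtain f where "f \<in> Hom C G X" "unit_vec (fobj F G) j = fmap F G X f *\<^sub>v x" by metis
    then have "unit_vec (fobj F G) j \<in> S G" unfolding S_def by blast
    then show ?case using S_add S_smult G L add by blast
  qed
  have S_through: "fmap F Y Y f *\<^sub>v y \<in> S Y" if "through C L Y Y f" and Y: "Y \<in> Ob C" and y: "y \<in> carrier_vec (fobj F Y)" for Y y f
    using that(1)
  proof (induction rule: through.induct)
    case through_zero
    have "fmap F Y Y (Zero C Y Y) *\<^sub>v y = 0\<^sub>v (fobj F Y)"
      using y by (simp add: functor_zero[OF F Y Y]) (intro eq_vecI; auto)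
    then show ?case using S_zero[OF Y] by simp
  next
    case (through_step f G b a)
    have G: "G \<in> Ob C" using through_step L by blast
    have f: "f \<in> Hom C Y Y" using through_in[OF through_step(1) Y Y L(2)] .
    note ab = comp_in[OF Y G Y through_step(3,4)]
    have "fmap F Y Y (Comp C a b) *\<^sub>v y = fmap F Y G b *\<^sub>v (fmap F G Y a *\<^sub>v y)"
      using functor_comp[OF F Y G Y through_step(3,4) y] .
    also have "\<dots> \<in> S Y"
      by (rule S_pull[OF Y G through_step(3) S_gen[OF through_step(2)]])
        (rule mult_mat_vec_carrier[OF functor_car[OF F G Y through_step(4)] y])
    finally have "fmap F Y Y (Comp C a b) *\<^sub>v y + fmap F Y Y f *\<^sub>v y \<in> S Y"
      using S_add[OF Y] through_step by blast
    then show ?case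
      using F Y ab f add_mult_distrib_mat_vec[OF functor_car[OF F Y Y ab] functor_car[OF F Y Y f] y]
      by (simp add: contravariant_linear_functor_def)
  qed
  have "\<exists>f \<in> Hom C Y X. fmap F Y X f *\<^sub>v x = y" if Y: "Y \<in> Ob C" and y: "y \<in> carrier_vec (fobj F Y)" for Y y
  proof -
    have "y = fmap F Y Y (Ident C Y) *\<^sub>v y" using F Y y by (simp add: contravariant_linear_functor_def)
    also have "\<dots> \<in> S Y" using S_through[OF L(3)[OF Y] Y y] .
    finally show ?thesis by (auto simp: S_def)
  qed
  then show ?thesis using that X x by blast
qed

lemma exact_at_mod_op:
  assumes O: "contravariant_linear_functor C A" "contravariant_linear_functor C B" "contravariant_linear_functor C D"
      "contravariant_linear_functor C K"
    and k: "k \<in> rep_homs QC (rep_of K) (rep_of B)" "pointwise_injective QC (rep_of K) (rep_of B) k"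
      "pointwise_exact QC (rep_of K) k (rep_of B) g"
    and e: "e \<in> rep_homs QC (rep_of A) (rep_of K)" "pointwise_surjective QC (rep_of A) (rep_of K) e"
    and g: "g \<in> rep_homs QC (rep_of B) (rep_of D)" and f: "f = rep_comp QC k e"
  shows "exact_at (mod_op C) A f B g D"
proof -
  have "kernel_of (mod_op C) B D g K k" by (rule kernel_of_mod_op[OF O(4,2,3) k(1) g k(2,3)])
  moreover have "epimorphism (mod_op C) A K e" using e epimorphism_mod_op_iff[OF O(1,4)] by blast
  moreover have "f \<in> rep_homs QC (rep_of A) (rep_of B)"
    unfolding f by (rule rep_comp_in[OF wf_mod_quiver functor_Ob[OF O(1)] functor_Ob[OF O(4)] functor_Ob[OF O(2)] e(1) k(1)])
  ultimately show ?thesis using g f unfolding exact_at_def mod_op_simps by blast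
qed

lemma representable_cover:
  assumes F: "contravariant_linear_functor C F" and ne: "Ob C \<noteq> {}" and bi: "has_biproducts C"
    and L: "finite L" "L \<subseteq> Ob C" "\<And>X. X \<in> Ob C \<Longrightarrow> through C L X X (Ident C X)"
    and co: "\<And>X. X \<in> Ob C \<Longrightarrow> \<exists>n b. coordinates C X n b"
  obtains X n b e where "X \<in> Ob C" "coordinates C X n b" "e \<in> rep_homs QC (rep_of (representable C n b)) (rep_of F)"
    "pointwise_surjective QC (rep_of (representable C n b)) (rep_of F) e"
proof -
  obtain X x where x: "X \<in> Ob C" "x \<in> carrier_vec (fobj F X)"
    "\<forall>Y \<in> Ob C. \<forall>y \<in> carrier_vec (fobj F Y). \<exists>f \<in> Hom C Y X. fmap F Y X f *\<^sub>v x = y"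
    by (rule functor_cyclic[OF F ne bi L])
  obtain n b where "coordinates C X n b" using co[OF x(1)] by blast
  note * = x(1) this
  show ?thesis by (rule that[OF * yoneda_natural[OF * F x(2)] yoneda_surjective[OF * F x(2) x(3)[rule_format]]])
qed

text \<open>By the Yoneda lemma \<open>d\<close> is composition with \<open>u\<close>, and the maps into \<open>Y\<close> that \<open>u\<close> kills are those that
  factor uniquely through \<open>Z\<close>.\<close>

lemma representable_kernel:
  assumes X: "X \<in> Ob C" "coordinates C X n b" and Y: "Y \<in> Ob C" "coordinates C Y n' b'"
    and Z: "Z \<in> Ob C" "coordinates C Z n'' b''"
    and d: "d \<in> rep_homs QC (rep_of (representable C n' b')) (rep_of (representable C n b))"
    and u: "u = b Y (d Y *\<^sub>v coord n' b' Y (Ident C Y))" and k: "kernel_of C Y X u Z k"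
  obtains d' where "d' \<in> rep_homs QC (rep_of (representable C n'' b'')) (rep_of (representable C n' b'))"
    "pointwise_injective QC (rep_of (representable C n'' b'')) (rep_of (representable C n' b')) d'"
    "pointwise_exact QC (rep_of (representable C n'' b'')) d' (rep_of (representable C n' b')) d"
proof -
  let ?h = "representable C n b" and ?h' = "representable C n' b'" and ?h'' = "representable C n'' b''"
  let ?c = "coord n b" and ?c' = "coord n' b'" and ?c'' = "coord n'' b''"
  have k_in: "k \<in> Hom C Z Y" and uk: "Comp C u k = Zero C Z X"
    and univ: "\<And>T t. T \<in> Ob C \<Longrightarrow> t \<in> Hom C T Y \<Longrightarrow> Comp C u t = Zero C T X \<Longrightarrow> \<exists>!w. w \<in> Hom C T Z \<and> Comp C k w = t"
    using k unfolding kernel_of_def by blast+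
  have dc: "d W \<in> carrier_mat (n W) (n' W)" if "W \<in> Ob C" for W
    using rep_hom_carrier[OF d, of W] that by (simp add: representable_def)
  note idY = ident_in[OF Y(1)]
  have dY: "d Y *\<^sub>v ?c' Y (Ident C Y) \<in> carrier_vec (n Y)"
    by (rule mult_mat_vec_carrier[OF dc[OF Y(1)] c_in[OF Y Y(1) idY]])
  have u_in: "u \<in> Hom C Y X" unfolding u by (rule b_in[OF X Y(1) dY])
  have cu: "?c Y u = d Y *\<^sub>v ?c' Y (Ident C Y)" unfolding u by (rule c_b[OF X Y(1) dY])
  have d_eq: "d W *\<^sub>v ?c' W g = ?c W (Comp C u g)" if "W \<in> Ob C" "g \<in> Hom C W Y" for W g
    using natural_vec[OF Y representable_functor[OF X] d that] representable_apply[OF X that(1) Y(1) that(2) u_in]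
    by (simp add: cu)
  define x where "x = ?c' Z k"
  have x: "x \<in> carrier_vec (fobj ?h' Z)"
    unfolding x_def using c_in[OF Y Z(1) k_in] by (simp add: representable_def)
  define d' where "d' = yoneda Z n'' b'' ?h' x"
  note d' = yoneda_natural[OF Z representable_functor[OF Y] x, folded d'_def]
  have d'c: "d' W \<in> carrier_mat (n' W) (n'' W)" if "W \<in> Ob C" for W
    using rep_hom_carrier[OF d', of W] that by (simp add: representable_def)
  have d'_eq: "d' W *\<^sub>v ?c'' W g = ?c' W (Comp C k g)" if "W \<in> Ob C" "g \<in> Hom C W Z" for W g
    using yoneda_apply[OF Z representable_functor[OF Y] x that] representable_apply[OF Y that(1) Z(1) that(2) k_in]
    by (simp add: d'_def x_def)
  have kg: "Comp C u (Comp C k g) = Zero C W X" if "W \<in> Ob C" "g \<in> Hom C W Z" for W g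
    using comp_assoc[OF that(1) Z(1) Y(1) X(1) that(2) k_in u_in] uk comp_zero_left[OF that(1) Z(1) X(1) that(2)] by simp
  have inj: "pointwise_injective QC (rep_of ?h'') (rep_of ?h') d'"
    unfolding pointwise_injective_def
  proof
    fix W assume "W \<in> verts QC"
    then have W: "W \<in> Ob C" by simp
    have "inj_on (\<lambda>v. d' W *\<^sub>v v) (carrier_vec (n'' W))"
    proof (rule inj_onI)
      fix v w :: "'k vec" assume v: "v \<in> carrier_vec (n'' W)" and w: "w \<in> carrier_vec (n'' W)" and eq: "d' W *\<^sub>v v = d' W *\<^sub>v w"
      obtain g where g: "g \<in> Hom C W Z" "v = ?c'' W g" using vec_from_hom[OF Z W v] by metis
      obtain g' where g': "g' \<in> Hom C W Z" "w = ?c'' W g'" using vec_from_hom[OF Z W w] by metis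
      note kin = comp_in[OF W Z(1) Y(1) g(1) k_in] and kin' = comp_in[OF W Z(1) Y(1) g'(1) k_in]
      have "?c' W (Comp C k g) = ?c' W (Comp C k g')"
        using eq d'_eq[OF W g(1)] d'_eq[OF W g'(1)] g g' by simp
      then have "Comp C k g = Comp C k g'" using b_c[OF Y W kin] b_c[OF Y W kin'] by metis
      then have "g = g'" using univ[OF W kin kg[OF W g(1)]] g(1) g'(1) by metis
      then show "v = w" using g g' by simp
    qed
    then obtain L where "L \<in> fcar (n'' W) (n' W)" "L * of_mat (d' W) = fone (n'' W)"
      by (rule left_inverse_of_inj_on[OF d'c[OF W]])
    then show "\<exists>L \<in> fcar (rdim (rep_of ?h'') W) (rdim (rep_of ?h') W). L * of_mat (d' W) = fone (rdim (rep_of ?h'') W)"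
      by (intro bexI[of _ L]) (simp_all add: representable_def)
  qed
  have c0: "?c W (Zero C W X) = 0\<^sub>v (n W)" if W: "W \<in> Ob C" for W
  proof -
    note m = representable_apply[OF X W X(1) zero_in[OF W X(1)] ident_in[OF X(1)]]
    have "?c W (Zero C W X) = fmap ?h W X (Zero C W X) *\<^sub>v ?c X (Ident C X)"
      using m ident_left[OF W X(1) zero_in[OF W X(1)]] by simp
    also have "\<dots> = 0\<^sub>v (n W)"
      using c_in[OF X X(1) ident_in[OF X(1)]] functor_zero[OF representable_functor[OF X] W X(1)]
      by (simp add: representable_def) (intro eq_vecI; auto)
    finally show ?thesis .
  qed
  have "pointwise_exact QC (rep_of ?h'') d' (rep_of ?h') d"
    unfolding pointwise_exact_def
  proof (intro ballI conjI allI impI)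
    fix W assume "W \<in> verts QC"
    then have W: "W \<in> Ob C" by simp
    have "d W * d' W = 0\<^sub>m (n W) (n'' W)"
    proof (rule mat_eq_if_vec_eq[of _ "n W" "n'' W"])
      fix v :: "'k vec" assume v: "v \<in> carrier_vec (n'' W)"
      obtain g where g: "g \<in> Hom C W Z" "v = ?c'' W g" using vec_from_hom[OF Z W v] by metis
      have "(d W * d' W) *\<^sub>v v = ?c W (Comp C u (Comp C k g))"
        using assoc_mult_mat_vec[OF dc[OF W] d'c[OF W] v] d'_eq[OF W g(1)] d_eq[OF W comp_in[OF W Z(1) Y(1) g(1) k_in]] g(2)
        by simp
      also have "\<dots> = 0\<^sub>m (n W) (n'' W) *\<^sub>v v" using kg[OF W g(1)] c0[OF W] v by simp (intro eq_vecI; auto)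
      finally show "(d W * d' W) *\<^sub>v v = 0\<^sub>m (n W) (n'' W) *\<^sub>v v" .
    qed (simp_all add: mult_carrier_mat[OF dc[OF W] d'c[OF W]])
    then have "of_mat (d W * d' W) = 0" by simp
    then show "of_mat (d W) * of_mat (d' W) = 0" using dc[OF W] d'c[OF W] by (simp add: of_mat_mult)
    fix p A assume "A \<in> fcar (rdim (rep_of ?h') W) p" and dA: "of_mat (d W) * A = 0"
    then have A: "A \<in> fcar (n' W) p" by (simp add: representable_def)
    let ?A = "to_mat (n' W) p A"
    have "of_mat (d W * ?A) = of_mat (0\<^sub>m (n W) p)" using dA A dc[OF W] by (simp add: of_mat_mult)
    then have dA': "d W * ?A = 0\<^sub>m (n W) p" using dc[OF W] by (subst (asm) of_mat_inj[of _ "n W" p]) auto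
    obtain B where "B \<in> fcar (n'' W) p" "A = of_mat (d' W) * B"
    proof (rule solve_columnwise[OF d'c[OF W] A])
      fix j assume j: "j < p"
      have col: "col ?A j \<in> carrier_vec (n' W)" by (simp add: carrier_vecI)
      have "d W *\<^sub>v col ?A j = col (d W * ?A) j" using j by (intro col_mult2[OF dc[OF W], symmetric]) auto
      then have z: "d W *\<^sub>v col ?A j = 0\<^sub>v (n W)" using j by (simp add: dA')
      obtain g where g: "g \<in> Hom C W Y" "col ?A j = ?c' W g" using vec_from_hom[OF Y W col] by metis
      have "?c W (Comp C u g) = ?c W (Zero C W X)" using z d_eq[OF W g(1)] g(2) c0[OF W] by simp
      then have "Comp C u g = Zero C W X"
        using b_c[OF X W comp_in[OF W Y(1) X(1) g(1) u_in]] b_c[OF X W zero_in[OF W X(1)]] by metis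
      from univ[OF W g(1) this] obtain w where w: "w \<in> Hom C W Z" "Comp C k w = g" by blast
      then have "d' W *\<^sub>v ?c'' W w = col ?A j" using d'_eq[OF W w(1)] g(2) by simp
      then show "\<exists>y \<in> carrier_vec (n'' W). d' W *\<^sub>v y = col ?A j" using c_in[OF Z W w(1)] by blast
    qed
    then show "\<exists>B \<in> fcar (rdim (rep_of ?h'') W) p. A = of_mat (d' W) * B"
      by (intro bexI[of _ B]) (simp_all add: representable_def)
  qed
  then show ?thesis using that d' inj by blast
qed

text \<open>The resolution is \<open>Hom(-,Z) \<rightarrow> Hom(-,Y) \<rightarrow> Hom(-,X)\<close>, followed by zero functors.\<close>

theorem global_dimension_mod_op_le_2:
  assumes ne: "Ob C \<noteq> {}" and bi: "has_biproducts C" and ker: "has_kernels C"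
    and L: "finite L" "L \<subseteq> Ob C" "\<And>X. X \<in> Ob C \<Longrightarrow> through C L X X (Ident C X)"
    and co: "\<And>X. X \<in> Ob C \<Longrightarrow> \<exists>n b. coordinates C X n b"
  shows "global_dimension (mod_op C) \<le> 2"
  unfolding global_dimension_def
proof (rule SUP_least)
  fix F assume "F \<in> Ob (mod_op C)"
  then have F: "contravariant_linear_functor C F" by (simp add: mod_op_simps)
  obtain X n b \<epsilon> where X: "X \<in> Ob C" "coordinates C X n b"
    and \<epsilon>: "\<epsilon> \<in> rep_homs QC (rep_of (representable C n b)) (rep_of F)"
      "pointwise_surjective QC (rep_of (representable C n b)) (rep_of F) \<epsilon>"
    by (rule representable_cover[OF F ne bi L co])
  let ?P0 = "representable C n b"
  note P0 = representable_functor[OF X]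
  obtain M k where M: "M \<in> Ob (Rep QC)" "k \<in> rep_homs QC M (rep_of ?P0)" "pointwise_injective QC M (rep_of ?P0) k"
    "pointwise_exact QC M k (rep_of ?P0) \<epsilon>"
    by (rule kernel_rep[OF wf_mod_quiver functor_Ob[OF P0] functor_Ob[OF F] \<epsilon>(1)])
  define K where "K = functor_of M"
  have MK: "M = rep_of K" by (simp add: K_def)
  note M = M[unfolded MK]
  have K: "contravariant_linear_functor C K" by (rule subfunctor[OF P0 M(1-3)])
  obtain Y n' b' e where Y: "Y \<in> Ob C" "coordinates C Y n' b'"
    and e: "e \<in> rep_homs QC (rep_of (representable C n' b')) (rep_of K)"
      "pointwise_surjective QC (rep_of (representable C n' b')) (rep_of K) e"
    by (rule representable_cover[OF K ne bi L co])
  let ?P1 = "representable C n' b'"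
  note P1 = representable_functor[OF Y]
  define d0 where "d0 = rep_comp QC k e"
  have d0: "d0 \<in> rep_homs QC (rep_of ?P1) (rep_of ?P0)"
    unfolding d0_def by (rule rep_comp_in[OF wf_mod_quiver functor_Ob[OF P1] functor_Ob[OF K] functor_Ob[OF P0] e(1) M(2)])
  define u where "u = b Y (d0 Y *\<^sub>v coord n' b' Y (Ident C Y))"
  have "d0 Y \<in> carrier_mat (n Y) (n' Y)"
    using rep_hom_carrier[OF d0, of Y] Y(1) by (simp add: representable_def)
  then have "u \<in> Hom C Y X"
    unfolding u_def by (intro b_in[OF X Y(1)] mult_mat_vec_carrier[OF _ c_in[OF Y Y(1) ident_in[OF Y(1)]]])
  then obtain Z w where Zw: "kernel_of C Y X u Z w" using ker Y(1) X(1) unfolding has_kernels_def by blast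
  then have Z1: "Z \<in> Ob C" by (simp add: kernel_of_def)
  obtain n'' b'' where "coordinates C Z n'' b''" using co[OF Z1] by blast
  note Z = Z1 this
  let ?P2 = "representable C n'' b''"
  note P2 = representable_functor[OF Z]
  obtain d1 where d1: "d1 \<in> rep_homs QC (rep_of ?P2) (rep_of ?P1)"
    "pointwise_injective QC (rep_of ?P2) (rep_of ?P1) d1" "pointwise_exact QC (rep_of ?P2) d1 (rep_of ?P1) d0"
    by (rule representable_kernel[OF X Y Z d0 u_def Zw])
  \<comment> \<open>The zero functor continues the resolution to the left.\<close>
  define N :: "('k, 'o, 'm) matrix_functor" where "N = \<lparr>fobj = (\<lambda>_. 0), fmap = (\<lambda>_ _ _. 0\<^sub>m 0 0)\<rparr>"
  have N: "contravariant_linear_functor C N"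
    by (auto simp: N_def contravariant_linear_functor_def intro!: eq_matI)
  have Nz: "zero_object (mod_op C) N"
    using N by (auto simp: zero_object_def mod_op_simps N_def intro!: restrict_ext eq_matI)
  define z where "z A = (\<lambda>X \<in> Ob C. 0\<^sub>m (fobj A X) 0 :: 'k mat)" for A :: "('k, 'o, 'm) matrix_functor"
  have z: "z A \<in> rep_homs QC (rep_of N) (rep_of A)" if "contravariant_linear_functor C A" for A
    using rep_zero_in[OF wf_mod_quiver functor_Ob[OF N] functor_Ob[OF that]] by (simp add: z_def N_def)
  have NN: "f = g" if "f \<in> rep_homs QC (rep_of N) (rep_of A)" "g \<in> rep_homs QC (rep_of N) (rep_of A)" for f g A
    using that rep_hom_fcar[OF that(1)] rep_hom_fcar[OF that(2)] by (intro rep_hom_eqI[OF that]) (simp add: N_def)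
  have zinj: "pointwise_injective QC (rep_of N) (rep_of A) (z A)" for A
    unfolding pointwise_injective_def by (auto simp: N_def z_def)
  have zsurj: "pointwise_surjective QC (rep_of N) (rep_of N) (z N)"
    unfolding pointwise_surjective_def by (auto simp: N_def z_def)
  have exN: "exact_at (mod_op C) N (z A) A f B"
    if A: "contravariant_linear_functor C A" and B: "contravariant_linear_functor C B"
      and f: "f \<in> rep_homs QC (rep_of A) (rep_of B)" "pointwise_injective QC (rep_of A) (rep_of B) f" for A B f
  proof (rule exact_at_mod_op[OF N A B N z[OF A] zinj _ z[OF N] zsurj f(1)])
    show "pointwise_exact QC (rep_of N) (z A) (rep_of A) f"
      unfolding pointwise_exact_def
    proof (intro ballI conjI allI impI)
      fix v p Xa assume v: "v \<in> verts QC"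
      show "of_mat (f v) * of_mat (z A v) = 0" using v by (simp add: z_def)
      assume Xa: "Xa \<in> fcar (rdim (rep_of A) v) p" "of_mat (f v) * Xa = 0"
      obtain L where "L * of_mat (f v) = fone (rdim (rep_of A) v)" using f(2) v by (auto simp: pointwise_injective_def)
      from left_cancel[OF this Xa(1) fcar_zero] have "Xa = 0" using Xa(2) by simp
      then show "\<exists>Y \<in> fcar (rdim (rep_of N) v) p. Xa = of_mat (z A v) * Y" by (intro bexI[of _ 0]) auto
    qed
    show "z A = rep_comp QC (z A) (z N)"
      by (rule NN[OF z[OF A] rep_comp_in[OF wf_mod_quiver functor_Ob[OF N] functor_Ob[OF N] functor_Ob[OF A] z[OF N] z[OF A]]])
  qed
  have Nproj: "projective_object (mod_op C) N"
    unfolding projective_object_def mod_op_simps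
  proof (intro conjI ballI allI impI)
    show "N \<in> {F. contravariant_linear_functor C F}" using N by simp
    fix A B g f assume "A \<in> {F. contravariant_linear_functor C F}" "B \<in> {F. contravariant_linear_functor C F}"
      and epi: "epimorphism (mod_op C) A B g" and f: "f \<in> rep_homs QC (rep_of N) (rep_of B)"
    then have A: "contravariant_linear_functor C A" and B: "contravariant_linear_functor C B" by auto
    have g: "g \<in> rep_homs QC (rep_of A) (rep_of B)" using epi epimorphism_mod_op_iff[OF A B] by blast
    have "rep_comp QC g (z A) = f"
      by (rule NN[OF rep_comp_in[OF wf_mod_quiver functor_Ob[OF N] functor_Ob[OF A] functor_Ob[OF B] z[OF A] g] f])
    then show "\<exists>h \<in> rep_homs QC (rep_of N) (rep_of A). rep_comp QC g h = f" using z[OF A] by blast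
  qed
  define P where "P i = (if i = 0 then ?P0 else if i = 1 then ?P1 else if i = 2 then ?P2 else N)" for i :: nat
  define d where "d i = (if i = 0 then d0 else if i = 1 then d1 else z (P i))" for i :: nat
  have idP2: "rep_comp QC d1 (Ident (mod_op C) ?P2) = d1"
  proof -
    have i: "Ident (mod_op C) ?P2 \<in> rep_homs QC (rep_of ?P2) (rep_of ?P2)"
      using rep_ident_in[OF wf_mod_quiver functor_Ob[OF P2]] by (simp add: mod_op_simps)
    show ?thesis
      by (rule rep_hom_eqI[OF rep_comp_in[OF wf_mod_quiver functor_Ob[OF P2] functor_Ob[OF P2] functor_Ob[OF P1] i d1(1)] d1(1)])
        (simp add: rep_comp_dims[OF d1(1) i], simp add: mod_op_simps fone_right[OF rep_hom_fcar[OF d1(1), simplified]])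
  qed
  have ident: "Ident (mod_op C) ?P2 \<in> rep_homs QC (rep_of ?P2) (rep_of ?P2)"
      "pointwise_surjective QC (rep_of ?P2) (rep_of ?P2) (Ident (mod_op C) ?P2)"
    using rep_ident_in[OF wf_mod_quiver functor_Ob[OF P2]] by (auto simp: mod_op_simps pointwise_surjective_def)
  have "projective_resolution (mod_op C) F P d \<epsilon>"
    unfolding projective_resolution_def
  proof (intro conjI allI)
    fix i
    show "projective_object (mod_op C) (P i)"
      using representable_projective[OF X] representable_projective[OF Y] representable_projective[OF Z] Nproj by (simp add: P_def)
    show "exact_at (mod_op C) (P (i + 2)) (d (i + 1)) (P (i + 1)) (d i) (P i)"
    proof -
      consider "i = 0" | "i = 1" | "i \<ge> 2" by linarith
      then show ?thesis
      proof cases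
        case 1
        have "exact_at (mod_op C) ?P2 d1 ?P1 d0 ?P0"
          by (rule exact_at_mod_op[OF P2 P1 P0 P2 d1 ident d0]) (simp add: idP2)
        then show ?thesis using 1 by (simp add: P_def d_def)
      next
        case 2
        have "exact_at (mod_op C) N (z ?P2) ?P2 d1 ?P1" by (rule exN[OF P2 P1 d1(1,2)])
        then show ?thesis using 2 by (simp add: P_def d_def)
      next
        case 3
        have "contravariant_linear_functor C (P i)" using P2 N 3 by (simp add: P_def)
        then have "exact_at (mod_op C) N (z N) N (z (P i)) (P i)" by (intro exN[OF N _ z zinj])
        moreover have "P (i + 2) = N" "P (i + 1) = N" "d (i + 1) = z N" "d i = z (P i)" using 3 by (simp_all add: P_def d_def)
        ultimately show ?thesis by simp
      qed
    qed
  next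
    show "epimorphism (mod_op C) (P 0) F \<epsilon>" using epimorphism_mod_op_iff[OF P0 F] \<epsilon> by (simp add: P_def)
    have "exact_at (mod_op C) ?P1 d0 ?P0 \<epsilon> F" by (rule exact_at_mod_op[OF P1 P0 F K M(2-4) e \<epsilon>(1) d0_def])
    then show "exact_at (mod_op C) (P 1) (d 0) (P 0) \<epsilon> F" by (simp add: P_def d_def)
  qed
  moreover have "\<forall>i > 2. zero_object (mod_op C) (P i)" using Nz by (simp add: P_def)
  ultimately have "enat 2 \<in> {enat n | n. \<exists>P d \<epsilon>. projective_resolution (mod_op C) F P d \<epsilon> \<and> (\<forall>i > n. zero_object (mod_op C) (P i))}"
    by blast
  then have "projective_dimension (mod_op C) F \<le> enat 2"
    unfolding projective_dimension_def by (rule Inf_lower)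
  then show "projective_dimension (mod_op C) F \<le> 2" by (simp add: numeral_eq_enat)
qed

end

section \<open>Projective representations of a graded quiver\<close>

text \<open>A height function that every arrow raises by one exists for every orientation of a tree.  It
  excludes oriented cycles and makes recursion along the arrows possible.\<close>

locale graded_quiver =
  fixes Q :: "('v, 'e) pre_digraph" and ht :: "'v \<Rightarrow> int"
  assumes wf: "wf_digraph Q" and fin_verts: "finite (verts Q)" and fin_arcs: "finite (arcs Q)"
    and ht: "a \<in> arcs Q \<Longrightarrow> ht (head Q a) = ht (tail Q a) + 1"
begin

definition into :: "'v \<Rightarrow> 'e set" where
  "into w = {a \<in> arcs Q. head Q a = w}"

lemma finite_into [simp]: "finite (into w)"
  using fin_arcs by (simp add: into_def)

lemma into_arcs: "a \<in> into w \<Longrightarrow> a \<in> arcs Q" "a \<in> into w \<Longrightarrow> head Q a = w"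
  "a \<in> arcs Q \<Longrightarrow> a \<in> into (head Q a)"
  by (auto simp: into_def)

lemma into_tail: "a \<in> into w \<Longrightarrow> tail Q a \<in> verts Q"
  using arc_ends(2)[OF wf] into_arcs by blast

lemma height_bound: "\<exists>m. \<forall>w \<in> verts Q. m < ht w"
proof -
  have "\<forall>w \<in> verts Q. Min (ht ` verts Q) - 1 < ht w"
    using fin_verts by (auto simp: less_le_trans[OF _ Min_le])
      (metis Min_le diff_less_eq finite_imageI image_eqI less_add_one order_le_less_trans)
  then show ?thesis by blast
qed

lemma height_induct [consumes 1, case_names step]:
  assumes "w \<in> verts Q" and "\<And>w. w \<in> verts Q \<Longrightarrow> (\<And>a. a \<in> into w \<Longrightarrow> P (tail Q a)) \<Longrightarrow> P w"
  shows "P w"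
proof -
  obtain m where m: "\<And>w. w \<in> verts Q \<Longrightarrow> m < ht w" using height_bound by blast
  show ?thesis using assms(1)
  proof (induction w rule: measure_induct_rule[where f = "\<lambda>w. nat (ht w - m)"])
    case (less w)
    show ?case
    proof (rule assms(2)[OF less.prems])
      fix a assume a: "a \<in> into w"
      have "ht w = ht (tail Q a) + 1" using ht[of a] into_arcs(1,2)[OF a] by simp
      then show "P (tail Q a)" using less.IH[of "tail Q a"] into_tail[OF a] m[OF into_tail[OF a]] by simp
    qed
  qed
qed

text \<open>Iterate \<open>\<Phi>\<close>: the value at a vertex is stable after as many steps as the vertex has height above the
  minimum.\<close>

lemma height_recursion:
  assumes \<Phi>: "\<And>w g g'. w \<in> verts Q \<Longrightarrow> (\<And>a. a \<in> into w \<Longrightarrow> g (tail Q a) = g' (tail Q a)) \<Longrightarrow> \<Phi> g w = \<Phi> g' w"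
  obtains g where "\<And>w. w \<in> verts Q \<Longrightarrow> g w = \<Phi> g w"
proof -
  obtain m where m: "\<And>w. w \<in> verts Q \<Longrightarrow> m < ht w" using height_bound by blast
  define g where "g k = (\<Phi> ^^ k) undefined" for k :: nat
  have gS: "g (Suc k) = \<Phi> (g k)" for k by (simp add: g_def)
  have stable: "g (Suc k) w = g k w" if "w \<in> verts Q" "nat (ht w - m) \<le> k" for k w
    using that
  proof (induction k arbitrary: w)
    case 0
    then show ?case using m[of w] by simp
  next
    case (Suc k)
    have "g (Suc k) (tail Q a) = g k (tail Q a)" if a: "a \<in> into w" for a
    proof (rule Suc.IH[OF into_tail[OF a]])
      have "ht w = ht (tail Q a) + 1" using ht[of a] into_arcs(1,2)[OF a] by simp
      then show "nat (ht (tail Q a) - m) \<le> k" using Suc.prems by simp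
    qed
    then show ?case unfolding gS[of "Suc k"] gS[of k] using \<Phi>[OF Suc.prems(1)] gS by metis
  qed
  define N where "N = (\<Sum>w \<in> verts Q. nat (ht w - m))"
  have "g N w = \<Phi> (g N) w" if w: "w \<in> verts Q" for w
  proof -
    have "nat (ht w - m) \<le> N" unfolding N_def using fin_verts w by (intro member_le_sum) auto
    from stable[OF w this] show ?thesis by (simp add: gS)
  qed
  then show ?thesis by (rule that)
qed

text \<open>At every vertex the incoming maps are jointly a split monomorphism.  In terms of modules over the
  path algebra this says that the radical is the direct sum of the submodules generated by the
  arrows, which characterizes the projectives and is visibly inherited by subrepresentations.\<close>

definition split_incoming :: "('k :: field, 'v, 'e) representation \<Rightarrow> bool" where
  "split_incoming M \<longleftrightarrow> (\<exists>r. \<forall>a \<in> arcs Q. r a \<in> fcar (rdim M (tail Q a)) (rdim M (head Q a)) \<and>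
     (\<forall>b \<in> arcs Q. head Q a = head Q b \<longrightarrow> r a * of_mat (rmap M b) = (if a = b then fone (rdim M (tail Q a)) else 0)))"

lemma split_incoming_sub:
  fixes M N :: "('k :: field, 'v, 'e) representation"
  assumes O: "N \<in> Ob (Rep Q)" "M \<in> Ob (Rep Q)" and k: "k \<in> rep_homs Q N M"
    and inj: "pointwise_injective Q N M k" and M: "split_incoming M"
  shows "split_incoming N"
proof -
  obtain r where r: "\<And>a. a \<in> arcs Q \<Longrightarrow> r a \<in> fcar (rdim M (tail Q a)) (rdim M (head Q a))"
    "\<And>a b. a \<in> arcs Q \<Longrightarrow> b \<in> arcs Q \<Longrightarrow> head Q a = head Q b \<Longrightarrow>
       r a * of_mat (rmap M b) = (if a = b then fone (rdim M (tail Q a)) else 0)"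
    using M by (auto simp: split_incoming_def)
  obtain l where l: "\<And>v. v \<in> verts Q \<Longrightarrow> l v \<in> fcar (rdim N v) (rdim M v)"
    "\<And>v. v \<in> verts Q \<Longrightarrow> l v * of_mat (k v) = fone (rdim N v)"
    using inj unfolding pointwise_injective_def by metis
  define s where "s a = l (tail Q a) * r a * of_mat (k (head Q a))" for a
  have "s a \<in> fcar (rdim N (tail Q a)) (rdim N (head Q a))" if a: "a \<in> arcs Q" for a
    unfolding s_def by (rule fcar_times l r rep_hom_fcar[OF k] arc_ends[OF wf] a)+
  moreover have "s a * of_mat (rmap N b) = (if a = b then fone (rdim N (tail Q a)) else 0)"
    if a: "a \<in> arcs Q" and b: "b \<in> arcs Q" and ab: "head Q a = head Q b" for a b
  proof -
    have "s a * of_mat (rmap N b) = l (tail Q a) * (r a * of_mat (rmap M b)) * of_mat (k (tail Q b))"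
      using rep_hom_natural[OF wf O k b] by (simp add: s_def ab mult.assoc)
    then show ?thesis
      using r(2)[OF a b ab] l(1)[OF arc_ends(2)[OF wf a]] l(2)[OF arc_ends(2)[OF wf a]] by auto
  qed
  ultimately show ?thesis unfolding split_incoming_def by (intro exI[of _ s]) blast
qed

text \<open>The lift is built by recursion on the height.  On the image of the incoming maps it is forced by
  naturality; on the complement that the splitting provides it is any vertexwise lift.\<close>

lemma split_incoming_projective:
  fixes M :: "('k :: field, 'v, 'e) representation"
  assumes M: "M \<in> Ob (Rep Q)" and sp: "split_incoming M"
  shows "projective_object (Rep Q) M"
  unfolding projective_object_def
proof (intro conjI M ballI allI impI)
  fix X Y :: "('k, 'v, 'e) representation" and e f
  assume X: "X \<in> Ob (Rep Q)" and Y: "Y \<in> Ob (Rep Q)"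
    and epi: "epimorphism (Rep Q) X Y e" and f': "f \<in> Hom (Rep Q) M Y"
  from f' have f: "f \<in> rep_homs Q M Y" by simp
  have e: "e \<in> rep_homs Q X Y" and surj: "pointwise_surjective Q X Y e"
    using epi epimorphism_rep_iff[OF wf X Y] by blast+
  obtain r where r: "\<And>a. a \<in> arcs Q \<Longrightarrow> r a \<in> fcar (rdim M (tail Q a)) (rdim M (head Q a))"
    "\<And>a b. a \<in> arcs Q \<Longrightarrow> b \<in> arcs Q \<Longrightarrow> head Q a = head Q b \<Longrightarrow>
       r a * of_mat (rmap M b) = (if a = b then fone (rdim M (tail Q a)) else 0)"
    using sp by (auto simp: split_incoming_def)
  obtain s where s: "\<And>v. v \<in> verts Q \<Longrightarrow> s v \<in> fcar (rdim X v) (rdim Y v)"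
    "\<And>v. v \<in> verts Q \<Longrightarrow> of_mat (e v) * s v = fone (rdim Y v)"
    using surj unfolding pointwise_surjective_def by metis
  \<comment> \<open>\<open>\<Sum>a. M\<^sub>a r\<^sub>a\<close> projects onto the image of the incoming maps, and \<open>s\<close> is a vertexwise section of \<open>e\<close>.\<close>
  define \<Phi> where "\<Phi> g w = (\<Sum>a \<in> into w. of_mat (rmap X a) * g (tail Q a) * r a) +
    s w * of_mat (f w) * (fone (rdim M w) - (\<Sum>a \<in> into w. of_mat (rmap M a) * r a))" for g w
  obtain g where g: "\<And>w. w \<in> verts Q \<Longrightarrow> g w = \<Phi> g w"
    by (rule height_recursion[of \<Phi>]) (auto simp: \<Phi>_def)
  have c: "fone (rdim M w) - (\<Sum>a \<in> into w. of_mat (rmap M a) * r a) \<in> fcar (rdim M w) (rdim M w)" if "w \<in> verts Q" for w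
    by (intro fcar_diff fone_fcar fcar_sum) (use fcar_times[OF rep_map_fcar[OF M] r(1)] into_arcs in metis)
  have gw: "g w \<in> fcar (rdim X w) (rdim M w) \<and> of_mat (e w) * g w = of_mat (f w)" if "w \<in> verts Q" for w
    using that
  proof (induction w rule: height_induct)
    case (step w)
    have "of_mat (rmap X a) * g (tail Q a) * r a \<in> fcar (rdim X w) (rdim M w)" if a: "a \<in> into w" for a
      using fcar_times[OF fcar_times[OF rep_map_fcar[OF X into_arcs(1)[OF a]] step.IH[OF a, THEN conjunct1]] r(1)[OF into_arcs(1)[OF a]]]
      by (simp add: into_arcs(2)[OF a])
    then have 1: "g w \<in> fcar (rdim X w) (rdim M w)"
      unfolding g[OF step.hyps] \<Phi>_def
      by (intro fcar_add fcar_sum fcar_times[OF fcar_times[OF s(1)[OF step.hyps] rep_hom_fcar[OF f step.hyps]] c[OF step.hyps]])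
    have "of_mat (e w) * (of_mat (rmap X a) * g (tail Q a) * r a) = of_mat (f w) * (of_mat (rmap M a) * r a)" if a: "a \<in> into w" for a
    proof -
      have "of_mat (e w) * (of_mat (rmap X a) * g (tail Q a) * r a) = of_mat (rmap Y a) * (of_mat (e (tail Q a)) * g (tail Q a)) * r a"
        using rep_hom_natural[OF wf X Y e into_arcs(1)[OF a]] by (simp add: into_arcs(2)[OF a] mult.assoc[symmetric])
      also have "\<dots> = of_mat (f w) * (of_mat (rmap M a) * r a)"
        using step.IH[OF a] rep_hom_natural[OF wf M Y f into_arcs(1)[OF a]] by (simp add: into_arcs(2)[OF a] mult.assoc[symmetric])
      finally show ?thesis .
    qed
    then have "of_mat (e w) * g w = of_mat (f w) * (\<Sum>a \<in> into w. of_mat (rmap M a) * r a) +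
        (of_mat (e w) * s w) * of_mat (f w) * (fone (rdim M w) - (\<Sum>a \<in> into w. of_mat (rmap M a) * r a))"
      unfolding g[OF step.hyps] \<Phi>_def by (simp add: distrib_left sum_distrib_left mult.assoc)
    also have "\<dots> = of_mat (f w)"
      using rep_hom_fcar[OF f step.hyps] by (simp add: s(2)[OF step.hyps] right_diff_distrib)
    finally show ?case using 1 by blast
  qed
  have nat: "g (head Q b) * of_mat (rmap M b) = of_mat (rmap X b) * g (tail Q b)" if b: "b \<in> arcs Q" for b
  proof -
    let ?w = "head Q b"
    have bi: "b \<in> into ?w" using b by (rule into_arcs(3))
    have "(\<Sum>a \<in> into ?w. of_mat (rmap X a) * g (tail Q a) * r a) * of_mat (rmap M b)
        = (\<Sum>a \<in> into ?w. if a = b then of_mat (rmap X b) * g (tail Q b) else 0)"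
      unfolding sum_distrib_right
    proof (rule sum.cong[OF refl])
      fix a assume a: "a \<in> into ?w"
      have "g (tail Q b) \<in> fcar (rdim X (tail Q b)) (rdim M (tail Q b))" using gw[OF arc_ends(2)[OF wf b]] by blast
      then have "of_mat (rmap X b) * (g (tail Q b) * fone (rdim M (tail Q b))) = of_mat (rmap X b) * g (tail Q b)" by simp
      then show "of_mat (rmap X a) * g (tail Q a) * r a * of_mat (rmap M b) = (if a = b then of_mat (rmap X b) * g (tail Q b) else 0)"
        using r(2)[OF into_arcs(1)[OF a] b into_arcs(2)[OF a]] by (auto simp: mult.assoc)
    qed
    also have "\<dots> = of_mat (rmap X b) * g (tail Q b)" using bi by simp
    finally have 1: "(\<Sum>a \<in> into ?w. of_mat (rmap X a) * g (tail Q a) * r a) * of_mat (rmap M b) = of_mat (rmap X b) * g (tail Q b)" .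
    have "(\<Sum>a \<in> into ?w. of_mat (rmap M a) * r a) * of_mat (rmap M b) = (\<Sum>a \<in> into ?w. if a = b then of_mat (rmap M b) else 0)"
      unfolding sum_distrib_right
      by (rule sum.cong[OF refl]) (use r(2)[OF into_arcs(1) b into_arcs(2)] fone_right[OF rep_map_fcar[OF M b]] in \<open>auto simp: mult.assoc\<close>)
    also have "\<dots> = of_mat (rmap M b)" using bi by simp
    finally have 2: "(fone (rdim M ?w) - (\<Sum>a \<in> into ?w. of_mat (rmap M a) * r a)) * of_mat (rmap M b) = 0"
      using fone_left[OF rep_map_fcar[OF M b]] by (simp add: left_diff_distrib)
    show ?thesis
      unfolding g[OF arc_ends(1)[OF wf b]] \<Phi>_def by (simp only: distrib_right 1) (simp add: mult.assoc 2)
  qed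
  note m = mk_hom[OF wf M X, of g, OF gw[THEN conjunct1] nat]
  have "rep_comp Q e (mk_hom Q M X g) = f"
    by (rule rep_hom_eqI[OF rep_comp_in[OF wf M X Y m(1) e] f]) (simp_all add: rep_comp_dims[OF e m(1)] m(2) gw)
  then show "\<exists>g \<in> Hom (Rep Q) M X. Comp (Rep Q) e g = f" using m(1) by auto
qed

text \<open>The free representation on the spaces \<open>M w\<close>: its value at \<open>w\<close> is \<open>M w\<close> plus the values at the tails
  of the arrows into \<open>w\<close>, that is, a copy of \<open>M v\<close> for each path from \<open>v\<close> to \<open>w\<close>.\<close>

lemma free_cover:
  fixes M :: "('k :: field, 'v, 'e) representation"
  assumes M: "M \<in> Ob (Rep Q)"
  obtains P p where "P \<in> Ob (Rep Q)" "split_incoming P" "p \<in> rep_homs Q P M" "pointwise_surjective Q P M p"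
proof -
  obtain d where d: "\<And>w. w \<in> verts Q \<Longrightarrow> d w = rdim M w + (\<Sum>a \<in> into w. d (tail Q a))"
    by (rule height_recursion[of "\<lambda>d w. rdim M w + (\<Sum>a \<in> into w. d (tail Q a))"]) auto
  \<comment> \<open>The summand of index \<open>None\<close> consists of the new generators at \<open>w\<close>.\<close>
  define D where "D w x = (case x of None \<Rightarrow> rdim M w | Some a \<Rightarrow> d (tail Q a))" for w x
  define S where "S w = insert None (Some ` into w)" for w
  have sum: "sum (D w) (S w) = d w" if "w \<in> verts Q" for w
    by (simp add: S_def sum.reindex D_def d[OF that])
  define B where "B w \<iota> \<pi> \<longleftrightarrow> (\<forall>x \<in> S w. \<iota> x \<in> fcar (d w) (D w x) \<and> \<pi> x \<in> fcar (D w x) (d w)) \<and>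
     (\<forall>x \<in> S w. \<forall>y \<in> S w. \<pi> x * \<iota> y = (if x = y then fone (D w x) else 0))" for w and \<iota> \<pi> :: "'e option \<Rightarrow> 'k fmat"
  have "\<exists>\<iota> \<pi>. B w \<iota> \<pi>" if w: "w \<in> verts Q" for w
  proof -
    have fin: "finite (S w)" by (simp add: S_def)
    show ?thesis
    proof (rule finite_direct_sum[OF fin, of "D w", where ?'k = 'k])
      fix \<iota> \<pi> :: "'e option \<Rightarrow> 'k fmat"
      assume "\<And>a. a \<in> S w \<Longrightarrow> \<iota> a \<in> fcar (sum (D w) (S w)) (D w a)" "\<And>a. a \<in> S w \<Longrightarrow> \<pi> a \<in> fcar (D w a) (sum (D w) (S w))"
        "\<And>a b. a \<in> S w \<Longrightarrow> b \<in> S w \<Longrightarrow> \<pi> a * \<iota> b = (if a = b then fone (D w a) else 0)"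
      then have "B w \<iota> \<pi>" by (simp add: B_def sum[OF w])
      then show ?thesis by blast
    qed
  qed
  then obtain \<iota> \<pi> where "\<And>w. w \<in> verts Q \<Longrightarrow> B w (\<iota> w) (\<pi> w)" by metis
  then have i: "\<And>w x. w \<in> verts Q \<Longrightarrow> x \<in> S w \<Longrightarrow> \<iota> w x \<in> fcar (d w) (D w x)"
    and pi: "\<And>w x. w \<in> verts Q \<Longrightarrow> x \<in> S w \<Longrightarrow> \<pi> w x \<in> fcar (D w x) (d w)"
    and pii: "\<And>w x y. w \<in> verts Q \<Longrightarrow> x \<in> S w \<Longrightarrow> y \<in> S w \<Longrightarrow> \<pi> w x * \<iota> w y = (if x = y then fone (D w x) else 0)"
    by (auto simp: B_def)
  have aS: "Some a \<in> S (head Q a)" if "a \<in> arcs Q" for a using into_arcs(3)[OF that] by (simp add: S_def)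
  define P where "P = mk_rep Q d (\<lambda>a. \<iota> (head Q a) (Some a))"
  have P: "P \<in> Ob (Rep Q)" unfolding P_def by (rule mk_rep_Ob)
  have rd: "rdim P = d" by (simp add: P_def)
  have rm: "of_mat (rmap P a) = \<iota> (head Q a) (Some a)" if a: "a \<in> arcs Q" for a
    unfolding P_def using i[OF arc_ends(1)[OF wf a] aS[OF a]] by (intro mk_rep_rmap) (simp add: D_def)
  have sp: "split_incoming P"
    unfolding split_incoming_def rd
  proof (intro exI[of _ "\<lambda>a. \<pi> (head Q a) (Some a)"] ballI conjI impI)
    fix a assume a: "a \<in> arcs Q"
    show "\<pi> (head Q a) (Some a) \<in> fcar (d (tail Q a)) (d (head Q a))"
      using pi[OF arc_ends(1)[OF wf a] aS[OF a]] by (simp add: D_def)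
    fix b assume b: "b \<in> arcs Q" "head Q a = head Q b"
    show "\<pi> (head Q a) (Some a) * of_mat (rmap P b) = (if a = b then fone (d (tail Q a)) else 0)"
      using pii[OF arc_ends(1)[OF wf a] aS[OF a], of "Some b"] aS[OF b(1)] b by (simp add: rm D_def)
  qed
  define \<Phi> where "\<Phi> p w = \<pi> w None + (\<Sum>a \<in> into w. of_mat (rmap M a) * p (tail Q a) * \<pi> w (Some a))" for p w
  obtain p where p: "\<And>w. w \<in> verts Q \<Longrightarrow> p w = \<Phi> p w"
    by (rule height_recursion[of \<Phi>]) (auto simp: \<Phi>_def)
  have pc: "p w \<in> fcar (rdim M w) (d w)" if "w \<in> verts Q" for w
    using that
  proof (induction w rule: height_induct)
    case (step w)
    have "of_mat (rmap M a) * p (tail Q a) * \<pi> w (Some a) \<in> fcar (rdim M w) (d w)" if a: "a \<in> into w" for a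
    proof -
      have "Some a \<in> S w" using a by (simp add: S_def)
      from fcar_times[OF fcar_times[OF rep_map_fcar[OF M into_arcs(1)[OF a]] step.IH[OF a]] pi[OF step.hyps this]]
      show ?thesis by (simp add: into_arcs(2)[OF a])
    qed
    then show ?case unfolding p[OF step.hyps] \<Phi>_def
      using pi[OF step.hyps, of None] by (intro fcar_add fcar_sum) (auto simp: S_def D_def)
  qed
  have pi_at: "p w * \<iota> w x = \<pi> w None * \<iota> w x + (\<Sum>a \<in> into w. of_mat (rmap M a) * p (tail Q a) * (\<pi> w (Some a) * \<iota> w x))"
    if "w \<in> verts Q" for w x
    unfolding p[OF that] \<Phi>_def by (simp add: distrib_right sum_distrib_right mult.assoc)
  have nat: "p (head Q b) * of_mat (rmap P b) = of_mat (rmap M b) * p (tail Q b)" if b: "b \<in> arcs Q" for b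
  proof -
    let ?w = "head Q b"
    note w = arc_ends(1)[OF wf b]
    have "\<pi> ?w None * \<iota> ?w (Some b) = 0" using pii[OF w, of None "Some b"] aS[OF b] by (simp add: S_def)
    moreover have "(\<Sum>a \<in> into ?w. of_mat (rmap M a) * p (tail Q a) * (\<pi> ?w (Some a) * \<iota> ?w (Some b)))
        = (\<Sum>a \<in> into ?w. if a = b then of_mat (rmap M b) * p (tail Q b) else 0)"
    proof (rule sum.cong[OF refl])
      fix a assume a: "a \<in> into ?w"
      have "\<pi> ?w (Some a) * \<iota> ?w (Some b) = (if a = b then fone (d (tail Q b)) else 0)"
        using pii[OF w, of "Some a" "Some b"] aS[OF b] a by (simp add: S_def D_def)
      then show "of_mat (rmap M a) * p (tail Q a) * (\<pi> ?w (Some a) * \<iota> ?w (Some b)) = (if a = b then of_mat (rmap M b) * p (tail Q b) else 0)"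
        using fone_right[OF pc[OF arc_ends(2)[OF wf b]]] by (simp add: mult.assoc)
    qed
    ultimately show ?thesis using pi_at[OF w, of "Some b"] into_arcs(3)[OF b] by (simp add: rm[OF b])
  qed
  note m = mk_hom[OF wf P M, unfolded rd, OF pc nat]
  have "pointwise_surjective Q P M (mk_hom Q P M p)"
    unfolding pointwise_surjective_def
  proof
    fix w assume w: "w \<in> verts Q"
    have "(\<Sum>a \<in> into w. of_mat (rmap M a) * p (tail Q a) * (\<pi> w (Some a) * \<iota> w None)) = 0"
      by (rule sum.neutral) (use pii[OF w, of _ None] in \<open>auto simp: S_def\<close>)
    then have "p w * \<iota> w None = fone (rdim M w)"
      using pi_at[OF w, of None] pii[OF w, of None None] by (simp add: S_def D_def)
    moreover have "\<iota> w None \<in> fcar (d w) (rdim M w)" using i[OF w, of None] by (simp add: S_def D_def)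
    moreover have "of_mat (mk_hom Q P M p w) = p w" by (rule m(2)[OF _ _ w]) auto
    ultimately show "\<exists>R \<in> fcar (rdim P w) (rdim M w). of_mat (mk_hom Q P M p w) * R = fone (rdim M w)"
      unfolding rd by auto
  qed
  moreover have "mk_hom Q P M p \<in> rep_homs Q P M" by (rule m(1)) auto
  ultimately show ?thesis using that[OF P sp] by blast
qed

text \<open>A projective is a retract of its free cover, in particular a subrepresentation of it.\<close>

lemma projective_iff_split_incoming:
  fixes M :: "('k :: field, 'v, 'e) representation"
  assumes M: "M \<in> Ob (Rep Q)"
  shows "projective_object (Rep Q) M \<longleftrightarrow> split_incoming M"
proof
  assume proj: "projective_object (Rep Q) M"
  obtain P p where P: "P \<in> Ob (Rep Q)" "split_incoming P" "p \<in> rep_homs Q P M" "pointwise_surjective Q P M p"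
    by (rule free_cover[OF M])
  have epi: "epimorphism (Rep Q) P M p" using P epimorphism_rep_iff[OF wf P(1) M] by blast
  have i: "Ident (Rep Q) M \<in> rep_homs Q M M" using rep_ident_in[OF wf M] by simp
  from proj epi i P(1) M obtain s where s: "s \<in> rep_homs Q M P" "rep_comp Q p s = Ident (Rep Q) M"
    unfolding projective_object_def rep_category_simps(2,3) by blast
  have "pointwise_injective Q M P s"
    unfolding pointwise_injective_def
  proof
    fix v assume v: "v \<in> verts Q"
    have "of_mat (p v) * of_mat (s v) = fone (rdim M v)"
      using arg_cong[OF s(2), of "\<lambda>f. of_mat (f v)"] v by (simp add: rep_comp_dims[OF P(3) s(1) v])
    then show "\<exists>L \<in> fcar (rdim M v) (rdim P v). L * of_mat (s v) = fone (rdim M v)"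
      using rep_hom_fcar[OF P(3) v] by blast
  qed
  then show "split_incoming M" using split_incoming_sub[OF M P(1) s(1)] P(2) by blast
qed (rule split_incoming_projective[OF M])

lemma subrep_projective:
  fixes N :: "('k :: field, 'v, 'e) representation"
  assumes "N \<in> Ob (Rep Q)" "projective_object (Rep Q) M" "k \<in> rep_homs Q N M" "pointwise_injective Q N M k"
  shows "projective_object (Rep Q) N"
  using assms split_incoming_sub projective_iff_split_incoming unfolding projective_object_def by metis

lemma projective_cover_exists:
  fixes M :: "('k :: field, 'v, 'e) representation"
  assumes "M \<in> Ob (Rep Q)"
  obtains P p where "projective_object (Rep Q) P" "p \<in> rep_homs Q P M" "pointwise_surjective Q P M p"
  using free_cover[OF assms] split_incoming_projective by metis

end

section \<open>Reflections at a sink\<close>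

text \<open>Only arrows with head \<open>i\<close> are turned around, since reflections are applied at sinks.\<close>

definition reflect :: "('v, 'e) pre_digraph \<Rightarrow> 'v \<Rightarrow> ('v, 'e) pre_digraph" where
  "reflect Q i = Q\<lparr>tail := (\<lambda>a. if head Q a = i then i else tail Q a),
     head := (\<lambda>a. if head Q a = i then tail Q a else head Q a)\<rparr>"

lemma reflect_simps [simp]:
  "verts (reflect Q i) = verts Q" "arcs (reflect Q i) = arcs Q"
  "tail (reflect Q i) a = (if head Q a = i then i else tail Q a)"
  "head (reflect Q i) a = (if head Q a = i then tail Q a else head Q a)"
  by (simp_all add: reflect_def)

definition simple_rep :: "('v, 'e) pre_digraph \<Rightarrow> 'v \<Rightarrow> ('k :: field, 'v, 'e) representation" where
  "simple_rep Q i = mk_rep Q (\<lambda>v. if v = i then 1 else 0) (\<lambda>_. 0)"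

text \<open>The simple reflection of the root lattice at \<open>i\<close>.\<close>

definition reflect_dim :: "('v, 'e) pre_digraph \<Rightarrow> 'v \<Rightarrow> ('v \<Rightarrow> int) \<Rightarrow> 'v \<Rightarrow> int" where
  "reflect_dim Q i d = d(i := (\<Sum>a | a \<in> arcs Q \<and> head Q a = i. d (tail Q a)) +
     (\<Sum>a | a \<in> arcs Q \<and> tail Q a = i. d (head Q a)) - d i)"

locale quiver_sink =
  fixes Q :: "('v, 'e) pre_digraph" and i :: 'v
  assumes wf: "wf_digraph Q" and fin_arcs: "finite (arcs Q)" and i: "i \<in> verts Q"
    and sink: "a \<in> arcs Q \<Longrightarrow> tail Q a \<noteq> i"
begin

abbreviation "Q' \<equiv> reflect Q i"
abbreviation "I \<equiv> {a \<in> arcs Q. head Q a = i}"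

lemma wf': "wf_digraph Q'"
  using wf by (auto simp: wf_digraph_def)

lemma finI: "finite I"
  using fin_arcs by simp

text \<open>The maps \<open>N i \<rightarrow> \<Oplus> N (tail a) \<rightarrow> M i\<close> have composite zero, the second one is split by \<open>\<sigma>\<close>, and \<open>\<rho>\<close>
  lifts the projection onto its kernel along the first one.  So \<open>M i\<close> is the cokernel of the first map, and \<open>M\<close> is the value at \<open>N\<close> of the
  reflection functor from the reflected quiver, where \<open>i\<close> is a source, back to \<open>Q\<close>.\<close>

definition right_reflection :: "('k :: field, 'v, 'e) representation \<Rightarrow> ('k, 'v, 'e) representation \<Rightarrow>
    ('e \<Rightarrow> 'k fmat) \<Rightarrow> ('e \<Rightarrow> 'k fmat) \<Rightarrow> bool" where
  "right_reflection N M \<sigma> \<rho> \<longleftrightarrow>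
     (\<forall>w. w \<noteq> i \<longrightarrow> rdim M w = rdim N w) \<and>
     (\<forall>a \<in> arcs Q. head Q a \<noteq> i \<longrightarrow> of_mat (rmap M a) = of_mat (rmap N a)) \<and>
     (\<forall>a \<in> I. \<sigma> a \<in> fcar (rdim M (tail Q a)) (rdim M i) \<and> \<rho> a \<in> fcar (rdim N i) (rdim M (tail Q a))) \<and>
     (\<Sum>a \<in> I. of_mat (rmap M a) * of_mat (rmap N a)) = 0 \<and>
     (\<Sum>a \<in> I. of_mat (rmap M a) * \<sigma> a) = fone (rdim M i) \<and>
     (\<forall>a \<in> I. \<forall>b \<in> I. of_mat (rmap N a) * \<rho> b = (if a = b then fone (rdim M (tail Q a)) else 0) - \<sigma> a * of_mat (rmap M b))"

definition injective_at :: "('k :: field, 'v, 'e) representation \<Rightarrow> bool" where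
  "injective_at N \<longleftrightarrow> (\<exists>\<tau>. (\<forall>a \<in> I. \<tau> a \<in> fcar (rdim N i) (rdim N (tail Q a))) \<and>
     (\<Sum>a \<in> I. \<tau> a * of_mat (rmap N a)) = fone (rdim N i))"

definition surjective_at :: "('k :: field, 'v, 'e) representation \<Rightarrow> bool" where
  "surjective_at M \<longleftrightarrow> (\<exists>\<sigma>. (\<forall>a \<in> I. \<sigma> a \<in> fcar (rdim M (tail Q a)) (rdim M i)) \<and>
     (\<Sum>a \<in> I. of_mat (rmap M a) * \<sigma> a) = fone (rdim M i))"

lemma map_M: "M \<in> Ob (Rep Q) \<Longrightarrow> a \<in> I \<Longrightarrow> of_mat (rmap M a) \<in> fcar (rdim M i) (rdim M (tail Q a))"
  using rep_map_fcar[of M Q a] by auto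

lemma map_N: "N \<in> Ob (Rep Q') \<Longrightarrow> a \<in> I \<Longrightarrow> of_mat (rmap N a) \<in> fcar (rdim N (tail Q a)) (rdim N i)"
  using rep_map_fcar[of N Q' a] by auto

lemma right_reflection_exists:
  fixes N :: "('k :: field, 'v, 'e) representation"
  assumes N: "N \<in> Ob (Rep Q')"
  obtains M \<sigma> \<rho> where "M \<in> Ob (Rep Q)" "right_reflection N M \<sigma> \<rho>"
proof -
  let ?d = "\<lambda>a. rdim N (tail Q a)" and ?n = "rdim N i"
  obtain \<iota> \<pi> :: "'e \<Rightarrow> 'k fmat" where
    io: "\<And>a. a \<in> I \<Longrightarrow> \<iota> a \<in> fcar (sum ?d I) (?d a)" and pr: "\<And>a. a \<in> I \<Longrightarrow> \<pi> a \<in> fcar (?d a) (sum ?d I)"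
    and pio: "\<And>a b. a \<in> I \<Longrightarrow> b \<in> I \<Longrightarrow> \<pi> a * \<iota> b = (if a = b then fone (?d a) else 0)"
    and iop: "(\<Sum>a\<in>I. \<iota> a * \<pi> a) = fone (sum ?d I)"
    by (rule finite_direct_sum[OF finI, of ?d, where ?'k = 'k]) blast
  let ?D = "sum ?d I"
  define A where "A = (\<Sum>a\<in>I. \<iota> a * of_mat (rmap N a))"
  have A: "A \<in> fcar ?D ?n" unfolding A_def by (intro fcar_sum fcar_times[OF io map_N[OF N]])
  have pA: "\<pi> a * A = of_mat (rmap N a)" if a: "a \<in> I" for a
  proof -
    have "\<pi> a * A = (\<Sum>b\<in>I. if b = a then of_mat (rmap N a) else 0)"
      unfolding A_def sum_distrib_left
      by (rule sum.cong[OF refl]) (use pio[OF a] fone_left[OF map_N[OF N a]] in \<open>auto simp: mult.assoc[symmetric]\<close>)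
    then show ?thesis using a finI by simp
  qed
  obtain r C C' where C: "C \<in> fcar r ?D" "C' \<in> fcar ?D r" "C * C' = fone r" "C * A = 0"
    "\<And>p X. X \<in> fcar p ?D \<Longrightarrow> X * A = 0 \<Longrightarrow> X * C' * C = X"
    by (rule cokernel_matrix[OF A]) blast
  obtain q E E' D D' where f: "E \<in> fcar ?D q" "E' \<in> fcar q ?D" "D \<in> fcar q ?n" "D' \<in> fcar ?n q"
    "A = E * D" "E' * E = fone q" "D * D' = fone q"
    by (rule rank_factorization[OF A])
  define B where "B = D' * E' * (fone ?D - C' * C)"
  have c1: "fone ?D - C' * C \<in> fcar ?D ?D" by (rule fcar_diff fone_fcar fcar_times C)+
  have B: "B \<in> fcar ?n ?D" unfolding B_def by (rule fcar_times f c1)+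
  have e: "fone ?D - E * E' \<in> fcar ?D ?D" by (rule fcar_diff fone_fcar fcar_times f)+
  have "E * E' * E = E" using f by (simp add: mult.assoc)
  then have "(fone ?D - E * E') * A = 0" using f by (simp add: left_diff_distrib mult.assoc[symmetric])
  then have "(fone ?D - E * E') * C' * C = fone ?D - E * E'" by (rule C(5)[OF e])
  then have "(fone ?D - E * E') * (fone ?D - C' * C) = 0"
    by (simp add: right_diff_distrib fone_right[OF e] mult.assoc)
  then have "fone ?D - C' * C = E * E' * (fone ?D - C' * C)"
    by (simp only: left_diff_distrib fone_left[OF c1]) simp
  also have "\<dots> = E * (D * D') * E' * (fone ?D - C' * C)" using f by simp
  also have "\<dots> = A * B" by (simp only: B_def f(5) mult.assoc)
  finally have AB: "fone ?D - C' * C = A * B" .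
  define M where "M = mk_rep Q ((rdim N)(i := r)) (\<lambda>a. if head Q a = i then C * \<iota> a else of_mat (rmap N a))"
  have M: "M \<in> Ob (Rep Q)" unfolding M_def by (rule mk_rep_Ob)
  have rd: "rdim M = (rdim N)(i := r)" by (simp add: M_def)
  have rm: "of_mat (rmap M a) = (if head Q a = i then C * \<iota> a else of_mat (rmap N a))" if a: "a \<in> arcs Q" for a
    unfolding M_def
    by (rule mk_rep_rmap) (use a sink[OF a] fcar_times[OF C(1) io] rep_map_fcar[OF N, of a] in auto)
  define \<sigma> where "\<sigma> a = \<pi> a * C'" for a
  define \<rho> where "\<rho> a = B * \<iota> a" for a
  have "right_reflection N M \<sigma> \<rho>"
    unfolding right_reflection_def rd
  proof (intro conjI allI impI ballI)
    fix a assume a: "a \<in> I"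
    then have t: "tail Q a \<noteq> i" using sink by blast
    show "\<sigma> a \<in> fcar (((rdim N)(i := r)) (tail Q a)) (((rdim N)(i := r)) i)"
      using fcar_times[OF pr[OF a] C(2)] t by (simp add: \<sigma>_def)
    show "\<rho> a \<in> fcar (rdim N i) (((rdim N)(i := r)) (tail Q a))"
      using fcar_times[OF B io[OF a]] t by (simp add: \<rho>_def)
    fix b assume b: "b \<in> I"
    have "of_mat (rmap N a) * \<rho> b = \<pi> a * (A * B) * \<iota> b" by (simp only: pA[OF a, symmetric] \<rho>_def mult.assoc)
    also have "\<dots> = \<pi> a * \<iota> b - \<pi> a * C' * (C * \<iota> b)"
      using fone_right[OF pr[OF a]] by (simp add: AB[symmetric] left_diff_distrib right_diff_distrib mult.assoc fone_left[OF io[OF b]])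
    finally show "of_mat (rmap N a) * \<rho> b =
        (if a = b then fone (((rdim N)(i := r)) (tail Q a)) else 0) - \<sigma> a * of_mat (rmap M b)"
      using a b t sink[of b] by (simp add: pio[OF a b] \<sigma>_def rm)
  next
    have "(\<Sum>a \<in> I. of_mat (rmap M a) * of_mat (rmap N a)) = C * A"
      unfolding A_def sum_distrib_left by (rule sum.cong) (auto simp: rm mult.assoc)
    then show "(\<Sum>a \<in> I. of_mat (rmap M a) * of_mat (rmap N a)) = 0" by (simp add: C)
    have "(\<Sum>a \<in> I. of_mat (rmap M a) * \<sigma> a) = C * (\<Sum>a\<in>I. \<iota> a * \<pi> a) * C'"
      unfolding sum_distrib_left sum_distrib_right by (rule sum.cong) (auto simp: rm \<sigma>_def mult.assoc)
    then show "(\<Sum>a \<in> I. of_mat (rmap M a) * \<sigma> a) = fone (((rdim N)(i := r)) i)"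
      by (simp add: iop fone_right[OF C(1)] C(3))
  qed (auto simp: rm)
  then show ?thesis using that M by blast
qed

text \<open>Dually, the kernel of the incoming maps of \<open>M\<close> at the sink gives a representation of the reflected
  quiver from which \<open>M\<close> is recovered when these maps are jointly surjective.\<close>

lemma reflection_of_surjective:
  fixes M :: "('k :: field, 'v, 'e) representation"
  assumes M: "M \<in> Ob (Rep Q)" and surj: "surjective_at M"
  obtains N \<sigma> \<rho> where "N \<in> Ob (Rep Q')" "right_reflection N M \<sigma> \<rho>" "injective_at N"
proof -
  let ?d = "\<lambda>a. rdim M (tail Q a)" and ?m = "rdim M i"
  obtain \<iota> \<pi> :: "'e \<Rightarrow> 'k fmat" where
    io: "\<And>a. a \<in> I \<Longrightarrow> \<iota> a \<in> fcar (sum ?d I) (?d a)" and pr: "\<And>a. a \<in> I \<Longrightarrow> \<pi> a \<in> fcar (?d a) (sum ?d I)"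
    and pio: "\<And>a b. a \<in> I \<Longrightarrow> b \<in> I \<Longrightarrow> \<pi> a * \<iota> b = (if a = b then fone (?d a) else 0)"
    and iop: "(\<Sum>a\<in>I. \<iota> a * \<pi> a) = fone (sum ?d I)"
    by (rule finite_direct_sum[OF finI, of ?d, where ?'k = 'k]) blast
  let ?D = "sum ?d I"
  obtain \<sigma> where s: "\<And>a. a \<in> I \<Longrightarrow> \<sigma> a \<in> fcar (?d a) ?m" "(\<Sum>a \<in> I. of_mat (rmap M a) * \<sigma> a) = fone ?m"
    using surj by (auto simp: surjective_at_def)
  define A where "A = (\<Sum>a\<in>I. of_mat (rmap M a) * \<pi> a)"
  define S where "S = (\<Sum>a\<in>I. \<iota> a * \<sigma> a)"
  have A: "A \<in> fcar ?m ?D" unfolding A_def by (intro fcar_sum fcar_times[OF map_M[OF M] pr])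
  have S: "S \<in> fcar ?D ?m" unfolding S_def by (intro fcar_sum fcar_times[OF io s(1)])
  have Ai: "A * \<iota> b = of_mat (rmap M b)" if b: "b \<in> I" for b
  proof -
    have "A * \<iota> b = (\<Sum>a\<in>I. if a = b then of_mat (rmap M b) else 0)"
      unfolding A_def sum_distrib_right
      by (rule sum.cong[OF refl]) (use pio[OF _ b] fone_right[OF map_M[OF M b]] in \<open>auto simp: mult.assoc\<close>)
    then show ?thesis using b finI by simp
  qed
  have pS: "\<pi> b * S = \<sigma> b" if b: "b \<in> I" for b
  proof -
    have "\<pi> b * S = (\<Sum>a\<in>I. if a = b then \<sigma> b else 0)"
      unfolding S_def sum_distrib_left
      by (rule sum.cong[OF refl]) (use pio[OF b] fone_left[OF s(1)[OF b]] in \<open>auto simp: mult.assoc[symmetric]\<close>)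
    then show ?thesis using b finI by simp
  qed
  have AS: "A * S = fone ?m"
    unfolding S_def sum_distrib_left s(2)[symmetric] by (rule sum.cong[OF refl]) (simp add: Ai mult.assoc[symmetric])
  obtain r K K' where K: "K \<in> fcar ?D r" "K' \<in> fcar r ?D" "K' * K = fone r" "A * K = 0"
    "\<And>p X. X \<in> fcar ?D p \<Longrightarrow> A * X = 0 \<Longrightarrow> K * (K' * X) = X"
    by (rule kernel_matrix[OF A]) blast
  have e: "fone ?D - S * A \<in> fcar ?D ?D" by (rule fcar_diff fone_fcar fcar_times S A)+
  have "A * (fone ?D - S * A) = 0"
    using A by (simp add: right_diff_distrib mult.assoc[symmetric] AS)
  from K(5)[OF e this] have KK: "K * (K' * (fone ?D - S * A)) = fone ?D - S * A" .
  define N where "N = mk_rep Q' ((rdim M)(i := r)) (\<lambda>a. if head Q a = i then \<pi> a * K else of_mat (rmap M a))"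
  have N: "N \<in> Ob (Rep Q')" unfolding N_def by (rule mk_rep_Ob)
  have rd: "rdim N = (rdim M)(i := r)" by (simp add: N_def)
  have rm: "of_mat (rmap N a) = (if head Q a = i then \<pi> a * K else of_mat (rmap M a))" if a: "a \<in> arcs Q" for a
    unfolding N_def
    by (rule mk_rep_rmap) (use a sink[OF a] fcar_times[OF pr K(1)] rep_map_fcar[OF M a] in auto)
  define \<rho> where "\<rho> b = K' * (fone ?D - S * A) * \<iota> b" for b
  have 1: "right_reflection N M \<sigma> \<rho>"
    unfolding right_reflection_def rd
  proof (intro conjI allI impI ballI)
    fix a assume a: "a \<in> I"
    show "\<sigma> a \<in> fcar (rdim M (tail Q a)) (rdim M i)" by (rule s(1)[OF a])
    show "\<rho> a \<in> fcar (((rdim M)(i := r)) i) (rdim M (tail Q a))"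
      using fcar_times[OF fcar_times[OF K(2) e] io[OF a]] by (simp add: \<rho>_def)
    fix b assume b: "b \<in> I"
    have "of_mat (rmap N a) * \<rho> b = \<pi> a * (K * (K' * (fone ?D - S * A))) * \<iota> b"
      using a by (simp add: rm \<rho>_def mult.assoc)
    also have "\<dots> = \<pi> a * \<iota> b - (\<pi> a * S) * (A * \<iota> b)"
      using fone_right[OF pr[OF a]] by (simp only: KK) (simp add: left_diff_distrib right_diff_distrib mult.assoc fone_left[OF io[OF b]])
    finally show "of_mat (rmap N a) * \<rho> b = (if a = b then fone (rdim M (tail Q a)) else 0) - \<sigma> a * of_mat (rmap M b)"
      by (simp add: pio[OF a b] pS[OF a] Ai[OF b])
  next
    have "(\<Sum>a \<in> I. of_mat (rmap M a) * of_mat (rmap N a)) = A * K"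
      unfolding A_def sum_distrib_right by (rule sum.cong) (auto simp: rm mult.assoc)
    then show "(\<Sum>a \<in> I. of_mat (rmap M a) * of_mat (rmap N a)) = 0" by (simp add: K)
  qed (auto simp: rm s(2))
  have "(\<Sum>a \<in> I. K' * \<iota> a * of_mat (rmap N a)) = K' * (\<Sum>a\<in>I. \<iota> a * \<pi> a) * K"
    unfolding sum_distrib_left sum_distrib_right by (rule sum.cong) (auto simp: rm mult.assoc)
  then have "(\<Sum>a \<in> I. K' * \<iota> a * of_mat (rmap N a)) = fone r" by (simp add: iop fone_right[OF K(2)] K(3))
  then have "injective_at N"
    unfolding injective_at_def rd using fcar_times[OF K(2) io] sink by (intro exI[of _ "\<lambda>a. K' * \<iota> a"]) auto
  then show ?thesis using that N 1 by blast
qed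

lemma reflection_dim:
  assumes M: "M \<in> Ob (Rep Q)" and N: "N \<in> Ob (Rep Q')"
    and R: "right_reflection N M \<sigma> \<rho>" and inj: "injective_at N"
  shows "rdim N i + rdim M i = (\<Sum>a \<in> I. rdim M (tail Q a))"
proof -
  let ?d = "\<lambda>a. rdim M (tail Q a)"
  have rd: "rdim N (tail Q a) = ?d a" if "a \<in> I" for a using R that sink by (auto simp: right_reflection_def)
  have s: "\<And>a. a \<in> I \<Longrightarrow> \<sigma> a \<in> fcar (?d a) (rdim M i)" and r: "\<And>a. a \<in> I \<Longrightarrow> \<rho> a \<in> fcar (rdim N i) (?d a)"
    and MN: "(\<Sum>a \<in> I. of_mat (rmap M a) * of_mat (rmap N a)) = 0"
    and Ms: "(\<Sum>a \<in> I. of_mat (rmap M a) * \<sigma> a) = fone (rdim M i)"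
    and Nr: "\<And>a b. a \<in> I \<Longrightarrow> b \<in> I \<Longrightarrow> of_mat (rmap N a) * \<rho> b = (if a = b then fone (?d a) else 0) - \<sigma> a * of_mat (rmap M b)"
    using R unfolding right_reflection_def by blast+
  have mapN: "of_mat (rmap N a) \<in> fcar (?d a) (rdim N i)" if "a \<in> I" for a
    using map_N[OF N that] rd[OF that] by simp
  obtain t where t: "(\<Sum>a \<in> I. t a * of_mat (rmap N a)) = fone (rdim N i)" using inj by (auto simp: injective_at_def)
  define X where "X = (\<Sum>b \<in> I. \<rho> b * of_mat (rmap N b))"
  have X: "X \<in> fcar (rdim N i) (rdim N i)" unfolding X_def by (intro fcar_sum fcar_times[OF r mapN])
  have NX: "of_mat (rmap N a) * X = of_mat (rmap N a)" if a: "a \<in> I" for a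
  proof -
    have "of_mat (rmap N a) * X = (\<Sum>b \<in> I. (if b = a then of_mat (rmap N a) else 0) - \<sigma> a * (of_mat (rmap M b) * of_mat (rmap N b)))"
      unfolding X_def sum_distrib_left
      by (rule sum.cong[OF refl]) (use fone_left[OF mapN[OF a]] in \<open>simp add: mult.assoc[symmetric] Nr[OF a] left_diff_distrib\<close>)
    also have "\<dots> = of_mat (rmap N a) - \<sigma> a * (\<Sum>b \<in> I. of_mat (rmap M b) * of_mat (rmap N b))"
      using a finI by (simp add: sum_subtractf sum_distrib_left)
    finally show ?thesis by (simp add: MN)
  qed
  have "X = (\<Sum>a \<in> I. t a * of_mat (rmap N a)) * X" by (simp add: t fone_left[OF X])
  also have "\<dots> = (\<Sum>a \<in> I. t a * of_mat (rmap N a))" by (simp add: sum_distrib_right mult.assoc NX)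
  finally have rN: "X = fone (rdim N i)" by (simp add: t)
  obtain \<iota> \<pi> :: "'e \<Rightarrow> 'a fmat" where
    io: "\<And>a. a \<in> I \<Longrightarrow> \<iota> a \<in> fcar (sum ?d I) (?d a)" and pr: "\<And>a. a \<in> I \<Longrightarrow> \<pi> a \<in> fcar (?d a) (sum ?d I)"
    and pio: "\<And>a b. a \<in> I \<Longrightarrow> b \<in> I \<Longrightarrow> \<pi> a * \<iota> b = (if a = b then fone (?d a) else 0)"
    and iop: "(\<Sum>a\<in>I. \<iota> a * \<pi> a) = fone (sum ?d I)"
    by (rule finite_direct_sum[OF finI, of ?d, where ?'k = 'a]) blast
  have prod: "(\<Sum>a\<in>I. x a * \<pi> a) * (\<Sum>b\<in>I. \<iota> b * y b) = (\<Sum>a\<in>I. x a * y a)"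
    if y: "\<And>a. a \<in> I \<Longrightarrow> y a \<in> fcar (?d a) p" for x y p
  proof -
    have "x a * \<pi> a * (\<Sum>b\<in>I. \<iota> b * y b) = x a * y a" if a: "a \<in> I" for a
    proof -
      have "x a * \<pi> a * (\<Sum>b\<in>I. \<iota> b * y b) = (\<Sum>b\<in>I. if b = a then x a * y a else 0)"
        unfolding sum_distrib_left
      proof (rule sum.cong[OF refl])
        fix b assume b: "b \<in> I"
        have "x a * \<pi> a * (\<iota> b * y b) = x a * (\<pi> a * \<iota> b) * y b" by (simp only: mult.assoc)
        then show "x a * \<pi> a * (\<iota> b * y b) = (if b = a then x a * y a else 0)"
          using fone_left[OF y[OF a]] by (simp add: pio[OF a b] mult.assoc)
      qed
      then show ?thesis using a finI by simp
    qed
    then show ?thesis by (simp add: sum_distrib_right)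
  qed
  show ?thesis
  proof (rule split_exact_dim[where K = "\<Sum>a\<in>I. \<iota> a * of_mat (rmap N a)" and K' = "\<Sum>a\<in>I. \<rho> a * \<pi> a"
        and E = "\<Sum>a\<in>I. \<iota> a * \<sigma> a" and E' = "\<Sum>a\<in>I. of_mat (rmap M a) * \<pi> a"])
    show "(\<Sum>a\<in>I. \<iota> a * of_mat (rmap N a)) \<in> fcar (sum ?d I) (rdim N i)" by (intro fcar_sum fcar_times[OF io mapN])
    show "(\<Sum>a\<in>I. \<rho> a * \<pi> a) \<in> fcar (rdim N i) (sum ?d I)" by (intro fcar_sum fcar_times[OF r pr])
    show "(\<Sum>a\<in>I. \<iota> a * \<sigma> a) \<in> fcar (sum ?d I) (rdim M i)" by (intro fcar_sum fcar_times[OF io s])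
    show "(\<Sum>a\<in>I. of_mat (rmap M a) * \<pi> a) \<in> fcar (rdim M i) (sum ?d I)" by (intro fcar_sum fcar_times[OF map_M[OF M] pr])
    show "(\<Sum>a\<in>I. \<rho> a * \<pi> a) * (\<Sum>a\<in>I. \<iota> a * of_mat (rmap N a)) = fone (rdim N i)"
      using prod[of "\<lambda>a. of_mat (rmap N a)" _ \<rho>, OF mapN] rN by (simp add: X_def)
    show "(\<Sum>a\<in>I. of_mat (rmap M a) * \<pi> a) * (\<Sum>a\<in>I. \<iota> a * \<sigma> a) = fone (rdim M i)"
      using prod[of \<sigma> _ "\<lambda>a. of_mat (rmap M a)", OF s] Ms by simp
    have "(\<Sum>a\<in>I. \<iota> a * of_mat (rmap N a)) * (\<Sum>a\<in>I. \<rho> a * \<pi> a) + (\<Sum>a\<in>I. \<iota> a * \<sigma> a) * (\<Sum>a\<in>I. of_mat (rmap M a) * \<pi> a)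
        = (\<Sum>a\<in>I. \<Sum>b\<in>I. \<iota> a * (of_mat (rmap N a) * \<rho> b + \<sigma> a * of_mat (rmap M b)) * \<pi> b)"
      by (simp add: sum_product sum.distrib distrib_left distrib_right mult.assoc)
    also have "\<dots> = (\<Sum>a\<in>I. \<Sum>b\<in>I. if b = a then \<iota> a * \<pi> a else 0)"
    proof (intro sum.cong refl)
      fix a b assume a: "a \<in> I" and b: "b \<in> I"
      have "of_mat (rmap N a) * \<rho> b + \<sigma> a * of_mat (rmap M b) = (if a = b then fone (?d a) else 0)"
        by (simp add: Nr[OF a b])
      then show "\<iota> a * (of_mat (rmap N a) * \<rho> b + \<sigma> a * of_mat (rmap M b)) * \<pi> b = (if b = a then \<iota> a * \<pi> a else 0)"
        using fone_right[OF io[OF a]] by simp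
    qed
    also have "\<dots> = fone (sum ?d I)" using finI iop by simp
    finally show "(\<Sum>a\<in>I. \<iota> a * of_mat (rmap N a)) * (\<Sum>a\<in>I. \<rho> a * \<pi> a) +
        (\<Sum>a\<in>I. \<iota> a * \<sigma> a) * (\<Sum>a\<in>I. of_mat (rmap M a) * \<pi> a) = fone (sum ?d I)" .
  qed
qed

end

text \<open>From here on, identities, zeros and sums of homomorphisms are only evaluated at vertices.\<close>

declare rep_category_simps(4-7) [simp del]

context quiver_sink
begin

lemma simple_rep_Ob: "simple_rep Q i \<in> Ob (Rep Q)"
  unfolding simple_rep_def by (rule mk_rep_Ob)

lemma simple_rep_rdim: "rdim (simple_rep Q i) v = (if v = i then 1 else 0)"
  by (simp add: simple_rep_def)

lemma hom_at_sink:
  fixes M N :: "('k :: field, 'v, 'e) representation"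
  assumes M: "M \<in> Ob (Rep Q)" and N: "N \<in> Ob (Rep Q)"
    and x: "x \<in> fcar (rdim N i) (rdim M i)" and z: "\<And>a. a \<in> I \<Longrightarrow> x * of_mat (rmap M a) = 0"
  shows "mk_hom Q M N (\<lambda>v. if v = i then x else 0) \<in> rep_homs Q M N"
    "v \<in> verts Q \<Longrightarrow> of_mat (mk_hom Q M N (\<lambda>v. if v = i then x else 0) v) = (if v = i then x else 0)"
  using assms sink by (intro mk_hom[OF wf M N]; auto)+

text \<open>An endomorphism concentrated at the sink that kills the incoming maps factors through copies
  of the simple representation at the sink: write the identity of \<open>k\<^sup>m\<close> as the sum of its \<open>m\<close>
  coordinate projections.\<close>

lemma through_simple:
  fixes M :: "('k :: field, 'v, 'e) representation"
  assumes M: "M \<in> Ob (Rep Q)" and x: "x \<in> fcar (rdim M i) (rdim M i)" and z: "\<And>a. a \<in> I \<Longrightarrow> x * of_mat (rmap M a) = 0"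
  shows "through (Rep Q) {simple_rep Q i} M M (mk_hom Q M M (\<lambda>v. if v = i then x else 0))"
proof -
  let ?S = "simple_rep Q i :: ('k, 'v, 'e) representation"
  let ?m = "rdim M i"
  let ?h = "\<lambda>k. mk_hom Q M M (\<lambda>v. if v = i then fone k * x else 0)"
  have kx: "fone k * x \<in> fcar ?m ?m" if "k \<le> ?m" for k
    using that x by (intro fcar_times[of _ _ ?m]) (auto simp: fcar_def ent_fone)
  have kz: "fone k * x * of_mat (rmap M a) = 0" if "a \<in> I" for a k using z[OF that] by (simp add: mult.assoc)
  have "through (Rep Q) {?S} M M (?h k)" if "k \<le> ?m" for k
    using that
  proof (induction k)
    case 0
    have "?h 0 = Zero (Rep Q) M M"
    proof (rule rep_hom_eqI)
      show "?h 0 \<in> rep_homs Q M M" using hom_at_sink(1)[OF M M kx[of 0] kz] by simp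
      show "Zero (Rep Q) M M \<in> rep_homs Q M M" by (rule rep_Zero_in[OF wf M M])
      show "of_mat (?h 0 v) = of_mat (Zero (Rep Q) M M v)" if "v \<in> verts Q" for v
        using that by (simp add: mk_hom_def)
    qed
    then show ?case using through_zero[of "Rep Q" "{?S}" M M] by (simp only:)
  next
    case (Suc k)
    let ?c = "shift_in k 1 :: 'k fmat" and ?r = "shift_out k 1 :: 'k fmat"
    have c: "?c \<in> fcar ?m 1" using shift_fcar(1)[of k 1] Suc.prems by (auto simp: fcar_def)
    have r: "?r * x \<in> fcar 1 ?m" by (rule fcar_times[OF shift_fcar(2) x])
    define b where "b = mk_hom Q M ?S (\<lambda>v. if v = i then ?r * x else 0)"
    define a where "a = mk_hom Q ?S M (\<lambda>v. if v = i then ?c else 0)"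
    have b: "b \<in> rep_homs Q M ?S" "\<And>v. v \<in> verts Q \<Longrightarrow> of_mat (b v) = (if v = i then ?r * x else 0)"
      unfolding b_def using r z by (intro hom_at_sink[OF M simple_rep_Ob]; simp add: simple_rep_rdim mult.assoc)+
    have Sz: "of_mat (rmap ?S e) = 0" if "e \<in> I" for e
      using map_M[OF simple_rep_Ob that] that sink by (auto simp: simple_rep_rdim)
    have a: "a \<in> rep_homs Q ?S M" "\<And>v. v \<in> verts Q \<Longrightarrow> of_mat (a v) = (if v = i then ?c else 0)"
      unfolding a_def using c by (intro hom_at_sink[OF simple_rep_Ob M]; simp add: simple_rep_rdim Sz)+
    note IH = Suc.IH[OF Suc_leD[OF Suc.prems]]
    have hk: "?h k \<in> rep_homs Q M M" "\<And>v. v \<in> verts Q \<Longrightarrow> of_mat (?h k v) = (if v = i then fone k * x else 0)"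
      using hom_at_sink[OF M M kx[OF Suc_leD[OF Suc.prems]] kz] by blast+
    have hS: "?h (Suc k) \<in> rep_homs Q M M" "\<And>v. v \<in> verts Q \<Longrightarrow> of_mat (?h (Suc k) v) = (if v = i then fone (Suc k) * x else 0)"
      using hom_at_sink[OF M M kx[OF Suc.prems] kz] by blast+
    have ab: "rep_comp Q a b \<in> rep_homs Q M M" by (rule rep_comp_in[OF wf M simple_rep_Ob M b(1) a(1)])
    have one: "fone (Suc k) = fone k + ?c * ?r" unfolding Suc_eq_plus1 by (rule shift_mult(4)[symmetric])
    have "?h (Suc k) = Add (Rep Q) (rep_comp Q a b) (?h k)"
    proof (rule rep_hom_eqI[OF hS(1) rep_Add_in[OF wf M M ab hk(1)]])
      fix v assume v: "v \<in> verts Q"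
      show "of_mat (?h (Suc k) v) = of_mat (Add (Rep Q) (rep_comp Q a b) (?h k) v)"
        unfolding rep_add_at[OF ab hk(1) v] rep_comp_dims[OF a(1) b(1) v] hS(2)[OF v] hk(2)[OF v] a(2)[OF v] b(2)[OF v]
        by (simp add: one distrib_right mult.assoc add.commute)
    qed
    moreover have "through (Rep Q) {?S} M M (Add (Rep Q) (Comp (Rep Q) a b) (?h k))"
      by (rule through_step[OF IH, of ?S b a]) (use a b in simp_all)
    ultimately show ?case by (simp only: rep_category_simps(3))
  qed
  from this[OF order_refl] show ?thesis unfolding fone_left[OF x] .
qed

text \<open>A complement in \<open>M i\<close> of the sum of the images of the incoming maps is a sum of copies of the simple
  representation at the sink.\<close>

lemma split_off_simple:
  fixes M :: "('k :: field, 'v, 'e) representation"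
  assumes M: "M \<in> Ob (Rep Q)"
  obtains M' u v z where "M' \<in> Ob (Rep Q)" "surjective_at M'" "u \<in> rep_homs Q M' M" "v \<in> rep_homs Q M M'"
    "rep_comp Q v u = Ident (Rep Q) M'" "through (Rep Q) {simple_rep Q i} M M z"
    "Ident (Rep Q) M = Add (Rep Q) (rep_comp Q u v) z"
proof -
  let ?d = "\<lambda>a. rdim M (tail Q a)" and ?m = "rdim M i"
  obtain \<iota> \<pi> :: "'e \<Rightarrow> 'k fmat" where
    io: "\<And>a. a \<in> I \<Longrightarrow> \<iota> a \<in> fcar (sum ?d I) (?d a)" and pr: "\<And>a. a \<in> I \<Longrightarrow> \<pi> a \<in> fcar (?d a) (sum ?d I)"
    and pio: "\<And>a b. a \<in> I \<Longrightarrow> b \<in> I \<Longrightarrow> \<pi> a * \<iota> b = (if a = b then fone (?d a) else 0)"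
    and iop: "(\<Sum>a\<in>I. \<iota> a * \<pi> a) = fone (sum ?d I)"
    by (rule finite_direct_sum[OF finI, of ?d, where ?'k = 'k]) blast
  let ?D = "sum ?d I"
  define A where "A = (\<Sum>a\<in>I. of_mat (rmap M a) * \<pi> a)"
  have A: "A \<in> fcar ?m ?D" unfolding A_def by (intro fcar_sum fcar_times[OF map_M[OF M] pr])
  have Ai: "A * \<iota> b = of_mat (rmap M b)" if b: "b \<in> I" for b
  proof -
    have "A * \<iota> b = (\<Sum>a\<in>I. if a = b then of_mat (rmap M b) else 0)"
      unfolding A_def sum_distrib_right
      by (rule sum.cong[OF refl]) (use pio[OF _ b] fone_right[OF map_M[OF M b]] in \<open>auto simp: mult.assoc\<close>)
    then show ?thesis using b finI by simp
  qed
  obtain r E E' D D' where f: "E \<in> fcar ?m r" "E' \<in> fcar r ?m" "D \<in> fcar r ?D" "D' \<in> fcar ?D r"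
    "A = E * D" "E' * E = fone r" "D * D' = fone r"
    by (rule rank_factorization[OF A])
  define M' where "M' = mk_rep Q ((rdim M)(i := r)) (\<lambda>a. if head Q a = i then D * \<iota> a else of_mat (rmap M a))"
  have M': "M' \<in> Ob (Rep Q)" unfolding M'_def by (rule mk_rep_Ob)
  have rd: "rdim M' = (rdim M)(i := r)" by (simp add: M'_def)
  have rm: "of_mat (rmap M' a) = (if head Q a = i then D * \<iota> a else of_mat (rmap M a))" if a: "a \<in> arcs Q" for a
    unfolding M'_def
    by (rule mk_rep_rmap) (use a sink[OF a] fcar_times[OF f(3) io] rep_map_fcar[OF M a] in auto)
  have ED: "of_mat (rmap M a) = E * (D * \<iota> a)" if a: "a \<in> I" for a
    by (simp only: Ai[OF a, symmetric] f(5) mult.assoc)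
  have E'M: "E' * of_mat (rmap M a) = D * \<iota> a" if a: "a \<in> I" for a
  proof -
    have "E' * of_mat (rmap M a) = (E' * E) * (D * \<iota> a)" by (simp only: ED[OF a] mult.assoc)
    then show ?thesis using fone_left[OF fcar_times[OF f(3) io[OF a]]] f(6) by simp
  qed
  have surj: "surjective_at M'"
    unfolding surjective_at_def
  proof (intro exI[of _ "\<lambda>a. \<pi> a * D'"] conjI ballI)
    fix a assume a: "a \<in> I"
    then show "\<pi> a * D' \<in> fcar (rdim M' (tail Q a)) (rdim M' i)"
      using fcar_times[OF pr[OF a] f(4)] sink by (auto simp: rd)
  next
    have "(\<Sum>a \<in> I. of_mat (rmap M' a) * (\<pi> a * D')) = D * (\<Sum>a\<in>I. \<iota> a * \<pi> a) * D'"
      unfolding sum_distrib_left sum_distrib_right by (rule sum.cong) (auto simp: rm mult.assoc)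
    then show "(\<Sum>a \<in> I. of_mat (rmap M' a) * (\<pi> a * D')) = fone (rdim M' i)"
      by (simp add: iop fone_right[OF f(3)] f(7) rd)
  qed
  define u where "u = mk_hom Q M' M (\<lambda>v. if v = i then E else fone (rdim M v))"
  define v where "v = mk_hom Q M M' (\<lambda>v. if v = i then E' else fone (rdim M v))"
  note mm = fone_left[OF rep_map_fcar[OF M]] fone_right[OF rep_map_fcar[OF M]]
  have r1: "X * fone (rdim M (tail Q a)) = X" if "a \<in> I" "X = D * \<iota> a" for X a
    using that fone_right[OF fcar_times[OF f(3) io[OF that(1)]]] by simp
  have u: "u \<in> rep_homs Q M' M" "\<And>w. w \<in> verts Q \<Longrightarrow> of_mat (u w) = (if w = i then E else fone (rdim M w))"
    unfolding u_def using f
    by (intro mk_hom[OF wf M' M]; auto simp: rd rm mm ED[symmetric] dest: sink)+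
  have v: "v \<in> rep_homs Q M M'" "\<And>w. w \<in> verts Q \<Longrightarrow> of_mat (v w) = (if w = i then E' else fone (rdim M w))"
    unfolding v_def using f
    by (intro mk_hom[OF wf M M']; auto simp: rd rm mm E'M r1 dest: sink)+
  have vu: "rep_comp Q v u = Ident (Rep Q) M'"
  proof (rule rep_hom_eqI[OF rep_comp_in[OF wf M' M M' u(1) v(1)]])
    show "Ident (Rep Q) M' \<in> rep_homs Q M' M'" by (rule rep_Ident_in[OF wf M'])
    show "of_mat (rep_comp Q v u w) = of_mat (Ident (Rep Q) M' w)" if "w \<in> verts Q" for w
      using that by (simp add: rep_comp_dims[OF v(1) u(1)] u(2) v(2) f(6) rd)
  qed
  let ?e = "fone ?m - E * E'"
  have e: "?e \<in> fcar ?m ?m" by (rule fcar_diff fone_fcar fcar_times f)+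
  have ez: "?e * of_mat (rmap M a) = 0" if a: "a \<in> I" for a
    using E'M[OF a] ED[OF a] fone_left[OF map_M[OF M a]] by (simp add: left_diff_distrib mult.assoc)
  let ?z = "mk_hom Q M M (\<lambda>v. if v = i then ?e else 0)"
  have z: "?z \<in> rep_homs Q M M" "\<And>w. w \<in> verts Q \<Longrightarrow> of_mat (?z w) = (if w = i then ?e else 0)"
    using hom_at_sink[OF M M e ez] by blast+
  have uv: "rep_comp Q u v \<in> rep_homs Q M M" by (rule rep_comp_in[OF wf M M' M v(1) u(1)])
  have id: "Ident (Rep Q) M = Add (Rep Q) (rep_comp Q u v) ?z"
    by (rule rep_hom_eqI[OF rep_Ident_in[OF wf M] rep_Add_in[OF wf M M uv z(1)]])
      (simp add: rep_add_at[OF uv z(1)] rep_comp_dims[OF u(1) v(1)] z(2) u(2) v(2))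
  show ?thesis by (rule that[OF M' surj u(1) v(1) vu through_simple[OF M e ez] id])
qed

text \<open>The value of a homomorphism at the sink is determined by the others, because the incoming maps
  are jointly surjective.\<close>

lemma reflection_hom_eqI:
  assumes R: "right_reflection N M \<sigma> \<rho>" and M: "M \<in> Ob (Rep Q)" and X: "X \<in> Ob (Rep Q)"
    and f: "f \<in> rep_homs Q M X" and g: "g \<in> rep_homs Q M X"
    and eq: "\<And>w. w \<in> verts Q \<Longrightarrow> w \<noteq> i \<Longrightarrow> of_mat (f w) = of_mat (g w)"
  shows "f = g"
proof (rule rep_hom_eqI[OF f g])
  have Ms: "(\<Sum>a \<in> I. of_mat (rmap M a) * \<sigma> a) = fone (rdim M i)"
    using R unfolding right_reflection_def by blast
  have at_i: "of_mat (h i) = (\<Sum>a \<in> I. of_mat (rmap X a) * of_mat (h (tail Q a)) * \<sigma> a)" if h: "h \<in> rep_homs Q M X" for h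
  proof -
    have "of_mat (h i) = of_mat (h i) * (\<Sum>a \<in> I. of_mat (rmap M a) * \<sigma> a)"
      using fone_right[OF rep_hom_fcar[OF h i]] by (simp add: Ms)
    also have "\<dots> = (\<Sum>a \<in> I. of_mat (rmap X a) * of_mat (h (tail Q a)) * \<sigma> a)"
      unfolding sum_distrib_left
    proof (rule sum.cong[OF refl])
      fix a assume a: "a \<in> I"
      then have "of_mat (h i) * of_mat (rmap M a) = of_mat (rmap X a) * of_mat (h (tail Q a))"
        using rep_hom_natural[OF wf M X h, of a] by simp
      then show "of_mat (h i) * (of_mat (rmap M a) * \<sigma> a) = of_mat (rmap X a) * of_mat (h (tail Q a)) * \<sigma> a"
        by (simp only: mult.assoc[symmetric])
    qed
    finally show ?thesis .
  qed
  have "of_mat (f i) = of_mat (g i)"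
    unfolding at_i[OF f] at_i[OF g]
    by (rule sum.cong[OF refl]) (use eq arc_ends[OF wf] sink in auto)
  then show "of_mat (f w) = of_mat (g w)" if "w \<in> verts Q" for w using eq that by (cases "w = i") auto
qed

text \<open>The map on cokernels that \<open>g\<close> induces.\<close>

lemma reflection_hom_lift:
  assumes R1: "right_reflection N1 M1 \<sigma>1 \<rho>1" and R2: "right_reflection N2 M2 \<sigma>2 \<rho>2"
    and O: "M1 \<in> Ob (Rep Q)" "M2 \<in> Ob (Rep Q)" "N1 \<in> Ob (Rep Q')" "N2 \<in> Ob (Rep Q')"
    and g: "g \<in> rep_homs Q' N1 N2"
  obtains f where "f \<in> rep_homs Q M1 M2" "\<And>w. w \<in> verts Q \<Longrightarrow> w \<noteq> i \<Longrightarrow> of_mat (f w) = of_mat (g w)"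
proof -
  have rd: "\<And>w. w \<noteq> i \<Longrightarrow> rdim M1 w = rdim N1 w" "\<And>w. w \<noteq> i \<Longrightarrow> rdim M2 w = rdim N2 w"
    and rm: "\<And>a. a \<in> arcs Q \<Longrightarrow> head Q a \<noteq> i \<Longrightarrow> of_mat (rmap M1 a) = of_mat (rmap N1 a)"
       "\<And>a. a \<in> arcs Q \<Longrightarrow> head Q a \<noteq> i \<Longrightarrow> of_mat (rmap M2 a) = of_mat (rmap N2 a)"
    and s: "\<And>a. a \<in> I \<Longrightarrow> \<sigma>1 a \<in> fcar (rdim M1 (tail Q a)) (rdim M1 i)"
    and MN: "(\<Sum>a \<in> I. of_mat (rmap M2 a) * of_mat (rmap N2 a)) = 0"
    and Nr: "\<And>a b. a \<in> I \<Longrightarrow> b \<in> I \<Longrightarrow> of_mat (rmap N1 a) * \<rho>1 b =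
       (if a = b then fone (rdim M1 (tail Q a)) else 0) - \<sigma>1 a * of_mat (rmap M1 b)"
    using R1 R2 unfolding right_reflection_def by blast+
  have gc: "of_mat (g w) \<in> fcar (rdim M2 w) (rdim M1 w)" if "w \<in> verts Q" "w \<noteq> i" for w
    using rep_hom_fcar[OF g, of w] that rd by simp
  have gn: "of_mat (g (tail Q a)) * of_mat (rmap N1 a) = of_mat (rmap N2 a) * of_mat (g i)" if "a \<in> I" for a
    using rep_hom_natural[OF wf' O(3,4) g, of a] that by simp
  have gn': "of_mat (g (head Q a)) * of_mat (rmap N1 a) = of_mat (rmap N2 a) * of_mat (g (tail Q a))"
    if "a \<in> arcs Q" "head Q a \<noteq> i" for a
    using rep_hom_natural[OF wf' O(3,4) g, of a] that by simp
  define x where "x = (\<Sum>a \<in> I. of_mat (rmap M2 a) * of_mat (g (tail Q a)) * \<sigma>1 a)"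
  have t: "tail Q a \<in> verts Q" "tail Q a \<noteq> i" if "a \<in> I" for a
    using that arc_ends(2)[OF wf] sink by auto
  have x: "x \<in> fcar (rdim M2 i) (rdim M1 i)"
    unfolding x_def by (intro fcar_sum fcar_times[OF fcar_times[OF map_M[OF O(2)] gc[OF t]] s])
  have xM: "x * of_mat (rmap M1 b) = of_mat (rmap M2 b) * of_mat (g (tail Q b))" if b: "b \<in> I" for b
  proof -
    let ?y = "of_mat (rmap M2 b) * of_mat (g (tail Q b))"
    have "x * of_mat (rmap M1 b) = (\<Sum>a \<in> I. (if a = b then ?y else 0) - of_mat (rmap M2 a) * of_mat (rmap N2 a) * (of_mat (g i) * \<rho>1 b))"
      unfolding x_def sum_distrib_right
    proof (rule sum.cong[OF refl])
      fix a assume a: "a \<in> I"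
      have sM: "\<sigma>1 a * of_mat (rmap M1 b) = (if a = b then fone (rdim M1 (tail Q a)) else 0) - of_mat (rmap N1 a) * \<rho>1 b"
        by (simp add: Nr[OF a b])
      have "of_mat (rmap M2 a) * of_mat (g (tail Q a)) * \<sigma>1 a * of_mat (rmap M1 b)
          = of_mat (rmap M2 a) * of_mat (g (tail Q a)) * (if a = b then fone (rdim M1 (tail Q a)) else 0)
          - of_mat (rmap M2 a) * (of_mat (g (tail Q a)) * of_mat (rmap N1 a)) * \<rho>1 b"
        by (simp only: mult.assoc sM right_diff_distrib)
      also have "of_mat (rmap M2 a) * of_mat (g (tail Q a)) * (if a = b then fone (rdim M1 (tail Q a)) else 0) = (if a = b then ?y else 0)"
        using fone_right[OF fcar_times[OF map_M[OF O(2) b] gc[OF t[OF b]]]] by simp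
      finally show "of_mat (rmap M2 a) * of_mat (g (tail Q a)) * \<sigma>1 a * of_mat (rmap M1 b)
          = (if a = b then ?y else 0) - of_mat (rmap M2 a) * of_mat (rmap N2 a) * (of_mat (g i) * \<rho>1 b)"
        by (simp only: gn[OF a] mult.assoc)
    qed
    also have "\<dots> = ?y - (\<Sum>a \<in> I. of_mat (rmap M2 a) * of_mat (rmap N2 a)) * (of_mat (g i) * \<rho>1 b)"
      using b finI by (simp add: sum_subtractf sum_distrib_right)
    finally show ?thesis by (simp add: MN)
  qed
  define f where "f = mk_hom Q M1 M2 (\<lambda>w. if w = i then x else of_mat (g w))"
  have f: "f \<in> rep_homs Q M1 M2" "\<And>w. w \<in> verts Q \<Longrightarrow> of_mat (f w) = (if w = i then x else of_mat (g w))"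
    unfolding f_def using x gc xM rm gn' sink by (intro mk_hom[OF wf O(1,2)]; auto)+
  then show ?thesis using that by simp
qed

text \<open>Reflection is functorial, so it preserves factorizations.\<close>

lemma reflection_through_lift:
  fixes L :: "('k :: field, 'v, 'e) representation set"
  assumes th: "through (Rep Q') L' N1 N2 z"
    and R1: "right_reflection N1 M1 \<sigma>1 \<rho>1" and R2: "right_reflection N2 M2 \<sigma>2 \<rho>2"
    and O: "M1 \<in> Ob (Rep Q)" "M2 \<in> Ob (Rep Q)" "N1 \<in> Ob (Rep Q')" "N2 \<in> Ob (Rep Q')"
    and L: "L' \<subseteq> Ob (Rep Q')" "L \<subseteq> Ob (Rep Q)" "\<And>G. G \<in> L' \<Longrightarrow> \<exists>G' \<in> L. \<exists>\<sigma> \<rho>. right_reflection G G' \<sigma> \<rho>"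
  shows "\<exists>f. through (Rep Q) L M1 M2 f \<and> (\<forall>w \<in> verts Q. w \<noteq> i \<longrightarrow> of_mat (f w) = of_mat (z w))"
  using th
proof (induction rule: through.induct)
  case through_zero
  have "rdim M1 w = rdim N1 w \<and> rdim M2 w = rdim N2 w" if "w \<noteq> i" for w
    using R1 R2 that by (simp add: right_reflection_def)
  then show ?case using through.through_zero[of "Rep Q" L M1 M2] by (intro exI conjI) auto
next
  case (through_step z G b a)
  interpret C: lincat "Rep Q" by (rule lincat_rep_category[OF wf])
  interpret C': lincat "Rep Q'" by (rule lincat_rep_category[OF wf'])
  obtain f where f: "through (Rep Q) L M1 M2 f" "\<And>w. w \<in> verts Q \<Longrightarrow> w \<noteq> i \<Longrightarrow> of_mat (f w) = of_mat (z w)"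
    using through_step.IH by blast
  obtain G' \<sigma> \<rho> where G': "G' \<in> L" "right_reflection G G' \<sigma> \<rho>" using L(3)[OF through_step.hyps(2)] by blast
  have G: "G \<in> Ob (Rep Q')" and GO: "G' \<in> Ob (Rep Q)" using through_step.hyps(2) G' L by blast+
  have ba: "b \<in> rep_homs Q' N1 G" "a \<in> rep_homs Q' G N2" using through_step.hyps(3,4) by simp_all
  obtain b' where b': "b' \<in> rep_homs Q M1 G'" "\<And>w. w \<in> verts Q \<Longrightarrow> w \<noteq> i \<Longrightarrow> of_mat (b' w) = of_mat (b w)"
    by (rule reflection_hom_lift[OF R1 G'(2) O(1) GO O(3) G ba(1)]) blast
  obtain a' where a': "a' \<in> rep_homs Q G' M2" "\<And>w. w \<in> verts Q \<Longrightarrow> w \<noteq> i \<Longrightarrow> of_mat (a' w) = of_mat (a w)"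
    by (rule reflection_hom_lift[OF G'(2) R2 GO O(2) G O(4) ba(2)]) blast
  have z: "z \<in> rep_homs Q' N1 N2" using C'.through_in[OF through_step.hyps(1) O(3,4) L(1)] by simp
  have f': "f \<in> rep_homs Q M1 M2" using C.through_in[OF f(1) O(1,2) L(2)] by simp
  note ab = rep_comp_in[OF wf' O(3) G O(4) ba] and ab' = rep_comp_in[OF wf O(1) GO O(2) b'(1) a'(1)]
  have vQ: "verts Q' = verts Q" by simp
  have "of_mat (Add (Rep Q) (rep_comp Q a' b') f w) = of_mat (Add (Rep Q') (rep_comp Q' a b) z w)"
    if w: "w \<in> verts Q" "w \<noteq> i" for w
    unfolding rep_add_at[OF ab' f' w(1)] rep_comp_dims[OF a'(1) b'(1) w(1)]
      rep_add_at[OF ab z, unfolded vQ, OF w(1)] rep_comp_dims[OF ba(2,1), unfolded vQ, OF w(1)]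
    using w by (simp add: a'(2) b'(2) f(2))
  moreover have "through (Rep Q) L M1 M2 (Add (Rep Q) (rep_comp Q a' b') f)"
    using through.through_step[OF f(1) G'(1)] a'(1) b'(1) by simp
  ultimately show ?case unfolding rep_category_simps(3) by blast
qed

lemma injective_at_retract:
  assumes O: "B \<in> Ob (Rep Q')" "N \<in> Ob (Rep Q')" and u: "u \<in> rep_homs Q' B N" and v: "v \<in> rep_homs Q' N B"
    and vu: "rep_comp Q' v u = Ident (Rep Q') B" and N: "injective_at N"
  shows "injective_at B"
proof -
  obtain t where t: "\<And>a. a \<in> I \<Longrightarrow> t a \<in> fcar (rdim N i) (rdim N (tail Q a))" "(\<Sum>a \<in> I. t a * of_mat (rmap N a)) = fone (rdim N i)"
    using N by (auto simp: injective_at_def)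
  have i': "i \<in> verts Q'" using i by simp
  have vui: "of_mat (v i) * of_mat (u i) = fone (rdim B i)"
    using arg_cong[OF vu, of "\<lambda>f. of_mat (f i)"] i by (simp add: rep_comp_dims[OF v u i'])
  define s where "s a = of_mat (v i) * t a * of_mat (u (tail Q a))" for a
  have "s a \<in> fcar (rdim B i) (rdim B (tail Q a))" if a: "a \<in> I" for a
  proof -
    have "tail Q a \<in> verts Q'" using a arc_ends(2)[OF wf] by simp
    then show ?thesis unfolding s_def using fcar_times[OF fcar_times[OF rep_hom_fcar[OF v i'] t(1)[OF a]] rep_hom_fcar[OF u]] by blast
  qed
  moreover have "(\<Sum>a \<in> I. s a * of_mat (rmap B a)) = of_mat (v i) * (\<Sum>a \<in> I. t a * of_mat (rmap N a)) * of_mat (u i)"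
    unfolding sum_distrib_left sum_distrib_right
  proof (rule sum.cong[OF refl])
    fix a assume a: "a \<in> I"
    have "of_mat (u (tail Q a)) * of_mat (rmap B a) = of_mat (rmap N a) * of_mat (u i)"
      using rep_hom_natural[OF wf' O u, of a] a by simp
    then show "s a * of_mat (rmap B a) = of_mat (v i) * (t a * of_mat (rmap N a)) * of_mat (u i)"
      by (simp add: s_def mult.assoc)
  qed
  ultimately show ?thesis
    unfolding injective_at_def using vui fone_left[OF rep_hom_fcar[OF u i']] by (intro exI[of _ s]) (simp add: t(2) mult.assoc)
qed

end

text \<open>All dimension vectors along the sequence of reflections are nonnegative.\<close>

fun survives :: "('v, 'e) pre_digraph \<Rightarrow> 'v list \<Rightarrow> ('v \<Rightarrow> int) \<Rightarrow> bool" where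
  "survives Q [] d \<longleftrightarrow> (\<forall>v \<in> verts Q. d v \<ge> 0)"
| "survives Q (i # is) d \<longleftrightarrow> (\<forall>v \<in> verts Q. d v \<ge> 0) \<and> survives (reflect Q i) is (reflect_dim Q i d)"

fun admissible :: "('v, 'e) pre_digraph \<Rightarrow> 'v list \<Rightarrow> bool" where
  "admissible Q [] \<longleftrightarrow> True"
| "admissible Q (i # is) \<longleftrightarrow> i \<in> verts Q \<and> (\<forall>a \<in> arcs Q. tail Q a \<noteq> i) \<and> admissible (reflect Q i) is"

text \<open>Every \<open>M\<close> is \<open>B\<close> plus a part that \<open>L\<close> generates.\<close>

definition generates_up_to_survivors where
  "generates_up_to_survivors Q is L \<longleftrightarrow> (\<forall>M \<in> Ob (Rep Q). \<exists>B \<in> Ob (Rep Q). \<exists>u \<in> rep_homs Q B M. \<exists>v \<in> rep_homs Q M B. \<exists>z.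
     rep_comp Q v u = Ident (Rep Q) B \<and> through (Rep Q) L M M z \<and>
     Ident (Rep Q) M = Add (Rep Q) (rep_comp Q u v) z \<and> survives Q is (\<lambda>v. int (rdim B v)))"

text \<open>Split off the simple at the first sink, reflect the rest, decompose it over the reflected quiver and
  reflect back.  The reflected decomposition is a decomposition because homomorphisms between
  reflected representations are determined away from the sink.\<close>

theorem reflections_generate:
  fixes Q :: "('v, 'e) pre_digraph"
  assumes "wf_digraph Q" "finite (arcs Q)" "admissible Q is"
  shows "\<exists>L :: ('k :: field, 'v, 'e) representation set. finite L \<and> L \<subseteq> Ob (Rep Q) \<and> generates_up_to_survivors Q is L"
  using assms
proof (induction "is" arbitrary: Q)
  case Nil
  note wf = Nil.prems(1)
  interpret C: lincat "Rep Q :: ('k, ('k, 'v, 'e) representation, 'v \<Rightarrow> 'k mat) linear_category" by (rule lincat_rep_category[OF wf])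
  have "generates_up_to_survivors Q [] ({} :: ('k, 'v, 'e) representation set)"
    unfolding generates_up_to_survivors_def
  proof
    fix M :: "('k, 'v, 'e) representation" assume M: "M \<in> Ob (Rep Q)"
    let ?i = "Ident (Rep Q) M"
    have i: "?i \<in> rep_homs Q M M" using C.ident_in[OF M] by (simp only: rep_category_simps)
    have 1: "rep_comp Q ?i ?i = ?i" using C.ident_left[OF M M C.ident_in[OF M]] by (simp only: rep_category_simps)
    have 2: "?i = Add (Rep Q) (rep_comp Q ?i ?i) (Zero (Rep Q) M M)"
      using C.add_zero[OF M M C.ident_in[OF M]] by (simp only: 1)
    have 3: "survives Q [] (\<lambda>v. int (rdim M v))" by simp
    show "\<exists>B\<in>Ob (Rep Q). \<exists>u\<in>rep_homs Q B M. \<exists>v\<in>rep_homs Q M B. \<exists>z.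
       rep_comp Q v u = Ident (Rep Q) B \<and> through (Rep Q) {} M M z \<and>
       Ident (Rep Q) M = Add (Rep Q) (rep_comp Q u v) z \<and> survives Q [] (\<lambda>v. int (rdim B v))"
      by (rule bexI[OF _ M], rule bexI[OF _ i], rule bexI[OF _ i], rule exI[of _ "Zero (Rep Q) M M"])
        (intro conjI 1 2 3 through_zero)
  qed
  then show ?case by blast
next
  case (Cons i "is")
  interpret quiver_sink Q i by (rule quiver_sink.intro) (use Cons.prems in auto)
  interpret C: lincat "Rep Q :: ('k, ('k, 'v, 'e) representation, 'v \<Rightarrow> 'k mat) linear_category" by (rule lincat_rep_category[OF wf])
  have "finite (arcs Q')" "admissible Q' is" using Cons.prems by simp_all
  from Cons.IH[OF wf' this] obtain L' :: "('k, 'v, 'e) representation set" where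
    L': "finite L'" "L' \<subseteq> Ob (Rep Q')" "generates_up_to_survivors Q' is L'" by blast
  have "\<exists>G'. G' \<in> Ob (Rep Q) \<and> (\<exists>\<sigma> \<rho>. right_reflection G G' \<sigma> \<rho>)" if "G \<in> L'" for G
    by (rule right_reflection_exists[of G]) (use that L'(2) in blast)+
  then obtain \<phi> where \<phi>: "\<And>G. G \<in> L' \<Longrightarrow> \<phi> G \<in> Ob (Rep Q)" "\<And>G. G \<in> L' \<Longrightarrow> \<exists>\<sigma> \<rho>. right_reflection G (\<phi> G) \<sigma> \<rho>"
    by metis
  define L where "L = insert (simple_rep Q i) (\<phi> ` L')"
  have L: "finite L" "L \<subseteq> Ob (Rep Q)" "\<phi> ` L' \<subseteq> L" using L'(1) \<phi>(1) simple_rep_Ob by (auto simp: L_def simp del: rep_category_simps)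
  have "generates_up_to_survivors Q (i # is) L"
    unfolding generates_up_to_survivors_def
  proof
    fix M :: "('k, 'v, 'e) representation" assume M: "M \<in> Ob (Rep Q)"
    let ?id = "Ident (Rep Q)" and ?add = "Add (Rep Q)" and ?c = "rep_comp Q"
    obtain M' u0 v0 z0 where M': "M' \<in> Ob (Rep Q)" "surjective_at M'" "u0 \<in> rep_homs Q M' M" "v0 \<in> rep_homs Q M M'"
      "?c v0 u0 = ?id M'" "through (Rep Q) {simple_rep Q i} M M z0" "?id M = ?add (?c u0 v0) z0"
      by (rule split_off_simple[OF M])
    obtain N \<sigma> \<rho> where N: "N \<in> Ob (Rep Q')" "right_reflection N M' \<sigma> \<rho>" "injective_at N"
      by (rule reflection_of_surjective[OF M'(1,2)])
    from L'(3) N(1) obtain B u v z where B: "B \<in> Ob (Rep Q')" "u \<in> rep_homs Q' B N" "v \<in> rep_homs Q' N B"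
      "rep_comp Q' v u = Ident (Rep Q') B" "through (Rep Q') L' N N z"
      "Ident (Rep Q') N = Add (Rep Q') (rep_comp Q' u v) z" "survives Q' is (\<lambda>v. int (rdim B v))"
      unfolding generates_up_to_survivors_def by blast
    obtain A \<sigma>' \<rho>' where A: "A \<in> Ob (Rep Q)" "right_reflection B A \<sigma>' \<rho>'"
      by (rule right_reflection_exists[OF B(1)])
    obtain U where U: "U \<in> rep_homs Q A M'" "\<And>w. w \<in> verts Q \<Longrightarrow> w \<noteq> i \<Longrightarrow> of_mat (U w) = of_mat (u w)"
      by (rule reflection_hom_lift[OF A(2) N(2) A(1) M'(1) B(1) N(1) B(2)]) blast
    obtain V where V: "V \<in> rep_homs Q M' A" "\<And>w. w \<in> verts Q \<Longrightarrow> w \<noteq> i \<Longrightarrow> of_mat (V w) = of_mat (v w)"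
      by (rule reflection_hom_lift[OF N(2) A(2) M'(1) A(1) N(1) B(1) B(3)]) blast
    have gen: "\<exists>G'\<in>\<phi> ` L'. \<exists>\<sigma> \<rho>. right_reflection G G' \<sigma> \<rho>" if "G \<in> L'" for G using \<phi>(2)[OF that] that by blast
    have \<phi>O: "\<phi> ` L' \<subseteq> Ob (Rep Q)" using \<phi>(1) by blast
    obtain Z where Z: "through (Rep Q) (\<phi> ` L') M' M' Z" "\<And>w. w \<in> verts Q \<Longrightarrow> w \<noteq> i \<Longrightarrow> of_mat (Z w) = of_mat (z w)"
      using reflection_through_lift[OF B(5) N(2) N(2) M'(1) M'(1) N(1) N(1) L'(2) \<phi>O gen] by blast
    have Zin: "Z \<in> rep_homs Q M' M'" using C.through_in[OF Z(1) M'(1) M'(1) \<phi>O] by (simp only: rep_category_simps)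
    interpret C': lincat "Rep Q' :: ('k, ('k, 'v, 'e) representation, 'v \<Rightarrow> 'k mat) linear_category" by (rule lincat_rep_category[OF wf'])
    have zin: "z \<in> rep_homs Q' N N" using C'.through_in[OF B(5) N(1) N(1) L'(2)] by (simp only: rep_category_simps)
    have rdA: "rdim A w = rdim B w" "rdim M' w = rdim N w" if "w \<noteq> i" for w
      using A(2) N(2) that by (simp_all add: right_reflection_def)
    have vQ: "verts Q' = verts Q" by simp
    note idin = C.ident_in[unfolded rep_category_simps(2)]
    \<comment> \<open>It suffices to compare \<open>V U\<close> with \<open>1\<close> and \<open>U V + Z\<close> with \<open>1\<close> away from the sink.\<close>
    note VU = rep_comp_in[OF wf A(1) M'(1) A(1) U(1) V(1)] and UV = rep_comp_in[OF wf M'(1) A(1) M'(1) V(1) U(1)]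
    have 1: "?c V U = ?id A"
    proof (rule reflection_hom_eqI[OF A(2) A(1) A(1) VU idin[OF A(1)]])
      fix w assume w: "w \<in> verts Q" "w \<noteq> i"
      have "of_mat (v w) * of_mat (u w) = fone (rdim B w)"
        using arg_cong[OF B(4), of "\<lambda>f. of_mat (f w)"] w rep_comp_dims[OF B(3,2), unfolded vQ, OF w(1)] by simp
      then show "of_mat (?c V U w) = of_mat (?id A w)"
        using w by (simp add: rep_comp_dims[OF V(1) U(1) w(1)] U(2) V(2) rdA)
    qed
    have 2: "?id M' = ?add (?c U V) Z"
    proof (rule reflection_hom_eqI[OF N(2) M'(1) M'(1) idin[OF M'(1)] rep_Add_in[OF wf M'(1) M'(1) UV Zin]])
      fix w assume w: "w \<in> verts Q" "w \<noteq> i"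
      note uv' = rep_comp_in[OF wf' N(1) B(1) N(1) B(3,2)]
      have "of_mat (Ident (Rep Q') N w) = of_mat (u w) * of_mat (v w) + of_mat (z w)"
        using arg_cong[OF B(6), of "\<lambda>f. of_mat (f w)"] rep_add_at[OF uv' zin, unfolded vQ, OF w(1)]
          rep_comp_dims[OF B(2,3), unfolded vQ, OF w(1)] by (simp only:)
      then show "of_mat (?id M' w) = of_mat (?add (?c U V) Z w)"
        unfolding rep_add_at[OF UV Zin w(1)] rep_comp_dims[OF U(1) V(1) w(1)]
        using w by (simp add: U(2) V(2) Z(2) rdA)
    qed
    note h = C.comp_in[unfolded rep_category_simps(2,3)] and assoc = C.comp_assoc[unfolded rep_category_simps(2,3)]
    have z0in: "z0 \<in> rep_homs Q M M" using C.through_in[OF M'(6) M M] simple_rep_Ob by (simp only: rep_category_simps(2)) simp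
    note u0U = h[OF A(1) M'(1) M U(1) M'(3)] and Vv0 = h[OF M M'(1) A(1) M'(4) V(1)]
    have 3: "?c (?c V v0) (?c u0 U) = ?id A"
    proof -
      have "?c (?c V v0) (?c u0 U) = ?c V (?c (?c v0 u0) U)"
        using assoc[OF A(1) M M'(1) A(1) u0U M'(4) V(1)] assoc[OF A(1) M'(1) M M'(1) U(1) M'(3,4)] by simp
      also have "\<dots> = ?c V U" using C.ident_left[unfolded rep_category_simps(2,3), OF A(1) M'(1) U(1)] M'(5) by simp
      finally show ?thesis using 1 by simp
    qed
    \<comment> \<open>The part generated by \<open>L\<close> collects the simples at the sink and the reflected maps.\<close>
    define y where "y = ?add (?c u0 (?c Z v0)) z0"
    have Zv0: "through (Rep Q) L M M' (?c Z v0)"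
      using C.through_comp_right[OF through_mono[OF Z(1) L(3)], unfolded rep_category_simps(2,3), OF M'(4) M M'(1) M'(1) L(2)] .
    have Zt: "through (Rep Q) L M M (?c u0 (?c Z v0))"
      using C.through_comp_left[OF Zv0, unfolded rep_category_simps(2,3), OF M'(3) M M'(1) M L(2)] .
    have yt: "through (Rep Q) L M M y"
      unfolding y_def by (rule C.through_add[OF Zt through_mono[OF M'(6)] M M L(2)]) (simp add: L_def)
    have 4: "?id M = ?add (?c (?c u0 U) (?c V v0)) y"
    proof -
      note Zv0in = h[OF M M'(1) M'(1) M'(4) Zin] and UVv0 = h[OF M M'(1) M'(1) M'(4) UV]
      have "v0 = ?c (?add (?c U V) Z) v0" using C.ident_left[unfolded rep_category_simps(2,3), OF M M'(1,4)] 2 by simp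
      also have "\<dots> = ?add (?c (?c U V) v0) (?c Z v0)"
        using C.comp_add_left[unfolded rep_category_simps(2,3), OF M M'(1) M'(1) M'(4) UV Zin] .
      finally have "?c u0 v0 = ?add (?c u0 (?c (?c U V) v0)) (?c u0 (?c Z v0))"
        using C.comp_add_right[unfolded rep_category_simps(2,3), OF M M'(1) M UVv0 Zv0in M'(3)] by simp
      also have "?c u0 (?c (?c U V) v0) = ?c (?c u0 U) (?c V v0)"
        using assoc[OF M M'(1) A(1) M'(1) M'(4) V(1) U(1)] assoc[OF M A(1) M'(1) M Vv0 U(1) M'(3)] by simp
      finally show ?thesis unfolding M'(7) y_def
        using C.add_assoc[unfolded rep_category_simps(2,3), OF M M h[OF M A(1) M Vv0 u0U] h[OF M M'(1) M Zv0in M'(3)] z0in] by simp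
    qed
    have inj: "injective_at B" by (rule injective_at_retract[OF B(1) N(1) B(2,3,4) N(3)])
    have "int (rdim B i) = (\<Sum>a \<in> I. int (rdim A (tail Q a))) - int (rdim A i)"
      using reflection_dim[OF A(1) B(1) A(2) inj, symmetric] by (simp add: of_nat_sum[symmetric] del: of_nat_sum)
    moreover have "(\<Sum>a | a \<in> arcs Q \<and> tail Q a = i. int (rdim A (head Q a))) = 0" by (rule sum.neutral) (use sink in auto)
    \<comment> \<open>Injectivity of \<open>B\<close> at \<open>i\<close> makes the reflection of dimension vectors exact.\<close>
    ultimately have dB: "reflect_dim Q i (\<lambda>v. int (rdim A v)) = (\<lambda>v. int (rdim B v))"
      using rdA(1) by (auto simp: reflect_dim_def fun_eq_iff)
    have 5: "survives Q (i # is) (\<lambda>v. int (rdim A v))" using B(7) by (simp add: dB)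
    show "\<exists>B\<in>Ob (Rep Q). \<exists>u\<in>rep_homs Q B M. \<exists>v\<in>rep_homs Q M B. \<exists>z.
       ?c v u = ?id B \<and> through (Rep Q) L M M z \<and> ?id M = ?add (?c u v) z \<and> survives Q (i # is) (\<lambda>v. int (rdim B v))"
      by (rule bexI[OF _ A(1)], rule bexI[OF _ u0U], rule bexI[OF _ Vv0], rule exI[of _ y]) (intro conjI 3 yt 4 5)
  qed
  then show ?case using L by blast
qed

section \<open>Dynkin diagrams as weighted trees\<close>

text \<open>The vertices are numbered such that \<open>p j\<close> is the parent of \<open>j\<close>, with root \<open>0\<close>.  When the squares in
  the Tits form are completed from the leaves towards the root, the vertex \<open>j\<close> keeps a coefficient
  \<open>\<alpha> j\<close>: completing the square at a child \<open>c\<close> costs its parent \<open>1 / (4 * \<alpha> c)\<close>.\<close>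

definition weighted_tree :: "nat \<Rightarrow> (nat \<Rightarrow> nat) \<Rightarrow> (nat \<Rightarrow> real) \<Rightarrow> bool" where
  "weighted_tree n p \<alpha> \<longleftrightarrow> (\<forall>j \<in> {1..<n}. p j < j) \<and> (\<forall>j < n. \<alpha> j > 0) \<and>
     (\<forall>j < n. \<alpha> j + (\<Sum>c \<in> {1..<n}. if p c = j then 1 / (4 * \<alpha> c) else 0) \<le> 1)"

lemma chain_edges_image: "chain_edges n = (\<lambda>j. {j, j - 1}) ` {1..<n}"
  unfolding chain_edges_def
proof (intro equalityI subsetI)
  fix x assume "x \<in> {{i, i + 1} |i. i + 1 < n}"
  then obtain i where "x = {i, i + 1}" "i + 1 < n" by blast
  then show "x \<in> (\<lambda>j. {j, j - 1}) ` {1..<n}" by (intro image_eqI[of _ _ "i + 1"]) auto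
next
  fix x assume "x \<in> (\<lambda>j. {j, j - 1}) ` {1..<n}"
  then obtain j where "x = {j, j - 1}" "1 \<le> j" "j < n" by auto
  then show "x \<in> {{i, i + 1} |i. i + 1 < n}" by (intro CollectI exI[of _ "j - 1"]) auto
qed

lemma branched_chain_edges:
  assumes "n \<ge> 2"
  shows "insert {c, n - 1} (chain_edges (n - 1)) = (\<lambda>j. {j, if j = n - 1 then c else j - 1}) ` {1..<n}"
proof -
  have "{1..<n} = insert (n - 1) {1..<n - 1}" using assms by auto
  moreover have "(\<lambda>j. {j, if j = n - 1 then c else j - 1}) ` {1..<n - 1} = (\<lambda>j. {j, j - 1}) ` {1..<n - 1}"
    by (rule image_cong) auto
  ultimately show ?thesis by (simp only: chain_edges_image image_insert insert_commute[of c] simp_thms if_True)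
qed

text \<open>In type A the weight \<open>1/2\<close> reproduces itself along the chain.  In type D the two leaves at the fork
  cost \<open>1/4\<close> each, which again leaves \<open>1/2\<close>.  In type E the weights are computed from the leaves
  towards the root; that the last one is still positive is where \<open>n \<le> 8\<close> enters.\<close>

lemma dynkin_weighted_tree:
  assumes "dynkin_diagram n E"
  shows "\<exists>p \<alpha>. weighted_tree n p \<alpha> \<and> E = (\<lambda>j. {j, p j}) ` {1..<n}"
  using assms
proof cases
  case type_A
  have half: "(\<Sum>c \<in> {1..<n}. if c - 1 = j then 1 / (4 * (1 / 2)) else 0) \<le> (1 / 2 :: real)" for j
  proof -
    have "(\<Sum>c \<in> {1..<n}. if c - 1 = j then 1 / (4 * (1 / 2)) else 0) = (\<Sum>c \<in> {1..<n}. if c = Suc j then 1 / 2 else (0 :: real))"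
      by (rule sum.cong) auto
    then show ?thesis by simp
  qed
  have "1 / 2 + (\<Sum>c \<in> {1..<n}. if c - 1 = j then 1 / (4 * (1 / 2)) else 0) \<le> (1 :: real)" for j
    by (rule order_trans[OF add_left_mono[OF half]]) simp
  then have "weighted_tree n (\<lambda>j. j - 1) (\<lambda>_. 1 / 2)" unfolding weighted_tree_def by simp
  then show ?thesis using type_A chain_edges_image by blast
next
  case type_D
  define p where "p j = (if j = n - 1 then n - 3 else j - 1)" for j
  define \<alpha> :: "nat \<Rightarrow> real" where "\<alpha> j = (if j \<le> n - 3 then 1 / 2 else 1)" for j
  have le: "\<alpha> j + (\<Sum>c \<in> {1..<n}. if p c = j then 1 / (4 * \<alpha> c) else 0) \<le> 1" if j: "j < n" for j
  proof -
    consider "j < n - 3" | "j = n - 3" | "n - 3 < j" by linarith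
    then show ?thesis
    proof cases
      case 1
      have "(\<Sum>c \<in> {1..<n}. if p c = j then 1 / (4 * \<alpha> c) else 0) = (\<Sum>c \<in> {1..<n}. if c = Suc j then 1 / 2 else 0)"
        by (rule sum.cong) (use 1 in \<open>auto simp: p_def \<alpha>_def\<close>)
      then show ?thesis using 1 by (simp add: \<alpha>_def)
    next
      case 2
      have "(\<Sum>c \<in> {1..<n}. if p c = j then 1 / (4 * \<alpha> c) else 0)
          = (\<Sum>c \<in> {1..<n}. (if c = n - 1 then 1 / 4 else 0) + (if c = n - 2 then 1 / 4 else 0))"
        by (rule sum.cong) (use 2 type_D in \<open>auto simp: p_def \<alpha>_def\<close>)
      then show ?thesis using 2 type_D by (simp add: \<alpha>_def sum.distrib)
    next
      case 3
      have "(\<Sum>c \<in> {1..<n}. if p c = j then 1 / (4 * \<alpha> c) else 0) = 0"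
        by (rule sum.neutral) (use 3 type_D in \<open>auto simp: p_def\<close>)
      then show ?thesis by (simp add: \<alpha>_def)
    qed
  qed
  then have "weighted_tree n p \<alpha>" using type_D by (auto simp: weighted_tree_def p_def \<alpha>_def)
  moreover have "E = (\<lambda>j. {j, p j}) ` {1..<n}"
  proof -
    have "n \<ge> 2" using type_D by auto
    from branched_chain_edges[OF this, of "n - 3"] type_D(1) show ?thesis by (simp only: p_def)
  qed
  ultimately show ?thesis by blast
next
  case type_E
  define p where "p j = (if j = n - 1 then 2 else j - 1)" for j
  define ws :: "real list" where "ws = (if n = 6 then [3/8, 2/5, 5/12, 3/4, 1, 1]
    else if n = 7 then [1/4, 1/3, 3/8, 2/3, 3/4, 1, 1] else [1/8, 2/7, 7/20, 5/8, 2/3, 3/4, 1, 1])"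
  have "weighted_tree n p ((!) ws)"
  proof -
    consider "n = 6" | "n = 7" | "n = 8" using type_E by auto
    then show ?thesis
      unfolding weighted_tree_def lessThan_iff[symmetric] Ball_def[symmetric]
      by cases (simp_all add: p_def ws_def lessThan_nat_numeral atLeastLessThan_nat_numeral)
  qed
  moreover have "E = (\<lambda>j. {j, p j}) ` {1..<n}"
  proof -
    have "n \<ge> 2" using type_E by auto
    from branched_chain_edges[OF this, of 2] type_E(1) show ?thesis by (simp only: p_def)
  qed
  ultimately show ?thesis by blast
qed

definition tree_form :: "nat \<Rightarrow> (nat \<Rightarrow> nat) \<Rightarrow> (nat \<Rightarrow> real) \<Rightarrow> real" where
  "tree_form n p y = (\<Sum>j<n. (y j)\<^sup>2) - (\<Sum>j\<in>{1..<n}. y j * y (p j))"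

lemma tree_form_ge:
  assumes t: "weighted_tree n p \<alpha>" and n: "n \<ge> 1"
  shows "\<alpha> 0 * (y 0)\<^sup>2 + (\<Sum>j\<in>{1..<n}. \<alpha> j * (y j - y (p j) / (2 * \<alpha> j))\<^sup>2) \<le> tree_form n p y"
proof -
  have pj: "p j < n" if "j \<in> {1..<n}" for j using t that by (auto simp: weighted_tree_def intro: less_trans)
  have pos: "\<alpha> j > 0" if "j < n" for j using t that by (simp add: weighted_tree_def)
  have split: "(\<Sum>j<n. f j) = f 0 + (\<Sum>j\<in>{1..<n}. f j)" for f :: "nat \<Rightarrow> real"
    using n by (simp add: lessThan_atLeast0 sum.atLeast_Suc_lessThan)
  have "(\<Sum>j\<in>{1..<n}. \<alpha> j * (y j - y (p j) / (2 * \<alpha> j))\<^sup>2)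
      = (\<Sum>j\<in>{1..<n}. \<alpha> j * (y j)\<^sup>2 - y j * y (p j) + 1 / (4 * \<alpha> j) * (y (p j))\<^sup>2)"
  proof (rule sum.cong[OF refl])
    fix j assume "j \<in> {1..<n}"
    then have "\<alpha> j \<noteq> 0" using pos[of j] by auto
    then show "\<alpha> j * (y j - y (p j) / (2 * \<alpha> j))\<^sup>2 = \<alpha> j * (y j)\<^sup>2 - y j * y (p j) + 1 / (4 * \<alpha> j) * (y (p j))\<^sup>2"
      by (simp add: power2_eq_square field_simps)
  qed
  also have "\<dots> = (\<Sum>j\<in>{1..<n}. \<alpha> j * (y j)\<^sup>2) - (\<Sum>j\<in>{1..<n}. y j * y (p j)) + (\<Sum>j\<in>{1..<n}. 1 / (4 * \<alpha> j) * (y (p j))\<^sup>2)"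
    by (simp add: sum.distrib sum_subtractf)
  also have "(\<Sum>c\<in>{1..<n}. 1 / (4 * \<alpha> c) * (y (p c))\<^sup>2) = (\<Sum>c\<in>{1..<n}. \<Sum>j<n. if p c = j then 1 / (4 * \<alpha> c) * (y j)\<^sup>2 else 0)"
    by (rule sum.cong[OF refl]) (use pj in simp)
  also have "\<dots> = (\<Sum>j<n. (\<Sum>c\<in>{1..<n}. if p c = j then 1 / (4 * \<alpha> c) else 0) * (y j)\<^sup>2)"
    by (subst sum.swap) (auto simp: sum_distrib_right intro!: sum.cong)
  also have "\<dots> \<le> (\<Sum>j<n. (1 - \<alpha> j) * (y j)\<^sup>2)"
    by (intro sum_mono mult_right_mono) (use t in \<open>auto simp: weighted_tree_def\<close>)
  also have "\<dots> = (\<Sum>j<n. (y j)\<^sup>2) - (\<alpha> 0 * (y 0)\<^sup>2 + (\<Sum>j\<in>{1..<n}. \<alpha> j * (y j)\<^sup>2))"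
    by (simp add: left_diff_distrib sum_subtractf split)
  finally show ?thesis by (simp add: tree_form_def)
qed

text \<open>Every vertex has a bounded square in \<open>tree_form_ge\<close>, up to a multiple of the coordinate at its
  parent; so bounds propagate from the root.\<close>

lemma tree_form_bound:
  assumes t: "weighted_tree n p \<alpha>" and n: "n \<ge> 1" and j: "j < n"
  shows "\<exists>B. \<forall>y. tree_form n p y \<le> 1 \<longrightarrow> \<bar>y j\<bar> \<le> B"
  using j
proof (induction j rule: less_induct)
  case (less j)
  have pos: "\<alpha> k > 0" if "k < n" for k using t that by (simp add: weighted_tree_def)
  have terms: "0 \<le> \<alpha> k * (y k - y (p k) / (2 * \<alpha> k))\<^sup>2" if "k \<in> {1..<n}" for y k
    using pos[of k] that by simp
  have r0: "0 \<le> \<alpha> 0 * (y 0)\<^sup>2" for y :: "nat \<Rightarrow> real" using pos[of 0] n by simp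
  have sq: "\<bar>z\<bar> \<le> 1 + 1 / \<alpha> j" if "\<alpha> j * z\<^sup>2 \<le> 1" for z
  proof -
    have "z\<^sup>2 \<le> 1 / \<alpha> j" using that pos[OF less.prems] by (simp add: field_simps)
    moreover have "\<bar>z\<bar> \<le> 1 + z\<^sup>2"
    proof -
      have "0 \<le> (\<bar>z\<bar> - 1)\<^sup>2" by simp
      then show ?thesis by (simp add: power2_eq_square algebra_simps)
    qed
    ultimately show ?thesis by linarith
  qed
  show ?case
  proof (cases "j = 0")
    case True
    have "\<bar>y j\<bar> \<le> 1 + 1 / \<alpha> j" if "tree_form n p y \<le> 1" for y
    proof (rule sq)
      have "0 \<le> (\<Sum>k\<in>{1..<n}. \<alpha> k * (y k - y (p k) / (2 * \<alpha> k))\<^sup>2)" by (rule sum_nonneg) (rule terms)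
      then show "\<alpha> j * (y j)\<^sup>2 \<le> 1" using tree_form_ge[OF t n, of y] that True by simp
    qed
    then show ?thesis by blast
  next
    case False
    then have j1: "j \<in> {1..<n}" using less.prems by simp
    then have "p j < j" using t by (simp add: weighted_tree_def)
    then obtain B where B: "\<And>y. tree_form n p y \<le> 1 \<Longrightarrow> \<bar>y (p j)\<bar> \<le> B" using less.IH[of "p j"] less.prems by auto
    have "\<bar>y j\<bar> \<le> 1 + 1 / \<alpha> j + B / (2 * \<alpha> j)" if y: "tree_form n p y \<le> 1" for y
    proof -
      have "\<alpha> j * (y j - y (p j) / (2 * \<alpha> j))\<^sup>2 \<le> (\<Sum>k\<in>{1..<n}. \<alpha> k * (y k - y (p k) / (2 * \<alpha> k))\<^sup>2)"
        by (rule member_le_sum[OF j1]) (use terms in auto)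
      also have "\<dots> \<le> 1" using tree_form_ge[OF t n, of y] y r0[of y] by linarith
      finally have "\<bar>y j - y (p j) / (2 * \<alpha> j)\<bar> \<le> 1 + 1 / \<alpha> j" by (rule sq)
      moreover have "\<bar>y (p j) / (2 * \<alpha> j)\<bar> \<le> B / (2 * \<alpha> j)"
        using B[OF y] pos[OF less.prems] by (simp add: abs_divide divide_right_mono)
      ultimately show ?thesis by linarith
    qed
    then show ?thesis by blast
  qed
qed

lemma tree_form_pos:
  assumes t: "weighted_tree n p \<alpha>" and n: "n \<ge> 1" and y: "tree_form n p y \<le> 0" and j: "j < n"
  shows "y j = 0"
  using j
proof (induction j rule: less_induct)
  case (less j)
  have pos: "\<alpha> k > 0" if "k < n" for k using t that by (simp add: weighted_tree_def)
  have terms: "0 \<le> \<alpha> k * (y k - y (p k) / (2 * \<alpha> k))\<^sup>2" if "k \<in> {1..<n}" for k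
    using pos[of k] that by simp
  have s0: "0 \<le> (\<Sum>k\<in>{1..<n}. \<alpha> k * (y k - y (p k) / (2 * \<alpha> k))\<^sup>2)" by (rule sum_nonneg) (rule terms)
  have r0: "0 \<le> \<alpha> 0 * (y 0)\<^sup>2" using pos[of 0] n by simp
  note ge = tree_form_ge[OF t n, of y]
  show ?case
  proof (cases "j = 0")
    case True
    have "\<alpha> 0 * (y 0)\<^sup>2 \<le> 0" using ge s0 y by linarith
    then show ?thesis using pos[of 0] n True by (simp add: mult_le_0_iff)
  next
    case False
    then have j1: "j \<in> {1..<n}" using less.prems by simp
    then have "p j < j" using t by (simp add: weighted_tree_def)
    then have p0: "y (p j) = 0" using less by simp
    have "\<alpha> j * (y j - y (p j) / (2 * \<alpha> j))\<^sup>2 \<le> (\<Sum>k\<in>{1..<n}. \<alpha> k * (y k - y (p k) / (2 * \<alpha> k))\<^sup>2)"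
      by (rule member_le_sum[OF j1]) (use terms in auto)
    also have "\<dots> \<le> 0" using ge r0 y by linarith
    finally show ?thesis using pos[OF less.prems] p0 by (simp add: mult_le_0_iff)
  qed
qed

section \<open>Finite representation type\<close>

definition supported :: "('v, 'e) pre_digraph \<Rightarrow> ('v \<Rightarrow> int) \<Rightarrow> bool" where
  "supported Q d \<longleftrightarrow> (\<forall>v. v \<notin> verts Q \<longrightarrow> d v = 0)"

text \<open>The Tits form.  Dimension vectors are functions on the whole type of vertices, hence the
  predicate \<open>supported\<close>.\<close>

definition quiver_form :: "('v, 'e) pre_digraph \<Rightarrow> ('v \<Rightarrow> int) \<Rightarrow> int" where
  "quiver_form Q d = (\<Sum>v \<in> verts Q. (d v)\<^sup>2) - (\<Sum>a \<in> arcs Q. d (tail Q a) * d (head Q a))"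

text \<open>These properties of the Tits form are all that is used about Dynkin quivers besides the height.\<close>

locale definite_quiver = graded_quiver Q ht for Q :: "('v, 'e) pre_digraph" and ht +
  assumes form_finite: "finite {d. supported Q d \<and> quiver_form Q d \<le> 1}"
    and form_pos: "supported Q d \<Longrightarrow> quiver_form Q d \<le> 0 \<Longrightarrow> d = (\<lambda>_. 0)"
begin

definition neighbour_sum :: "'v \<Rightarrow> ('v \<Rightarrow> int) \<Rightarrow> int" where
  "neighbour_sum i d = (\<Sum>a | a \<in> arcs Q \<and> head Q a = i. d (tail Q a)) + (\<Sum>a | a \<in> arcs Q \<and> tail Q a = i. d (head Q a))"

lemma reflect_dim_eq: "reflect_dim Q i d = d(i := neighbour_sum i d - d i)"
  by (simp add: reflect_dim_def neighbour_sum_def)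

lemma no_loop: "a \<in> arcs Q \<Longrightarrow> head Q a \<noteq> tail Q a"
  using ht by fastforce

lemma neighbour_sum_alt:
  "neighbour_sum i d = (\<Sum>a \<in> arcs Q. (if head Q a = i then d (tail Q a) else 0) + (if tail Q a = i then d (head Q a) else 0))"
  by (simp only: neighbour_sum_def sum.inter_filter[OF fin_arcs] sum.distrib)

lemma neighbour_sum_cong:
  "(\<And>v. v \<in> verts Q \<Longrightarrow> v \<noteq> i \<Longrightarrow> d v = d' v) \<Longrightarrow> neighbour_sum i d = neighbour_sum i d'"
  unfolding neighbour_sum_def
proof (intro arg_cong2[where f = "(+)"] sum.cong refl)
  assume eq: "\<And>v. v \<in> verts Q \<Longrightarrow> v \<noteq> i \<Longrightarrow> d v = d' v"
  fix a
  show "d (tail Q a) = d' (tail Q a)" if "a \<in> {a \<in> arcs Q. head Q a = i}"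
    using that no_loop[of a] arc_ends(2)[OF wf, of a] by (intro eq) auto
  show "d (head Q a) = d' (head Q a)" if "a \<in> {a \<in> arcs Q. tail Q a = i}"
    using that no_loop[of a] arc_ends(1)[OF wf, of a] by (intro eq) auto
qed

lemma neighbour_sum_upd [simp]: "neighbour_sum i (d(i := x)) = neighbour_sum i d"
  by (rule neighbour_sum_cong) simp

lemma reflect_involution [simp]: "reflect_dim Q i (reflect_dim Q i d) = d"
  by (simp add: reflect_dim_eq)

lemma reflect_supported: "supported Q d \<Longrightarrow> i \<in> verts Q \<Longrightarrow> supported Q (reflect_dim Q i d)"
  by (auto simp: supported_def reflect_dim_eq)

text \<open>As a polynomial in the coordinate at \<open>i\<close> the form is monic of degree two; the reflection at \<open>i\<close>
  exchanges the coordinates at which it takes equal values.\<close>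

lemma form_at:
  assumes i: "i \<in> verts Q"
  shows "quiver_form Q d = (d i)\<^sup>2 - d i * neighbour_sum i d + quiver_form Q (d(i := 0))"
proof -
  let ?e = "d(i := 0)"
  have v: "(\<Sum>v \<in> verts Q. (d v)\<^sup>2) = (d i)\<^sup>2 + (\<Sum>v \<in> verts Q. (?e v)\<^sup>2)"
    using fin_verts i by (simp add: sum.remove[of _ i] power2_eq_square)
  have "(\<Sum>a \<in> arcs Q. d (tail Q a) * d (head Q a)) = (\<Sum>a \<in> arcs Q. (if head Q a = i then d i * d (tail Q a) else 0)
      + (if tail Q a = i then d i * d (head Q a) else 0) + ?e (tail Q a) * ?e (head Q a))"
    by (rule sum.cong[OF refl]) (use no_loop in auto)
  also have "\<dots> = d i * neighbour_sum i d + (\<Sum>a \<in> arcs Q. ?e (tail Q a) * ?e (head Q a))"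
    unfolding neighbour_sum_alt sum_distrib_left sum.distrib[symmetric] by (rule sum.cong[OF refl]) (simp add: distrib_left)
  finally show ?thesis using v by (simp add: quiver_form_def)
qed

lemma form_reflect: "i \<in> verts Q \<Longrightarrow> quiver_form Q (reflect_dim Q i d) = quiver_form Q d"
  by (subst (1 2) form_at, assumption, assumption) (simp add: reflect_dim_eq power2_eq_square algebra_simps)

lemma form_euler: "2 * quiver_form Q d = (\<Sum>v \<in> verts Q. d v * (2 * d v - neighbour_sum v d))"
proof -
  have "(\<Sum>v \<in> verts Q. d v * neighbour_sum v d) = (\<Sum>v \<in> verts Q. \<Sum>a \<in> arcs Q.
      (if head Q a = v then d v * d (tail Q a) else 0) + (if tail Q a = v then d v * d (head Q a) else 0))"
    unfolding neighbour_sum_alt sum_distrib_left by (intro sum.cong refl) (simp add: distrib_left)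
  also have "\<dots> = (\<Sum>a \<in> arcs Q. \<Sum>v \<in> verts Q.
      (if head Q a = v then d v * d (tail Q a) else 0) + (if tail Q a = v then d v * d (head Q a) else 0))"
    by (rule sum.swap)
  also have "\<dots> = (\<Sum>a \<in> arcs Q. d (head Q a) * d (tail Q a) + d (tail Q a) * d (head Q a))"
    by (rule sum.cong[OF refl]) (simp add: sum.distrib fin_verts arc_ends[OF wf])
  finally have "(\<Sum>v \<in> verts Q. d v * neighbour_sum v d) = 2 * (\<Sum>a \<in> arcs Q. d (tail Q a) * d (head Q a))"
    by (simp add: mult.commute sum_distrib_left)
  then show ?thesis
    by (simp add: quiver_form_def right_diff_distrib sum_subtractf power2_eq_square mult.left_commute sum_distrib_left)
qed

definition reflects :: "'v list \<Rightarrow> ('v \<Rightarrow> int) \<Rightarrow> 'v \<Rightarrow> int" where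
  "reflects is = fold (reflect_dim Q) is"

lemma reflects_simps [simp]: "reflects [] d = d" "reflects (i # is) d = reflects is (reflect_dim Q i d)"
  "reflects (xs @ ys) d = reflects ys (reflects xs d)"
  by (simp_all add: reflects_def)

lemma reflects_outside: "v \<notin> set is \<Longrightarrow> reflects is d v = d v"
  by (induction "is" arbitrary: d) (auto simp: reflect_dim_eq)

lemma reflects_inj: "reflects is d = reflects is d' \<Longrightarrow> d = d'"
  by (induction "is" arbitrary: d d') (auto, metis reflect_involution)

lemma reflects_supported: "supported Q d \<Longrightarrow> set is \<subseteq> verts Q \<Longrightarrow> supported Q (reflects is d)"
  by (induction "is" arbitrary: d) (auto intro: reflect_supported)

lemma reflects_form: "set is \<subseteq> verts Q \<Longrightarrow> quiver_form Q (reflects is d) = quiver_form Q d"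
  by (induction "is" arbitrary: d) (auto simp: form_reflect)

lemma neighbour_sum_linear:
  "neighbour_sum i (\<lambda>v. x v + y v) = neighbour_sum i x + neighbour_sum i y"
  "neighbour_sum i (\<lambda>v. k * x v) = k * neighbour_sum i x"
  by (simp_all add: neighbour_sum_def sum.distrib sum_distrib_left distrib_left)

lemma reflects_linear:
  "reflects is (\<lambda>v. x v + y v) = (\<lambda>v. reflects is x v + reflects is y v)"
  "reflects is (\<lambda>v. k * x v) = (\<lambda>v. k * reflects is x v)"
proof -
  have 1: "reflect_dim Q i (\<lambda>v. x v + y v) = (\<lambda>v. reflect_dim Q i x v + reflect_dim Q i y v)" for i and x y :: "'v \<Rightarrow> int"
    by (auto simp: reflect_dim_eq neighbour_sum_linear)
  have 2: "reflect_dim Q i (\<lambda>v. k * x v) = (\<lambda>v. k * reflect_dim Q i x v)" for i and x :: "'v \<Rightarrow> int"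
    by (auto simp: reflect_dim_eq neighbour_sum_linear right_diff_distrib)
  show "reflects is (\<lambda>v. x v + y v) = (\<lambda>v. reflects is x v + reflects is y v)"
    by (induction "is" arbitrary: x y) (simp_all add: 1)
  show "reflects is (\<lambda>v. k * x v) = (\<lambda>v. k * reflects is x v)"
    by (induction "is" arbitrary: x) (simp_all add: 2)
qed

text \<open>Each reflection changes one coordinate, and the vertices are distinct, so no change can be
  undone by a later reflection.\<close>

lemma reflects_fixed:
  assumes "distinct is" "reflects is d = d" "i \<in> set is"
  shows "reflect_dim Q i d = d"
  using assms
proof (induction "is")
  case (Cons j "is")
  have "reflects is (reflect_dim Q j d) j = reflect_dim Q j d j" using Cons.prems by (intro reflects_outside) simp
  then have "reflect_dim Q j d j = d j" using Cons.prems by simp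
  then have j: "reflect_dim Q j d = d" by (auto simp: reflect_dim_eq fun_eq_iff)
  then have "reflects is d = d" using Cons.prems by simp
  then show ?case using Cons j by auto
qed simp

text \<open>A fixed vector is fixed by all simple reflections, that is, orthogonal to all unit vectors.  By
  \<open>form_euler\<close> its form vanishes.\<close>

lemma coxeter_no_fixed_vector:
  assumes "distinct is" "set is = verts Q" "reflects is d = d" "supported Q d"
  shows "d = (\<lambda>_. 0)"
proof (rule form_pos[OF assms(4)])
  have "2 * d v = neighbour_sum v d" if "v \<in> verts Q" for v
    using reflects_fixed[OF assms(1,3), of v] that assms(2) by (auto simp: reflect_dim_eq fun_eq_iff split: if_splits)
  then have "2 * quiver_form Q d = 0" unfolding form_euler by (intro sum.neutral) auto
  then show "quiver_form Q d \<le> 0" by simp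
qed

lemma reflects_power: "reflects (concat (replicate h is)) d = (reflects is ^^ h) d"
  by (induction h arbitrary: d) (simp_all add: funpow_swap1)

lemma finite_order_on_finite_set:
  assumes F: "finite F" and f: "\<And>x. x \<in> F \<Longrightarrow> f x \<in> F" and inj: "\<And>x y. f x = f y \<Longrightarrow> x = y"
  obtains h :: nat where "h > 0" "\<And>x. x \<in> F \<Longrightarrow> (f ^^ h) x = x"
proof -
  have mem: "(f ^^ n) x \<in> F" if "x \<in> F" for n x using that f by (induction n) auto
  have injn: "x = y" if "(f ^^ n) x = (f ^^ n) y" for n x y using that by (induction n) (auto dest: inj)
  have "range (\<lambda>n. restrict (f ^^ n) F) \<subseteq> F \<rightarrow>\<^sub>E F" using mem by auto
  then have "finite (range (\<lambda>n. restrict (f ^^ n) F))" using F by (meson finite_PiE finite_subset)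
  then have "\<not> inj (\<lambda>n. restrict (f ^^ n) F)" using finite_imageD infinite_UNIV_nat by blast
  then obtain m n where mn: "m < n" "restrict (f ^^ m) F = restrict (f ^^ n) F"
    by (metis (no_types, lifting) injI linorder_neqE_nat)
  have "(f ^^ (n - m)) x = x" if x: "x \<in> F" for x
  proof -
    have "(f ^^ m) ((f ^^ (n - m)) x) = (f ^^ n) x" using mn(1) by (metis comp_apply funpow_add le_add_diff_inverse less_imp_le)
    also have "\<dots> = (f ^^ m) x" using fun_cong[OF mn(2), of x] x by simp
    finally show ?thesis by (rule injn)
  qed
  then show ?thesis using that[of "n - m"] mn(1) by simp
qed

text \<open>The reflections permute the finitely many vectors of form at most one, which include the unit
  vectors; a power fixes these and, by linearity, everything.\<close>

lemma coxeter_finite_order: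
  assumes "is": "set is \<subseteq> verts Q"
  obtains h where "h > 0" "\<And>d. supported Q d \<Longrightarrow> (reflects is ^^ h) d = d"
proof -
  let ?F = "{d. supported Q d \<and> quiver_form Q d \<le> 1}"
  obtain h where h: "h > 0" "\<And>d. d \<in> ?F \<Longrightarrow> (reflects is ^^ h) d = d"
    by (rule finite_order_on_finite_set[OF form_finite, of "reflects is"])
      (use "is" reflects_supported reflects_form reflects_inj in auto)
  let ?T = "reflects (concat (replicate h is))"
  have T: "?T d = (reflects is ^^ h) d" for d by (rule reflects_power)
  let ?u = "\<lambda>w v. if v = w then 1 else 0 :: int"
  have unit: "?T (?u w) = ?u w" if w: "w \<in> verts Q" for w
  proof -
    have "supported Q (?u w)" using w by (auto simp: supported_def)
    moreover have "quiver_form Q (?u w) \<le> 1"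
    proof -
      have "(?u w)(w := 0) = (\<lambda>_. 0)" by auto
      then have "quiver_form Q (?u w) = 1 - neighbour_sum w (?u w) + quiver_form Q (\<lambda>_. 0)"
        using form_at[OF w, of "?u w"] by simp
      moreover have "neighbour_sum w (?u w) = neighbour_sum w (\<lambda>_. 0)" by (rule neighbour_sum_cong) simp
      ultimately show ?thesis by (simp add: neighbour_sum_def quiver_form_def)
    qed
    ultimately show ?thesis using h(2)[of "?u w"] T by simp
  qed
  have "?T (\<lambda>v. \<Sum>w \<in> S. d w * ?u w v) = (\<lambda>v. \<Sum>w \<in> S. d w * ?u w v)" if "finite S" "S \<subseteq> verts Q" for S d
    using that
  proof (induction S)
    case empty
    show ?case using reflects_linear(2)[of "concat (replicate h is)" 0 "\<lambda>_. 0"] by simp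
  next
    case (insert x S)
    have "?T (\<lambda>v. d x * ?u x v + (\<Sum>w \<in> S. d w * ?u w v)) = (\<lambda>v. ?T (\<lambda>v. d x * ?u x v) v + ?T (\<lambda>v. \<Sum>w \<in> S. d w * ?u w v) v)"
      by (rule reflects_linear(1))
    also have "?T (\<lambda>v. d x * ?u x v) = (\<lambda>v. d x * ?T (?u x) v)" by (rule reflects_linear(2))
    also have "?T (?u x) = ?u x" using insert.prems by (intro unit) simp
    also have "?T (\<lambda>v. \<Sum>w \<in> S. d w * ?u w v) = (\<lambda>v. \<Sum>w \<in> S. d w * ?u w v)" using insert by simp
    finally show ?case using insert.hyps by simp
  qed
  note all = this[OF fin_verts subset_refl]
  have "(reflects is ^^ h) d = d" if d: "supported Q d" for d
  proof -
    have "(\<lambda>v. \<Sum>w \<in> verts Q. d w * ?u w v) = d"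
    proof
      fix v
      have "(\<Sum>w \<in> verts Q. d w * ?u w v) = (\<Sum>w \<in> verts Q. if w = v then d w else 0)" by (rule sum.cong) auto
      then show "(\<Sum>w \<in> verts Q. d w * ?u w v) = d v" using fin_verts d by (simp add: supported_def)
    qed
    then show ?thesis using all[of d] T by simp
  qed
  then show ?thesis using that h(1) by blast
qed

text \<open>The sum of the orbit is a fixed vector, hence zero, and its summands are nonnegative.\<close>

lemma coxeter_orbit_negative:
  assumes "is": "distinct is" "set is = verts Q" and h: "h > 0" "(reflects is ^^ h) d = d"
    and d: "supported Q d" and nn: "\<And>j v. j < h \<Longrightarrow> v \<in> verts Q \<Longrightarrow> 0 \<le> (reflects is ^^ j) d v"
  shows "d = (\<lambda>_. 0)"
proof -
  let ?c = "reflects is"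
  have sup: "supported Q ((?c ^^ j) d)" for j using d "is" reflects_supported by (induction j) auto
  define s where "s v = (\<Sum>j<h. (?c ^^ j) d v)" for v
  have lin: "?c (\<lambda>v. \<Sum>j<k. (?c ^^ j) d v) = (\<lambda>v. \<Sum>j<k. (?c ^^ Suc j) d v)" for k
  proof (induction k)
    case 0
    show ?case using reflects_linear(2)[of "is" 0 "\<lambda>_. 0"] by simp
  next
    case (Suc k)
    then show ?case using reflects_linear(1)[of "is" "\<lambda>v. \<Sum>j<k. (?c ^^ j) d v" "(?c ^^ k) d"] by simp
  qed
  have "?c s = s"
  proof
    fix v
    have "?c s v = (\<Sum>j<h. (?c ^^ Suc j) d v)" using lin[of h] by (simp add: s_def[abs_def])
    also have "\<dots> = (\<Sum>j<h. (?c ^^ j) d v)"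
      using sum.lessThan_Suc_shift[of "\<lambda>j. (?c ^^ j) d v" h] sum.lessThan_Suc[of "\<lambda>j. (?c ^^ j) d v" h] h(2) by simp
    finally show "?c s v = s v" by (simp add: s_def)
  qed
  moreover have "supported Q s" using sup by (auto simp: supported_def s_def intro: sum.neutral)
  ultimately have "s = (\<lambda>_. 0)" by (intro coxeter_no_fixed_vector[OF "is"])
  then have "d v = 0" if v: "v \<in> verts Q" for v
  proof -
    have "(\<Sum>j<h. (?c ^^ j) d v) = 0" using \<open>s = (\<lambda>_. 0)\<close> by (simp add: s_def fun_eq_iff)
    then have "\<forall>j \<in> {..<h}. (?c ^^ j) d v = 0" using nn[OF _ v] by (subst (asm) sum_nonneg_eq_0_iff) auto
    from bspec[OF this, of 0] show ?thesis using h(1) by simp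
  qed
  then show ?thesis using d by (auto simp: supported_def fun_eq_iff)
qed

text \<open>After reflecting at a set \<open>P\<close> of vertices that is closed under successors, exactly the arrows
  that enter \<open>P\<close> are reversed.\<close>

definition reversed_into :: "'v set \<Rightarrow> ('v, 'e) pre_digraph \<Rightarrow> bool" where
  "reversed_into P Q' \<longleftrightarrow> verts Q' = verts Q \<and> arcs Q' = arcs Q \<and> (\<forall>a \<in> arcs Q.
     if head Q a \<in> P \<and> tail Q a \<notin> P then tail Q' a = head Q a \<and> head Q' a = tail Q a
     else tail Q' a = tail Q a \<and> head Q' a = head Q a)"

lemma reversed_into_step:
  assumes R: "reversed_into P Q'" and P: "i \<notin> P" "\<And>a. a \<in> arcs Q \<Longrightarrow> tail Q a \<in> P \<Longrightarrow> head Q a \<in> P"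
    and i: "\<And>a. a \<in> arcs Q \<Longrightarrow> tail Q a = i \<Longrightarrow> head Q a \<in> P"
  shows "\<forall>a \<in> arcs Q'. tail Q' a \<noteq> i" "reversed_into (insert i P) (reflect Q' i)"
proof -
  show "\<forall>a \<in> arcs Q'. tail Q' a \<noteq> i"
    using R P i unfolding reversed_into_def by metis
  show "reversed_into (insert i P) (reflect Q' i)"
    unfolding reversed_into_def
  proof (intro conjI ballI)
    fix a assume a: "a \<in> arcs Q"
    have "if head Q a \<in> P \<and> tail Q a \<notin> P then tail Q' a = head Q a \<and> head Q' a = tail Q a
       else tail Q' a = tail Q a \<and> head Q' a = head Q a" using R a by (simp add: reversed_into_def)
    then show "if head Q a \<in> insert i P \<and> tail Q a \<notin> insert i P
          then tail (reflect Q' i) a = head Q a \<and> head (reflect Q' i) a = tail Q a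
          else tail (reflect Q' i) a = tail Q a \<and> head (reflect Q' i) a = head Q a"
      using P(1) P(2)[OF a] i[OF a] no_loop[OF a] by (auto split: if_splits)
  qed (use R in \<open>auto simp: reversed_into_def\<close>)
qed

text \<open>A list that enumerates vertices such that each becomes a sink once its predecessors in the list, and
  the vertices in \<open>P\<close>, have been reflected.\<close>

fun sink_order :: "'v set \<Rightarrow> 'v list \<Rightarrow> bool" where
  "sink_order P [] \<longleftrightarrow> True"
| "sink_order P (i # is) \<longleftrightarrow> i \<in> verts Q \<and> i \<notin> P \<and> (\<forall>a \<in> arcs Q. tail Q a = i \<longrightarrow> head Q a \<in> P) \<and> sink_order (insert i P) is"

lemma sink_order_admissible:
  assumes "sink_order P is" "\<And>a. a \<in> arcs Q \<Longrightarrow> tail Q a \<in> P \<Longrightarrow> head Q a \<in> P" "reversed_into P Q'"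
    and "\<And>Q''. reversed_into (P \<union> set is) Q'' \<Longrightarrow> admissible Q'' js"
  shows "admissible Q' (is @ js)"
  using assms
proof (induction "is" arbitrary: P Q')
  case Nil
  then show ?case by simp
next
  case (Cons i "is")
  have i: "i \<in> verts Q" "i \<notin> P" "\<And>a. a \<in> arcs Q \<Longrightarrow> tail Q a = i \<Longrightarrow> head Q a \<in> P" "sink_order (insert i P) is"
    using Cons.prems(1) by auto
  have st: "\<forall>a \<in> arcs Q'. tail Q' a \<noteq> i" "reversed_into (insert i P) (reflect Q' i)"
    by (rule reversed_into_step[of P], fact Cons.prems(3), fact i(2), fact Cons.prems(2), fact i(3))+
  have "admissible (reflect Q' i) (is @ js)"
  proof (rule Cons.IH[OF i(4) _ st(2)])
    show "head Q a \<in> insert i P" if "a \<in> arcs Q" "tail Q a \<in> insert i P" for a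
      using that Cons.prems(2) i(3) by auto
    show "admissible Q'' js" if "reversed_into (insert i P \<union> set is) Q''" for Q''
    proof -
      have "insert i P \<union> set is = P \<union> set (i # is)" by auto
      from that[unfolded this] show ?thesis by (rule Cons.prems(4))
    qed
  qed
  then show ?case using st(1) i(1) Cons.prems(3) by (simp add: reversed_into_def)
qed

lemma sink_order_exists:
  assumes "P \<subseteq> verts Q" "\<And>a. a \<in> arcs Q \<Longrightarrow> tail Q a \<in> P \<Longrightarrow> head Q a \<in> P"
  shows "\<exists>is. sink_order P is \<and> P \<union> set is = verts Q \<and> distinct is \<and> set is \<inter> P = {}"
  using assms
proof (induction "card (verts Q - P)" arbitrary: P)
  case 0
  then have "verts Q - P = {}" using fin_verts by simp
  then show ?case using 0 by (intro exI[of _ "[]"]) auto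
next
  case (Suc n)
  have fin: "finite (verts Q - P)" using fin_verts by simp
  have ne: "verts Q - P \<noteq> {}"
    using Suc.hyps(2) by (metis card.empty nat.distinct(1))
  obtain i where i: "i \<in> verts Q - P" "\<And>v. v \<in> verts Q - P \<Longrightarrow> ht v \<le> ht i"
  proof -
    have "Max (ht ` (verts Q - P)) \<in> ht ` (verts Q - P)" using fin ne by (intro Max_in) auto
    then obtain i where "i \<in> verts Q - P" "ht i = Max (ht ` (verts Q - P))" by auto
    then show ?thesis using that fin by (metis Max_ge finite_imageI imageI)
  qed
  have out: "head Q a \<in> P" if a: "a \<in> arcs Q" "tail Q a = i" for a
  proof (rule ccontr)
    assume "head Q a \<notin> P"
    then have "ht (head Q a) \<le> ht i" using i(2) arc_ends(1)[OF wf a(1)] by simp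
    then show False using ht[OF a(1)] a(2) by simp
  qed
  have card: "card (verts Q - insert i P) = n"
  proof -
    have "verts Q - insert i P = (verts Q - P) - {i}" by auto
    then show ?thesis using Suc.hyps(2) i(1) fin by simp
  qed
  have "\<exists>is. sink_order (insert i P) is \<and> insert i P \<union> set is = verts Q \<and> distinct is \<and> set is \<inter> insert i P = {}"
    by (rule Suc.hyps(1)) (use card Suc.prems i out in auto)
  then obtain "is" where "is": "sink_order (insert i P) is" "insert i P \<union> set is = verts Q" "distinct is" "set is \<inter> insert i P = {}"
    by blast
  then show ?case using i out by (intro exI[of _ "i # is"]) auto
qed

text \<open>Vertices in the order of decreasing height can be reflected one after the other.  Afterwards every
  arrow has been turned around twice, so the process can be repeated.\<close>

lemma coxeter_sequence:
  obtains "is" where "distinct is" "set is = verts Q" "\<And>h. admissible Q (concat (replicate h is))"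
proof -
  obtain "is" where "is": "sink_order {} is" "set is = verts Q" "distinct is"
    using sink_order_exists[of "{}"] by auto
  have "admissible Q' (concat (replicate h is))" if "reversed_into {} Q'" for h Q'
    using that
  proof (induction h arbitrary: Q')
    case (Suc h)
    have "admissible Q' (is @ concat (replicate h is))"
    proof (rule sink_order_admissible[OF "is"(1) _ Suc.prems])
      fix Q'' assume "reversed_into ({} \<union> set is) Q''"
      then have "reversed_into {} Q''" using arc_ends[OF wf] by (simp add: reversed_into_def "is"(2))
      then show "admissible Q'' (concat (replicate h is))" by (rule Suc.IH)
    qed simp
    then show ?case by simp
  qed simp
  moreover have "reversed_into {} Q" by (simp add: reversed_into_def)
  ultimately show ?thesis using that "is" by blast
qed

definition same_graph :: "('v, 'e) pre_digraph \<Rightarrow> bool" where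
  "same_graph Q' \<longleftrightarrow> verts Q' = verts Q \<and> arcs Q' = arcs Q \<and> (\<forall>a \<in> arcs Q.
     (tail Q' a = tail Q a \<and> head Q' a = head Q a) \<or> (tail Q' a = head Q a \<and> head Q' a = tail Q a))"

lemma same_graph_reflect: "same_graph Q' \<Longrightarrow> same_graph (reflect Q' i)"
  unfolding same_graph_def by auto

lemma same_graph_reflect_dim: "same_graph Q' \<Longrightarrow> reflect_dim Q' i d = reflect_dim Q i d"
proof -
  assume g: "same_graph Q'"
  have "(\<Sum>a | a \<in> arcs Q' \<and> head Q' a = i. d (tail Q' a)) + (\<Sum>a | a \<in> arcs Q' \<and> tail Q' a = i. d (head Q' a))
      = (\<Sum>a \<in> arcs Q. (if head Q' a = i then d (tail Q' a) else 0) + (if tail Q' a = i then d (head Q' a) else 0))"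
    using g fin_arcs by (simp only: same_graph_def sum.inter_filter sum.distrib)
  also have "\<dots> = neighbour_sum i d"
    unfolding neighbour_sum_alt
  proof (rule sum.cong[OF refl])
    fix a assume "a \<in> arcs Q"
    then have "(tail Q' a = tail Q a \<and> head Q' a = head Q a) \<or> (tail Q' a = head Q a \<and> head Q' a = tail Q a)"
      using g by (simp add: same_graph_def)
    then show "(if head Q' a = i then d (tail Q' a) else 0) + (if tail Q' a = i then d (head Q' a) else 0)
        = (if head Q a = i then d (tail Q a) else 0) + (if tail Q a = i then d (head Q a) else 0)"
      by (elim disjE conjE) (simp_all only: add.commute)
  qed
  finally show ?thesis by (simp add: reflect_dim_eq) (simp add: reflect_dim_def)
qed

text \<open>Dimension vectors are reflected alike over all orientations of the graph.\<close>

lemma survives_prefix: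
  assumes "same_graph Q'" "survives Q' (xs @ ys) d" "v \<in> verts Q"
  shows "0 \<le> reflects xs d v"
  using assms
proof (induction xs arbitrary: Q' d)
  case Nil
  then show ?case by (cases ys) (auto simp: same_graph_def)
next
  case (Cons x xs)
  then have "survives (reflect Q' x) (xs @ ys) (reflect_dim Q x d)" by (simp add: same_graph_reflect_dim)
  from Cons.IH[OF same_graph_reflect[OF Cons.prems(1)] this Cons.prems(3)] show ?case by simp
qed

lemma reflects_cong: "(\<And>v. v \<in> verts Q \<Longrightarrow> x v = y v) \<Longrightarrow> v \<in> verts Q \<Longrightarrow> reflects is x v = reflects is y v"
proof (induction "is" arbitrary: x y)
  case (Cons i "is")
  have "reflect_dim Q i x v = reflect_dim Q i y v" if "v \<in> verts Q" for v
  proof -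
    have "neighbour_sum i x = neighbour_sum i y" using Cons.prems(1) by (rule neighbour_sum_cong)
    then show ?thesis using Cons.prems(1)[OF that] by (cases "v = i") (simp_all add: reflect_dim_eq)
  qed
  from Cons.IH[OF this Cons.prems(2)] show ?case by simp
qed simp

text \<open>Choose \<open>h\<close> such that the \<open>h\<close>-th power of the Coxeter transformation is the identity, and reflect \<open>h\<close>
  times at all vertices.  The dimension vector of a survivor vanishes by
  \<open>coxeter_orbit_negative\<close>, so the identity of \<open>M\<close> is a sum of maps through \<open>L\<close>.\<close>

theorem finite_type:
  "\<exists>L :: ('k :: field, 'v, 'e) representation set. finite L \<and> L \<subseteq> Ob (Rep Q) \<and>
     (\<forall>M \<in> Ob (Rep Q). through (Rep Q) L M M (Ident (Rep Q) M))"
proof -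
  obtain "is" where "is": "distinct is" "set is = verts Q" "\<And>h. admissible Q (concat (replicate h is))"
    by (rule coxeter_sequence) blast
  obtain h where h: "h > 0" "\<And>d. supported Q d \<Longrightarrow> (reflects is ^^ h) d = d"
    by (rule coxeter_finite_order[of "is"]) (use "is" in auto)
  let ?js = "concat (replicate h is)"
  obtain L :: "('k, 'v, 'e) representation set" where L: "finite L" "L \<subseteq> Ob (Rep Q)" "generates_up_to_survivors Q ?js L"
    using reflections_generate[OF wf fin_arcs "is"(3)] by blast
  interpret C: lincat "Rep Q :: ('k, ('k, 'v, 'e) representation, 'v \<Rightarrow> 'k mat) linear_category" by (rule lincat_rep_category[OF wf])
  have "through (Rep Q) L M M (Ident (Rep Q) M)" if M: "M \<in> Ob (Rep Q)" for M
  proof -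
    obtain B u v z where B: "B \<in> Ob (Rep Q)" "u \<in> rep_homs Q B M" "v \<in> rep_homs Q M B"
      "through (Rep Q) L M M z" "Ident (Rep Q) M = Add (Rep Q) (rep_comp Q u v) z"
      "survives Q ?js (\<lambda>v. int (rdim B v))"
      using L(3) M unfolding generates_up_to_survivors_def by blast
    define d where "d v = (if v \<in> verts Q then int (rdim B v) else 0)" for v
    have sup: "supported Q d" by (simp add: supported_def d_def)
    have "0 \<le> (reflects is ^^ j) d w" if j: "j < h" and w: "w \<in> verts Q" for j w
    proof -
      have "?js = concat (replicate j is) @ concat (replicate (h - j) is)"
        using j by (metis concat_append le_add_diff_inverse less_imp_le replicate_add)
      then have "0 \<le> reflects (concat (replicate j is)) (\<lambda>v. int (rdim B v)) w"
        using survives_prefix[of Q _ _ "\<lambda>v. int (rdim B v)" w] B(6) w by (simp add: same_graph_def)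
      also have "\<dots> = reflects (concat (replicate j is)) d w" by (rule reflects_cong[OF _ w]) (simp add: d_def)
      finally show ?thesis by (simp add: reflects_power)
    qed
    from coxeter_orbit_negative[OF "is"(1,2) h(1) h(2)[OF sup] sup this] have d0: "d = (\<lambda>_. 0)" by blast
    have B0: "rdim B w = 0" if "w \<in> verts Q" for w
      using fun_cong[OF d0, of w] that by (simp add: d_def)
    note uv = rep_comp_in[OF wf M B(1) M B(3,2)]
    have "rep_comp Q u v = Zero (Rep Q) M M"
    proof (rule rep_hom_eqI[OF uv rep_Zero_in[OF wf M M]])
      fix w assume w: "w \<in> verts Q"
      have "of_mat (u w) = 0" using rep_hom_fcar[OF B(2) w] B0[OF w] by simp
      then show "of_mat (rep_comp Q u v w) = of_mat (Zero (Rep Q) M M w)"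
        using w by (simp add: rep_comp_dims[OF B(2,3) w])
    qed
    then have "Ident (Rep Q) M = z"
      using B(5) C.add_left_zero[OF M M C.through_in[OF B(4) M M L(2)]] by simp
    then show ?thesis using B(4) by simp
  qed
  then show ?thesis using L(1,2) by blast
qed

end

section \<open>Dynkin quivers are definite\<close>

text \<open>An arbitrary orientation of a tree, given by the sign \<open>s j\<close> of the edge between \<open>j\<close> and its parent,
  has a height function.\<close>

lemma tree_potential:
  fixes s :: "nat \<Rightarrow> int"
  assumes "\<And>j. j \<in> {1..<n} \<Longrightarrow> p j < j"
  shows "\<exists>g. \<forall>j \<in> {1..<n}. g j = g (p j) + s j"
  using assms
proof (induction n)
  case (Suc n)
  then obtain g where g: "\<forall>j \<in> {1..<n}. g j = g (p j) + s j" by auto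
  have "(g(n := g (p n) + s n)) j = (g(n := g (p n) + s n)) (p j) + s j" if "j \<in> {1..<Suc n}" for j
    using g that Suc.prems[OF that] by (cases "j = n") auto
  then show ?case by blast
qed simp

text \<open>Transport everything to \<open>{..<n}\<close>: an arrow corresponds to the endpoint of its edge that is further
  away from the root.\<close>

theorem dynkin_definite:
  assumes D: "dynkin_quiver Q"
  obtains ht where "definite_quiver Q ht"
proof -
  define e where "e \<phi> a = {\<phi> (tail Q a), \<phi> (head Q a)}" for \<phi> :: "'a \<Rightarrow> nat" and a
  from D obtain n E \<phi> where wf: "wf_digraph Q" and dd: "dynkin_diagram n E"
    and \<phi>: "bij_betw \<phi> (verts Q) {..<n}" and ab: "bij_betw (e \<phi>) (arcs Q) E"
    unfolding dynkin_quiver_def e_def[abs_def] by blast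
  have n: "n \<ge> 1" using dd by cases auto
  obtain p \<alpha> where t: "weighted_tree n p \<alpha>" and E: "E = (\<lambda>j. {j, p j}) ` {1..<n}"
    using dynkin_weighted_tree[OF dd] by blast
  have p: "p j < j" if "j \<in> {1..<n}" for j using t that by (simp add: weighted_tree_def)
  have inj: "inj_on (\<lambda>j. {j, p j}) {1..<n}"
  proof (rule inj_onI)
    fix i j assume "i \<in> {1..<n}" "j \<in> {1..<n}" and eq: "{i, p i} = {j, p j}"
    then show "i = j" using p[of i] p[of j] by (auto simp: doubleton_eq_iff)
  qed
  define c where "c a = inv_into {1..<n} (\<lambda>j. {j, p j}) (e \<phi> a)" for a
  have c: "bij_betw c (arcs Q) {1..<n}"
    using bij_betw_trans[OF ab[unfolded E] bij_betw_inv_into[OF inj_on_imp_bij_betw[OF inj]]]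
    by (simp add: c_def[abs_def] comp_def)
  have fin_arcs: "finite (arcs Q)" using bij_betw_finite[OF c] by simp
  have fin_verts: "finite (verts Q)" using bij_betw_finite[OF \<phi>] by simp
  have ca: "c a \<in> {1..<n}" if "a \<in> arcs Q" for a using c that by (auto simp: bij_betw_def)
  have ce: "{c a, p (c a)} = {\<phi> (tail Q a), \<phi> (head Q a)}" if a: "a \<in> arcs Q" for a
  proof -
    have "e \<phi> a \<in> (\<lambda>j. {j, p j}) ` {1..<n}" using ab a E by (auto simp: bij_betw_def)
    from f_inv_into_f[OF this] show ?thesis by (simp add: c_def e_def)
  qed
  have co: "(c a = \<phi> (head Q a) \<and> p (c a) = \<phi> (tail Q a)) \<or> (c a = \<phi> (tail Q a) \<and> p (c a) = \<phi> (head Q a))"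
    if "a \<in> arcs Q" for a
    using ce[OF that] by (auto simp: doubleton_eq_iff)
  \<comment> \<open>Positive iff the arrow points away from the root.\<close>
  define s where "s j = (if \<phi> (head Q (inv_into (arcs Q) c j)) = j then 1 else - 1 :: int)" for j
  have sc: "s (c a) = (if \<phi> (head Q a) = c a then 1 else - 1)" if "a \<in> arcs Q" for a
    using that c by (simp add: s_def bij_betw_def inv_into_f_f)
  obtain g where g: "\<forall>j \<in> {1..<n}. g j = g (p j) + s j"
    using tree_potential[of n p s] p by blast
  have ht: "g (\<phi> (head Q a)) = g (\<phi> (tail Q a)) + 1" if a: "a \<in> arcs Q" for a
    using bspec[OF g ca[OF a]] sc[OF a] co[OF a] p[OF ca[OF a]] by (auto split: if_splits)
  define y where "y d j = real_of_int (d (inv_into (verts Q) \<phi> j))" for d j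
  have y\<phi>: "y d (\<phi> v) = real_of_int (d v)" if "v \<in> verts Q" for d v
    using that \<phi> by (simp add: y_def bij_betw_def inv_into_f_f)
  have ends: "head Q a \<in> verts Q" "tail Q a \<in> verts Q" if "a \<in> arcs Q" for a
    using wf that by (auto simp: wf_digraph_def)
  have form: "tree_form n p (y d) = real_of_int (quiver_form Q d)" for d
  proof -
    have "(\<Sum>j<n. (y d j)\<^sup>2) = (\<Sum>v \<in> verts Q. (y d (\<phi> v))\<^sup>2)"
      by (rule sum.reindex_bij_betw[OF \<phi>, symmetric])
    also have "\<dots> = real_of_int (\<Sum>v \<in> verts Q. (d v)\<^sup>2)" by (simp add: y\<phi>)
    finally have 1: "(\<Sum>j<n. (y d j)\<^sup>2) = real_of_int (\<Sum>v \<in> verts Q. (d v)\<^sup>2)" .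
    have "(\<Sum>j\<in>{1..<n}. y d j * y d (p j)) = (\<Sum>a \<in> arcs Q. y d (c a) * y d (p (c a)))"
      by (rule sum.reindex_bij_betw[OF c, symmetric])
    also have "\<dots> = (\<Sum>a \<in> arcs Q. real_of_int (d (tail Q a) * d (head Q a)))"
    proof (rule sum.cong[OF refl])
      fix a assume a: "a \<in> arcs Q"
      show "y d (c a) * y d (p (c a)) = real_of_int (d (tail Q a) * d (head Q a))"
        using co[OF a] by (elim disjE conjE) (simp_all add: y\<phi> ends[OF a])
    qed
    finally show ?thesis using 1 by (simp add: tree_form_def quiver_form_def)
  qed
  have \<phi>n: "\<phi> v < n" if "v \<in> verts Q" for v using \<phi> that by (auto simp: bij_betw_def)
  have bounded: "\<exists>m :: int. \<forall>d. quiver_form Q d \<le> 1 \<longrightarrow> \<bar>d v\<bar> \<le> m" if v: "v \<in> verts Q" for v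
  proof -
    obtain B where B: "\<And>x. tree_form n p x \<le> 1 \<Longrightarrow> \<bar>x (\<phi> v)\<bar> \<le> B"
      using tree_form_bound[OF t n \<phi>n[OF v]] by blast
    have "\<bar>d v\<bar> \<le> \<lceil>B\<rceil>" if "quiver_form Q d \<le> 1" for d
    proof -
      have "\<bar>y d (\<phi> v)\<bar> \<le> B" by (rule B) (use that form in simp)
      then have "real_of_int \<bar>d v\<bar> \<le> B" by (simp add: y\<phi>[OF v])
      then show ?thesis using le_of_int_ceiling[of B] by linarith
    qed
    then show ?thesis by blast
  qed
  then obtain m :: "'a \<Rightarrow> int" where m: "\<And>v d. v \<in> verts Q \<Longrightarrow> quiver_form Q d \<le> 1 \<Longrightarrow> \<bar>d v\<bar> \<le> m v"
    by metis
  have "finite {d. supported Q d \<and> quiver_form Q d \<le> 1}"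
  proof (rule finite_subset)
    let ?B = "\<Union>v \<in> verts Q. {- m v .. m v}"
    show "finite {d. \<forall>v. (v \<in> verts Q \<longrightarrow> d v \<in> ?B) \<and> (v \<notin> verts Q \<longrightarrow> d v = 0)}"
      using fin_verts by (intro finite_set_of_finite_funs) auto
    show "{d. supported Q d \<and> quiver_form Q d \<le> 1} \<subseteq> {d. \<forall>v. (v \<in> verts Q \<longrightarrow> d v \<in> ?B) \<and> (v \<notin> verts Q \<longrightarrow> d v = 0)}"
    proof (intro subsetI CollectI allI conjI impI)
      fix d v assume d: "d \<in> {d. supported Q d \<and> quiver_form Q d \<le> 1}"
      show "d v \<in> ?B" if v: "v \<in> verts Q"
      proof -
        have "\<bar>d v\<bar> \<le> m v" using m[OF v] d by blast
        then show ?thesis using v by (intro UN_I[of v]) auto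
      qed
      show "d v = 0" if "v \<notin> verts Q" using d that by (simp add: supported_def)
    qed
  qed
  moreover have "d = (\<lambda>_. 0)" if d: "supported Q d" "quiver_form Q d \<le> 0" for d
  proof
    fix v
    show "d v = 0"
    proof (cases "v \<in> verts Q")
      case True
      have "tree_form n p (y d) \<le> 0" using d(2) by (simp add: form)
      from tree_form_pos[OF t n this \<phi>n[OF True]] show ?thesis by (simp add: y\<phi>[OF True])
    next
      case False
      then show ?thesis using d(1) by (simp add: supported_def)
    qed
  qed
  ultimately have "definite_quiver Q (\<lambda>v. g (\<phi> v))"
    using wf fin_verts fin_arcs ht ends by unfold_locales
  then show ?thesis by (rule that)
qed

section \<open>The category of monomorphisms between projectives\<close>

declare rep_category_simps(1) [simp del]

lemma projective_Ob [dest]: "projective_object C P \<Longrightarrow> P \<in> Ob C"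
  by (simp add: projective_object_def)

text \<open>The objects are the injective maps between projectives, before removing the summands \<open>0 \<rightarrow> P\<close>.\<close>

abbreviation MonoP where "MonoP \<equiv> mono_proj_category"

lemma mono_Ob_iff:
  "A \<in> Ob (MonoP Q) \<longleftrightarrow> projective_object (Rep Q) (asrc A) \<and> projective_object (Rep Q) (atgt A) \<and>
     amap A \<in> rep_homs Q (asrc A) (atgt A) \<and> pointwise_injective Q (asrc A) (atgt A) (amap A)"
  by (auto simp: mono_proj_category_def Let_def injective_rep_hom_iff)

lemma mono_ObD:
  assumes "A \<in> Ob (MonoP Q)"
  shows "projective_object (Rep Q) (asrc A)" "projective_object (Rep Q) (atgt A)"
    "asrc A \<in> Ob (Rep Q)" "atgt A \<in> Ob (Rep Q)"
    "amap A \<in> rep_homs Q (asrc A) (atgt A)" "pointwise_injective Q (asrc A) (atgt A) (amap A)"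
  using assms by (auto simp: mono_Ob_iff)

lemma mono_Hom_iff:
  "f \<in> Hom (MonoP Q) A B \<longleftrightarrow> fst f \<in> rep_homs Q (asrc A) (asrc B) \<and> snd f \<in> rep_homs Q (atgt A) (atgt B) \<and>
     rep_comp Q (snd f) (amap A) = rep_comp Q (amap B) (fst f)"
  by (auto simp: mono_proj_category_def Let_def)

lemma mono_HomD:
  assumes "f \<in> Hom (MonoP Q) A B"
  shows "fst f \<in> rep_homs Q (asrc A) (asrc B)" "snd f \<in> rep_homs Q (atgt A) (atgt B)"
    "rep_comp Q (snd f) (amap A) = rep_comp Q (amap B) (fst f)"
  using assms by (auto simp: mono_Hom_iff)

lemma mono_simps [simp]:
  "Comp (MonoP Q) g f = (rep_comp Q (fst g) (fst f), rep_comp Q (snd g) (snd f))"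
  "Ident (MonoP Q) A = (Ident (Rep Q) (asrc A), Ident (Rep Q) (atgt A))"
  "Zero (MonoP Q) A B = (Zero (Rep Q) (asrc A) (asrc B), Zero (Rep Q) (atgt A) (atgt B))"
  "Add (MonoP Q) f g = (Add (Rep Q) (fst f) (fst g), Add (Rep Q) (snd f) (snd g))"
  "Smult (MonoP Q) c f = (Smult (Rep Q) c (fst f), Smult (Rep Q) c (snd f))"
  by (simp_all add: mono_proj_category_def Let_def)

lemma lincat_mono_proj_category:
  assumes wf: "wf_digraph Q"
  shows "lincat (MonoP Q)"
proof -
  interpret R: lincat "Rep Q" by (rule lincat_rep_category[OF wf])
  note laws = R.comp_in R.ident_in R.zero_in R.add_in R.smult_in R.comp_assoc R.ident_left R.ident_right
    R.add_assoc R.add_commute R.add_zero R.add_neg R.comp_add_right R.comp_add_left R.smult_left R.smult_right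
    R.smult_add R.smult_zero R.comp_zero_left R.comp_zero_right
  note laws' = laws[unfolded rep_category_simps(2,3)]
  note O = mono_ObD(3-5)
  show ?thesis
  proof
    let ?C = "MonoP Q"
    fix W X Y Z :: "('k :: field, 'a, 'b) rep_arrow" and f g h :: "('a \<Rightarrow> 'k mat) \<times> ('a \<Rightarrow> 'k mat)" and c :: 'k
    note Hd = mono_HomD
    { assume a: "X \<in> Ob ?C" "Y \<in> Ob ?C"
      note x = O[OF a(1)] O[OF a(2)]
      show "Zero ?C X Y \<in> Hom ?C X Y"
        using x by (simp add: mono_Hom_iff laws'(3) laws'(19)[of "asrc X" "atgt X" "atgt Y"] laws'(20)[of "asrc X" "asrc Y" "atgt Y"])
      show "Smult ?C c (Zero ?C X Y) = Zero ?C X Y"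
        using x by (simp add: laws'(18))
      assume f: "f \<in> Hom ?C X Y"
      note x = O[OF a(1)] O[OF a(2)] Hd[OF f]
      show "Smult ?C c f \<in> Hom ?C X Y"
        using x by (simp add: mono_Hom_iff laws'(5) laws'(15)[of "asrc X" "atgt X" "atgt Y"] laws'(16)[of "asrc X" "asrc Y" "atgt Y"])
      show "Comp ?C (Ident ?C Y) f = f" using x by (simp add: laws'(7)[of "asrc X" "asrc Y"] laws'(7)[of "atgt X" "atgt Y"])
      show "Comp ?C f (Ident ?C X) = f" using x by (simp add: laws'(8)[of "asrc X" "asrc Y"] laws'(8)[of "atgt X" "atgt Y"])
      show "Add ?C f (Zero ?C X Y) = f" using x by (simp add: laws'(11)[of "asrc X" "asrc Y"] laws'(11)[of "atgt X" "atgt Y"])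
      show "Add ?C f (Smult ?C (- 1) f) = Zero ?C X Y" using x by (simp add: laws'(12)[of "asrc X" "asrc Y"] laws'(12)[of "atgt X" "atgt Y"])
      assume g: "g \<in> Hom ?C X Y"
      note x = x Hd[OF g]
      show "Add ?C f g \<in> Hom ?C X Y"
        using x by (simp add: mono_Hom_iff laws'(4) laws'(13)[of "asrc X" "asrc Y" "atgt Y"] laws'(14)[of "asrc X" "atgt X" "atgt Y"])
      show "Add ?C f g = Add ?C g f" using x by (simp add: laws'(10)[of "asrc X" "asrc Y"] laws'(10)[of "atgt X" "atgt Y"])
      show "Smult ?C c (Add ?C f g) = Add ?C (Smult ?C c f) (Smult ?C c g)"
        using x by (simp add: laws'(17)[of "asrc X" "asrc Y"] laws'(17)[of "atgt X" "atgt Y"])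
      assume h: "h \<in> Hom ?C X Y"
      note x = x Hd[OF h]
      show "Add ?C (Add ?C f g) h = Add ?C f (Add ?C g h)"
        using x by (simp add: laws'(9)[of "asrc X" "asrc Y"] laws'(9)[of "atgt X" "atgt Y"])
    }
    { assume a: "X \<in> Ob ?C" "Y \<in> Ob ?C" "Z \<in> Ob ?C" and f: "f \<in> Hom ?C X Y"
      note x = O[OF a(1)] O[OF a(2)] O[OF a(3)]
      show "Comp ?C (Zero ?C Y Z) f = Zero ?C X Z"
        using x Hd[OF f] by (simp add: laws'(19)[of "asrc X" "asrc Y" "asrc Z"] laws'(19)[of "atgt X" "atgt Y" "atgt Z"])
      assume g: "g \<in> Hom ?C Y Z"
      note x = x Hd[OF f] Hd[OF g]
      have "rep_comp Q (rep_comp Q (snd g) (snd f)) (amap X) = rep_comp Q (snd g) (rep_comp Q (snd f) (amap X))"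
        by (rule laws'(6)[of "asrc X" "atgt X" "atgt Y" "atgt Z"]) (fact x)+
      also have "\<dots> = rep_comp Q (snd g) (rep_comp Q (amap Y) (fst f))" by (simp only: Hd[OF f])
      also have "\<dots> = rep_comp Q (rep_comp Q (snd g) (amap Y)) (fst f)"
        by (rule laws'(6)[of "asrc X" "asrc Y" "atgt Y" "atgt Z", symmetric]) (fact x)+
      also have "\<dots> = rep_comp Q (amap Z) (rep_comp Q (fst g) (fst f))"
        using x by (simp add: laws'(6)[of "asrc X" "asrc Y" "asrc Z" "atgt Z"])
      finally show "Comp ?C g f \<in> Hom ?C X Z"
        using x by (simp add: mono_Hom_iff laws'(1)[of "asrc X" "asrc Y" "asrc Z"] laws'(1)[of "atgt X" "atgt Y" "atgt Z"])
      show "Comp ?C (Smult ?C c g) f = Smult ?C c (Comp ?C g f)"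
        using x by (simp add: laws'(15)[of "asrc X" "asrc Y" "asrc Z"] laws'(15)[of "atgt X" "atgt Y" "atgt Z"])
      show "Comp ?C g (Smult ?C c f) = Smult ?C c (Comp ?C g f)"
        using x by (simp add: laws'(16)[of "asrc X" "asrc Y" "asrc Z"] laws'(16)[of "atgt X" "atgt Y" "atgt Z"])
      assume h: "h \<in> Hom ?C Y Z"
      show "Comp ?C (Add ?C g h) f = Add ?C (Comp ?C g f) (Comp ?C h f)"
        using x Hd[OF h] by (simp add: laws'(14)[of "asrc X" "asrc Y" "asrc Z"] laws'(14)[of "atgt X" "atgt Y" "atgt Z"])
    }
    { assume a: "X \<in> Ob ?C" "Y \<in> Ob ?C" "Z \<in> Ob ?C" and f: "f \<in> Hom ?C Y Z"
      then show "Comp ?C f (Zero ?C X Y) = Zero ?C X Z"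
        using O[OF a(1)] O[OF a(2)] O[OF a(3)] Hd[OF f]
        by (simp add: laws'(20)[of "asrc X" "asrc Y" "asrc Z"] laws'(20)[of "atgt X" "atgt Y" "atgt Z"])
    }
    { assume a: "X \<in> Ob ?C" "Y \<in> Ob ?C" "Z \<in> Ob ?C" and f: "f \<in> Hom ?C X Y" "g \<in> Hom ?C X Y" "h \<in> Hom ?C Y Z"
      then show "Comp ?C h (Add ?C f g) = Add ?C (Comp ?C h f) (Comp ?C h g)"
        using O[OF a(1)] O[OF a(2)] O[OF a(3)] Hd[OF f(1)] Hd[OF f(2)] Hd[OF f(3)]
        by (simp add: laws'(13)[of "asrc X" "asrc Y" "asrc Z"] laws'(13)[of "atgt X" "atgt Y" "atgt Z"])
    }
    { assume a: "X \<in> Ob ?C" "Y \<in> Ob ?C" "Z \<in> Ob ?C" "W \<in> Ob ?C" and f: "f \<in> Hom ?C X Y" "g \<in> Hom ?C Y Z" "h \<in> Hom ?C Z W"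
      then show "Comp ?C (Comp ?C h g) f = Comp ?C h (Comp ?C g f)"
        using O[OF a(1)] O[OF a(2)] O[OF a(3)] O[OF a(4)] Hd[OF f(1)] Hd[OF f(2)] Hd[OF f(3)]
        by (simp add: laws'(6)[of "asrc X" "asrc Y" "asrc Z" "asrc W"] laws'(6)[of "atgt X" "atgt Y" "atgt Z" "atgt W"])
    }
    { assume a: "X \<in> Ob ?C"
      show "Ident ?C X \<in> Hom ?C X X"
        using O[OF a] by (simp add: mono_Hom_iff laws'(2) laws'(7)[of "asrc X" "atgt X"] laws'(8)[of "asrc X" "atgt X"])
    }
  qed
qed

lemma pointwise_injective_comp:
  assumes "wf_digraph Q" "g \<in> rep_homs Q N L" "f \<in> rep_homs Q M N" "pointwise_injective Q N L g" "pointwise_injective Q M N f"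
  shows "pointwise_injective Q M L (rep_comp Q g f)"
  unfolding pointwise_injective_def
proof
  fix v assume v: "v \<in> verts Q"
  obtain A where A: "A \<in> fcar (rdim N v) (rdim L v)" "A * of_mat (g v) = fone (rdim N v)"
    using assms(4) v unfolding pointwise_injective_def by blast
  obtain B where B: "B \<in> fcar (rdim M v) (rdim N v)" "B * of_mat (f v) = fone (rdim M v)"
    using assms(5) v unfolding pointwise_injective_def by blast
  have "(B * A) * of_mat (rep_comp Q g f v) = B * ((A * of_mat (g v)) * of_mat (f v))"
    by (simp only: rep_comp_dims[OF assms(2,3) v] mult.assoc)
  also have "\<dots> = fone (rdim M v)" using B A(2) fone_left[OF rep_hom_fcar[OF assms(3) v]] by simp
  finally show "\<exists>L' \<in> fcar (rdim M v) (rdim L v). L' * of_mat (rep_comp Q g f v) = fone (rdim M v)"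
    using fcar_times[OF B(1) A(1)] by blast
qed

lemma pointwise_injective_right_factor:
  assumes "g \<in> rep_homs Q N L" "f \<in> rep_homs Q M N" "pointwise_injective Q M L (rep_comp Q g f)"
  shows "pointwise_injective Q M N f"
  unfolding pointwise_injective_def
proof
  fix v assume v: "v \<in> verts Q"
  obtain A where A: "A \<in> fcar (rdim M v) (rdim L v)" "A * of_mat (rep_comp Q g f v) = fone (rdim M v)"
    using assms(3) v unfolding pointwise_injective_def by blast
  have "(A * of_mat (g v)) * of_mat (f v) = fone (rdim M v)"
    using A(2) by (simp only: rep_comp_dims[OF assms(1,2) v] mult.assoc)
  then show "\<exists>L' \<in> fcar (rdim M v) (rdim N v). L' * of_mat (f v) = fone (rdim M v)"
    using fcar_times[OF A(1) rep_hom_fcar[OF assms(1) v]] by blast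
qed

lemma zero_object_rep_iff:
  "zero_object (Rep Q) M \<longleftrightarrow> M \<in> Ob (Rep Q) \<and> (\<forall>v \<in> verts Q. rdim M v = 0)"
proof -
  have "Ident (Rep Q) M = Zero (Rep Q) M M \<longleftrightarrow> (\<forall>v \<in> verts Q. rdim M v = 0)"
  proof
    assume eq: "Ident (Rep Q) M = Zero (Rep Q) M M"
    show "\<forall>v \<in> verts Q. rdim M v = 0"
    proof
      fix v assume v: "v \<in> verts Q"
      have "fone (rdim M v) = (0 :: 'a fmat)" using rep_ident_at[OF v, of M] rep_zero_at[OF v, of M M] by (simp only: eq)
      then show "rdim M v = 0" by simp
    qed
  next
    assume "\<forall>v \<in> verts Q. rdim M v = 0"
    then show "Ident (Rep Q) M = Zero (Rep Q) M M"
      by (auto simp: rep_category_simps(4,5) intro!: restrict_ext eq_matI)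
  qed
  then show ?thesis by (simp add: zero_object_def)
qed

lemma hom_zero_source:
  assumes wf: "wf_digraph Q" and M: "zero_object (Rep Q) M" and N: "N \<in> Ob (Rep Q)" and f: "f \<in> rep_homs Q M N"
  shows "f = Zero (Rep Q) M N"
proof (rule rep_hom_eqI[OF f rep_Zero_in[OF wf _ N]])
  show "M \<in> Ob (Rep Q)" using M by (simp add: zero_object_rep_iff)
  show "of_mat (f v) = of_mat (Zero (Rep Q) M N v)" if v: "v \<in> verts Q" for v
    using rep_hom_fcar[OF f v] M v by (simp add: zero_object_rep_iff)
qed

lemma hom_zero_target:
  assumes wf: "wf_digraph Q" and N: "zero_object (Rep Q) N" and M: "M \<in> Ob (Rep Q)" and f: "f \<in> rep_homs Q M N"
  shows "f = Zero (Rep Q) M N"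
proof (rule rep_hom_eqI[OF f rep_Zero_in[OF wf M]])
  show "N \<in> Ob (Rep Q)" using N by (simp add: zero_object_rep_iff)
  show "of_mat (f v) = of_mat (Zero (Rep Q) M N v)" if v: "v \<in> verts Q" for v
    using rep_hom_fcar[OF f v] N v by (simp add: zero_object_rep_iff)
qed

lemma (in lincat) projective_biproduct:
  assumes X: "projective_object C X" and Y: "projective_object C Y" and S: "S \<in> Ob C"
    and h: "i \<in> Hom C X S" "j \<in> Hom C Y S" "p \<in> Hom C S X" "q \<in> Hom C S Y"
    and one: "Add C (Comp C i p) (Comp C j q) = Ident C S"
  shows "projective_object C S"
  unfolding projective_object_def
proof (intro conjI ballI allI impI)
  fix A B e f
  assume A: "A \<in> Ob C" and B: "B \<in> Ob C" and e: "epimorphism C A B e" and f: "f \<in> Hom C S B"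
  have XO: "X \<in> Ob C" and YO: "Y \<in> Ob C" using X Y by (auto simp: projective_object_def)
  have eh: "e \<in> Hom C A B" using e by (simp add: epimorphism_def)
  obtain g where g: "g \<in> Hom C X A" "Comp C e g = Comp C f i"
    using X A B e comp_in[OF XO S B h(1) f] unfolding projective_object_def by blast
  obtain k where k: "k \<in> Hom C Y A" "Comp C e k = Comp C f j"
    using Y A B e comp_in[OF YO S B h(2) f] unfolding projective_object_def by blast
  have "Comp C e (Add C (Comp C g p) (Comp C k q)) = Add C (Comp C e (Comp C g p)) (Comp C e (Comp C k q))"
    by (rule comp_add_right[OF S A B comp_in[OF S XO A h(3) g(1)] comp_in[OF S YO A h(4) k(1)] eh])
  also have "Comp C e (Comp C g p) = Comp C f (Comp C i p)"
    using comp_assoc[OF S XO A B h(3) g(1) eh] comp_assoc[OF S XO S B h(3) h(1) f] g(2) by simp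
  also have "Comp C e (Comp C k q) = Comp C f (Comp C j q)"
    using comp_assoc[OF S YO A B h(4) k(1) eh] comp_assoc[OF S YO S B h(4) h(2) f] k(2) by simp
  also have "Add C (Comp C f (Comp C i p)) (Comp C f (Comp C j q)) = Comp C f (Ident C S)"
    using comp_add_right[OF S S B comp_in[OF S XO S h(3,1)] comp_in[OF S YO S h(4,2)] f] one by simp
  also have "\<dots> = f" by (rule ident_right[OF S B f])
  finally show "\<exists>g \<in> Hom C S A. Comp C e g = f"
    using add_in[OF S A comp_in[OF S XO A h(3) g(1)] comp_in[OF S YO A h(4) k(1)]] by blast
qed (rule S)

lemma (in lincat) retract_comp:
  assumes O: "X \<in> Ob C" "Y \<in> Ob C" "S \<in> Ob C" "T \<in> Ob C"
    and h: "f \<in> Hom C X Y" "a \<in> Hom C S X" "b \<in> Hom C Y T"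
    and Z: "Z \<in> Ob C" "t \<in> Hom C Z S"
  shows "Comp C (Comp C b (Comp C f a)) t = Comp C b (Comp C f (Comp C a t))"
  using comp_assoc[OF Z(1) O(3,1,2) Z(2) h(2,1)] comp_assoc[OF Z(1) O(3,2,4) Z(2) comp_in[OF O(3,1,2) h(2,1)] h(3)] by simp

lemma (in lincat) sub_cancel:
  assumes "X \<in> Ob C" "Y \<in> Ob C" "f \<in> Hom C X Y" "g \<in> Hom C X Y"
  shows "Add C g (Add C f (Smult C (- 1) g)) = f"
proof -
  have n: "Smult C (- 1) g \<in> Hom C X Y" using assms smult_in by blast
  have "Add C g (Add C f (Smult C (- 1) g)) = Add C (Add C f (Smult C (- 1) g)) g"
    by (rule add_commute[OF assms(1,2) assms(4) add_in[OF assms(1-3) n]])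
  also have "\<dots> = Add C f (Add C (Smult C (- 1) g) g)" by (rule add_assoc[OF assms(1-3) n assms(4)])
  also have "Add C (Smult C (- 1) g) g = Zero C X Y"
    using add_commute[OF assms(1,2) n assms(4)] add_neg[OF assms(1,2,4)] by simp
  finally show ?thesis using add_zero[OF assms(1-3)] by simp
qed

context graded_quiver
begin

lemma lift_projective:
  assumes "projective_object (Rep Q) P" "M \<in> Ob (Rep Q)" "N \<in> Ob (Rep Q)"
    and "e \<in> rep_homs Q M N" "pointwise_surjective Q M N e" "f \<in> rep_homs Q P N"
  obtains g where "g \<in> rep_homs Q P M" "rep_comp Q e g = f"
proof -
  have "epimorphism (Rep Q) M N e" using assms(4,5) epimorphism_rep_iff[OF wf assms(2,3)] by blast
  then have "\<exists>g \<in> Hom (Rep Q) P M. Comp (Rep Q) e g = f"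
    using assms(1-3,6) unfolding projective_object_def by simp
  then show ?thesis using that by auto
qed

text \<open>Take kernels of both components.  The map between them is injective, and subrepresentations of
  projectives are projective.\<close>

lemma mono_kernel:
  assumes A: "A \<in> Ob (MonoP Q)" and B: "B \<in> Ob (MonoP Q)" and f: "f \<in> Hom (MonoP Q) A B"
  shows "\<exists>K \<kappa>. kernel_of (MonoP Q) A B f K \<kappa>"
proof -
  interpret R: lincat "Rep Q" by (rule lincat_rep_category[OF wf])
  note assoc = R.comp_assoc[unfolded rep_category_simps(2,3)]
  note a = mono_ObD[OF A] and b = mono_ObD[OF B] and f' = mono_HomD[OF f]
  obtain K k where K: "K \<in> Ob (Rep Q)" "k \<in> rep_homs Q K (asrc A)" "pointwise_injective Q K (asrc A) k"
    "pointwise_exact Q K k (asrc A) (fst f)" by (rule kernel_rep[OF wf a(3) b(3) f'(1)])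
  obtain L l where L: "L \<in> Ob (Rep Q)" "l \<in> rep_homs Q L (atgt A)" "pointwise_injective Q L (atgt A) l"
    "pointwise_exact Q L l (atgt A) (snd f)" by (rule kernel_rep[OF wf a(4) b(4) f'(2)])
  note kK = kernel_of_pointwise[OF wf K(1) a(3) b(3) K(2) f'(1) K(3,4)]
  note kL = kernel_of_pointwise[OF wf L(1) a(4) b(4) L(2) f'(2) L(3,4)]
  have ak: "rep_comp Q (amap A) k \<in> rep_homs Q K (atgt A)" by (rule rep_comp_in[OF wf K(1) a(3,4) K(2) a(5)])
  have "rep_comp Q (snd f) (rep_comp Q (amap A) k) = rep_comp Q (rep_comp Q (amap B) (fst f)) k"
    using assoc[OF K(1) a(3,4) b(4) K(2) a(5) f'(2)] f'(3) by simp
  also have "\<dots> = rep_comp Q (amap B) (rep_comp Q (fst f) k)" by (rule assoc[OF K(1) a(3) b(3,4) K(2) f'(1) b(5)])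
  also have "rep_comp Q (fst f) k = Zero (Rep Q) K (asrc B)" using kK by (simp add: kernel_of_def)
  also have "rep_comp Q (amap B) \<dots> = Zero (Rep Q) K (atgt B)"
    using R.comp_zero_right[OF K(1) b(3,4)] b(5) by simp
  finally have "\<exists>u \<in> rep_homs Q K L. rep_comp Q l u = rep_comp Q (amap A) k"
    using kL K(1) ak unfolding kernel_of_def rep_category_simps(2,3) by blast
  then obtain u where u: "u \<in> rep_homs Q K L" "rep_comp Q l u = rep_comp Q (amap A) k" by blast
  have ui: "pointwise_injective Q K L u"
    using pointwise_injective_right_factor[OF L(2) u(1)] pointwise_injective_comp[OF wf a(5) K(2) a(6) K(3)] u(2) by simp
  let ?K = "\<lparr>asrc = K, atgt = L, amap = u\<rparr>"
  have KO: "?K \<in> Ob (MonoP Q)"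
    using subrep_projective[OF K(1) a(1) K(2,3)] subrep_projective[OF L(1) a(2) L(2,3)] u(1) ui by (simp add: mono_Ob_iff)
  have "kernel_of (MonoP Q) A B f ?K (k, l)"
    unfolding kernel_of_def
  proof (intro conjI ballI impI)
    show "?K \<in> Ob (MonoP Q)" by (rule KO)
    show "(k, l) \<in> Hom (MonoP Q) ?K A" using K(2) L(2) u(2) by (simp add: mono_Hom_iff)
    show "Comp (MonoP Q) f (k, l) = Zero (MonoP Q) ?K B"
      using kK kL by (simp add: kernel_of_def)
    fix T t
    assume T: "T \<in> Ob (MonoP Q)" and t: "t \<in> Hom (MonoP Q) T A"
      and ft: "Comp (MonoP Q) f t = Zero (MonoP Q) T B"
    note T' = mono_ObD[OF T] and t' = mono_HomD[OF t]
    have "\<exists>!x. x \<in> rep_homs Q (asrc T) K \<and> rep_comp Q k x = fst t"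
      using kK T'(3) t'(1) ft unfolding kernel_of_def by simp
    then obtain x where x: "x \<in> rep_homs Q (asrc T) K" "rep_comp Q k x = fst t" by blast
    have "\<exists>!y. y \<in> rep_homs Q (atgt T) L \<and> rep_comp Q l y = snd t"
      using kL T'(4) t'(2) ft unfolding kernel_of_def by simp
    then obtain y where y: "y \<in> rep_homs Q (atgt T) L" "rep_comp Q l y = snd t" by blast
    have "rep_comp Q y (amap T) = rep_comp Q u x"
    proof (rule pointwise_injective_cancel[OF wf T'(3) L(1) a(4) L(2,3)])
      show "rep_comp Q y (amap T) \<in> rep_homs Q (asrc T) L" by (rule rep_comp_in[OF wf T'(3,4) L(1) T'(5) y(1)])
      show "rep_comp Q u x \<in> rep_homs Q (asrc T) L" by (rule rep_comp_in[OF wf T'(3) K(1) L(1) x(1) u(1)])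
      have "rep_comp Q l (rep_comp Q y (amap T)) = rep_comp Q (snd t) (amap T)"
        using assoc[OF T'(3,4) L(1) a(4) T'(5) y(1) L(2)] y(2) by simp
      also have "\<dots> = rep_comp Q (amap A) (rep_comp Q k x)" by (simp only: t'(3) x(2))
      also have "\<dots> = rep_comp Q (rep_comp Q l u) x" using assoc[OF T'(3) K(1) a(3,4) x(1) K(2) a(5)] u(2) by simp
      also have "\<dots> = rep_comp Q l (rep_comp Q u x)" by (rule assoc[OF T'(3) K(1) L(1) a(4) x(1) u(1) L(2)])
      finally show "rep_comp Q l (rep_comp Q y (amap T)) = rep_comp Q l (rep_comp Q u x)" .
    qed
    then have xy: "(x, y) \<in> Hom (MonoP Q) T ?K" using x(1) y(1) by (simp add: mono_Hom_iff)
    show "\<exists>!w. w \<in> Hom (MonoP Q) T ?K \<and> Comp (MonoP Q) (k, l) w = t"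
    proof (rule ex1I[of _ "(x, y)"])
      show "(x, y) \<in> Hom (MonoP Q) T ?K \<and> Comp (MonoP Q) (k, l) (x, y) = t"
        using xy x(2) y(2) by simp
      fix w assume w: "w \<in> Hom (MonoP Q) T ?K \<and> Comp (MonoP Q) (k, l) w = t"
      then have w': "fst w \<in> rep_homs Q (asrc T) K" "snd w \<in> rep_homs Q (atgt T) L"
        "rep_comp Q k (fst w) = fst t" "rep_comp Q l (snd w) = snd t" by (auto simp: mono_Hom_iff)
      have "fst w = x" by (rule pointwise_injective_cancel[OF wf T'(3) K(1) a(3) K(2,3) w'(1) x(1)]) (simp add: w' x)
      moreover have "snd w = y" by (rule pointwise_injective_cancel[OF wf T'(4) L(1) a(4) L(2,3) w'(2) y(1)]) (simp add: w' y)
      ultimately show "w = (x, y)" by (metis prod.collapse)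
    qed
  qed
  then show ?thesis by blast
qed

definition zero_arrow :: "('k :: field, 'v, 'e) representation \<Rightarrow> ('k, 'v, 'e) rep_arrow" where
  "zero_arrow P = \<lparr>asrc = mk_rep Q (\<lambda>_. 0) (\<lambda>_. 0), atgt = P, amap = Zero (Rep Q) (mk_rep Q (\<lambda>_. 0) (\<lambda>_. 0)) P\<rparr>"

lemma zero_rep_projective: "projective_object (Rep Q) (mk_rep Q (\<lambda>_. 0) (\<lambda>_. 0) :: ('k :: field, 'v, 'e) representation)"
  (is "projective_object ?R ?Z")
  unfolding projective_object_def
proof (intro conjI ballI allI impI)
  show Z: "?Z \<in> Ob ?R" by simp
  fix X Y e f assume X: "X \<in> Ob ?R" and Y: "Y \<in> Ob ?R" and e: "epimorphism ?R X Y e" and f: "f \<in> Hom ?R ?Z Y"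
  interpret R: lincat ?R by (rule lincat_rep_category[OF wf])
  have "Comp ?R e (Zero ?R ?Z X) = Zero ?R ?Z Y" using e by (intro R.comp_zero_right[OF Z X Y]) (simp add: epimorphism_def)
  also have "\<dots> = f" using hom_zero_source[OF wf zero_rep(2)[OF wf] Y] f by simp
  finally show "\<exists>g \<in> Hom ?R ?Z X. Comp ?R e g = f" using R.zero_in[OF Z X] by blast
qed

lemma zero_arrow_Ob:
  assumes P: "projective_object (Rep Q) P"
  shows "zero_arrow P \<in> Ob (MonoP Q)"
proof -
  have "Zero (Rep Q) (mk_rep Q (\<lambda>_. 0) (\<lambda>_. 0)) P \<in> rep_homs Q (mk_rep Q (\<lambda>_. 0) (\<lambda>_. 0)) P"
    using P by (intro rep_Zero_in[OF wf]) auto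
  then show ?thesis
    using P zero_rep_projective by (auto simp: mono_Ob_iff zero_arrow_def pointwise_injective_def)
qed

text \<open>The nontrivial implication uses heredity: for a map to an object \<open>0 \<rightarrow> P\<close>, the image \<open>I\<close> in \<open>P\<close> is
  projective, so \<open>0 \<rightarrow> I\<close> is a retract of \<open>A\<close>.  Retracts with a kernel are direct summands, hence \<open>I\<close> is
  zero.  This description of \<open>\<H>\<close> is closed under biproducts and is what makes \<open>\<H>\<close>-parts functorial.\<close>

lemma H_Ob_iff:
  assumes A: "A \<in> Ob (MonoP Q)"
  shows "A \<in> Ob (H_category Q) \<longleftrightarrow> (\<forall>B \<in> Ob (MonoP Q). zero_object (Rep Q) (asrc B) \<longrightarrow>
           (\<forall>f \<in> Hom (MonoP Q) A B. f = Zero (MonoP Q) A B))"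
proof (intro iffI ballI impI)
  interpret R: lincat "Rep Q" by (rule lincat_rep_category[OF wf])
  interpret C: lincat "MonoP Q" by (rule lincat_mono_proj_category[OF wf])
  note a = mono_ObD[OF A]
  { fix B f
    assume H: "A \<in> Ob (H_category Q)" and B: "B \<in> Ob (MonoP Q)" and z: "zero_object (Rep Q) (asrc B)"
      and f: "f \<in> Hom (MonoP Q) A B"
    note b = mono_ObD[OF B] and f' = mono_HomD[OF f]
    have f1: "fst f = Zero (Rep Q) (asrc A) (asrc B)" by (rule hom_zero_target[OF wf z a(3) f'(1)])
    obtain I e m where I: "I \<in> Ob (Rep Q)" "e \<in> rep_homs Q (atgt A) I" "m \<in> rep_homs Q I (atgt B)"
      "pointwise_surjective Q (atgt A) I e" "pointwise_injective Q I (atgt B) m" "snd f = rep_comp Q m e"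
      by (rule image_factorization[OF wf a(4) b(4) f'(2)])
    have IP: "projective_object (Rep Q) I" by (rule subrep_projective[OF I(1) b(2) I(3,5)])
    obtain s where s: "s \<in> rep_homs Q I (atgt A)" "rep_comp Q e s = Ident (Rep Q) I"
      using lift_projective[OF IP a(4) I(1,2,4) rep_Ident_in[OF wf I(1)]] .
    let ?O = "mk_rep Q (\<lambda>_. 0) (\<lambda>_. 0) :: ('a, 'v, 'e) representation"
    have OO: "?O \<in> Ob (Rep Q)" by simp
    have Oz: "zero_object (Rep Q) ?O" by (rule zero_rep(2)[OF wf])
    have "rep_comp Q e (amap A) = Zero (Rep Q) (asrc A) I"
    proof (rule pointwise_injective_cancel[OF wf a(3) I(1) b(4) I(3,5)])
      show "rep_comp Q e (amap A) \<in> rep_homs Q (asrc A) I" by (rule rep_comp_in[OF wf a(3,4) I(1) a(5) I(2)])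
      show "Zero (Rep Q) (asrc A) I \<in> rep_homs Q (asrc A) I" by (rule rep_Zero_in[OF wf a(3) I(1)])
      have "rep_comp Q m (rep_comp Q e (amap A)) = rep_comp Q (amap B) (fst f)"
        using R.comp_assoc[unfolded rep_category_simps(2,3), OF a(3,4) I(1) b(4) a(5) I(2,3)] f'(3) I(6) by simp
      also have "\<dots> = Zero (Rep Q) (asrc A) (atgt B)"
        using R.comp_zero_right[unfolded rep_category_simps(2,3), OF a(3) b(3,4,5)] f1 by simp
      finally show "rep_comp Q m (rep_comp Q e (amap A)) = rep_comp Q m (Zero (Rep Q) (asrc A) I)"
        using R.comp_zero_right[unfolded rep_category_simps(2,3), OF a(3) I(1) b(4) I(3)] by simp
    qed
    also have "\<dots> = rep_comp Q (Zero (Rep Q) ?O I) (Zero (Rep Q) (asrc A) ?O)"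
      using R.comp_zero_right[OF a(3) OO I(1) R.zero_in[OF OO I(1)]] by simp
    finally have p: "(Zero (Rep Q) (asrc A) ?O, e) \<in> Hom (MonoP Q) A (zero_arrow I)"
      using I(2) rep_Zero_in[OF wf a(3) OO] by (simp add: mono_Hom_iff zero_arrow_def)
    have "rep_comp Q s (Zero (Rep Q) ?O I) = Zero (Rep Q) ?O (atgt A)"
      using R.comp_zero_right[OF OO I(1) a(4)] s(1) by simp
    also have "\<dots> = rep_comp Q (amap A) (Zero (Rep Q) ?O (asrc A))"
      using R.comp_zero_right[OF OO a(3,4)] a(5) by simp
    finally have i: "(Zero (Rep Q) ?O (asrc A), s) \<in> Hom (MonoP Q) (zero_arrow I) A"
      using s(1) rep_Zero_in[OF wf OO a(3)] by (simp add: mono_Hom_iff zero_arrow_def)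
    have "rep_comp Q (Zero (Rep Q) (asrc A) ?O) (Zero (Rep Q) ?O (asrc A)) = Ident (Rep Q) ?O"
      using R.comp_zero_right[OF OO a(3) OO R.zero_in[OF a(3) OO]] Oz by (simp add: zero_object_def)
    then have pi: "Comp (MonoP Q) (Zero (Rep Q) (asrc A) ?O, e) (Zero (Rep Q) ?O (asrc A), s)
        = Ident (MonoP Q) (zero_arrow I)"
      using s(2) by (simp add: zero_arrow_def)
    note ZO = zero_arrow_Ob[OF IP]
    obtain K \<kappa> where "kernel_of (MonoP Q) A (zero_arrow I) (Zero (Rep Q) (asrc A) ?O, e) K \<kappa>"
      using mono_kernel[OF A ZO p] by blast
    from C.summand_of_retract[OF A ZO i p pi this]
    have "zero_object (MonoP Q) (zero_arrow I)"
      using H Oz by (simp add: H_category_def zero_arrow_def)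
    then have "Ident (Rep Q) I = Zero (Rep Q) I I" by (simp add: zero_object_def zero_arrow_def)
    then have "e = Zero (Rep Q) (atgt A) I"
      using hom_zero_target[OF wf _ a(4) I(2)] I(1) by (simp add: zero_object_def)
    then have "snd f = Zero (Rep Q) (atgt A) (atgt B)"
      using R.comp_zero_right[OF a(4) I(1) b(4)] I(3,6) by simp
    then show "f = Zero (MonoP Q) A B" using f1 by (simp add: prod_eq_iff)
  }
  assume *: "\<forall>B \<in> Ob (MonoP Q). zero_object (Rep Q) (asrc B) \<longrightarrow>
           (\<forall>f \<in> Hom (MonoP Q) A B. f = Zero (MonoP Q) A B)"
  have "zero_object (MonoP Q) B"
    if d: "direct_summand (MonoP Q) B A" and z: "zero_object (Rep Q) (asrc B)" for B
  proof -
    from d obtain i p where B: "B \<in> Ob (MonoP Q)" and i: "i \<in> Hom (MonoP Q) B A"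
      and p: "p \<in> Hom (MonoP Q) A B" and pi: "Comp (MonoP Q) p i = Ident (MonoP Q) B"
      unfolding direct_summand_def by blast
    have "p = Zero (MonoP Q) A B" using * B z p by blast
    then show ?thesis using pi C.comp_zero_left[OF B A B i] B by (simp add: zero_object_def del: mono_simps)
  qed
  then show "A \<in> Ob (H_category Q)" using A by (simp add: H_category_def)
qed

end

section \<open>The subcategory \<open>\<H>\<close>: kernels and biproducts\<close>

context graded_quiver
begin

lemma H_simps [simp]:
  "Hom (H_category Q) = Hom (MonoP Q)" "Comp (H_category Q) = Comp (MonoP Q)"
  "Ident (H_category Q) = Ident (MonoP Q)" "Zero (H_category Q) = Zero (MonoP Q)"
  "Add (H_category Q) = Add (MonoP Q)" "Smult (H_category Q) = Smult (MonoP Q)"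
  by (simp_all add: H_category_def)

lemma H_ObD: "A \<in> Ob (H_category Q) \<Longrightarrow> A \<in> Ob (MonoP Q)"
  by (simp add: H_category_def)

lemma lincat_H_category: "lincat (H_category Q)"
  unfolding H_category_def by (rule lincat.lincat_full_subcategory[OF lincat_mono_proj_category[OF wf]])

definition total_dim :: "('k :: field, 'v, 'e) rep_arrow \<Rightarrow> nat" where
  "total_dim A = (\<Sum>v \<in> verts Q. rdim (asrc A) v + rdim (atgt A) v)"

lemma rep_splitting_dim:
  assumes "i \<in> rep_homs Q M S" "p \<in> rep_homs Q S M" "j \<in> rep_homs Q N S" "q \<in> rep_homs Q S N" "v \<in> verts Q"
    and "rep_comp Q p i = Ident (Rep Q) M" "rep_comp Q q j = Ident (Rep Q) N"
    and "Add (Rep Q) (rep_comp Q i p) (rep_comp Q j q) = Ident (Rep Q) S"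
    and O: "M \<in> Ob (Rep Q)" "N \<in> Ob (Rep Q)" "S \<in> Ob (Rep Q)"
  shows "rdim M v + rdim N v = rdim S v"
proof (rule split_exact_dim[OF rep_hom_fcar[OF assms(1,5)] rep_hom_fcar[OF assms(2,5)] rep_hom_fcar[OF assms(3,5)] rep_hom_fcar[OF assms(4,5)]])
  note v = assms(5)
  show "of_mat (p v) * of_mat (i v) = fone (rdim M v)"
    using rep_comp_dims[OF assms(2,1) v] assms(6) rep_ident_at[OF v] by metis
  show "of_mat (q v) * of_mat (j v) = fone (rdim N v)"
    using rep_comp_dims[OF assms(4,3) v] assms(7) rep_ident_at[OF v] by metis
  have "of_mat (Add (Rep Q) (rep_comp Q i p) (rep_comp Q j q) v) = of_mat (rep_comp Q i p v) + of_mat (rep_comp Q j q v)"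
    by (rule rep_add_at[OF rep_comp_in[OF wf O(3,1,3) assms(2,1)] rep_comp_in[OF wf O(3,2,3) assms(4,3)] v])
  then show "of_mat (i v) * of_mat (p v) + of_mat (j v) * of_mat (q v) = fone (rdim S v)"
    using rep_comp_dims[OF assms(1,2) v] rep_comp_dims[OF assms(3,4) v] assms(8) rep_ident_at[OF v, of S] by simp
qed

text \<open>If the retract \<open>K'\<close> is not yet in \<open>\<H>\<close>, remove a summand \<open>0 \<rightarrow> P\<close>; maps from \<open>\<H>\<close> vanish on it, and
  the total dimension decreases.\<close>

lemma H_part_aux:
  assumes "total_dim K' = n" "K \<in> Ob (MonoP Q)" "K' \<in> Ob (MonoP Q)"
    and "j \<in> Hom (MonoP Q) K' K" "q \<in> Hom (MonoP Q) K K'"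
    and "Comp (MonoP Q) q j = Ident (MonoP Q) K'"
    and "\<And>T u. T \<in> Ob (H_category Q) \<Longrightarrow> u \<in> Hom (MonoP Q) T K \<Longrightarrow>
           Comp (MonoP Q) j (Comp (MonoP Q) q u) = u"
  shows "\<exists>K' \<in> Ob (H_category Q). \<exists>j \<in> Hom (MonoP Q) K' K. \<exists>q \<in> Hom (MonoP Q) K K'.
     Comp (MonoP Q) q j = Ident (MonoP Q) K' \<and>
     (\<forall>T \<in> Ob (H_category Q). \<forall>u \<in> Hom (MonoP Q) T K.
        Comp (MonoP Q) j (Comp (MonoP Q) q u) = u)"
  using assms
proof (induction n arbitrary: K' j q rule: less_induct)
  case (less n)
  let ?C = "MonoP Q"
  interpret C: lincat ?C by (rule lincat_mono_proj_category[OF wf])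
  note K = less.prems(2) and K' = less.prems(3) and j = less.prems(4) and q = less.prems(5) and qj = less.prems(6)
  show ?case
  proof (cases "K' \<in> Ob (H_category Q)")
    case True
    show ?thesis
      by (rule bexI[OF _ True], rule bexI[OF _ j], rule bexI[OF _ q]) (use qj less.prems(7) in blast)
  next
    case False
    then obtain B where B: "direct_summand ?C B K'" "zero_object (Rep Q) (asrc B)" "\<not> zero_object ?C B"
      using K' unfolding H_category_def full_subcategory_simps by blast
    then obtain W i p i' p' where BO: "B \<in> Ob ?C" and W: "W \<in> Ob ?C" and h: "i \<in> Hom ?C B K'" "p \<in> Hom ?C K' B"
      "i' \<in> Hom ?C W K'" "p' \<in> Hom ?C K' W" and e: "Comp ?C p i = Ident ?C B" "Comp ?C p' i' = Ident ?C W"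
      "Add ?C (Comp ?C i p) (Comp ?C i' p') = Ident ?C K'"
      unfolding direct_summand_def by blast
    note b = mono_ObD[OF BO] and w = mono_ObD[OF W] and k = mono_ObD[OF K']
    have dim: "rdim (asrc B) v + rdim (asrc W) v = rdim (asrc K') v \<and> rdim (atgt B) v + rdim (atgt W) v = rdim (atgt K') v"
      if v: "v \<in> verts Q" for v
      using e
      by (intro conjI rep_splitting_dim[OF mono_HomD(1)[OF h(1)] mono_HomD(1)[OF h(2)] mono_HomD(1)[OF h(3)] mono_HomD(1)[OF h(4)] v]
           rep_splitting_dim[OF mono_HomD(2)[OF h(1)] mono_HomD(2)[OF h(2)] mono_HomD(2)[OF h(3)] mono_HomD(2)[OF h(4)] v] b w k)
        simp_all
    have "total_dim K' = total_dim B + total_dim W"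
      unfolding total_dim_def sum.distrib[symmetric] by (rule sum.cong[OF refl]) (use dim in force)
    moreover have "total_dim B > 0"
    proof (rule ccontr)
      assume "\<not> total_dim B > 0"
      then have "\<forall>v \<in> verts Q. rdim (asrc B) v = 0 \<and> rdim (atgt B) v = 0" using fin_verts by (simp add: total_dim_def)
      then have "zero_object (Rep Q) (asrc B)" "zero_object (Rep Q) (atgt B)"
        using b(3,4) by (simp_all add: zero_object_rep_iff)
      then show False using B(3) BO by (simp add: zero_object_def)
    qed
    ultimately have less: "total_dim W < n" using less.prems(1) by simp
    show ?thesis
    proof (rule less.IH[OF less refl K W])
      show "Comp ?C j i' \<in> Hom ?C W K" by (rule C.comp_in[OF W K' K h(3) j])
      show "Comp ?C p' q \<in> Hom ?C K W" by (rule C.comp_in[OF K K' W q h(4)])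
      have "Comp ?C (Comp ?C p' q) (Comp ?C j i') = Comp ?C p' (Comp ?C (Comp ?C q j) i')"
        using C.comp_assoc[OF W K K' W C.comp_in[OF W K' K h(3) j] q h(4)] C.comp_assoc[OF W K' K K' h(3) j q] by metis
      then show "Comp ?C (Comp ?C p' q) (Comp ?C j i') = Ident ?C W"
        using qj C.ident_left[OF W K' h(3)] e(2) by metis
      fix T u assume T: "T \<in> Ob (H_category Q)" and u: "u \<in> Hom ?C T K"
      note TO = H_ObD[OF T]
      let ?v = "Comp ?C q u"
      have v: "?v \<in> Hom ?C T K'" by (rule C.comp_in[OF TO K K' u q])
      have "Comp ?C p ?v = Zero ?C T B"
        using T[unfolded H_Ob_iff[OF TO]] BO B(2) C.comp_in[OF TO K' BO v h(2)] by blast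
      then have "Comp ?C (Comp ?C i p) ?v = Zero ?C T K'"
        using C.comp_assoc[OF TO K' BO K' v h(2,1)] C.comp_zero_right[OF TO BO K' h(1)] by metis
      moreover have "Comp ?C (Ident ?C K') ?v = Add ?C (Comp ?C (Comp ?C i p) ?v) (Comp ?C (Comp ?C i' p') ?v)"
        using C.comp_add_left[OF TO K' K' v C.comp_in[OF K' BO K' h(2,1)] C.comp_in[OF K' W K' h(4,3)]] e(3) by metis
      ultimately have "?v = Comp ?C (Comp ?C i' p') ?v"
        using C.ident_left[OF TO K' v] C.add_left_zero[OF TO K' C.comp_in[OF TO K' K' v C.comp_in[OF K' W K' h(4,3)]]] by metis
      also have "\<dots> = Comp ?C i' (Comp ?C p' ?v)" by (rule C.comp_assoc[OF TO K' W K' v h(4,3)])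
      finally have v2: "Comp ?C i' (Comp ?C p' ?v) = ?v" by (rule sym)
      have "Comp ?C (Comp ?C p' q) u = Comp ?C p' ?v" by (rule C.comp_assoc[OF TO K K' W u q h(4)])
      moreover have "Comp ?C (Comp ?C j i') (Comp ?C p' ?v) = Comp ?C j (Comp ?C i' (Comp ?C p' ?v))"
        by (rule C.comp_assoc[OF TO W K' K C.comp_in[OF TO K' W v h(4)] h(3) j])
      ultimately show "Comp ?C (Comp ?C j i') (Comp ?C (Comp ?C p' q) u) = u"
        using v2 less.prems(7)[OF T u] by metis
    qed
  qed
qed

text \<open>The \<open>\<H>\<close>-part is right adjoint to the inclusion: composition with \<open>j\<close> is a bijection from maps
  \<open>T \<rightarrow> K'\<close> to maps \<open>T \<rightarrow> K\<close>, with inverse composition with \<open>q\<close>.\<close>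

lemma H_part:
  assumes K: "K \<in> Ob (MonoP Q)"
  obtains K' j q where "K' \<in> Ob (H_category Q)" "j \<in> Hom (MonoP Q) K' K" "q \<in> Hom (MonoP Q) K K'"
    "Comp (MonoP Q) q j = Ident (MonoP Q) K'"
    "\<And>T u. T \<in> Ob (H_category Q) \<Longrightarrow> u \<in> Hom (MonoP Q) T K \<Longrightarrow>
        Comp (MonoP Q) j (Comp (MonoP Q) q u) = u"
proof -
  let ?C = "MonoP Q"
  interpret C: lincat ?C by (rule lincat_mono_proj_category[OF wf])
  note i = C.ident_in[OF K]
  have "Comp ?C (Ident ?C K) (Comp ?C (Ident ?C K) u) = u" if "T \<in> Ob (H_category Q)" "u \<in> Hom ?C T K" for T u
    using C.ident_left[OF H_ObD[OF that(1)] K that(2)] by metis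
  then have "\<exists>K' \<in> Ob (H_category Q). \<exists>j \<in> Hom ?C K' K. \<exists>q \<in> Hom ?C K K'. Comp ?C q j = Ident ?C K' \<and>
     (\<forall>T \<in> Ob (H_category Q). \<forall>u \<in> Hom ?C T K. Comp ?C j (Comp ?C q u) = u)"
    by (rule H_part_aux[OF refl K K i i C.ident_left[OF K K i]])
  then show ?thesis by (elim bexE conjE) (rule that, assumption+, blast)
qed

lemma has_kernels_H: "has_kernels (H_category Q :: ('k :: field, ('k, 'v, 'e) rep_arrow, _) linear_category)"
  unfolding has_kernels_def H_simps
proof (intro ballI)
  let ?C = "MonoP Q :: ('k :: field, ('k, 'v, 'e) rep_arrow, _) linear_category"
  interpret C: lincat ?C by (rule lincat_mono_proj_category[OF wf])
  fix X Y :: "('k, 'v, 'e) rep_arrow" and f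
  assume X: "X \<in> Ob (H_category Q)" and Y: "Y \<in> Ob (H_category Q)" and f: "f \<in> Hom ?C X Y"
  note XO = H_ObD[OF X] and YO = H_ObD[OF Y]
  obtain K \<kappa> where kK: "kernel_of ?C X Y f K \<kappa>" using mono_kernel[OF XO YO f] by blast
  then have K: "K \<in> Ob ?C" and \<kappa>: "\<kappa> \<in> Hom ?C K X" and f\<kappa>: "Comp ?C f \<kappa> = Zero ?C K Y"
    and U: "\<And>T t. \<lbrakk>T \<in> Ob ?C; t \<in> Hom ?C T X; Comp ?C f t = Zero ?C T Y\<rbrakk> \<Longrightarrow> \<exists>!u. u \<in> Hom ?C T K \<and> Comp ?C \<kappa> u = t"
    unfolding kernel_of_def by blast+
  obtain K' j q where K': "K' \<in> Ob (H_category Q)" and j: "j \<in> Hom ?C K' K" and q: "q \<in> Hom ?C K K'"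
    and qj: "Comp ?C q j = Ident ?C K'"
    and jq: "\<And>T u. T \<in> Ob (H_category Q) \<Longrightarrow> u \<in> Hom ?C T K \<Longrightarrow> Comp ?C j (Comp ?C q u) = u"
    by (rule H_part[OF K]) blast
  note KO = H_ObD[OF K']
  have "kernel_of (H_category Q) X Y f K' (Comp ?C \<kappa> j)"
    unfolding kernel_of_def H_simps
  proof (intro conjI ballI impI)
    show "K' \<in> Ob (H_category Q)" by (rule K')
    show "Comp ?C \<kappa> j \<in> Hom ?C K' X" by (rule C.comp_in[OF KO K XO j \<kappa>])
    show "Comp ?C f (Comp ?C \<kappa> j) = Zero ?C K' Y"
      using C.comp_assoc[OF KO K XO YO j \<kappa> f] f\<kappa> C.comp_zero_left[OF KO K YO j] by metis
    fix T t assume T: "T \<in> Ob (H_category Q)" and t: "t \<in> Hom ?C T X" and ft: "Comp ?C f t = Zero ?C T Y"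
    note TO = H_ObD[OF T]
    obtain u where u: "u \<in> Hom ?C T K" "Comp ?C \<kappa> u = t" and uniq: "\<And>w. w \<in> Hom ?C T K \<Longrightarrow> Comp ?C \<kappa> w = t \<Longrightarrow> w = u"
      using U[OF TO t ft] by blast
    show "\<exists>!u. u \<in> Hom ?C T K' \<and> Comp ?C (Comp ?C \<kappa> j) u = t"
    proof (intro ex1I[of _ "Comp ?C q u"] conjI)
      show qu: "Comp ?C q u \<in> Hom ?C T K'" by (rule C.comp_in[OF TO K KO u(1) q])
      show "Comp ?C (Comp ?C \<kappa> j) (Comp ?C q u) = t"
        using C.comp_assoc[OF TO KO K XO qu j \<kappa>] jq[OF T u(1)] u(2) by metis
      fix w assume w: "w \<in> Hom ?C T K' \<and> Comp ?C (Comp ?C \<kappa> j) w = t"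
      then have w1: "w \<in> Hom ?C T K'" and w2: "Comp ?C (Comp ?C \<kappa> j) w = t" by (rule conjunct1, rule conjunct2)
      have "Comp ?C j w = u"
        using uniq[OF C.comp_in[OF TO KO K w1 j]] C.comp_assoc[OF TO KO K XO w1 j \<kappa>] w2 by metis
      then show "w = Comp ?C q u"
        using C.comp_assoc[OF TO KO K KO w1 j q] qj C.ident_left[OF TO KO w1] by metis
    qed
  qed
  then show "\<exists>K \<kappa>. kernel_of (H_category Q) X Y f K \<kappa>" by blast
qed

lemma zero_arrow_H: "zero_arrow (mk_rep Q (\<lambda>_. 0) (\<lambda>_. 0)) \<in> Ob (H_category Q)"
proof -
  let ?Z = "zero_arrow (mk_rep Q (\<lambda>_. 0) (\<lambda>_. 0))"
  have Z: "?Z \<in> Ob (MonoP Q)" by (rule zero_arrow_Ob[OF zero_rep_projective])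
  have "f = Zero (MonoP Q) ?Z B" if B: "B \<in> Ob (MonoP Q)" and f: "f \<in> Hom (MonoP Q) ?Z B" for B f
  proof -
    note b = mono_ObD[OF B] and f' = mono_HomD[OF f]
    have "fst f = Zero (Rep Q) (asrc ?Z) (asrc B)"
      by (rule hom_zero_source[OF wf _ b(3) f'(1)]) (simp add: zero_arrow_def zero_rep(2)[OF wf])
    moreover have "snd f = Zero (Rep Q) (atgt ?Z) (atgt B)"
      by (rule hom_zero_source[OF wf _ b(4) f'(2)]) (simp add: zero_arrow_def zero_rep(2)[OF wf])
    ultimately show ?thesis by (simp add: prod_eq_iff)
  qed
  then show ?thesis using H_Ob_iff[OF Z] by blast
qed

lemma rep_biproduct:
  assumes M: "M \<in> Ob (Rep Q)" and N: "N \<in> Ob (Rep Q)"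
  obtains S i j p q where "S \<in> Ob (Rep Q)" "i \<in> rep_homs Q M S" "j \<in> rep_homs Q N S"
    "p \<in> rep_homs Q S M" "q \<in> rep_homs Q S N" "rep_comp Q p i = Ident (Rep Q) M" "rep_comp Q q j = Ident (Rep Q) N"
    "rep_comp Q q i = Zero (Rep Q) M N" "rep_comp Q p j = Zero (Rep Q) N M"
    "Add (Rep Q) (rep_comp Q i p) (rep_comp Q j q) = Ident (Rep Q) S"
proof -
  obtain S i j p q where S: "S \<in> Ob (Rep Q)" and h: "i \<in> rep_homs Q M S" "j \<in> rep_homs Q N S"
    "p \<in> rep_homs Q S M" "q \<in> rep_homs Q S N"
    and e: "\<And>v. v \<in> verts Q \<Longrightarrow> of_mat (p v) * of_mat (i v) = fone (rdim M v)"
    "\<And>v. v \<in> verts Q \<Longrightarrow> of_mat (q v) * of_mat (j v) = fone (rdim N v)"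
    "\<And>v. v \<in> verts Q \<Longrightarrow> of_mat (q v) * of_mat (i v) = 0"
    "\<And>v. v \<in> verts Q \<Longrightarrow> of_mat (p v) * of_mat (j v) = 0"
    "\<And>v. v \<in> verts Q \<Longrightarrow> of_mat (i v) * of_mat (p v) + of_mat (j v) * of_mat (q v) = fone (rdim S v)"
    by (rule biproduct_rep[OF wf M N]) blast
  note ip = rep_comp_in[OF wf S M S h(3,1)] and jq = rep_comp_in[OF wf S N S h(4,2)]
  show ?thesis
  proof (rule that[OF S h])
    show "rep_comp Q p i = Ident (Rep Q) M"
      by (rule rep_hom_eqI[OF rep_comp_in[OF wf M S M h(1,3)] rep_Ident_in[OF wf M]]) (simp add: rep_comp_dims[OF h(3,1)] e)
    show "rep_comp Q q j = Ident (Rep Q) N"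
      by (rule rep_hom_eqI[OF rep_comp_in[OF wf N S N h(2,4)] rep_Ident_in[OF wf N]]) (simp add: rep_comp_dims[OF h(4,2)] e)
    show "rep_comp Q q i = Zero (Rep Q) M N"
      by (rule rep_hom_eqI[OF rep_comp_in[OF wf M S N h(1,4)] rep_Zero_in[OF wf M N]]) (simp add: rep_comp_dims[OF h(4,1)] e)
    show "rep_comp Q p j = Zero (Rep Q) N M"
      by (rule rep_hom_eqI[OF rep_comp_in[OF wf N S M h(2,3)] rep_Zero_in[OF wf N M]]) (simp add: rep_comp_dims[OF h(3,2)] e)
    show "Add (Rep Q) (rep_comp Q i p) (rep_comp Q j q) = Ident (Rep Q) S"
      by (rule rep_hom_eqI[OF rep_Add_in[OF wf S S ip jq] rep_Ident_in[OF wf S]])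
        (simp add: rep_add_at[OF ip jq] rep_comp_dims[OF h(1,3)] rep_comp_dims[OF h(2,4)] e)
  qed
qed

lemma has_biproducts_H: "has_biproducts (H_category Q :: ('k :: field, ('k, 'v, 'e) rep_arrow, _) linear_category)"
  unfolding has_biproducts_def H_simps
proof (intro ballI)
  let ?R = "Rep Q :: ('k :: field, ('k, 'v, 'e) representation, 'v \<Rightarrow> 'k mat) linear_category"
  let ?C = "MonoP Q :: ('k :: field, ('k, 'v, 'e) rep_arrow, _) linear_category"
  interpret R: lincat ?R by (rule lincat_rep_category[OF wf])
  interpret C: lincat ?C by (rule lincat_mono_proj_category[OF wf])
  fix X Y :: "('k, 'v, 'e) rep_arrow"
  assume XH: "X \<in> Ob (H_category Q)" and YH: "Y \<in> Ob (H_category Q)"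
  note X = H_ObD[OF XH] and Y = H_ObD[OF YH]
  note x = mono_ObD[OF X] and y = mono_ObD[OF Y]
  obtain S i j p q where S: "S \<in> Ob ?R" and h: "i \<in> rep_homs Q (asrc X) S" "j \<in> rep_homs Q (asrc Y) S"
    "p \<in> rep_homs Q S (asrc X)" "q \<in> rep_homs Q S (asrc Y)" and e: "rep_comp Q p i = Ident ?R (asrc X)" "rep_comp Q q j = Ident ?R (asrc Y)"
    "rep_comp Q q i = Zero ?R (asrc X) (asrc Y)" "rep_comp Q p j = Zero ?R (asrc Y) (asrc X)"
    "Add ?R (rep_comp Q i p) (rep_comp Q j q) = Ident ?R S"
    by (rule rep_biproduct[OF x(3) y(3)]) blast
  obtain T k l r s where T: "T \<in> Ob ?R" and g: "k \<in> rep_homs Q (atgt X) T" "l \<in> rep_homs Q (atgt Y) T"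
    "r \<in> rep_homs Q T (atgt X)" "s \<in> rep_homs Q T (atgt Y)" and d: "rep_comp Q r k = Ident ?R (atgt X)" "rep_comp Q s l = Ident ?R (atgt Y)"
    "rep_comp Q s k = Zero ?R (atgt X) (atgt Y)" "rep_comp Q r l = Zero ?R (atgt Y) (atgt X)"
    "Add ?R (rep_comp Q k r) (rep_comp Q l s) = Ident ?R T"
    by (rule rep_biproduct[OF x(4) y(4)]) blast
  note h' = h[folded rep_category_simps(2)] and e' = e[folded rep_category_simps(3)]
  note g' = g[folded rep_category_simps(2)] and d' = d[folded rep_category_simps(3)]
  have SP: "projective_object ?R S" by (rule R.projective_biproduct[OF x(1) y(1) S h' e'(5)])
  have TP: "projective_object ?R T" by (rule R.projective_biproduct[OF x(2) y(2) T g' d'(5)])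
  have xa: "amap X \<in> Hom ?R (asrc X) (atgt X)" and ya: "amap Y \<in> Hom ?R (asrc Y) (atgt Y)" using x(5) y(5) by simp_all
  let ?a = "Comp ?R k (Comp ?R (amap X) p)" and ?b = "Comp ?R l (Comp ?R (amap Y) q)"
  have a: "?a \<in> Hom ?R S T" by (rule R.comp_in[OF S x(4) T R.comp_in[OF S x(3,4) h'(3) xa] g'(1)])
  have b: "?b \<in> Hom ?R S T" by (rule R.comp_in[OF S y(4) T R.comp_in[OF S y(3,4) h'(4) ya] g'(2)])
  let ?m = "Add ?R ?a ?b"
  have m: "?m \<in> Hom ?R S T" by (rule R.add_in[OF S T a b])
  have mi: "Comp ?R ?m i = Comp ?R k (amap X)"
  proof -
    have "Comp ?R ?a i = Comp ?R k (amap X)"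
      using R.retract_comp[OF x(3,4) S T xa h'(3) g'(1) x(3) h'(1)] e'(1) R.ident_right[OF x(3,4) xa] by metis
    moreover have "Comp ?R ?b i = Zero ?R (asrc X) T"
      using R.retract_comp[OF y(3,4) S T ya h'(4) g'(2) x(3) h'(1)] e'(3) R.comp_zero_right[OF x(3) y(3,4) ya]
        R.comp_zero_right[OF x(3) y(4) T g'(2)] by metis
    ultimately show ?thesis
      using R.comp_add_left[OF x(3) S T h'(1) a b] R.add_zero[OF x(3) T R.comp_in[OF x(3,4) T xa g'(1)]] by metis
  qed
  have mj: "Comp ?R ?m j = Comp ?R l (amap Y)"
  proof -
    have "Comp ?R ?b j = Comp ?R l (amap Y)"
      using R.retract_comp[OF y(3,4) S T ya h'(4) g'(2) y(3) h'(2)] e'(2) R.ident_right[OF y(3,4) ya] by metis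
    moreover have "Comp ?R ?a j = Zero ?R (asrc Y) T"
      using R.retract_comp[OF x(3,4) S T xa h'(3) g'(1) y(3) h'(2)] e'(4) R.comp_zero_right[OF y(3) x(3,4) xa]
        R.comp_zero_right[OF y(3) x(4) T g'(1)] by metis
    ultimately show ?thesis
      using R.comp_add_left[OF y(3) S T h'(2) a b] R.add_left_zero[OF y(3) T R.comp_in[OF y(3,4) T ya g'(2)]] by metis
  qed
  have rm: "Comp ?R r ?m = Comp ?R (amap X) p"
  proof -
    have "Comp ?R r ?a = Comp ?R (amap X) p"
      using R.comp_assoc[OF S x(4) T x(4) R.comp_in[OF S x(3,4) h'(3) xa] g'(1,3)] d'(1)
        R.ident_left[OF S x(4) R.comp_in[OF S x(3,4) h'(3) xa]] by metis
    moreover have "Comp ?R r ?b = Zero ?R S (atgt X)"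
      using R.comp_assoc[OF S y(4) T x(4) R.comp_in[OF S y(3,4) h'(4) ya] g'(2,3)] d'(4)
        R.comp_zero_left[OF S y(4) x(4) R.comp_in[OF S y(3,4) h'(4) ya]] by metis
    ultimately show ?thesis
      using R.comp_add_right[OF S T x(4) a b g'(3)] R.add_zero[OF S x(4) R.comp_in[OF S x(3,4) h'(3) xa]] by metis
  qed
  have sm: "Comp ?R s ?m = Comp ?R (amap Y) q"
  proof -
    have "Comp ?R s ?b = Comp ?R (amap Y) q"
      using R.comp_assoc[OF S y(4) T y(4) R.comp_in[OF S y(3,4) h'(4) ya] g'(2,4)] d'(2)
        R.ident_left[OF S y(4) R.comp_in[OF S y(3,4) h'(4) ya]] by metis
    moreover have "Comp ?R s ?a = Zero ?R S (atgt Y)"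
      using R.comp_assoc[OF S x(4) T y(4) R.comp_in[OF S x(3,4) h'(3) xa] g'(1,4)] d'(3)
        R.comp_zero_left[OF S x(4) y(4) R.comp_in[OF S x(3,4) h'(3) xa]] by metis
    ultimately show ?thesis
      using R.comp_add_right[OF S T y(4) a b g'(4)] R.add_left_zero[OF S y(4) R.comp_in[OF S y(3,4) h'(4) ya]] by metis
  qed
  have inj: "pointwise_injective Q S T ?m"
    unfolding pointwise_injective_def
  proof
    fix v assume v: "v \<in> verts Q"
    obtain A where A: "A \<in> fcar (rdim (asrc X) v) (rdim (atgt X) v)" "A * of_mat (amap X v) = fone (rdim (asrc X) v)"
      using x(6) v unfolding pointwise_injective_def by blast
    obtain B where B: "B \<in> fcar (rdim (asrc Y) v) (rdim (atgt Y) v)" "B * of_mat (amap Y v) = fone (rdim (asrc Y) v)"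
      using y(6) v unfolding pointwise_injective_def by blast
    note m' = m[unfolded rep_category_simps(2)]
    have 1: "of_mat (r v) * of_mat (?m v) = of_mat (amap X v) * of_mat (p v)"
      using rep_comp_dims[OF g(3) m' v] rep_comp_dims[OF x(5) h(3) v] rm by simp
    have 2: "of_mat (s v) * of_mat (?m v) = of_mat (amap Y v) * of_mat (q v)"
      using rep_comp_dims[OF g(4) m' v] rep_comp_dims[OF y(5) h(4) v] sm by simp
    let ?L = "of_mat (i v) * (A * of_mat (r v)) + of_mat (j v) * (B * of_mat (s v))"
    have "?L * of_mat (?m v) = of_mat (i v) * (A * (of_mat (r v) * of_mat (?m v))) + of_mat (j v) * (B * (of_mat (s v) * of_mat (?m v)))"
      by (simp only: distrib_right mult.assoc)
    also have "\<dots> = of_mat (i v) * ((A * of_mat (amap X v)) * of_mat (p v)) + of_mat (j v) * ((B * of_mat (amap Y v)) * of_mat (q v))"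
      by (simp only: 1 2 mult.assoc)
    also have "\<dots> = of_mat (i v) * of_mat (p v) + of_mat (j v) * of_mat (q v)"
      by (simp only: A(2) B(2) fone_left[OF rep_hom_fcar[OF h(3) v]] fone_left[OF rep_hom_fcar[OF h(4) v]])
    also have "\<dots> = fone (rdim S v)"
      using rep_add_at[OF rep_comp_in[OF wf S x(3) S h(3,1)] rep_comp_in[OF wf S y(3) S h(4,2)] v] e(5)
        rep_comp_dims[OF h(1,3) v] rep_comp_dims[OF h(2,4) v] rep_ident_at[OF v, of S] by simp
    finally show "\<exists>L \<in> fcar (rdim S v) (rdim T v). L * of_mat (?m v) = fone (rdim S v)"
      using fcar_add[OF fcar_times[OF rep_hom_fcar[OF h(1) v] fcar_times[OF A(1) rep_hom_fcar[OF g(3) v]]]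
          fcar_times[OF rep_hom_fcar[OF h(2) v] fcar_times[OF B(1) rep_hom_fcar[OF g(4) v]]]] by blast
  qed
  let ?S = "\<lparr>asrc = S, atgt = T, amap = ?m\<rparr>"
  have SO: "?S \<in> Ob ?C" using SP TP m inj by (simp add: mono_Ob_iff)
  have hom: "(i, k) \<in> Hom ?C X ?S" "(j, l) \<in> Hom ?C Y ?S" "(p, r) \<in> Hom ?C ?S X" "(q, s) \<in> Hom ?C ?S Y"
    using h g mi mj rm sm by (simp_all add: mono_Hom_iff)
  have one: "Add ?C (Comp ?C (i, k) (p, r)) (Comp ?C (j, l) (q, s)) = Ident ?C ?S" using e(5) d(5) by simp
  have "?S \<in> Ob (H_category Q)"
    unfolding H_Ob_iff[OF SO]
  proof (intro ballI impI)
    fix B f assume B: "B \<in> Ob ?C" and z: "zero_object ?R (asrc B)" and f: "f \<in> Hom ?C ?S B"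
    have "Comp ?C f (i, k) = Zero ?C X B"
      using XH[unfolded H_Ob_iff[OF X]] B z C.comp_in[OF X SO B hom(1) f] by blast
    then have f1: "Comp ?C f (Comp ?C (i, k) (p, r)) = Zero ?C ?S B"
      using C.comp_assoc[OF SO X SO B hom(3,1) f] C.comp_zero_left[OF SO X B hom(3)] by metis
    have "Comp ?C f (j, l) = Zero ?C Y B"
      using YH[unfolded H_Ob_iff[OF Y]] B z C.comp_in[OF Y SO B hom(2) f] by blast
    then have f2: "Comp ?C f (Comp ?C (j, l) (q, s)) = Zero ?C ?S B"
      using C.comp_assoc[OF SO Y SO B hom(4,2) f] C.comp_zero_left[OF SO Y B hom(4)] by metis
    have "f = Comp ?C f (Ident ?C ?S)" using C.ident_right[OF SO B f] by metis
    also have "\<dots> = Add ?C (Comp ?C f (Comp ?C (i, k) (p, r))) (Comp ?C f (Comp ?C (j, l) (q, s)))"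
      unfolding one[symmetric] by (rule C.comp_add_right[OF SO SO B C.comp_in[OF SO X SO hom(3,1)] C.comp_in[OF SO Y SO hom(4,2)] f])
    also have "\<dots> = Zero ?C ?S B" unfolding f1 f2 by (rule C.add_zero[OF SO B C.zero_in[OF SO B]])
    finally show "f = Zero ?C ?S B" .
  qed
  then show "\<exists>S \<in> Ob (H_category Q). \<exists>i \<in> Hom ?C X S. \<exists>j \<in> Hom ?C Y S. \<exists>p \<in> Hom ?C S X. \<exists>q \<in> Hom ?C S Y.
      Comp ?C p i = Ident ?C X \<and> Comp ?C q j = Ident ?C Y \<and> Comp ?C q i = Zero ?C X Y \<and> Comp ?C p j = Zero ?C Y X"
    by (rule rev_bexI, intro rev_bexI[OF hom(1)] rev_bexI[OF hom(2)] rev_bexI[OF hom(3)] rev_bexI[OF hom(4)])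
      (use e d in simp)
qed

end

section \<open>A finite additive generator of \<open>\<H>\<close>\<close>

context graded_quiver
begin

text \<open>\<open>A\<close> is a projective resolution of \<open>X\<close>, with augmentation \<open>\<pi>\<close>.\<close>

definition presents :: "('k :: field, 'v, 'e) rep_arrow \<Rightarrow> ('k, 'v, 'e) representation \<Rightarrow> ('v \<Rightarrow> 'k mat) \<Rightarrow> bool" where
  "presents A X \<pi> \<longleftrightarrow> A \<in> Ob (MonoP Q) \<and> X \<in> Ob (Rep Q) \<and> \<pi> \<in> rep_homs Q (atgt A) X \<and>
     pointwise_surjective Q (atgt A) X \<pi> \<and> pointwise_exact Q (asrc A) (amap A) (atgt A) \<pi>"

lemma presentation_exists:
  assumes X: "X \<in> Ob (Rep Q)"
  obtains A \<pi> where "presents A X \<pi>"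
proof -
  obtain P p where P: "projective_object (Rep Q) P" "p \<in> rep_homs Q P X" "pointwise_surjective Q P X p"
    by (rule projective_cover_exists[OF X])
  have PO: "P \<in> Ob (Rep Q)" using P(1) by auto
  obtain K k where K: "K \<in> Ob (Rep Q)" "k \<in> rep_homs Q K P" "pointwise_injective Q K P k" "pointwise_exact Q K k P p"
    by (rule kernel_rep[OF wf PO X P(2)])
  have "presents \<lparr>asrc = K, atgt = P, amap = k\<rparr> X p"
    using P K X subrep_projective[OF K(1) P(1) K(2,3)] by (simp add: presents_def mono_Ob_iff)
  then show ?thesis by (rule that)
qed

lemma cokernel_presentation:
  assumes A: "A \<in> Ob (MonoP Q)"
  obtains X \<pi> where "presents A X \<pi>"
proof -
  note a = mono_ObD[OF A]
  obtain X \<pi> where X: "X \<in> Ob (Rep Q)" "\<pi> \<in> rep_homs Q (atgt A) X" "pointwise_surjective Q (atgt A) X \<pi>"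
    "pointwise_coexact Q (amap A) (atgt A) X \<pi>" by (rule cokernel_rep[OF wf a(3,4,5)])
  have "presents A X \<pi>"
    using A X pointwise_exact_cokernel[OF wf a(5,6) X(4)] by (simp add: presents_def)
  then show ?thesis by (rule that)
qed

lemma presents_kernel:
  assumes "presents A X \<pi>"
  shows "kernel_of (Rep Q) (atgt A) X \<pi> (asrc A) (amap A)"
proof -
  have A: "A \<in> Ob (MonoP Q)" using assms by (simp add: presents_def)
  note a = mono_ObD[OF A]
  show ?thesis
    by (rule kernel_of_pointwise[OF wf a(3,4) _ a(5) _ a(6)]) (use assms in \<open>simp_all add: presents_def\<close>)
qed

text \<open>The comparison theorem for projective resolutions.\<close>

lemma lift_to_presentations:
  assumes A: "presents A X \<pi>" and B: "presents B Y \<rho>" and g: "g \<in> rep_homs Q X Y"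
  obtains h where "h \<in> Hom (MonoP Q) A B" "rep_comp Q \<rho> (snd h) = rep_comp Q g \<pi>"
proof -
  let ?R = "Rep Q"
  interpret R: lincat ?R by (rule lincat_rep_category[OF wf])
  note assoc = R.comp_assoc[unfolded rep_category_simps(2,3)]
  have AO: "A \<in> Ob (MonoP Q)" and X: "X \<in> Ob ?R" and \<pi>: "\<pi> \<in> rep_homs Q (atgt A) X"
    using A by (simp_all add: presents_def)
  have BO: "B \<in> Ob (MonoP Q)" and Y: "Y \<in> Ob ?R" and \<rho>: "\<rho> \<in> rep_homs Q (atgt B) Y" "pointwise_surjective Q (atgt B) Y \<rho>"
    using B by (simp_all add: presents_def)
  note a = mono_ObD[OF AO] and b = mono_ObD[OF BO]
  have g\<pi>: "rep_comp Q g \<pi> \<in> rep_homs Q (atgt A) Y" by (rule rep_comp_in[OF wf a(4) X Y \<pi> g])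
  obtain h where h: "h \<in> rep_homs Q (atgt A) (atgt B)" "rep_comp Q \<rho> h = rep_comp Q g \<pi>"
    by (rule lift_projective[OF a(2) b(4) Y \<rho> g\<pi>])
  have ha: "rep_comp Q h (amap A) \<in> rep_homs Q (asrc A) (atgt B)" by (rule rep_comp_in[OF wf a(3,4) b(4) a(5) h(1)])
  have "rep_comp Q \<rho> (rep_comp Q h (amap A)) = rep_comp Q g (rep_comp Q \<pi> (amap A))"
    using assoc[OF a(3,4) b(4) Y a(5) h(1) \<rho>(1)] assoc[OF a(3,4) X Y a(5) \<pi> g] h(2) by simp
  also have "rep_comp Q \<pi> (amap A) = Zero ?R (asrc A) X" using presents_kernel[OF A] by (simp add: kernel_of_def)
  also have "rep_comp Q g \<dots> = Zero ?R (asrc A) Y" using R.comp_zero_right[OF a(3) X Y] g by simp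
  finally have "\<exists>u \<in> rep_homs Q (asrc A) (asrc B). rep_comp Q (amap B) u = rep_comp Q h (amap A)"
    using presents_kernel[OF B] a(3) ha unfolding kernel_of_def rep_category_simps(2,3) by blast
  then obtain u where u: "u \<in> rep_homs Q (asrc A) (asrc B)" "rep_comp Q (amap B) u = rep_comp Q h (amap A)" by blast
  show ?thesis by (rule that[of "(u, h)"]) (use h u in \<open>simp_all add: mono_Hom_iff\<close>)
qed

lemma lift_through_presentations:
  fixes L :: "('k :: field, 'v, 'e) representation set"
  assumes f: "through (Rep Q) L X Y f" and L: "L \<subseteq> Ob (Rep Q)"
    and res: "\<And>N. N \<in> L \<Longrightarrow> presents (res N) N (cov N)"
    and A: "presents A X \<pi>" and B: "presents B Y \<rho>"
  shows "\<exists>z. through (MonoP Q) (res ` L) A B z \<and> rep_comp Q \<rho> (snd z) = rep_comp Q f \<pi>"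
  using f
proof (induction rule: through.induct)
  let ?R = "Rep Q :: ('k, ('k, 'v, 'e) representation, 'v \<Rightarrow> 'k mat) linear_category"
  let ?C = "MonoP Q :: ('k, ('k, 'v, 'e) rep_arrow, _) linear_category"
  interpret R: lincat ?R by (rule lincat_rep_category[OF wf])
  interpret C: lincat ?C by (rule lincat_mono_proj_category[OF wf])
  have AO: "A \<in> Ob ?C" and X: "X \<in> Ob ?R" and \<pi>: "\<pi> \<in> Hom ?R (atgt A) X"
    using A by (simp_all add: presents_def)
  have BO: "B \<in> Ob ?C" and Y: "Y \<in> Ob ?R" and \<rho>: "\<rho> \<in> Hom ?R (atgt B) Y" using B by (simp_all add: presents_def)
  note a = mono_ObD[OF AO] and b = mono_ObD[OF BO]
  {
    case through_zero
    have "rep_comp Q \<rho> (snd (Zero ?C A B)) = rep_comp Q (Zero ?R X Y) \<pi>"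
      using R.comp_zero_right[OF a(4) b(4) Y \<rho>] R.comp_zero_left[OF a(4) X Y \<pi>] by simp
    then show ?case by (intro exI[of _ "Zero ?C A B"] conjI through.through_zero)
  next
    case (through_step f N \<beta> \<alpha>)
    then obtain z where z: "through ?C (res ` L) A B z" "rep_comp Q \<rho> (snd z) = rep_comp Q f \<pi>" by blast
    have N: "N \<in> L" "N \<in> Ob ?R" using through_step.hyps(2) subsetD[OF L through_step.hyps(2)] .
    note \<beta>' = through_step.hyps(3) and \<alpha>' = through_step.hyps(4)
    note P = res[OF N(1)]
    have PO: "res N \<in> Ob ?C" and p: "cov N \<in> Hom ?R (atgt (res N)) N" using P by (simp_all add: presents_def)
    note po = mono_ObD[OF PO]
    obtain u where u: "u \<in> Hom ?C A (res N)" "rep_comp Q (cov N) (snd u) = rep_comp Q \<beta> \<pi>"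
      using lift_to_presentations[OF A P] \<beta>' by auto
    obtain w where w: "w \<in> Hom ?C (res N) B" "rep_comp Q \<rho> (snd w) = rep_comp Q \<alpha> (cov N)"
      using lift_to_presentations[OF P B] \<alpha>' by auto
    have f: "f \<in> Hom ?R X Y" by (rule R.through_in[OF through_step.hyps(1) X Y L])
    have resL: "res ` L \<subseteq> Ob ?C" using res by (auto simp: presents_def)
    have zin: "z \<in> Hom ?C A B" by (rule C.through_in[OF z(1) AO BO resL])
    have u2: "snd u \<in> Hom ?R (atgt A) (atgt (res N))" and w2: "snd w \<in> Hom ?R (atgt (res N)) (atgt B)"
      and z2: "snd z \<in> Hom ?R (atgt A) (atgt B)"
      using u(1) w(1) zin by (simp_all add: mono_Hom_iff)
    have wu: "Comp ?R (snd w) (snd u) \<in> Hom ?R (atgt A) (atgt B)" by (rule R.comp_in[OF a(4) po(4) b(4) u2 w2])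
    have "Comp ?R \<rho> (Comp ?R (snd w) (snd u)) = Comp ?R (Comp ?R \<rho> (snd w)) (snd u)"
      by (rule R.comp_assoc[OF a(4) po(4) b(4) Y u2 w2 \<rho>, symmetric])
    also have "\<dots> = Comp ?R \<alpha> (Comp ?R (cov N) (snd u))"
      using R.comp_assoc[OF a(4) po(4) N(2) Y u2 p \<alpha>'] w(2) by simp
    also have "\<dots> = Comp ?R (Comp ?R \<alpha> \<beta>) \<pi>"
      using R.comp_assoc[OF a(4) X N(2) Y \<pi> \<beta>' \<alpha>'] u(2) by simp
    finally have "Comp ?R \<rho> (snd (Add ?C (Comp ?C w u) z)) = Comp ?R (Add ?R (Comp ?R \<alpha> \<beta>) f) \<pi>"
      using R.comp_add_right[OF a(4) b(4) Y wu z2 \<rho>] R.comp_add_left[OF a(4) X Y \<pi> R.comp_in[OF X N(2) Y \<beta>' \<alpha>'] f] z(2)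
      by simp
    then show ?case
      using through.through_step[OF z(1) imageI[OF N(1)] u(1) w(1)] by (intro exI[of _ "Add ?C (Comp ?C w u) z"]) simp
  }
qed

text \<open>These objects are the contractible resolutions.\<close>

definition identity_arrow :: "('k :: field, 'v, 'e) representation \<Rightarrow> ('k, 'v, 'e) rep_arrow" where
  "identity_arrow P = \<lparr>asrc = P, atgt = P, amap = Ident (Rep Q) P\<rparr>"

lemma identity_arrow_simps [simp]: "asrc (identity_arrow P) = P" "atgt (identity_arrow P) = P"
  "amap (identity_arrow P) = Ident (Rep Q) P"
  by (simp_all add: identity_arrow_def)

lemma identity_arrow_Ob:
  assumes P: "projective_object (Rep Q) P"
  shows "identity_arrow P \<in> Ob (MonoP Q)"
proof -
  have PO: "P \<in> Ob (Rep Q)" using P by auto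
  have "pointwise_injective Q P P (Ident (Rep Q) P)"
    unfolding pointwise_injective_def using rep_ident_at fone_idem fone_fcar by metis
  then show ?thesis using P rep_Ident_in[OF wf PO] by (simp add: mono_Ob_iff)
qed

lemma identity_arrow_hom:
  assumes "P \<in> Ob (Rep Q)" "P' \<in> Ob (Rep Q)" "f \<in> rep_homs Q P P'"
  shows "(f, f) \<in> Hom (MonoP Q) (identity_arrow P) (identity_arrow P')"
proof -
  interpret R: lincat "Rep Q" by (rule lincat_rep_category[OF wf])
  show ?thesis
    using assms R.ident_left[OF assms(1,2)] R.ident_right[OF assms(1,2)] by (simp add: mono_Hom_iff)
qed

text \<open>For projective \<open>X\<close> a map from \<open>X\<close> to \<open>N\<close> lifts to the projective cover of \<open>N\<close>.\<close>

lemma through_identity_arrows: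
  fixes L :: "('k :: field, 'v, 'e) representation set"
  assumes f: "through (Rep Q) L X Y f" and L: "L \<subseteq> Ob (Rep Q)"
    and res: "\<And>N. N \<in> L \<Longrightarrow> presents (res N) N (cov N)"
    and X: "projective_object (Rep Q) X" and Y: "projective_object (Rep Q) Y"
  shows "through (MonoP Q) ((\<lambda>N. identity_arrow (atgt (res N))) ` L) (identity_arrow X) (identity_arrow Y) (f, f)"
  using f
proof (induction rule: through.induct)
  let ?R = "Rep Q :: ('k, ('k, 'v, 'e) representation, 'v \<Rightarrow> 'k mat) linear_category"
  let ?C = "MonoP Q :: ('k, ('k, 'v, 'e) rep_arrow, _) linear_category"
  interpret R: lincat ?R by (rule lincat_rep_category[OF wf])
  have XO: "X \<in> Ob ?R" and YO: "Y \<in> Ob ?R" using X Y by auto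
  {
    case through_zero
    show ?case using through.through_zero[of ?C _ "identity_arrow X" "identity_arrow Y"] by simp
  next
    case (through_step f N \<beta> \<alpha>)
    have N: "N \<in> L" "N \<in> Ob ?R" using through_step.hyps(2) subsetD[OF L through_step.hyps(2)] .
    note P = res[OF N(1)]
    have PO: "res N \<in> Ob ?C" and p: "cov N \<in> rep_homs Q (atgt (res N)) N" "pointwise_surjective Q (atgt (res N)) N (cov N)"
      using P by (simp_all add: presents_def)
    note po = mono_ObD[OF PO]
    have \<beta>: "\<beta> \<in> rep_homs Q X N" and \<alpha>: "\<alpha> \<in> rep_homs Q N Y" using through_step.hyps by simp_all
    obtain b where b: "b \<in> rep_homs Q X (atgt (res N))" "rep_comp Q (cov N) b = \<beta>"
      by (rule lift_projective[OF X po(4) N(2) p \<beta>])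
    let ?a = "rep_comp Q \<alpha> (cov N)"
    have a: "?a \<in> rep_homs Q (atgt (res N)) Y" by (rule rep_comp_in[OF wf po(4) N(2) YO p(1) \<alpha>])
    have ab: "rep_comp Q ?a b = rep_comp Q \<alpha> \<beta>"
      using R.comp_assoc[OF XO po(4) N(2) YO] b p(1) \<alpha> by simp
    show ?case
      using through.through_step[OF through_step.IH imageI[OF N(1)] identity_arrow_hom[OF XO po(4) b(1)] identity_arrow_hom[OF po(4) YO a]] ab
      by simp
  }
qed

text \<open>The endomorphism \<open>z\<close> that lifts the decomposition of the identity of the cokernel induces the
  identity there.  So \<open>1 - z\<close> is null-homotopic: its second component is \<open>\<iota> s\<close> for some
  \<open>s : Q \<rightarrow> P\<close>, and it factors through the identity of \<open>Q\<close> as \<open>(\<iota>, 1)\<close> followed by \<open>(s, \<iota> s)\<close>.\<close>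

lemma mono_generated:
  fixes L :: "('k :: field, 'v, 'e) representation set"
  assumes L: "L \<subseteq> Ob (Rep Q)"
    and gen: "\<And>M. M \<in> Ob (Rep Q) \<Longrightarrow> through (Rep Q) L M M (Ident (Rep Q) M)"
    and res: "\<And>N. N \<in> L \<Longrightarrow> presents (res N) N (cov N)"
    and A: "A \<in> Ob (MonoP Q)"
  shows "through (MonoP Q) (res ` L \<union> (\<lambda>N. identity_arrow (atgt (res N))) ` L) A A (Ident (MonoP Q) A)"
proof -
  let ?R = "Rep Q :: ('k, ('k, 'v, 'e) representation, 'v \<Rightarrow> 'k mat) linear_category"
  let ?C = "MonoP Q :: ('k, ('k, 'v, 'e) rep_arrow, _) linear_category"
  let ?I = "(\<lambda>N. identity_arrow (atgt (res N))) ` L"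
  interpret R: lincat ?R by (rule lincat_rep_category[OF wf])
  interpret C: lincat ?C by (rule lincat_mono_proj_category[OF wf])
  note a = mono_ObD[OF A]
  have GO: "res ` L \<union> ?I \<subseteq> Ob ?C" (is "?G \<subseteq> _")
    using res by (auto simp: presents_def dest: mono_ObD(2) intro!: identity_arrow_Ob)
  obtain M \<pi> where \<pi>: "presents A M \<pi>" by (rule cokernel_presentation[OF A])
  then have M: "M \<in> Ob ?R" and \<pi>': "\<pi> \<in> Hom ?R (atgt A) M" by (simp_all add: presents_def)
  obtain z where z: "through ?C (res ` L) A A z" "rep_comp Q \<pi> (snd z) = rep_comp Q (Ident ?R M) \<pi>"
    using lift_through_presentations[OF gen[OF M] L res \<pi> \<pi>] by blast
  have zin: "z \<in> Hom ?C A A" by (rule C.through_in[OF z(1) A A]) (use GO in blast)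
  have \<pi>z: "Comp ?R \<pi> (snd z) = \<pi>" using z(2) R.ident_left[OF a(4) M \<pi>'] by simp
  note z' = mono_HomD[OF zin, folded rep_category_simps(2)]
  let ?w = "Add ?C (Ident ?C A) (Smult ?C (- 1) z)"
  have w: "?w \<in> Hom ?C A A" by (intro C.add_in C.ident_in C.smult_in A zin)
  note w' = mono_HomD[OF w, folded rep_category_simps(2)]
  note one = R.ident_in[OF a(4)]
  have "Comp ?R \<pi> (snd ?w) = Add ?R (Comp ?R \<pi> (Ident ?R (atgt A))) (Comp ?R \<pi> (Smult ?R (- 1) (snd z)))"
    unfolding mono_simps snd_conv by (rule R.comp_add_right[OF a(4,4) M one R.smult_in[OF a(4,4) z'(2)] \<pi>'])
  also have "\<dots> = Add ?R \<pi> (Smult ?R (- 1) \<pi>)"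
    using R.ident_right[OF a(4) M \<pi>'] R.smult_right[OF a(4,4) M z'(2) \<pi>'] \<pi>z by metis
  also have "\<dots> = Zero ?R (atgt A) M" by (rule R.add_neg[OF a(4) M \<pi>'])
  finally have "\<exists>s \<in> Hom ?R (atgt A) (asrc A). Comp ?R (amap A) s = snd ?w"
    using presents_kernel[OF \<pi>] a(4) w'(2) unfolding kernel_of_def by blast
  then obtain s where s: "s \<in> rep_homs Q (atgt A) (asrc A)" "rep_comp Q (amap A) s = snd ?w" by (elim bexE) simp
  have "fst ?w = rep_comp Q s (amap A)"
  proof (rule pointwise_injective_cancel[OF wf a(3,3,4,5,6)])
    show "fst ?w \<in> rep_homs Q (asrc A) (asrc A)" using w by (rule mono_HomD(1))
    show "rep_comp Q s (amap A) \<in> rep_homs Q (asrc A) (asrc A)" by (rule rep_comp_in[OF wf a(3,4,3,5) s(1)])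
    have "rep_comp Q (amap A) (fst ?w) = rep_comp Q (snd ?w) (amap A)" using mono_HomD(3)[OF w] by (rule sym)
    also have "\<dots> = rep_comp Q (rep_comp Q (amap A) s) (amap A)" by (simp only: s(2))
    also have "\<dots> = rep_comp Q (amap A) (rep_comp Q s (amap A))"
      using R.comp_assoc[OF a(3,4,3,4)] a(5) s(1) by simp
    finally show "rep_comp Q (amap A) (fst ?w) = rep_comp Q (amap A) (rep_comp Q s (amap A))" .
  qed
  let ?D = "identity_arrow (atgt A)"
  have D: "?D \<in> Ob ?C" by (rule identity_arrow_Ob[OF a(2)])
  have b: "(amap A, Ident ?R (atgt A)) \<in> Hom ?C A ?D"
    using a(5) rep_Ident_in[OF wf a(4)] by (simp add: mono_Hom_iff)
  have c: "(s, snd ?w) \<in> Hom ?C ?D A"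
    using s mono_HomD(2)[OF w] R.ident_right[OF a(4,4)] by (simp add: mono_Hom_iff)
  have "through ?C ?I ?D ?D (Ident ?C ?D)"
    using through_identity_arrows[OF gen[OF a(4)] L res a(2,2)] by simp
  then have "through ?C ?I A ?D (Comp ?C (Ident ?C ?D) (amap A, Ident ?R (atgt A)))"
    by (rule C.through_comp_right[OF _ b A D D]) (use GO in blast)
  then have "through ?C ?I A ?D (amap A, Ident ?R (atgt A))"
    using C.ident_left[OF A D b] by (simp del: mono_simps)
  then have "through ?C ?I A A (Comp ?C (s, snd ?w) (amap A, Ident ?R (atgt A)))"
    by (rule C.through_comp_left[OF _ c A D A]) (use GO in blast)
  moreover have "Comp ?C (s, snd ?w) (amap A, Ident ?R (atgt A)) = ?w"
  proof -
    have "Comp ?R (snd ?w) (Ident ?R (atgt A)) = snd ?w" by (rule R.ident_right[OF a(4,4) w'(2)])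
    then show ?thesis
      using \<open>fst ?w = rep_comp Q s (amap A)\<close> by (simp only: mono_simps(1) rep_category_simps(3) fst_conv snd_conv prod.collapse flip: \<open>fst ?w = rep_comp Q s (amap A)\<close>)
  qed
  ultimately have tw: "through ?C ?G A A ?w" using through_mono[of ?C ?I A A ?w ?G] by simp
  have "through ?C ?G A A (Add ?C z ?w)"
    by (rule C.through_add[OF through_mono[OF z(1)] tw A A GO]) blast
  also have "Add ?C z ?w = Ident ?C A" by (rule C.sub_cancel[OF A A C.ident_in[OF A] zin])
  finally show ?thesis .
qed

text \<open>Replace each generator by its \<open>\<H>\<close>-part, through which all maps from \<open>\<H>\<close> factor.\<close>

lemma H_through:
  assumes G: "G \<subseteq> Ob (MonoP Q)"
    and part: "\<And>K. K \<in> G \<Longrightarrow> pt K \<in> Ob (H_category Q)"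
      "\<And>K. K \<in> G \<Longrightarrow> j K \<in> Hom (MonoP Q) (pt K) K"
      "\<And>K. K \<in> G \<Longrightarrow> q K \<in> Hom (MonoP Q) K (pt K)"
      "\<And>K T u. K \<in> G \<Longrightarrow> T \<in> Ob (H_category Q) \<Longrightarrow> u \<in> Hom (MonoP Q) T K \<Longrightarrow>
         Comp (MonoP Q) (j K) (Comp (MonoP Q) (q K) u) = u"
    and X: "X \<in> Ob (H_category Q)" and Y: "Y \<in> Ob (MonoP Q)"
    and f: "through (MonoP Q) G X Y f"
  shows "through (H_category Q) (pt ` G) X Y f"
  using f
proof (induction rule: through.induct)
  case through_zero
  show ?case using through.through_zero[of "H_category Q" "pt ` G" X Y] by (simp del: mono_simps)
next
  case (through_step f K b a)
  let ?C = "MonoP Q"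
  interpret C: lincat ?C by (rule lincat_mono_proj_category[OF wf])
  note K = through_step.hyps(2) and b = through_step.hyps(3) and a = through_step.hyps(4)
  have KO: "K \<in> Ob ?C" using K G by blast
  note XO = H_ObD[OF X] and PO = H_ObD[OF part(1)[OF K]]
  have qb: "Comp ?C (q K) b \<in> Hom ?C X (pt K)" by (rule C.comp_in[OF XO KO PO b part(3)[OF K]])
  have aj: "Comp ?C a (j K) \<in> Hom ?C (pt K) Y" by (rule C.comp_in[OF PO KO Y part(2)[OF K] a])
  have "Comp ?C (Comp ?C a (j K)) (Comp ?C (q K) b) = Comp ?C a b"
    using C.comp_assoc[OF XO PO KO Y qb part(2)[OF K] a] part(4)[OF K X b] by (simp del: mono_simps)
  then show ?case
    using through.through_step[OF through_step.IH imageI[OF K], unfolded H_simps, OF qb aj] by (simp del: mono_simps)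
qed

end

context definite_quiver
begin

theorem H_finitely_generated:
  "\<exists>G :: ('k :: field, 'v, 'e) rep_arrow set. finite G \<and> G \<subseteq> Ob (H_category Q) \<and>
     (\<forall>X \<in> Ob (H_category Q). through (H_category Q) G X X (Ident (H_category Q) X))"
proof -
  let ?C = "MonoP Q :: ('k, ('k, 'v, 'e) rep_arrow, _) linear_category"
  obtain L :: "('k, 'v, 'e) representation set" where L: "finite L" "L \<subseteq> Ob (Rep Q)"
    "\<And>M. M \<in> Ob (Rep Q) \<Longrightarrow> through (Rep Q) L M M (Ident (Rep Q) M)"
    using finite_type by blast
  have "\<exists>A \<pi>. presents A N \<pi>" if "N \<in> L" for N
    using presentation_exists[of N] L(2) that by blast
  then obtain res cov where res: "\<And>N. N \<in> L \<Longrightarrow> presents (res N) N (cov N)" by metis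
  let ?G = "res ` L \<union> (\<lambda>N. identity_arrow (atgt (res N))) ` L"
  have G: "?G \<subseteq> Ob ?C"
    using res by (auto simp: presents_def dest: mono_ObD(2) intro!: identity_arrow_Ob)
  define \<Phi> where "\<Phi> K t \<longleftrightarrow> fst t \<in> Ob (H_category Q) \<and> fst (snd t) \<in> Hom ?C (fst t) K \<and> snd (snd t) \<in> Hom ?C K (fst t) \<and>
      (\<forall>T u. T \<in> Ob (H_category Q) \<longrightarrow> u \<in> Hom ?C T K \<longrightarrow> Comp ?C (fst (snd t)) (Comp ?C (snd (snd t)) u) = u)" for K t
  have "\<exists>t. \<Phi> K t" if "K \<in> ?G" for K
  proof (rule H_part[OF subsetD[OF G that]])
    fix K' j q
    assume "K' \<in> Ob (H_category Q)" "j \<in> Hom ?C K' K" "q \<in> Hom ?C K K'"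
      "\<And>T u. T \<in> Ob (H_category Q) \<Longrightarrow> u \<in> Hom ?C T K \<Longrightarrow> Comp ?C j (Comp ?C q u) = u"
    then show ?thesis unfolding \<Phi>_def by (intro exI[of _ "(K', j, q)"]) (simp del: mono_simps)
  qed
  then obtain t where t: "\<And>K. K \<in> ?G \<Longrightarrow> \<Phi> K (t K)" by metis
  define pt j q where "pt K = fst (t K)" and "j K = fst (snd (t K))" and "q K = snd (snd (t K))" for K
  have part: "pt K \<in> Ob (H_category Q)" "j K \<in> Hom ?C (pt K) K" "q K \<in> Hom ?C K (pt K)"
    "\<And>T u. T \<in> Ob (H_category Q) \<Longrightarrow> u \<in> Hom ?C T K \<Longrightarrow> Comp ?C (j K) (Comp ?C (q K) u) = u" if "K \<in> ?G" for K
    using t[OF that] unfolding \<Phi>_def pt_def j_def q_def by blast+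
  have "through (H_category Q) (pt ` ?G) X X (Ident (H_category Q) X)" if X: "X \<in> Ob (H_category Q)" for X
    unfolding H_simps
    by (rule H_through[OF G part X H_ObD[OF X] mono_generated[OF L(2,3) res H_ObD[OF X]]])
  moreover have "finite (pt ` ?G)" using L(1) by simp
  moreover have "pt ` ?G \<subseteq> Ob (H_category Q)" using part(1) by blast
  ultimately show ?thesis by blast
qed

end

section \<open>Coordinates on Hom spaces\<close>

text \<open>Induction on the support: a vector that does not vanish at the new point, if there is one,
  extends a basis of those that do.\<close>

lemma subspace_coordinates:
  fixes W :: "('a \<Rightarrow> 'k :: field) set"
  assumes "finite S" "(\<lambda>_. 0) \<in> W"
    and "\<And>f g. f \<in> W \<Longrightarrow> g \<in> W \<Longrightarrow> (\<lambda>x. f x + g x) \<in> W" "\<And>c f. f \<in> W \<Longrightarrow> (\<lambda>x. c * f x) \<in> W"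
    and "\<And>f x. f \<in> W \<Longrightarrow> x \<notin> S \<Longrightarrow> f x = 0"
  shows "\<exists>n B. bij_betw (\<lambda>v :: 'k vec. \<lambda>x. \<Sum>i<n. v $ i * B i x) (carrier_vec n) W"
  using assms
proof (induction S arbitrary: W rule: finite_induct)
  case empty
  have "W = {\<lambda>_. 0}" using empty.prems(1,4) by (auto simp: fun_eq_iff)
  moreover have "carrier_vec 0 = {vNil :: 'k vec}" by auto
  ultimately show ?case by (intro exI[of _ 0]) (simp add: bij_betw_def)
next
  case (insert s S)
  let ?W0 = "{f \<in> W. f s = 0}"
  have "\<exists>n B. bij_betw (\<lambda>v :: 'k vec. \<lambda>x. \<Sum>i<n. v $ i * B i x) (carrier_vec n) ?W0"
  proof (rule insert.IH)
    show "f x = 0" if "f \<in> ?W0" "x \<notin> S" for f x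
      using insert.prems(4)[of f x] that by (cases "x = s") auto
  qed (use insert.prems in auto)
  then obtain n and B :: "nat \<Rightarrow> 'a \<Rightarrow> 'k" where B: "bij_betw (\<lambda>v :: 'k vec. \<lambda>x. \<Sum>i<n. v $ i * B i x) (carrier_vec n) ?W0" by blast
  show ?case
  proof (cases "\<exists>g \<in> W. g s \<noteq> 0")
    case False
    then have "?W0 = W" by blast
    then show ?thesis using B by metis
  next
    case True
    then obtain g0 where g0: "g0 \<in> W" "g0 s \<noteq> 0" by blast
    define g where "g x = inverse (g0 s) * g0 x" for x
    have g: "g \<in> W" "g s = 1" using insert.prems(3)[OF g0(1), of "inverse (g0 s)"] g0(2) by (simp_all add: g_def[abs_def])
    define B' where "B' i = (if i = n then g else B i)" for i
    let ?b = "\<lambda>v :: 'k vec. \<lambda>x. \<Sum>i<n. v $ i * B i x"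
    define b' where "b' v = (\<lambda>x. \<Sum>i<Suc n. v $ i * B' i x)" for v :: "'k vec"
    have b': "b' v = (\<lambda>x. ?b (vec n (($) v)) x + v $ n * g x)" for v by (simp add: b'_def B'_def)
    have bW: "?b v \<in> W" "?b v s = 0" if "v \<in> carrier_vec n" for v
      using bij_betwE[OF B] that by blast+
    have b's: "b' v s = v $ n" for v
      using bW(2)[of "vec n (($) v)"] by (simp add: b' g(2) del: index_vec)
    have "bij_betw b' (carrier_vec (Suc n)) W"
      unfolding bij_betw_def
    proof (intro conjI inj_onI subset_antisym image_subsetI subsetI)
      fix v w :: "'k vec" assume v: "v \<in> carrier_vec (Suc n)" and w: "w \<in> carrier_vec (Suc n)" and eq: "b' v = b' w"
      have last: "v $ n = w $ n" using fun_cong[OF eq, of s] by (simp only: b's)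
      have "?b (vec n (($) v)) = ?b (vec n (($) w))"
      proof
        fix x
        show "?b (vec n (($) v)) x = ?b (vec n (($) w)) x" using fun_cong[OF eq, of x] last unfolding b' by (simp del: index_vec)
      qed
      then have init: "vec n (($) v) = vec n (($) w)"
        using inj_onD[OF bij_betw_imp_inj_on[OF B], of "vec n (($) v)" "vec n (($) w)"] by simp
      have init: "v $ i = w $ i" if "i < n" for i using arg_cong[OF init, of "\<lambda>u. u $ i"] that by simp
      show "v = w"
      proof (rule eq_vecI)
        show "v $ i = w $ i" if "i < dim_vec w" for i
          using init[of i] last that w by (cases "i = n") auto
      qed (use v w in simp)
    next
      fix v :: "'k vec"
      show "b' v \<in> W" unfolding b' using bW(1)[of "vec n (($) v)"] g(1) insert.prems(2,3) by simp
    next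
      fix f assume f: "f \<in> W"
      let ?f = "\<lambda>x. f x + - f s * g x"
      have "?f \<in> W" by (rule insert.prems(2)[OF f insert.prems(3)[OF g(1)]])
      then have "?f \<in> ?W0" using g(2) by simp
      then have "?f \<in> ?b ` carrier_vec n" using B unfolding bij_betw_def by blast
      then obtain v where v: "v \<in> carrier_vec n" "?f = ?b v" by blast
      let ?v = "vec (Suc n) (\<lambda>i. if i = n then f s else v $ i)"
      have "b' ?v x = f x" for x
      proof -
        have "b' ?v x = ?b v x + f s * g x" by (simp add: b'_def B'_def)
        also have "?b v x = ?f x" by (rule fun_cong[OF v(2)[symmetric]])
        finally show ?thesis by simp
      qed
      then show "f \<in> b' ` carrier_vec (Suc n)" by (intro image_eqI[of _ _ ?v]) auto
    qed
    then show ?thesis unfolding b'_def by blast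
  qed
qed

context graded_quiver
begin

text \<open>All matrix entries of both components, as one function; it embeds each Hom space linearly into
  functions of finite support.\<close>

definition entries :: "('v \<Rightarrow> 'k :: field mat) \<times> ('v \<Rightarrow> 'k mat) \<Rightarrow> bool \<times> 'v \<times> nat \<times> nat \<Rightarrow> 'k" where
  "entries f = (\<lambda>(t, v, i, j). if v \<in> verts Q then ent (of_mat ((if t then snd f else fst f) v)) i j else 0)"

lemma entries_inj: "inj_on entries (Hom (MonoP Q) Y X)"
proof (rule inj_onI)
  fix f g assume f: "f \<in> Hom (MonoP Q) Y X" and g: "g \<in> Hom (MonoP Q) Y X"
    and eq: "entries f = entries g"
  note f' = mono_HomD[OF f] and g' = mono_HomD[OF g]
  have "fst f = fst g"
  proof (rule rep_hom_eqI[OF f'(1) g'(1)], rule fmat_eqI)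
    fix v i j assume "v \<in> verts Q"
    then show "ent (of_mat (fst f v)) i j = ent (of_mat (fst g v)) i j"
      using fun_cong[OF eq, of "(False, v, i, j)"] by (simp add: entries_def)
  qed
  moreover have "snd f = snd g"
  proof (rule rep_hom_eqI[OF f'(2) g'(2)], rule fmat_eqI)
    fix v i j assume "v \<in> verts Q"
    then show "ent (of_mat (snd f v)) i j = ent (of_mat (snd g v)) i j"
      using fun_cong[OF eq, of "(True, v, i, j)"] by (simp add: entries_def)
  qed
  ultimately show "f = g" by (rule prod_eqI)
qed

lemma rep_smult_at: "v \<in> verts Q \<Longrightarrow> of_mat (Smult (Rep Q) c f v) = fscale c (of_mat (f v))"
  by (simp add: rep_category_simps(7) of_mat_smult)

lemma entries_linear:
  "f \<in> Hom (MonoP Q) Y X \<Longrightarrow> g \<in> Hom (MonoP Q) Y X \<Longrightarrow>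
     entries (Add (MonoP Q) f g) = (\<lambda>x. entries f x + entries g x)"
  "entries (Smult (MonoP Q) c f) = (\<lambda>x. c * entries f x)"
  "entries (Zero (MonoP Q) Y X) = (\<lambda>_. 0)"
proof -
  show "entries (Add (MonoP Q) f g) = (\<lambda>x. entries f x + entries g x)"
    if f: "f \<in> Hom (MonoP Q) Y X" and g: "g \<in> Hom (MonoP Q) Y X"
    by (auto simp: entries_def fun_eq_iff rep_add_at[OF mono_HomD(1)[OF f] mono_HomD(1)[OF g]]
        rep_add_at[OF mono_HomD(2)[OF f] mono_HomD(2)[OF g]])
qed (auto simp: entries_def fun_eq_iff rep_smult_at)

lemma entries_support:
  assumes Y: "Y \<in> Ob (MonoP Q)" and X: "X \<in> Ob (MonoP Q)"
  shows "\<exists>S. finite S \<and> (\<forall>f \<in> Hom (MonoP Q) Y X. \<forall>x. x \<notin> S \<longrightarrow> entries f x = 0)"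
proof (intro exI conjI ballI allI impI)
  let ?d = "\<lambda>v. rdim (asrc X) v + rdim (atgt X) v + rdim (asrc Y) v + rdim (atgt Y) v"
  let ?S = "(UNIV :: bool set) \<times> (SIGMA v : verts Q. {..<?d v} \<times> {..<?d v})"
  show "finite ?S" using fin_verts by (intro finite_SigmaI finite_cartesian_product) auto
  fix f x assume f: "f \<in> Hom (MonoP Q) Y X" and x: "x \<notin> ?S"
  obtain t v i j where x': "x = (t, v, i, j)" by (cases x)
  show "entries f x = 0"
  proof (cases "v \<in> verts Q")
    case True
    then have "\<not> (i < ?d v \<and> j < ?d v)" using x x' by auto
    then show ?thesis
      using rep_hom_dims[OF mono_HomD(1)[OF f] True] rep_hom_dims[OF mono_HomD(2)[OF f] True]
      by (auto simp: entries_def x' ent_of_mat)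
  qed (simp add: entries_def x')
qed

lemma H_coordinates:
  assumes X: "X \<in> Ob (H_category Q)"
  shows "\<exists>n b. coordinates (H_category Q) X n b"
proof -
  let ?C = "MonoP Q"
  interpret C: lincat ?C by (rule lincat_mono_proj_category[OF wf])
  note XO = H_ObD[OF X]
  have "\<exists>n b. bij_betw b (carrier_vec n) (Hom ?C Y X) \<and>
      (\<forall>u \<in> carrier_vec n. \<forall>v \<in> carrier_vec n. b (u + v) = Add ?C (b u) (b v)) \<and>
      (\<forall>c. \<forall>u \<in> carrier_vec n. b (c \<cdot>\<^sub>v u) = Smult ?C c (b u))" (is "\<exists>n b. ?P n b")
    if YH: "Y \<in> Ob (H_category Q)" for Y
  proof -
    note Y = H_ObD[OF YH]
    let ?H = "Hom ?C Y X"
    obtain S where S: "finite S" "\<And>f x. f \<in> ?H \<Longrightarrow> x \<notin> S \<Longrightarrow> entries f x = 0"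
      using entries_support[OF Y XO] by blast
    have "\<exists>n B. bij_betw (\<lambda>v. \<lambda>x. \<Sum>i<n. v $ i * B i x) (carrier_vec n) (entries ` ?H)"
    proof (rule subspace_coordinates[OF S(1)])
      show "(\<lambda>_. 0) \<in> entries ` ?H"
        using C.zero_in[OF Y XO] by (intro image_eqI[of _ _ "Zero ?C Y X"]) (simp_all only: entries_linear)
      show "(\<lambda>x. f x + g x) \<in> entries ` ?H" if fH: "f \<in> entries ` ?H" and gH: "g \<in> entries ` ?H" for f g
      proof -
        obtain f' where f: "f = entries f'" "f' \<in> ?H" using fH by (rule imageE)
        obtain g' where g: "g = entries g'" "g' \<in> ?H" using gH by (rule imageE)
        show ?thesis
          by (rule image_eqI[of _ _ "Add ?C f' g'"]) (simp only: f(1) g(1) entries_linear(1)[OF f(2) g(2)], rule C.add_in[OF Y XO f(2) g(2)])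
      qed
      show "(\<lambda>x. c * f x) \<in> entries ` ?H" if fH: "f \<in> entries ` ?H" for c f
      proof -
        obtain f' where f: "f = entries f'" "f' \<in> ?H" using fH by (rule imageE)
        show ?thesis
          by (rule image_eqI[of _ _ "Smult ?C c f'"]) (simp only: f(1) entries_linear(2), rule C.smult_in[OF Y XO f(2)])
      qed
      show "f x = 0" if "f \<in> entries ` ?H" "x \<notin> S" for f x using that S(2) by blast
    qed
    then obtain n and B where B: "bij_betw (\<lambda>v. \<lambda>x. \<Sum>i<n. v $ i * B i x) (carrier_vec n) (entries ` ?H)" by blast
    let ?c = "\<lambda>v. \<lambda>x. \<Sum>i<n. v $ i * B i x"
    define b where "b v = inv_into ?H entries (?c v)" for v
    have bij: "bij_betw b (carrier_vec n) ?H"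
      using bij_betw_trans[OF B bij_betw_inv_into[OF inj_on_imp_bij_betw[OF entries_inj]]] by (simp add: b_def[abs_def] comp_def)
    have bH: "b v \<in> ?H" if "v \<in> carrier_vec n" for v using bij_betwE[OF bij] that by blast
    have eb: "entries (b v) = ?c v" if "v \<in> carrier_vec n" for v
    proof -
      have "?c v \<in> entries ` ?H" using bij_betwE[OF B] that by blast
      then show ?thesis unfolding b_def by (rule f_inv_into_f)
    qed
    have "b (u + v) = Add ?C (b u) (b v)" if u: "u \<in> carrier_vec n" and v: "v \<in> carrier_vec n" for u v
    proof (rule inj_onD[OF entries_inj _ bH C.add_in[OF Y XO bH[OF u] bH[OF v]]])
      show "entries (b (u + v)) = entries (Add ?C (b u) (b v))"
        using u v by (simp add: entries_linear(1)[OF bH[OF u] bH[OF v]] eb distrib_right sum.distrib del: mono_simps)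
    qed (use u v in simp)
    moreover have "b (c \<cdot>\<^sub>v u) = Smult ?C c (b u)" if u: "u \<in> carrier_vec n" for u c
    proof (rule inj_onD[OF entries_inj _ bH C.smult_in[OF Y XO bH[OF u]]])
      show "entries (b (c \<cdot>\<^sub>v u)) = entries (Smult ?C c (b u))"
        using u by (simp add: entries_linear(2) eb sum_distrib_left mult.assoc del: mono_simps)
    qed (use u in simp)
    ultimately show ?thesis using bij by blast
  qed
  then obtain n b where "\<And>Y. Y \<in> Ob (H_category Q) \<Longrightarrow> bij_betw (b Y) (carrier_vec (n Y)) (Hom ?C Y X) \<and>
      (\<forall>u \<in> carrier_vec (n Y). \<forall>v \<in> carrier_vec (n Y). b Y (u + v) = Add ?C (b Y u) (b Y v)) \<and>
      (\<forall>c. \<forall>u \<in> carrier_vec (n Y). b Y (c \<cdot>\<^sub>v u) = Smult ?C c (b Y u))" by metis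
  then have "coordinates (H_category Q) X n b" unfolding coordinates_def H_simps by blast
  then show ?thesis by blast
qed

end

theorem theorem4p2:
  fixes Q :: "('v, 'e) pre_digraph"
    and \<H> :: "('k :: field, ('k, 'v, 'e) rep_arrow,
               ('v \<Rightarrow> 'k mat) \<times> ('v \<Rightarrow> 'k mat)) linear_category"
  assumes "dynkin_quiver Q"
    and "\<H> = H_category Q"
  shows "global_dimension (mod_op \<H>) \<le> 2"
proof -
  obtain ht where "definite_quiver Q ht" by (rule dynkin_definite[OF assms(1)])
  then interpret definite_quiver Q ht .
  interpret H: lincat \<H> unfolding assms(2) by (rule lincat_H_category)
  obtain G where G: "finite G" "G \<subseteq> Ob \<H>" "\<And>X. X \<in> Ob \<H> \<Longrightarrow> through \<H> G X X (Ident \<H> X)"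
    using H_finitely_generated unfolding assms(2) by blast
  show ?thesis
  proof (rule H.global_dimension_mod_op_le_2[OF _ _ _ G])
    show "Ob \<H> \<noteq> {}" using zero_arrow_H unfolding assms(2) by blast
    show "has_biproducts \<H>" unfolding assms(2) by (rule has_biproducts_H)
    show "has_kernels \<H>" unfolding assms(2) by (rule has_kernels_H)
    show "\<exists>n b. coordinates \<H> X n b" if "X \<in> Ob \<H>" for X
      using H_coordinates that unfolding assms(2) by blast
  qed
qed

end
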